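(* Let $H(\theta,\varphi,I,J)=h(I)+\alpha\cdot J+f(\theta,\varphi,I,J)$ be a Hamiltonian as described in the context, where $h$ satisfies the Hessian bound with constant $M$ and the measure condition with constant $\bar m>0$, and $|f|_{r_0,s_0}\le\varepsilon$ with $\varepsilon>0$. Assume that $\alpha\in\mathbb{R}^m$ satisfies, for some $\gamma>0$ and $\tau\ge m-1$, $|k\cdot\alpha|\ge\gamma|k|^{-\tau}$ for all $k\in\mathbb{Z}^m\setminus\{0\}$. Let $0<\gamma'\le\gamma$ and let $\tau'$ satisfy $\tau'>n+m-1$ and $\tau'\ge\tau$. Set $$B_{\gamma',\tau'}=\{\omega\in\mathbb{R}^n: |(k,l)\cdot(\omega,\alpha)|\ge\gamma'(|k|+|l|)^{-\tau'}\ \ \forall (k,l)\in\mathbb{Z}^{n+m}\setminus\{0\}\},$$ $$D_{\gamma',\tau'}=\{I\in D:\nabla h(I)\in B_{\gamma',\tau'}\},\qquad \bar D_{\gamma',\tau'}=D_{\gamma',\tau'}\times\mathbb{R}^m,$$ and $$a'=\frac{1}{2(\tau'+1)},\quad R_*'=\frac{8\gamma'}{9M},\quad \varepsilon_0'=\frac{\gamma'^2}{768M},\quad \varepsilon_*'=\varepsilon_0'\left(\frac{r_0}{R_*'}\right)^2.$$ If $\varepsilon\le\min\{\varepsilon_0',\varepsilon_*'\}$, then for any solution $(I(t),J(t),\theta(t),\varphi(t))$ of the Hamiltonian system associated to $H$ with initial condition $(I_0,J_0,\theta_0,\varphi_0)\in\bar D_{\gamma',\tau'}\times\mathbb{T}^{n+m}$,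 we have $$\|(I(t),J(t))-(I_0,J_0)\|\le R_*'\left(\frac{\varepsilon}{\varepsilon_0'}\right)^{1/2}\quad\text{for all } |t|\le\frac{s_0R_*'}{5\varepsilon_0'}\left(\frac{\varepsilon_0'}{\varepsilon}\right)^{1/2}\exp\left(\frac{s_0}{6}\left(\frac{\varepsilon_0'}{\varepsilon}\right)^{a'}\right).$$ Moreover, the complement of $D_{\gamma',\tau'}$ in $D$ has Lebesgue measure of order $\gamma'$, i.e. there is a constant $C$ independent of $\gamma'$ (and of $\varepsilon$) such that $\mathrm{Leb}(D\setminus D_{\gamma',\tau'})\le C\gamma'$.
   Context: Let $n,m\ge1$ be integers, $D\subset\mathbb{R}^n$ an open bounded convex domain, $\bar D:=D\times\mathbb{R}^m$, $\mathbb{T}^n:=\mathbb{R}^n/(2\pi\mathbb{Z})^n$, $\alpha\in\mathbb{R}^m$. $\|\cdot\|$ is the Euclidean norm (for matrices, the induced operator norm), $\cdot$ the Euclidean scalar product, and for integer vectors $|k|=\sum_i|k_i|$, $|(k,l)|=|k|+|l|$. $\mathrm{Leb}$ is Lebesgue measure on $\mathbb{R}^n$. For $r_0,s_0>0$ set $V_{r_0}D=\{I\in\mathbb{C}^n: \inf_{I'\in D}\|I-I'\|<r_0\}$, $V_{r_0}\bar D=\{(I,J)\in\mathbb{C}^{n+m}: \inf_{(I',J')\in\bar D}\|(I,J)-(I',J')\|<r_0\}$, $V_{s_0}\mathbb{T}^{n+m}=\{(\theta,\varphi)\in\mathbb{C}^{n+m}/(2\pi\mathbb{Z})^{n+m}: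 \max_i|\mathrm{Im}\,\theta_i|<s_0,\ \max_i|\mathrm{Im}\,\varphi_i|<s_0\}$, $U_{r_0}D=V_{r_0}D\cap\mathbb{R}^n$ and $U_{r_0}\bar D=U_{r_0}D\times\mathbb{R}^m$. The function $h$ is real-analytic on $V_{r_0}D$ (holomorphic there and real-valued at real points). The conditions on $h$ are: - Hessian bound: $\sup_{I\in V_{r_0}D}\|\nabla^2h(I)\|\le M$; - measure condition: for every Lebesgue measurable $\mathcal{O}\subset\mathbb{R}^n$, $\mathrm{Leb}((\nabla h)^{-1}(\mathcal{O})\cap D)\le\bar m^{-1}\mathrm{Leb}(\mathcal{O})$. The function $f$ is real-analytic on $V_{r_0}\bar D\times V_{s_0}\mathbb{T}^{n+m}$, and with Fourier expansion $f=\sum_{(k,l)\in\mathbb{Z}^{n+m}}f_{k,l}(I,J)e^{i(k,l)\cdot(\theta,\varphi)}$ its norm is $|f|_{r_0,s_0}:=\sup_{(I,J)\in V_{r_0}\bar D}\sum_{(k,l)}|f_{k,l}(I,J)|e^{|(k,l)|s_0}$. The Hamiltonian system associated to $H$ is $\dot\theta=\partial_IH$, $\dot\varphi=\partial_JH$, $\dot I=-\partial_\theta H$, $\dot J=-\partial_\varphi H$ (on $U_{r_0}\bar D\times\mathbb{T}^{n+m}$). *)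

theory Defs
  imports "HOL-Analysis.Analysis"
begin

section \<open>Vectors\<close>

definition cvec :: "real ^ 'k \<Rightarrow> complex ^ 'k" where
  "cvec x = (\<chi> i. complex_of_real (x $ i))"

definition ivec :: "int ^ 'k \<Rightarrow> real ^ 'k" where
  "ivec k = (\<chi> i. real_of_int (k $ i))"

definition l1 :: "int ^ 'k \<Rightarrow> real" where
  "l1 k = (\<Sum>i\<in>UNIV. \<bar>real_of_int (k $ i)\<bar>)"

section \<open>Derivatives\<close>

text \<open>The following are used both over the reals and over the complex numbers.\<close>

definition partial :: "('a::real_normed_field ^ 'k \<Rightarrow> 'a) \<Rightarrow> 'k \<Rightarrow> 'a ^ 'k \<Rightarrow> 'a" where
  "partial F i x = deriv (\<lambda>s. F (x + axis i s)) 0"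

definition gradient :: "('a::real_normed_field ^ 'k \<Rightarrow> 'a) \<Rightarrow> 'a ^ 'k \<Rightarrow> 'a ^ 'k" where
  "gradient F x = (\<chi> i. partial F i x)"

definition hessian :: "('a::real_normed_field ^ 'k \<Rightarrow> 'a) \<Rightarrow> 'a ^ 'k \<Rightarrow> 'a ^ 'k ^ 'k" where
  "hessian F x = (\<chi> i j. partial (partial F j) i x)"

text \<open>Holomorphy in several variables: Frechet differentiability with a derivative that is
  linear over the complex numbers.  The complex scalar multiplication of the domain is passed
  as an argument, because products of complex vector spaces carry no such operation in the
  library.\<close>

definition holomorphic_wrt ::
    "(complex \<Rightarrow> 'v \<Rightarrow> 'v) \<Rightarrow> ('v::real_normed_vector \<Rightarrow> complex) \<Rightarrow> 'v set \<Rightarrow> bool" where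
  "holomorphic_wrt sc F S \<longleftrightarrow>
     (\<forall>x\<in>S. \<exists>F'. (F has_derivative F') (at x) \<and> (\<forall>c v. F' (sc c v) = c * F' v))"

text \<open>Points are ordered \<open>(\<theta>, \<phi>, I, J)\<close>.\<close>

type_synonym ('n, 'm) phase =
  "(complex, 'n) vec \<times> (complex, 'm) vec \<times> (complex, 'n) vec \<times> (complex, 'm) vec"

definition scale4 ::
    "complex \<Rightarrow> ('n::finite, 'm::finite) phase \<Rightarrow> ('n::finite, 'm::finite) phase" where
  "scale4 c = (\<lambda>(\<theta>, \<phi>, I, J). (c *s \<theta>, c *s \<phi>, c *s I, c *s J))"

section \<open>Domains\<close>

text \<open>The neighbourhoods are meant for nonempty \<open>D\<close> only (\<open>infdist x {} = 0\<close>).  The norm of a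
  product type is the Euclidean one.\<close>

definition V :: "real \<Rightarrow> (real ^ 'n) set \<Rightarrow> (complex ^ 'n) set" where
  "V r D = {I. infdist I (cvec ` D) < r}"

definition Vbar :: "real \<Rightarrow> (real ^ 'n) set \<Rightarrow> ((complex ^ 'n) \<times> (complex ^ 'm)) set" where
  "Vbar r D = {x. infdist x ((cvec ` D) \<times> range cvec) < r}"

definition U :: "real \<Rightarrow> (real ^ 'n) set \<Rightarrow> (real ^ 'n) set" where
  "U r D = {I. cvec I \<in> V r D}"

text \<open>Complex neighbourhood of the torus, lifted to the universal cover: functions on it are
  \<open>2 * pi\<close>-periodic functions on the strip.\<close>

definition strip :: "real \<Rightarrow> ((complex ^ 'n) \<times> (complex ^ 'm)) set" where
  "strip s = {(\<theta>, \<phi>). (\<forall>i. \<bar>Im (\<theta> $ i)\<bar> < s) \<and> (\<forall>j. \<bar>Im (\<phi> $ j)\<bar> < s)}"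

section \<open>The integrable part\<close>

definition analytic_integrable_part ::
    "real \<Rightarrow> (real ^ 'n) set \<Rightarrow> (complex ^ 'n \<Rightarrow> complex) \<Rightarrow> bool" where
  "analytic_integrable_part r D h \<longleftrightarrow>
     holomorphic_wrt (*s) h (V r D) \<and> (\<forall>I\<in>U r D. h (cvec I) \<in> \<real>)"

definition hessian_bound ::
    "real \<Rightarrow> (real ^ 'n) set \<Rightarrow> (complex ^ 'n \<Rightarrow> complex) \<Rightarrow> real \<Rightarrow> bool" where
  "hessian_bound r D h M \<longleftrightarrow> (\<forall>I\<in>V r D. onorm (\<lambda>v. hessian h I *v v) \<le> M)"

definition real_gradient :: "(complex ^ 'n \<Rightarrow> complex) \<Rightarrow> real ^ 'n \<Rightarrow> real ^ 'n" where
  "real_gradient h = gradient (\<lambda>I. Re (h (cvec I)))"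

text \<open>Measurability of the preimage need not be demanded: if the gradient is continuous on the
  open set \<open>D\<close>, preimages of Borel sets are Borel, and the bound then makes preimages of null
  sets null.\<close>

definition measure_condition ::
    "(real ^ 'n) set \<Rightarrow> (complex ^ 'n \<Rightarrow> complex) \<Rightarrow> real \<Rightarrow> bool" where
  "measure_condition D h mbar \<longleftrightarrow>
     (\<forall>A\<in>sets lebesgue. emeasure lebesgue (real_gradient h -` A \<inter> D)
        \<le> ennreal (inverse mbar) * emeasure lebesgue A)"

section \<open>The perturbation\<close>

definition analytic_perturbation ::
    "real \<Rightarrow> real \<Rightarrow> (real ^ 'n) set
      \<Rightarrow> (('n::finite, 'm::finite) phase \<Rightarrow> complex) \<Rightarrow> bool" where
  "analytic_perturbation r s D f \<longleftrightarrow>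
     holomorphic_wrt scale4 f {(\<theta>, \<phi>, I, J). (\<theta>, \<phi>) \<in> strip s \<and> (I, J) \<in> Vbar r D} \<and>
     (\<forall>(\<theta>, \<phi>)\<in>strip s. \<forall>(I, J)\<in>Vbar r D. \<forall>k l.
        f (\<theta> + cvec ((2 * pi) *\<^sub>R ivec k), \<phi> + cvec ((2 * pi) *\<^sub>R ivec l), I, J) = f (\<theta>, \<phi>, I, J)) \<and>
     (\<forall>\<theta> \<phi> J. \<forall>I\<in>U r D. f (cvec \<theta>, cvec \<phi>, cvec I, cvec J) \<in> \<real>)"

definition fourier_coeff ::
    "(('n::finite, 'm::finite) phase \<Rightarrow> complex)
      \<Rightarrow> int ^ 'n \<Rightarrow> int ^ 'm \<Rightarrow> complex ^ 'n \<Rightarrow> complex ^ 'm \<Rightarrow> complex" where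
  "fourier_coeff f k l I J =
     integral (cbox 0 (\<chi> i. 2 * pi) \<times> cbox 0 (\<chi> j. 2 * pi))
       (\<lambda>(\<theta>, \<phi>). f (cvec \<theta>, cvec \<phi>, I, J) * exp (- \<i> * complex_of_real (ivec k \<bullet> \<theta> + ivec l \<bullet> \<phi>)))
     / (2 * pi) ^ (CARD('n) + CARD('m))"

definition fourier_norm ::
    "real \<Rightarrow> real \<Rightarrow> (real ^ 'n) set
      \<Rightarrow> (('n::finite, 'm::finite) phase \<Rightarrow> complex) \<Rightarrow> ennreal" where
  "fourier_norm r s D f =
     (SUP (I, J)\<in>Vbar r D. \<Sum>\<^sub>\<infinity>(k, l)\<in>UNIV.
        ennreal (cmod (fourier_coeff f k l I J) * exp ((l1 k + l1 l) * s)))"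

section \<open>The Hamiltonian system\<close>

definition hamiltonian ::
    "(complex ^ 'n \<Rightarrow> complex) \<Rightarrow> real ^ 'm
      \<Rightarrow> (('n::finite, 'm::finite) phase \<Rightarrow> complex)
      \<Rightarrow> ('n::finite, 'm::finite) phase \<Rightarrow> complex" where
  "hamiltonian h \<alpha> f = (\<lambda>(\<theta>, \<phi>, I, J).
     h I + (\<Sum>j\<in>UNIV. complex_of_real (\<alpha> $ j) * J $ j) + f (\<theta>, \<phi>, I, J))"

definition real_hamiltonian ::
    "(('n::finite, 'm::finite) phase \<Rightarrow> complex)
      \<Rightarrow> real ^ 'n \<Rightarrow> real ^ 'm \<Rightarrow> real ^ 'n \<Rightarrow> real ^ 'm \<Rightarrow> real" where
  "real_hamiltonian H \<theta> \<phi> I J = Re (H (cvec \<theta>, cvec \<phi>, cvec I, cvec J))"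

text \<open>A solution on the time interval \<open>S\<close> with actions \<open>I\<close> staying in \<open>W\<close>; the angles are lifted
  from the torus to the universal cover.\<close>

definition hamilton_solution ::
    "(real ^ 'n \<Rightarrow> real ^ 'm \<Rightarrow> real ^ 'n \<Rightarrow> real ^ 'm \<Rightarrow> real) \<Rightarrow> (real ^ 'n) set \<Rightarrow> real set
      \<Rightarrow> (real \<Rightarrow> real ^ 'n) \<Rightarrow> (real \<Rightarrow> real ^ 'm) \<Rightarrow> (real \<Rightarrow> real ^ 'n) \<Rightarrow> (real \<Rightarrow> real ^ 'm) \<Rightarrow> bool"
  where
  "hamilton_solution H W S \<theta> \<phi> I J \<longleftrightarrow> is_interval S \<and> (\<forall>t\<in>S. I t \<in> W \<and>
     (\<theta> has_vector_derivative gradient (\<lambda>x. H (\<theta> t) (\<phi> t) x (J t)) (I t)) (at t within S) \<and>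
     (\<phi> has_vector_derivative gradient (\<lambda>y. H (\<theta> t) (\<phi> t) (I t) y) (J t)) (at t within S) \<and>
     (I has_vector_derivative - gradient (\<lambda>x. H x (\<phi> t) (I t) (J t)) (\<theta> t)) (at t within S) \<and>
     (J has_vector_derivative - gradient (\<lambda>y. H (\<theta> t) y (I t) (J t)) (\<phi> t)) (at t within S))"

definition maximal_hamilton_solution ::
    "(real ^ 'n \<Rightarrow> real ^ 'm \<Rightarrow> real ^ 'n \<Rightarrow> real ^ 'm \<Rightarrow> real) \<Rightarrow> (real ^ 'n) set \<Rightarrow> real set
      \<Rightarrow> (real \<Rightarrow> real ^ 'n) \<Rightarrow> (real \<Rightarrow> real ^ 'm) \<Rightarrow> (real \<Rightarrow> real ^ 'n) \<Rightarrow> (real \<Rightarrow> real ^ 'm) \<Rightarrow> bool"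
  where
  "maximal_hamilton_solution H W S \<theta> \<phi> I J \<longleftrightarrow> hamilton_solution H W S \<theta> \<phi> I J \<and>
     (\<forall>S' \<theta>' \<phi>' I' J'. hamilton_solution H W S' \<theta>' \<phi>' I' J' \<and> S \<subseteq> S' \<and>
        (\<forall>t\<in>S. \<theta>' t = \<theta> t \<and> \<phi>' t = \<phi> t \<and> I' t = I t \<and> J' t = J t) \<longrightarrow> S' = S)"

section \<open>Diophantine sets\<close>

definition diophantine :: "real ^ 'm \<Rightarrow> real \<Rightarrow> real \<Rightarrow> bool" where
  "diophantine \<alpha> \<gamma> \<tau> \<longleftrightarrow> (\<forall>k. k \<noteq> 0 \<longrightarrow> \<bar>ivec k \<bullet> \<alpha>\<bar> \<ge> \<gamma> * l1 k powr (- \<tau>))"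

definition Bset :: "real ^ 'm \<Rightarrow> real \<Rightarrow> real \<Rightarrow> (real ^ 'n) set" where
  "Bset \<alpha> \<gamma> \<tau> = {\<omega>. \<forall>k l. (k, l) \<noteq> (0, 0) \<longrightarrow>
     \<bar>ivec k \<bullet> \<omega> + ivec l \<bullet> \<alpha>\<bar> \<ge> \<gamma> * (l1 k + l1 l) powr (- \<tau>)}"

definition Dset ::
    "(real ^ 'n) set \<Rightarrow> (complex ^ 'n \<Rightarrow> complex) \<Rightarrow> real ^ 'm \<Rightarrow> real \<Rightarrow> real \<Rightarrow> (real ^ 'n) set" where
  "Dset D h \<alpha> \<gamma> \<tau> = {I \<in> D. real_gradient h I \<in> Bset \<alpha> \<gamma> \<tau>}"

end

theory Submission
  imports Defs "HOL-Complex_Analysis.Complex_Analysis" "HOL-Real_Asymp.Real_Asymp"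
begin

text \<open>At a point whose frequency is Diophantine together with \<open>\<alpha>\<close>, the Hessian bound rules out
  resonances of order at most \<open>K = (\<epsilon>\<^sub>0 / \<epsilon>) powr a\<close> on a ball of actions of radius of order
  \<open>sqrt \<epsilon>\<close>.  On that ball about \<open>K s\<^sub>0\<close> steps of a normal form iteration, carried out with truncated
  Lie series on families of Fourier coefficients, turn every linear function \<open>L\<close> of the actions into
  a nearby function \<open>G\<close> whose Poisson bracket with the Hamiltonian is exponentially small in
  \<open>K s\<^sub>0\<close>.  No change of coordinates has to be inverted: if the solution left the ball in the given
  time, then \<open>G\<close> for the direction of the displacement would have to vary more than its bracket
  allows.  For small \<open>K s\<^sub>0\<close> the bound on the speed of the actions suffices.  A maximal solution then
  exists throughout, since it stays in a closed set on which the vector field is bounded.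
  The resonant set is covered by preimages of slabs around the resonant hyperplanes.\<close>

text \<open>The scales come from one balance. With q = sqrt (\<epsilon> / \<epsilon>0) the cut-off
  satisfies K powr (\<tau>' + 1) = 1 / q, so at the initial point all divisors of order at most K
  are at least A = \<gamma>' * q * K. Moving the actions by \<rho> = R * q changes them by at most M
  * K * \<rho>, which is comparable with A. Then \<epsilon> * K / (A * \<rho>) is the absolute
  constant 3 / 2048: a step that gives up a strip of width of order 1 / K shrinks the perturbation
  by a fixed factor, and the width s0 pays for a number of steps proportional to K * s0. The
  obstacle is convergence. A bracket of coefficient families is a finite sum only when there are
  finitely many modes, so the perturbation is cut to a trigonometric polynomial and each Lie series
  to finitely many terms; all identities are then finite algebra. Both cuts leave errors, but their
  orders are chosen after the time T is known. Integrated over T the errors are a small fraction of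
  \<rho>, and they do not touch the exponent.\<close>

section \<open>Holomorphic functions of several variables\<close>

text \<open>The complex scalar multiplication is a parameter because the same calculus is used on
  three spaces: vectors of actions, pairs of them, and the whole phase space.\<close>

locale complex_space =
  fixes sc :: "complex \<Rightarrow> 'v::euclidean_space \<Rightarrow> 'v"
  assumes sc_add_left: "sc (a + b) v = sc a v + sc b v"
    and sc_add_right: "sc a (v + w) = sc a v + sc a w"
    and sc_assoc: "sc a (sc b v) = sc (a * b) v"
    and sc_of_real: "sc (of_real t) v = t *\<^sub>R v"
    and norm_sc: "norm (sc a v) = cmod a * norm v"
begin

lemma sc_zero [simp]: "sc 0 v = 0"
  using sc_of_real[of 0] by simp

lemma sc_one [simp]: "sc 1 v = v"
  using sc_of_real[of 1] by simp

lemma sc_zero_right [simp]: "sc a 0 = 0"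
  using norm_sc[of a 0] by simp

lemma bounded_linear_sc: "bounded_linear (\<lambda>c. sc c v)"
proof (rule bounded_linear_intro[where K = "norm v"])
  show "sc (t *\<^sub>R c) v = t *\<^sub>R sc c v" for t c
    by (simp add: scaleR_conv_of_real sc_of_real flip: sc_assoc)
qed (auto simp: sc_add_left norm_sc)

text \<open>A derivative along the complex line through x, so that the one-variable theory applies
  to it directly. Linearity in v is a theorem about holomorphic functions.\<close>

definition dd :: "'v \<Rightarrow> ('v \<Rightarrow> complex) \<Rightarrow> 'v \<Rightarrow> complex" where
  "dd v F x = deriv (\<lambda>z. F (x + sc z v)) 0"

abbreviation holo :: "('v \<Rightarrow> complex) \<Rightarrow> 'v set \<Rightarrow> bool" where
  "holo \<equiv> holomorphic_wrt sc"

lemma holo_subset: "holo F S \<Longrightarrow> T \<subseteq> S \<Longrightarrow> holo F T"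
  unfolding holomorphic_wrt_def by blast

lemma has_derivative_line:
  assumes "(F has_derivative F') (at (x + sc z v))" and "\<And>c v. F' (sc c v) = c * F' v"
  shows "((\<lambda>z. F (x + sc z v)) has_field_derivative F' v) (at z)"
proof -
  have "((\<lambda>z. x + sc z v) has_derivative (\<lambda>c. sc c v)) (at z)"
    using has_derivative_add[OF has_derivative_const bounded_linear_imp_has_derivative[OF bounded_linear_sc]]
    by simp
  from diff_chain_at[OF this, of F F'] assms(1)
  have "((\<lambda>z. F (x + sc z v)) has_derivative (\<lambda>c. F' (sc c v))) (at z)"
    by (simp add: o_def)
  then show ?thesis
    by (simp add: assms(2) has_field_derivative_def mult_commute_abs)
qed

lemma dd_eqI:
  assumes "(F has_derivative F') (at x)" and "\<And>c v. F' (sc c v) = c * F' v"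
  shows "dd v F x = F' v"
  using has_derivative_line[of F F' x 0 v] assms by (simp add: dd_def DERIV_imp_deriv)

lemma holo_has_derivative:
  assumes "holo F S" "x \<in> S"
  shows "(F has_derivative (\<lambda>v. dd v F x)) (at x)" and "dd (sc c v) F x = c * dd v F x"
    and "dd (v + w) F x = dd v F x + dd w F x"
proof -
  obtain F' where F': "(F has_derivative F') (at x)" "\<And>c v. F' (sc c v) = c * F' v"
    using assms unfolding holomorphic_wrt_def by blast
  have eq: "dd v F x = F' v" for v
    by (rule dd_eqI[OF F'])
  show "(F has_derivative (\<lambda>v. dd v F x)) (at x)"
    using F'(1) by (simp add: eq)
  show "dd (sc c v) F x = c * dd v F x"
    by (simp add: eq F'(2))
  show "dd (v + w) F x = dd v F x + dd w F x"
    unfolding eq using F'(1) by (metis has_derivative_linear linear_add)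
qed

lemma dd_zero_dir: "holo F S \<Longrightarrow> x \<in> S \<Longrightarrow> dd 0 F x = 0"
  using holo_has_derivative(2)[of F S x 0 0] by simp

lemma dd_scaleR_dir: "holo F S \<Longrightarrow> x \<in> S \<Longrightarrow> dd (t *\<^sub>R v) F x = of_real t * dd v F x"
  using holo_has_derivative(2)[of F S x "of_real t" v] sc_of_real[of t v] by simp

lemma holo_line:
  assumes "holo F S" "x + sc z v \<in> S"
  shows "((\<lambda>z. F (x + sc z v)) has_field_derivative dd v F (x + sc z v)) (at z)"
  by (rule has_derivative_line[OF holo_has_derivative(1,2)[OF assms]])

lemma holo_line0:
  assumes "holo F S" "x \<in> S"
  shows "((\<lambda>z. F (x + sc z v)) has_field_derivative dd v F x) (at 0)"
  using holo_line[of F S x 0 v] assms by simp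

lemma holo_continuous_on: "holo F S \<Longrightarrow> continuous_on S F"
  unfolding holomorphic_wrt_def
  by (meson continuous_at_imp_continuous_on has_derivative_continuous)

lemma dd_cong:
  assumes "open S" "\<And>x. x \<in> S \<Longrightarrow> F x = G x" "x \<in> S"
  shows "dd v F x = dd v G x"
proof -
  have "open ((\<lambda>z. x + sc z v) -` S)"
    by (intro open_vimage continuous_intros linear_continuous_on bounded_linear_sc assms)
  then have "\<forall>\<^sub>F z in nhds 0. z \<in> (\<lambda>z. x + sc z v) -` S"
    using assms(3) by (intro eventually_nhds_in_open) auto
  then show ?thesis
    unfolding dd_def by (intro deriv_cong_ev) (auto elim!: eventually_mono simp: assms(2))
qed

lemma holo_const [simp]: "holo (\<lambda>x. c) S"
  unfolding holomorphic_wrt_def by (auto intro!: exI[of _ "\<lambda>_. 0"])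

lemma dd_const [simp]: "dd v (\<lambda>x. c) x = 0"
  by (simp add: dd_def)

lemma holo_add:
  assumes "holo F S" "holo G S" shows "holo (\<lambda>x. F x + G x) S"
  unfolding holomorphic_wrt_def
proof
  fix x assume x: "x \<in> S"
  show "\<exists>F'. ((\<lambda>x. F x + G x) has_derivative F') (at x) \<and> (\<forall>c v. F' (sc c v) = c * F' v)"
    by (rule exI[of _ "\<lambda>v. dd v F x + dd v G x"])
       (use holo_has_derivative[OF assms(1) x] holo_has_derivative[OF assms(2) x] in
         \<open>auto intro!: has_derivative_add simp: algebra_simps\<close>)
qed

lemma holo_mult:
  assumes "holo F S" "holo G S" shows "holo (\<lambda>x. F x * G x) S"
  unfolding holomorphic_wrt_def
proof
  fix x assume x: "x \<in> S"
  show "\<exists>F'. ((\<lambda>x. F x * G x) has_derivative F') (at x) \<and> (\<forall>c v. F' (sc c v) = c * F' v)"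
    by (rule exI[of _ "\<lambda>v. F x * dd v G x + dd v F x * G x"])
       (use holo_has_derivative(2)[OF assms(1) x] holo_has_derivative(2)[OF assms(2) x]
         has_derivative_mult[OF holo_has_derivative(1)[OF assms(1) x] holo_has_derivative(1)[OF assms(2) x]]
         in \<open>simp add: algebra_simps\<close>)
qed

lemma holo_cmult: "holo F S \<Longrightarrow> holo (\<lambda>x. c * F x) S"
  by (intro holo_mult holo_const)

lemma holo_minus: "holo F S \<Longrightarrow> holo (\<lambda>x. - F x) S"
  using holo_cmult[of F S "-1"] by simp

lemma holo_diff: "holo F S \<Longrightarrow> holo G S \<Longrightarrow> holo (\<lambda>x. F x - G x) S"
  using holo_add[of F S "\<lambda>x. - G x"] holo_minus[of G S] by simp

lemma holo_sum: "(\<And>i. i \<in> I \<Longrightarrow> holo (F i) S) \<Longrightarrow> holo (\<lambda>x. \<Sum>i\<in>I. F i x) S"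
  by (induction I rule: infinite_finite_induct) (auto intro: holo_add)

lemma holo_inverse:
  assumes "holo F S" "\<And>x. x \<in> S \<Longrightarrow> F x \<noteq> 0" shows "holo (\<lambda>x. inverse (F x)) S"
  unfolding holomorphic_wrt_def
proof
  fix x assume x: "x \<in> S"
  show "\<exists>F'. ((\<lambda>x. inverse (F x)) has_derivative F') (at x) \<and> (\<forall>c v. F' (sc c v) = c * F' v)"
    by (rule exI[of _ "\<lambda>v. - (inverse (F x) * dd v F x * inverse (F x))"])
       (use Deriv.has_derivative_inverse[OF assms(2)[OF x] holo_has_derivative(1)[OF assms(1) x]]
          holo_has_derivative(2)[OF assms(1) x] in \<open>auto simp: algebra_simps\<close>)
qed

lemma holo_divide:
  assumes "holo F S" "holo G S" "\<And>x. x \<in> S \<Longrightarrow> G x \<noteq> 0" shows "holo (\<lambda>x. F x / G x) S"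
  unfolding divide_inverse by (intro holo_mult holo_inverse assms)

lemma dd_add:
  assumes "holo F S" "holo G S" "x \<in> S"
  shows "dd v (\<lambda>x. F x + G x) x = dd v F x + dd v G x"
  unfolding dd_def[of v "\<lambda>x. F x + G x"]
  by (rule DERIV_imp_deriv[OF DERIV_add[OF holo_line0[OF assms(1,3)] holo_line0[OF assms(2,3)]]])

lemma dd_mult:
  assumes "holo F S" "holo G S" "x \<in> S"
  shows "dd v (\<lambda>x. F x * G x) x = dd v F x * G x + F x * dd v G x"
  using DERIV_imp_deriv[OF DERIV_mult[OF holo_line0[OF assms(1,3), of v] holo_line0[OF assms(2,3), of v]]]
  by (simp add: dd_def[of v "\<lambda>x. F x * G x"] mult.commute)

lemma dd_cmult:
  assumes "holo F S" "x \<in> S"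
  shows "dd v (\<lambda>x. c * F x) x = c * dd v F x"
  using dd_mult[of "\<lambda>_. c" S F x v] assms by simp

lemma dd_minus:
  assumes "holo F S" "x \<in> S"
  shows "dd v (\<lambda>x. - F x) x = - dd v F x"
  using dd_cmult[OF assms, of v "-1"] by simp

lemma dd_diff:
  assumes "holo F S" "holo G S" "x \<in> S"
  shows "dd v (\<lambda>x. F x - G x) x = dd v F x - dd v G x"
  using dd_add[OF assms(1) holo_minus[OF assms(2)] assms(3), of v] dd_minus[OF assms(2,3)] by simp

lemma dd_sum:
  assumes "\<And>i. i \<in> I \<Longrightarrow> holo (F i) S" "x \<in> S"
  shows "dd v (\<lambda>x. \<Sum>i\<in>I. F i x) x = (\<Sum>i\<in>I. dd v (F i) x)"
  using assms
  by (induction I rule: infinite_finite_induct) (auto simp: dd_add[where S = S] holo_sum)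

lemma holo_line_on:
  assumes "holo F S" "\<And>z. z \<in> T \<Longrightarrow> x + sc z v \<in> S"
  shows "(\<lambda>z. F (x + sc z v)) holomorphic_on T"
  unfolding holomorphic_on_def field_differentiable_def
  using has_field_derivative_at_within[OF holo_line[OF assms(1) assms(2)]] by blast

section \<open>Cauchy estimates, Taylor remainder and second derivatives\<close>

lemma dd_line_bound:
  assumes "holo F S" "d > 0" "\<And>z. cmod z \<le> d \<Longrightarrow> x + sc z v \<in> S"
    and "\<And>z. cmod z = d \<Longrightarrow> cmod (F (x + sc z v)) \<le> C"
  shows "cmod (dd v F x) \<le> C / d"
proof -
  let ?f = "\<lambda>z. F (x + sc z v)"
  have "?f holomorphic_on cball 0 d"
    by (rule holo_line_on[OF assms(1)]) (simp add: assms(3))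
  then have "norm ((deriv ^^ 1) ?f 0) \<le> fact 1 * C / d ^ 1"
    by (intro Cauchy_inequality) (auto intro: holomorphic_on_subset holomorphic_on_imp_continuous_on
       simp: assms)
  then show ?thesis by (simp add: dd_def)
qed

text \<open>The complex line through x in direction v stays in the large ball on the disc of radius
  d / norm v. Cauchy's inequality on this disc produces the factor norm v / d.\<close>

lemma dd_bound:
  assumes F: "holo F (ball x0 r)" and C: "\<And>y. y \<in> ball x0 r \<Longrightarrow> cmod (F y) \<le> C"
    and x: "x \<in> ball x0 (r - d)" and "d > 0"
  shows "cmod (dd v F x) \<le> C * norm v / d"
proof (cases "v = 0")
  case True
  have "x \<in> ball x0 r" using x \<open>d > 0\<close> by auto
  with True show ?thesis using dd_zero_dir[OF F] by simp
next
  case False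
  have *: "x + sc z v \<in> ball x0 r" if "cmod z \<le> d / norm v" for z
  proof -
    have "norm (sc z v) \<le> d" using that False by (simp add: norm_sc pos_le_divide_eq)
    moreover have "dist x0 (x + sc z v) \<le> dist x0 x + norm (sc z v)"
      using dist_triangle[of x0 "x + sc z v" x] by (simp add: dist_norm)
    ultimately show ?thesis using x by simp
  qed
  have "cmod (dd v F x) \<le> C / (d / norm v)"
    by (rule dd_line_bound[OF F]) (use * C False \<open>d > 0\<close> in auto)
  then show ?thesis by simp
qed

text \<open>On the line through y in direction w the function is holomorphic in a disc whose radius
  is inversely proportional to norm w. Cauchy's inequality for the second derivative there puts the
  square of norm w into the Taylor remainder.\<close>

lemma holo_taylor:
  assumes F: "holo F (ball y R)" and C: "\<And>x. x \<in> ball y R \<Longrightarrow> cmod (F x) \<le> C"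
    and w: "norm w \<le> R / 4" and "R > 0"
  shows "cmod (F (y + w) - F y - dd w F y) \<le> 8 * C / R\<^sup>2 * (norm w)\<^sup>2"
proof (cases "w = 0")
  case True
  then show ?thesis using dd_zero_dir[OF F, of y] \<open>R > 0\<close> by simp
next
  case False
  define \<rho> where "\<rho> = R / (2 * norm w)"
  \<comment> \<open>With \<rho> \<ge> 2 every disc of radius \<rho> about a point of the unit disc
    lies in the disc of radius 2 * \<rho>, where the line is inside the ball.\<close>
  have \<rho>: "\<rho> \<ge> 2" using w False by (simp add: \<rho>_def field_simps)
  define f where "f z = F (y + sc z w)" for z
  have mem: "y + sc z w \<in> ball y R" if "cmod z < 2 * \<rho>" for z
    using that False by (simp add: dist_norm norm_sc \<rho>_def field_simps)
  have hol: "f holomorphic_on ball 0 (2 * \<rho>)"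
    unfolding f_def by (rule holo_line_on[OF F], rule mem) simp
  have d2: "cmod ((deriv ^^ 2) f z) \<le> fact 2 * C / \<rho> ^ 2" if z: "z \<in> cball 0 1" for z
  proof (rule Cauchy_inequality)
    have sub: "cball z \<rho> \<subseteq> ball 0 (2 * \<rho>)"
    proof
      fix u assume "u \<in> cball z \<rho>"
      moreover have "cmod u \<le> cmod z + dist z u"
        using dist_triangle[of 0 u z] by simp
      ultimately show "u \<in> ball 0 (2 * \<rho>)" using z \<rho> by (auto simp: dist_norm)
    qed
    show "f holomorphic_on ball z \<rho>" "continuous_on (cball z \<rho>) f"
      using hol sub ball_subset_cball
      by (blast intro: holomorphic_on_subset holomorphic_on_imp_continuous_on)+
    show "cmod (f u) \<le> C" if "cmod (z - u) = \<rho>" for u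
    proof -
      have "u \<in> cball z \<rho>" using that by (simp add: dist_norm)
      then show ?thesis unfolding f_def using sub mem by (intro C) auto
    qed
  qed (use \<rho> in auto)
  have "cmod ((deriv ^^ 0) f 1 - (\<Sum>i\<le>1. (deriv ^^ i) f 0 * (1 - 0) ^ i / fact i))
      \<le> (fact 2 * C / \<rho> ^ 2) * cmod (1 - 0) ^ Suc 1 / fact 1"
  proof (rule complex_Taylor[where S = "cball 0 1"])
    show "((deriv ^^ i) f has_field_derivative (deriv ^^ Suc i) f x) (at x within cball 0 1)"
      if "x \<in> cball 0 1" for i x
    proof -
      have "(deriv ^^ i) f holomorphic_on ball 0 (2 * \<rho>)"
        by (intro holomorphic_higher_deriv hol) auto
      then have "(deriv ^^ i) f field_differentiable at x"
        using that \<rho> by (intro holomorphic_on_imp_differentiable_at) auto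
      then show ?thesis
        by (simp add: DERIV_deriv_iff_field_differentiable has_field_derivative_at_within)
    qed
  qed (use d2 in \<open>auto simp: numeral_2_eq_2\<close>)
  moreover have "deriv f 0 = dd w F y" by (simp add: dd_def f_def[abs_def])
  ultimately have "cmod (F (y + w) - F y - dd w F y) \<le> 2 * C / \<rho>\<^sup>2"
    by (simp add: f_def algebra_simps)
  also have "2 * C / \<rho>\<^sup>2 = 8 * C / R\<^sup>2 * (norm w)\<^sup>2"
    by (simp add: \<rho>_def power_divide power_mult_distrib)
  finally show ?thesis .
qed

lemma holo_locally_bounded:
  assumes "open S" "holo F S" "x \<in> S"
  obtains R C where "R > 0" "ball x R \<subseteq> S" "\<And>y. y \<in> ball x R \<Longrightarrow> cmod (F y) \<le> C" "C > 0"
proof -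
  have "isCont F x"
    using holo_continuous_on[OF assms(2)] assms by (simp add: continuous_on_eq_continuous_at)
  then obtain d where d: "d > 0" "\<And>y. dist y x < d \<Longrightarrow> dist (F y) (F x) < 1"
    unfolding continuous_at_eps_delta by (metis zero_less_one)
  obtain d' where d': "d' > 0" "ball x d' \<subseteq> S"
    using assms by (meson open_contains_ball)
  show thesis
  proof (rule that[of "min d d'" "cmod (F x) + 1"])
    show "cmod (F y) \<le> cmod (F x) + 1" if "y \<in> ball x (min d d')" for y
    proof -
      have "dist (F y) (F x) < 1" using d(2)[of y] that by (simp add: dist_commute)
      then show ?thesis using norm_triangle_ineq2[of "F y" "F x"] by (simp add: dist_norm)
    qed
  qed (use d d' in \<open>auto simp: add_nonneg_pos\<close>)
qed

text \<open>The Taylor estimate makes the difference quotients of \<open>F\<close> in direction \<open>w\<close> converge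
  uniformly near \<open>x\<close>; Cauchy's inequality in direction \<open>v\<close> then controls the derivative of
  \<open>dd v F\<close>, which comes out as \<open>dd v (dd w F)\<close>.\<close>

lemma dd_has_derivative:
  assumes "open S" "holo F S" "x \<in> S"
  shows "(dd v F has_derivative (\<lambda>w. dd v (dd w F) x)) (at x)"
    and "dd v (dd (sc c w) F) x = c * dd v (dd w F) x"
proof -
  obtain R0 C where R0: "R0 > 0" "ball x R0 \<subseteq> S" "\<And>y. y \<in> ball x R0 \<Longrightarrow> cmod (F y) \<le> C" "C > 0"
    using holo_locally_bounded[OF assms] by blast
  \<comment> \<open>Balls of radius 2 * R about points within 2 * R of x stay in the ball of radius
    R0, so the Taylor estimate is uniform there.\<close>
  define R where "R = R0 / 4"
  have R: "R > 0" using R0 by (simp add: R_def)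
  define A where "A = 8 * C / (2 * R)\<^sup>2"
  have A: "A \<ge> 0" using R0 by (simp add: A_def)
  have sub: "ball y (2 * R) \<subseteq> ball x R0" if "dist x y < 2 * R" for y
  proof
    fix z assume "z \<in> ball y (2 * R)"
    then show "z \<in> ball x R0" using that dist_triangle[of x z y] by (simp add: R_def)
  qed
  have mem: "y \<in> S" if "dist x y < 2 * R" for y
    using that R R0 by (auto simp: R_def)
  have tay: "cmod (F (y + w) - F y - dd w F y) \<le> A * (norm w)\<^sup>2"
    if y: "dist x y < 2 * R" and w: "norm w \<le> R / 2" for y w
    unfolding A_def
  proof (rule holo_taylor)
    show "holo F (ball y (2 * R))"
      using sub[OF y] R0 holo_subset[OF assms(2)] by blast
    show "cmod (F z) \<le> C" if "z \<in> ball y (2 * R)" for z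
      using R0(3) sub[OF y] that by blast
  qed (use w R in auto)
  \<comment> \<open>For cmod z \<le> d the point moves by at most R in direction v; Cauchy's
    inequality in z is applied on this disc. The summand 1 covers v = 0.\<close>
  define d where "d = R / (norm v + 1)"
  have d: "d > 0" using R by (simp add: d_def add_nonneg_pos)
  have dv: "norm (sc z v) \<le> R" if "cmod z \<le> d" for z
  proof -
    have "cmod z * norm v \<le> d * (norm v + 1)"
      using that d by (intro mult_mono) auto
    also have "\<dots> = R" using add_nonneg_pos[OF norm_ge_zero[of v] zero_less_one] by (simp add: d_def)
    finally show ?thesis by (simp add: norm_sc)
  qed
  have near: "dist x (x + sc z v) < 2 * R" "dist x (x + u + sc z v) < 2 * R"
    if "cmod z \<le> d" "norm u < R" for z u
  proof -
    show "dist x (x + sc z v) < 2 * R"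
      using dv[OF that(1)] R by (simp add: dist_norm)
    have "norm (u + sc z v) < 2 * R"
      using dv[OF that(1)] that(2) norm_triangle_ineq[of u "sc z v"] by simp
    moreover have "x - (x + u + sc z v) = - (u + sc z v)" by simp
    ultimately show "dist x (x + u + sc z v) < 2 * R"
      unfolding dist_norm by (metis norm_minus_cancel)
  qed
  have near0: "dist x (x + sc z v) < 2 * R" if "cmod z \<le> d" for z
    using near(1)[of z 0] that R by simp
  have hol1: "(\<lambda>z. F (x + u + sc z v)) holomorphic_on cball 0 d" if "norm u < R" for u
    by (rule holo_line_on[OF assms(2)]) (use mem near(2)[OF _ that] in simp)
  have hol2: "(\<lambda>z. dd w F (x + sc z v)) holomorphic_on ball 0 d
      \<and> continuous_on (cball 0 d) (\<lambda>z. dd w F (x + sc z v))" for w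
  proof -
    define t where "t n = 1 / (of_nat (Suc n) :: real)" for n
    have t: "t n > 0" for n by (simp add: t_def)
    have t0: "t \<longlonglongrightarrow> 0" unfolding t_def by (rule LIMSEQ_Suc) (rule lim_1_over_n)
    define f where "f n z = (F (x + t n *\<^sub>R w + sc z v) - F (x + sc z v)) / of_real (t n)" for n z
    have "(\<lambda>n. t n * norm w) \<longlonglongrightarrow> 0" using tendsto_mult_left_zero[OF t0] .
    then have ev: "\<forall>\<^sub>F n in sequentially. t n * norm w < R / 2"
      using R by (intro order_tendstoD) auto
    show ?thesis
    proof (rule holomorphic_uniform_limit[of 0 d f sequentially "\<lambda>z. dd w F (x + sc z v)"])
      show "\<forall>\<^sub>F n in sequentially. continuous_on (cball 0 d) (f n) \<and> f n holomorphic_on ball 0 d"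
        using ev
      proof eventually_elim
        case (elim n)
        have "f n holomorphic_on cball 0 d"
          unfolding f_def
          using hol1[of 0] hol1[of "t n *\<^sub>R w"] elim t[of n] R by (intro holomorphic_intros) auto
        then show ?case
          using ball_subset_cball holomorphic_on_imp_continuous_on holomorphic_on_subset by blast
      qed
      show "uniform_limit (cball 0 d) f (\<lambda>z. dd w F (x + sc z v)) sequentially"
        unfolding uniform_limit_iff
      proof (intro allI impI)
        fix e :: real assume "e > 0"
        have "(\<lambda>n. A * t n * (norm w)\<^sup>2) \<longlonglongrightarrow> 0"
          by (intro tendsto_mult_left_zero tendsto_mult_right_zero t0)
        then have "\<forall>\<^sub>F n in sequentially. A * t n * (norm w)\<^sup>2 < e"
          using \<open>e > 0\<close> by (intro order_tendstoD) auto
        with ev show "\<forall>\<^sub>F n in sequentially. \<forall>z\<in>cball 0 d. dist (f n z) (dd w F (x + sc z v)) < e"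
        proof eventually_elim
          case (elim n)
          show ?case
          proof
            fix z :: complex assume z: "z \<in> cball 0 d"
            let ?y = "x + sc z v"
            have y: "dist x ?y < 2 * R" using near0 z by simp
            have "f n z - dd w F ?y = (F (?y + t n *\<^sub>R w) - F ?y - dd (t n *\<^sub>R w) F ?y) / of_real (t n)"
              using t[of n] dd_scaleR_dir[OF assms(2) mem[OF y], of "t n" w]
              by (simp add: f_def divide_simps algebra_simps)
            also have "cmod \<dots> \<le> A * (t n * norm w)\<^sup>2 / t n"
              using tay[OF y, of "t n *\<^sub>R w"] elim t[of n] by (simp add: norm_divide divide_right_mono)
            also have "\<dots> = A * t n * (norm w)\<^sup>2"
              using t[of n] by (simp add: power2_eq_square field_simps)
            finally show "dist (f n z) (dd w F ?y) < e" using elim by (simp add: dist_norm)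
          qed
        qed
      qed
    qed simp_all
  qed
  have fd: "(\<lambda>z. dd w F (x + sc z v)) field_differentiable at 0" for w
    using hol2[of w] d by (intro holomorphic_on_imp_differentiable_at) auto
  have fd': "((\<lambda>z. dd w F (x + sc z v)) has_field_derivative dd v (dd w F) x) (at 0)" for w
    using fd[of w] by (simp add: dd_def[of v "dd w F"] DERIV_deriv_iff_field_differentiable)
  have evm: "\<forall>\<^sub>F z in nhds 0. x + sc z v \<in> S"
    using eventually_nhds_in_open[of "ball 0 d" 0] d
    by (auto elim!: eventually_mono intro!: mem near0)
  have add: "dd v (dd (w + u) F) x = dd v (dd w F) x + dd v (dd u F) x" for w u
  proof -
    have "dd v (dd (w + u) F) x = deriv (\<lambda>z. dd w F (x + sc z v) + dd u F (x + sc z v)) 0"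
      unfolding dd_def[of v "dd (w + u) F"]
      by (rule deriv_cong_ev) (use evm in \<open>auto elim!: eventually_mono intro: holo_has_derivative(3)[OF assms(2)]\<close>)
    also have "\<dots> = dd v (dd w F) x + dd v (dd u F) x"
      by (rule DERIV_imp_deriv[OF DERIV_add[OF fd' fd']])
    finally show ?thesis .
  qed
  have scal: "dd v (dd (sc c w) F) x = c * dd v (dd w F) x" for c w
  proof -
    have "dd v (dd (sc c w) F) x = deriv (\<lambda>z. c * dd w F (x + sc z v)) 0"
      unfolding dd_def[of v "dd (sc c w) F"]
      by (rule deriv_cong_ev) (use evm in \<open>auto elim!: eventually_mono intro: holo_has_derivative(2)[OF assms(2)]\<close>)
    also have "\<dots> = c * dd v (dd w F) x"
      by (rule DERIV_imp_deriv[OF DERIV_cmult[OF fd']])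
    finally show ?thesis .
  qed
  then show "dd v (dd (sc c w) F) x = c * dd v (dd w F) x" .
  have lin: "bounded_linear (\<lambda>w. dd v (dd w F) x)"
    unfolding linear_conv_bounded_linear[symmetric]
  proof
    show "dd v (dd (r *\<^sub>R b) F) x = r *\<^sub>R dd v (dd b F) x" for r b
      using scal[of "of_real r" b] by (simp add: sc_of_real scaleR_conv_of_real)
  qed (rule add)
  have est: "cmod (dd v F (x + w) - dd v F x - dd v (dd w F) x) \<le> A * (norm w)\<^sup>2 / d"
    if w: "norm w < R / 2" for w
  proof -
    have wR: "norm w < R" using w R by simp
    let ?g = "\<lambda>z. F (x + w + sc z v) - F (x + sc z v) - dd w F (x + sc z v)"
    have "dist x (x + w) < 2 * R" using w R by (simp add: dist_norm)
    then have "(?g has_field_derivative (dd v F (x + w) - dd v F x - dd v (dd w F) x)) (at 0)"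
      using mem assms(3) by (intro DERIV_diff fd' holo_line0[OF assms(2)])
    then have "deriv ?g 0 = dd v F (x + w) - dd v F x - dd v (dd w F) x"
      by (rule DERIV_imp_deriv)
    moreover have "norm ((deriv ^^ 1) ?g 0) \<le> fact 1 * (A * (norm w)\<^sup>2) / d ^ 1"
    proof (rule Cauchy_inequality)
      show "?g holomorphic_on ball 0 d"
        using hol1[OF wR] hol1[of 0] hol2[of w] R
        by (intro holomorphic_intros) (auto intro: holomorphic_on_subset)
      show "continuous_on (cball 0 d) ?g"
        using hol1[OF wR] hol1[of 0] hol2[of w] R
        by (intro continuous_intros) (auto intro: holomorphic_on_imp_continuous_on)
      show "cmod (?g z) \<le> A * (norm w)\<^sup>2" if "cmod (0 - z) = d" for z
        using tay[OF near0, of z w] that w by (simp add: algebra_simps)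
    qed (rule d)
    ultimately show ?thesis by simp
  qed
  show "(dd v F has_derivative (\<lambda>w. dd v (dd w F) x)) (at x)"
  proof (rule has_derivativeI_sandwich[of "R / 2"])
    show "norm (dd v F y - dd v F x - dd v (dd (y - x) F) x) / norm (y - x) \<le> A / d * norm (y - x)"
      if "y \<noteq> x" "dist y x < R / 2" for y
    proof -
      have "norm (dd v F y - dd v F x - dd v (dd (y - x) F) x) / norm (y - x)
          \<le> A * (norm (y - x))\<^sup>2 / d / norm (y - x)"
        using est[of "y - x"] that by (intro divide_right_mono) (auto simp: dist_norm)
      then show ?thesis using that by (simp add: power2_eq_square)
    qed
    have "((\<lambda>y. A / d * norm (y - x)) \<longlongrightarrow> A / d * norm (x - x)) (at x)"
      by (intro tendsto_intros)
    then show "((\<lambda>y. A / d * norm (y - x)) \<longlongrightarrow> 0) (at x)" by simp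
  qed (use R lin in auto)
qed

lemma holo_dd: "open S \<Longrightarrow> holo F S \<Longrightarrow> holo (dd v F) S"
  unfolding holomorphic_wrt_def[of sc "dd v F"]
  using dd_has_derivative by blast

text \<open>The derivative of \<open>dd v F\<close> was found in the form
  \<open>dd v (dd w F)\<close>, with the directions in the other order, so uniqueness of the
  derivative is the symmetry.\<close>

lemma dd_commute:
  assumes "open S" "holo F S" "x \<in> S"
  shows "dd w (dd v F) x = dd v (dd w F) x"
  by (rule dd_eqI[OF dd_has_derivative[OF assms]])

end

section \<open>Poisson brackets of trigonometric polynomials\<close>

text \<open>A family \<open>F\<close> stands for \<open>\<Sum>k. F k x * exp (\<i> (k \<bullet> \<theta>))\<close>.  The vector \<open>dir k\<close> is the mode \<open>k\<close>
  seen as a direction in the space of actions and \<open>wt k\<close> is its \<open>l1\<close> norm.\<close>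

locale poisson_scale = complex_space sc
  for sc :: "complex \<Rightarrow> 'v::euclidean_space \<Rightarrow> 'v" +
  fixes dir :: "'z::ab_group_add \<Rightarrow> 'v" and wt :: "'z \<Rightarrow> real" and x0 :: 'v
  assumes dir_add: "dir (k + l) = dir k + dir l"
    and norm_dir: "norm (dir k) \<le> wt k"
    and wt_add: "wt (k + l) \<le> wt k + wt l"
    and wt_zero [simp]: "wt 0 = 0"
    and finite_wt: "finite {k. wt k \<le> R}"
begin

lemma wt_nonneg [simp]: "wt k \<ge> 0"
  using norm_dir[of k] norm_ge_zero order_trans by blast

lemma dir_zero [simp]: "dir 0 = 0"
  using dir_add[of 0 0] by simp

abbreviation B :: "real \<Rightarrow> 'v set" where "B r \<equiv> ball x0 r"

text \<open>No domain enters: a coefficient that vanishes on S but not elsewhere belongs to the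
  support. Families that agree on S may therefore have different supports, and they are compared by
  summing over a common finite superset.\<close>

definition supp :: "('z \<Rightarrow> 'v \<Rightarrow> complex) \<Rightarrow> 'z set" where
  "supp F = {k. F k \<noteq> (\<lambda>x. 0)}"

definition tp :: "'v set \<Rightarrow> ('z \<Rightarrow> 'v \<Rightarrow> complex) \<Rightarrow> bool" where
  "tp S F \<longleftrightarrow> finite (supp F) \<and> (\<forall>k. holo (F k) S)"

text \<open>Coefficient of mode p in the Poisson bracket whose first term differentiates F in the
  angles and G in the actions. An angle derivative multiplies by \<i> k, which pairs with the action
  gradient to the derivative in direction \<open>dir k\<close>. With this sign \<open>br G H\<close>
  is the rate of change of G along the flow of H.\<close>

definition br :: "('z \<Rightarrow> 'v \<Rightarrow> complex) \<Rightarrow> ('z \<Rightarrow> 'v \<Rightarrow> complex) \<Rightarrow> 'z \<Rightarrow> 'v \<Rightarrow> complex" where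
  "br F G = (\<lambda>p x. \<i> * (\<Sum>k\<in>supp F. F k x * dd (dir k) (G (p - k)) x - G (p - k) x * dd (dir (p - k)) (F k) x))"

definition eqon :: "'v set \<Rightarrow> ('z \<Rightarrow> 'v \<Rightarrow> complex) \<Rightarrow> ('z \<Rightarrow> 'v \<Rightarrow> complex) \<Rightarrow> bool" where
  "eqon S F G \<longleftrightarrow> (\<forall>p. \<forall>x\<in>S. F p x = G p x)"

lemma eqonI: "(\<And>p x. x \<in> S \<Longrightarrow> F p x = G p x) \<Longrightarrow> eqon S F G"
  by (simp add: eqon_def)

lemma eqonD: "eqon S F G \<Longrightarrow> x \<in> S \<Longrightarrow> F p x = G p x"
  by (simp add: eqon_def)

lemma not_supp: "k \<notin> supp F \<Longrightarrow> F k = (\<lambda>x. 0)"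
  by (simp add: supp_def)

lemma finite_supp: "tp S F \<Longrightarrow> finite (supp F)"
  and tp_holo: "tp S F \<Longrightarrow> holo (F k) S"
  by (auto simp: tp_def)

lemma tp_subset: "tp S F \<Longrightarrow> T \<subseteq> S \<Longrightarrow> tp T F"
  unfolding tp_def using holo_subset by blast

lemma tpI: "finite A \<Longrightarrow> (\<And>k. k \<notin> A \<Longrightarrow> F k = (\<lambda>x. 0)) \<Longrightarrow> (\<And>k. holo (F k) S) \<Longrightarrow> tp S F"
  unfolding tp_def by (auto simp: supp_def intro: finite_subset[of _ A])

lemma tp_add: "tp S F \<Longrightarrow> tp S G \<Longrightarrow> tp S (\<lambda>k x. F k x + G k x)"
  by (rule tpI[of "supp F \<union> supp G"]) (auto simp: finite_supp tp_holo not_supp intro: holo_add)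

lemma tp_cmult: "tp S F \<Longrightarrow> tp S (\<lambda>k x. c * F k x)"
  by (rule tpI[of "supp F"]) (auto simp: finite_supp tp_holo not_supp intro: holo_cmult)

lemma tp_diff: "tp S F \<Longrightarrow> tp S G \<Longrightarrow> tp S (\<lambda>k x. F k x - G k x)"
  by (rule tpI[of "supp F \<union> supp G"]) (auto simp: finite_supp tp_holo not_supp intro: holo_diff)

lemma tp_zero [simp]: "tp S (\<lambda>k x. 0)"
  by (rule tpI[of "{}"]) auto

lemma tp_sum: "(\<And>i. i \<in> I \<Longrightarrow> tp S (F i)) \<Longrightarrow> tp S (\<lambda>k x. \<Sum>i\<in>I. F i k x)"
  by (induction I rule: infinite_finite_induct) (auto intro: tp_add)

lemma br_eq:
  assumes "finite A" "supp F \<subseteq> A"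
  shows "br F G p x = \<i> * (\<Sum>k\<in>A. F k x * dd (dir k) (G (p - k)) x - G (p - k) x * dd (dir (p - k)) (F k) x)"
  unfolding br_def
  by (intro arg_cong[of _ _ "\<lambda>u. \<i> * u"] sum.mono_neutral_left assms) (auto simp: not_supp)

text \<open>A form symmetric in both families, summed over all pairs of modes with sum p;
  antisymmetry and the Jacobi identity are read off from it.\<close>

lemma br_eq2:
  assumes "finite A" "supp F \<subseteq> A" "finite C" "supp G \<subseteq> C"
  shows "br F G p x = \<i> * (\<Sum>k\<in>A. \<Sum>l\<in>C. if k + l = p
    then F k x * dd (dir k) (G l) x - G l x * dd (dir l) (F k) x else 0)"
proof -
  have "(\<Sum>l\<in>C. if k + l = p then F k x * dd (dir k) (G l) x - G l x * dd (dir l) (F k) x else 0)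
     = F k x * dd (dir k) (G (p - k)) x - G (p - k) x * dd (dir (p - k)) (F k) x" for k
  proof -
    have "(\<Sum>l\<in>C. if k + l = p then F k x * dd (dir k) (G l) x - G l x * dd (dir l) (F k) x else 0)
      = (\<Sum>l\<in>C. if l = p - k then F k x * dd (dir k) (G l) x - G l x * dd (dir l) (F k) x else 0)"
      by (intro sum.cong) (auto simp: algebra_simps)
    also have "\<dots> = (if p - k \<in> C then F k x * dd (dir k) (G (p - k)) x - G (p - k) x * dd (dir (p - k)) (F k) x else 0)"
      using assms(3) by (simp add: sum.delta)
    moreover have "p - k \<notin> C \<Longrightarrow> G (p - k) = (\<lambda>x. 0)"
      using assms(4) not_supp by blast
    ultimately show ?thesis by auto
  qed
  then show ?thesis by (simp add: br_eq[OF assms(1,2)])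
qed

lemma tp_br:
  assumes "open S" "tp S F" "tp S G"
  shows "tp S (br F G)"
proof (rule tpI[of "(\<lambda>(k, l). k + l) ` (supp F \<times> supp G)"])
  show "finite ((\<lambda>(k, l). k + l) ` (supp F \<times> supp G))"
    using assms finite_supp by blast
  fix p assume p: "p \<notin> (\<lambda>(k, l). k + l) ` (supp F \<times> supp G)"
  have "p - k \<notin> supp G" if "k \<in> supp F" for k
    using p that by (force simp: image_iff)
  then have "F k x * dd (dir k) (G (p - k)) x - G (p - k) x * dd (dir (p - k)) (F k) x = 0"
    if "k \<in> supp F" for k x
    using not_supp[of "p - k" G] that by simp
  then show "br F G p = (\<lambda>x. 0)" by (simp add: br_def)
next
  show "holo (br F G k) S" for k
    unfolding br_def
    by (intro holo_cmult holo_sum holo_diff holo_mult holo_dd tp_holo[OF assms(2)] tp_holo[OF assms(3)] assms(1))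
qed

lemma br_cong:
  assumes S: "open S" and F: "finite (supp F)" "finite (supp F')"
    and eq: "eqon S F F'" "eqon S G G'"
  shows "eqon S (br F G) (br F' G')"
proof (rule eqonI)
  fix p x assume x: "x \<in> S"
  let ?A = "supp F \<union> supp F'"
  have "dd v (F k) x = dd v (F' k) x" "dd v (G k) x = dd v (G' k) x" for v k
    using eq by (auto intro!: dd_cong[OF S _ x] simp: eqon_def)
  then show "br F G p x = br F' G' p x"
    using eqonD[OF eq(1) x] eqonD[OF eq(2) x] F by (simp add: br_eq[of ?A])
qed

lemma br_antisym:
  assumes "finite (supp F)" "finite (supp G)"
  shows "br F G p x = - br G F p x"
proof -
  have "(\<Sum>k\<in>supp F. \<Sum>l\<in>supp G. if k + l = p
      then F k x * dd (dir k) (G l) x - G l x * dd (dir l) (F k) x else 0)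
    = (\<Sum>l\<in>supp G. \<Sum>k\<in>supp F. - (if l + k = p
      then G l x * dd (dir l) (F k) x - F k x * dd (dir k) (G l) x else 0))"
    by (subst sum.swap) (intro sum.cong, auto simp: add.commute)
  then show ?thesis
    using br_eq2[of "supp F" F "supp G" G p x] br_eq2[of "supp G" G "supp F" F p x] assms
    by (simp add: sum_negf)
qed

lemma br_add_left:
  assumes "tp S F" "tp S G" "x \<in> S"
  shows "br (\<lambda>k x. F k x + G k x) H p x = br F H p x + br G H p x"
proof -
  let ?A = "supp F \<union> supp G"
  have A: "finite ?A" using assms finite_supp by blast
  have "supp (\<lambda>k x. F k x + G k x) \<subseteq> ?A" by (auto simp: supp_def)
  then show ?thesis
    by (simp add: br_eq[OF A] dd_add[OF tp_holo[OF assms(1)] tp_holo[OF assms(2)] assms(3)]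
        algebra_simps sum.distrib sum_subtractf)
qed

lemma br_cmult_left:
  assumes "tp S F" "x \<in> S"
  shows "br (\<lambda>k x. c * F k x) H p x = c * br F H p x"
proof -
  have A: "finite (supp F)" using assms finite_supp by blast
  have "supp (\<lambda>k x. c * F k x) \<subseteq> supp F" by (auto simp: supp_def)
  then show ?thesis
    by (simp add: br_eq[OF A] dd_cmult[OF tp_holo[OF assms(1)] assms(2)] sum_distrib_left algebra_simps)
qed

lemma br_zero_left [simp]: "br (\<lambda>k x. 0) H p x = 0"
  by (simp add: br_def supp_def)

lemma br_sum_left:
  assumes "\<And>i. i \<in> I \<Longrightarrow> tp S (F i)" "x \<in> S"
  shows "br (\<lambda>k x. \<Sum>i\<in>I. F i k x) H p x = (\<Sum>i\<in>I. br (F i) H p x)"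
  using assms(1)
proof (induction I rule: infinite_finite_induct)
  case (insert i I)
  have "br (\<lambda>k x. F i k x + (\<Sum>i\<in>I. F i k x)) H p x = br (F i) H p x + br (\<lambda>k x. \<Sum>i\<in>I. F i k x) H p x"
    by (rule br_add_left[OF _ tp_sum assms(2)]) (use insert in auto)
  then show ?case using insert by simp
qed auto

lemma br_sum_right:
  assumes "\<And>i. i \<in> I \<Longrightarrow> tp S (F i)" "x \<in> S" "tp S H"
  shows "br H (\<lambda>k x. \<Sum>i\<in>I. F i k x) p x = (\<Sum>i\<in>I. br H (F i) p x)"
proof -
  have "br H (\<lambda>k x. \<Sum>i\<in>I. F i k x) p x = - br (\<lambda>k x. \<Sum>i\<in>I. F i k x) H p x"
    by (rule br_antisym[OF finite_supp[OF assms(3)] finite_supp[OF tp_sum[OF assms(1)]]])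
  also have "\<dots> = (\<Sum>i\<in>I. - br (F i) H p x)"
    by (simp add: br_sum_left[OF assms(1,2)] sum_negf)
  also have "\<dots> = (\<Sum>i\<in>I. br H (F i) p x)"
    by (intro sum.cong refl br_antisym[symmetric] finite_supp[OF assms(3)] finite_supp[OF assms(1)])
  finally show ?thesis .
qed

lemma br_cmult_right:
  assumes "tp S F" "x \<in> S" "tp S H"
  shows "br H (\<lambda>k x. c * F k x) p x = c * br H F p x"
  using br_cmult_left[OF assms(1,2), of c H p]
    br_antisym[OF finite_supp[OF assms(3)] finite_supp[OF tp_cmult[OF assms(1)]]]
    br_antisym[OF finite_supp[OF assms(3)] finite_supp[OF assms(1)]]
  by simp

lemma br_add_right:
  assumes "tp S F" "tp S G" "x \<in> S" "tp S H"
  shows "br H (\<lambda>k x. F k x + G k x) p x = br H F p x + br H G p x"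
  using br_add_left[OF assms(1-3), of H p]
    br_antisym[OF finite_supp[OF assms(4)] finite_supp[OF tp_add[OF assms(1,2)]]]
    br_antisym[OF finite_supp[OF assms(4)] finite_supp[OF assms(1)]]
    br_antisym[OF finite_supp[OF assms(4)] finite_supp[OF assms(2)]]
  by simp

text \<open>All terms are sorted by the triple (k, l, m) of modes of F, G and H, so that the Jacobi
  identity can be checked triple by triple. The minus sign is the square of \<i>.\<close>

lemma br_br:
  assumes S: "open S" "x \<in> S" and P: "finite P"
    and F: "tp S F" "supp F \<subseteq> P" and G: "tp S G" "supp G \<subseteq> P" and H: "tp S H" "supp H \<subseteq> P"
  shows "br (br F G) H p x = - (\<Sum>k\<in>P. \<Sum>l\<in>P. \<Sum>m\<in>P. if k + l + m = p then
     (F k x * dd (dir k) (G l) x - G l x * dd (dir l) (F k) x) * (dd (dir k) (H m) x + dd (dir l) (H m) x)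
     - H m x * (dd (dir m) (F k) x * dd (dir k) (G l) x + F k x * dd (dir m) (dd (dir k) (G l)) x
       - dd (dir m) (G l) x * dd (dir l) (F k) x - G l x * dd (dir m) (dd (dir l) (F k)) x) else 0)"
proof -
  define u where "u k l y = F k y * dd (dir k) (G l) y - G l y * dd (dir l) (F k) y" for k l y
  \<comment> \<open>The modes q that the inner bracket can have. The outer bracket is summed over q
    in Q first, and q = k + l is eliminated again by exchanging the sums.\<close>
  define Q where "Q = (\<lambda>(k, l). k + l) ` (P \<times> P)"
  have Q: "finite Q" using P by (simp add: Q_def)
  have hu: "holo (u k l) S" for k l
    unfolding u_def
    by (intro holo_diff holo_mult holo_dd tp_holo[OF F(1)] tp_holo[OF G(1)] S)
  have du: "dd v (u k l) x = dd v (F k) x * dd (dir k) (G l) x + F k x * dd v (dd (dir k) (G l)) x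
       - dd v (G l) x * dd (dir l) (F k) x - G l x * dd v (dd (dir l) (F k)) x" for k l v
    unfolding u_def using S F(1) G(1)
    by (simp add: dd_diff[where S = S] dd_mult[where S = S] holo_mult holo_dd tp_holo algebra_simps)
  have bq: "br F G q = (\<lambda>y. \<i> * (\<Sum>k\<in>P. \<Sum>l\<in>P. if k + l = q then u k l y else 0))" for q
    unfolding u_def using br_eq2[OF P F(2) P G(2)] by blast
  have hi: "holo (\<lambda>y. if k + l = q then u k l y else 0) S" for k l q
    using hu by (cases "k + l = q") simp_all
  have dbq: "dd v (br F G q) x = \<i> * (\<Sum>k\<in>P. \<Sum>l\<in>P. if k + l = q then dd v (u k l) x else 0)" for v q
  proof -
    have "dd v (\<lambda>y. \<Sum>k\<in>P. \<Sum>l\<in>P. if k + l = q then u k l y else 0) x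
        = (\<Sum>k\<in>P. \<Sum>l\<in>P. dd v (\<lambda>y. if k + l = q then u k l y else 0) x)"
      by (subst dd_sum[where S = S] | intro sum.cong refl holo_sum hi S)+
    also have "\<dots> = (\<Sum>k\<in>P. \<Sum>l\<in>P. if k + l = q then dd v (u k l) x else 0)"
      by (intro sum.cong) auto
    finally show ?thesis
      unfolding bq by (subst dd_cmult[where S = S]) (auto intro!: holo_sum hi S)
  qed
  have sQ: "supp (br F G) \<subseteq> Q"
  proof
    fix q assume "q \<in> supp (br F G)"
    then obtain y where "br F G q y \<noteq> 0" by (auto simp: supp_def)
    then have nz: "(\<Sum>k\<in>P. \<Sum>l\<in>P. if k + l = q then u k l y else 0) \<noteq> 0" by (simp add: bq)
    have "\<exists>k\<in>P. \<exists>l\<in>P. k + l = q"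
    proof (rule ccontr)
      assume "\<not> (\<exists>k\<in>P. \<exists>l\<in>P. k + l = q)"
      then have "(\<Sum>k\<in>P. \<Sum>l\<in>P. if k + l = q then u k l y else 0) = 0"
        by (intro sum.neutral ballI) auto
      then show False using nz by blast
    qed
    then show "q \<in> Q" by (auto simp: Q_def)
  qed
  define t where "t k l m = u k l x * dd (dir (k + l)) (H m) x - H m x * dd (dir m) (u k l) x" for k l m
  have "br (br F G) H p x = \<i> * (\<Sum>q\<in>Q. \<Sum>m\<in>P. if q + m = p
     then br F G q x * dd (dir q) (H m) x - H m x * dd (dir m) (br F G q) x else 0)"
    by (rule br_eq2[OF Q sQ P H(2)])
  also have "\<dots> = \<i> * (\<Sum>q\<in>Q. \<Sum>m\<in>P. \<Sum>k\<in>P. \<Sum>l\<in>P. if q = k + l \<and> k + l + m = p then \<i> * t k l m else 0)"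
  proof (intro arg_cong[of _ _ "\<lambda>u. \<i> * u"] sum.cong refl)
    fix q m
    show "(if q + m = p then br F G q x * dd (dir q) (H m) x - H m x * dd (dir m) (br F G q) x else 0)
       = (\<Sum>k\<in>P. \<Sum>l\<in>P. if q = k + l \<and> k + l + m = p then \<i> * t k l m else 0)"
    proof (cases "q + m = p")
      case True
      have "br F G q x * dd (dir q) (H m) x - H m x * dd (dir m) (br F G q) x
        = (\<Sum>k\<in>P. \<Sum>l\<in>P. \<i> * ((if k + l = q then u k l x else 0) * dd (dir q) (H m) x
            - H m x * (if k + l = q then dd (dir m) (u k l) x else 0)))"
        unfolding dbq unfolding bq
        by (simp only: sum_distrib_left sum_distrib_right sum_subtractf right_diff_distrib mult.assoc mult.left_commute)
      also have "\<dots> = (\<Sum>k\<in>P. \<Sum>l\<in>P. if q = k + l \<and> k + l + m = p then \<i> * t k l m else 0)"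
        by (intro sum.cong refl) (use True in \<open>auto simp: t_def\<close>)
      finally show ?thesis using True by simp
    next
      case False
      then have "(\<Sum>k\<in>P. \<Sum>l\<in>P. if q = k + l \<and> k + l + m = p then \<i> * t k l m else 0) = 0"
        by (intro sum.neutral ballI) auto
      then show ?thesis using False by simp
    qed
  qed
  also have "(\<Sum>q\<in>Q. \<Sum>m\<in>P. \<Sum>k\<in>P. \<Sum>l\<in>P. if q = k + l \<and> k + l + m = p then \<i> * t k l m else 0)
     = (\<Sum>m\<in>P. \<Sum>k\<in>P. \<Sum>l\<in>P. \<Sum>q\<in>Q. if q = k + l \<and> k + l + m = p then \<i> * t k l m else 0)"
  proof -
    let ?f = "\<lambda>q m k l. if q = k + l \<and> k + l + m = p then \<i> * t k l m else 0"
    have "(\<Sum>q\<in>Q. \<Sum>m\<in>P. \<Sum>k\<in>P. \<Sum>l\<in>P. ?f q m k l) = (\<Sum>m\<in>P. \<Sum>q\<in>Q. \<Sum>k\<in>P. \<Sum>l\<in>P. ?f q m k l)"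
      by (rule sum.swap)
    also have "\<dots> = (\<Sum>m\<in>P. \<Sum>k\<in>P. \<Sum>q\<in>Q. \<Sum>l\<in>P. ?f q m k l)"
      by (intro sum.cong refl sum.swap)
    also have "\<dots> = (\<Sum>m\<in>P. \<Sum>k\<in>P. \<Sum>l\<in>P. \<Sum>q\<in>Q. ?f q m k l)"
      by (intro sum.cong refl sum.swap)
    finally show ?thesis .
  qed
  also have "\<dots> = (\<Sum>m\<in>P. \<Sum>k\<in>P. \<Sum>l\<in>P. if k + l + m = p then \<i> * t k l m else 0)"
  proof (intro sum.cong refl)
    fix m k l assume "m \<in> P" "k \<in> P" "l \<in> P"
    then have "k + l \<in> Q" by (auto simp: Q_def)
    then show "(\<Sum>q\<in>Q. if q = k + l \<and> k + l + m = p then \<i> * t k l m else 0)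
       = (if k + l + m = p then \<i> * t k l m else 0)"
      using Q by (cases "k + l + m = p") (simp_all add: sum.delta)
  qed
  also have "\<dots> = (\<Sum>k\<in>P. \<Sum>l\<in>P. \<Sum>m\<in>P. if k + l + m = p then \<i> * t k l m else 0)"
  proof -
    let ?f = "\<lambda>k l m. if k + l + m = p then \<i> * t k l m else 0"
    have "(\<Sum>m\<in>P. \<Sum>k\<in>P. \<Sum>l\<in>P. ?f k l m) = (\<Sum>k\<in>P. \<Sum>m\<in>P. \<Sum>l\<in>P. ?f k l m)"
      by (rule sum.swap)
    also have "\<dots> = (\<Sum>k\<in>P. \<Sum>l\<in>P. \<Sum>m\<in>P. ?f k l m)"
      by (intro sum.cong refl sum.swap)
    finally show ?thesis .
  qed
  also have "\<dots> = \<i> * (\<Sum>k\<in>P. \<Sum>l\<in>P. \<Sum>m\<in>P. if k + l + m = p then t k l m else 0)"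
    unfolding sum_distrib_left by (intro sum.cong) auto
  finally have *: "br (br F G) H p x = - (\<Sum>k\<in>P. \<Sum>l\<in>P. \<Sum>m\<in>P. if k + l + m = p then t k l m else 0)"
    by simp
  have "t k l m = (F k x * dd (dir k) (G l) x - G l x * dd (dir l) (F k) x) * (dd (dir k) (H m) x + dd (dir l) (H m) x)
     - H m x * (dd (dir m) (F k) x * dd (dir k) (G l) x + F k x * dd (dir m) (dd (dir k) (G l)) x
       - dd (dir m) (G l) x * dd (dir l) (F k) x - G l x * dd (dir m) (dd (dir l) (F k)) x)" for k l m
    unfolding t_def du
    by (simp add: u_def dir_add holo_has_derivative(3)[OF tp_holo[OF H(1)] S(2)])
  then show ?thesis by (simp only: *)
qed

text \<open>Once the three double brackets are expanded over the same triples, the terms of each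
  triple cancel by themselves; the second derivatives cancel by \<open>dd_commute\<close>.\<close>

lemma br_jacobi:
  assumes S: "open S" "x \<in> S" and F: "tp S F" and G: "tp S G" and H: "tp S H"
  shows "br (br F G) H p x = br (br F H) G p x + br F (br G H) p x"
proof -
  define P where "P = supp F \<union> supp G \<union> supp H"
  have P: "finite P" "supp F \<subseteq> P" "supp G \<subseteq> P" "supp H \<subseteq> P"
    using finite_supp F G H by (auto simp: P_def)
  have "br F (br G H) p x = - br (br G H) F p x"
    by (intro br_antisym finite_supp[OF F] finite_supp[OF tp_br[OF S(1) G H]])
  moreover have "br (br F G) H p x - br (br F H) G p x + br (br G H) F p x = 0"
  proof -
    define T where "T F G H k l m = (if k + l + m = p then
     (F k x * dd (dir k) (G l) x - G l x * dd (dir l) (F k) x) * (dd (dir k) (H m) x + dd (dir l) (H m) x)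
     - H m x * (dd (dir m) (F k) x * dd (dir k) (G l) x + F k x * dd (dir m) (dd (dir k) (G l)) x
       - dd (dir m) (G l) x * dd (dir l) (F k) x - G l x * dd (dir m) (dd (dir l) (F k)) x) else 0)"
     for F G H :: "'z \<Rightarrow> 'v \<Rightarrow> complex" and k l m
    have 1: "br (br F G) H p x = - (\<Sum>k\<in>P. \<Sum>l\<in>P. \<Sum>m\<in>P. T F G H k l m)"
      unfolding T_def by (rule br_br[OF S P(1)]) (use P F G H in auto)
    have 2: "br (br F H) G p x = - (\<Sum>k\<in>P. \<Sum>l\<in>P. \<Sum>m\<in>P. T F H G k m l)"
      by (subst sum.swap[of _ P P]) (unfold T_def, rule br_br[OF S P(1)], use P F G H in auto)
    have 3: "br (br G H) F p x = - (\<Sum>k\<in>P. \<Sum>l\<in>P. \<Sum>m\<in>P. T G H F l m k)"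
    proof -
      have "br (br G H) F p x = - (\<Sum>l\<in>P. \<Sum>m\<in>P. \<Sum>k\<in>P. T G H F l m k)"
        unfolding T_def by (rule br_br[OF S P(1)]) (use P F G H in auto)
      also have "(\<Sum>l\<in>P. \<Sum>m\<in>P. \<Sum>k\<in>P. T G H F l m k) = (\<Sum>l\<in>P. \<Sum>k\<in>P. \<Sum>m\<in>P. T G H F l m k)"
        by (intro sum.cong refl sum.swap)
      also have "\<dots> = (\<Sum>k\<in>P. \<Sum>l\<in>P. \<Sum>m\<in>P. T G H F l m k)"
        by (rule sum.swap)
      finally show ?thesis .
    qed
    have 0: "T F G H k l m - T F H G k m l + T G H F l m k = 0" for k l m
    proof (cases "k + l + m = p")
      case True
      then have "k + m + l = p" "l + m + k = p" by (auto simp: algebra_simps)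
      then show ?thesis
        unfolding T_def using True
        by (simp add: dd_commute[OF S(1) tp_holo[OF F] S(2), of "dir l" "dir m"]
          dd_commute[OF S(1) tp_holo[OF G] S(2), of "dir k" "dir m"]
          dd_commute[OF S(1) tp_holo[OF H] S(2), of "dir k" "dir l"] algebra_simps)
    next
      case False
      then have "k + m + l \<noteq> p" "l + m + k \<noteq> p" by (auto simp: algebra_simps)
      then show ?thesis using False by (simp add: T_def)
    qed
    have "br (br F G) H p x - br (br F H) G p x + br (br G H) F p x
      = - (\<Sum>k\<in>P. \<Sum>l\<in>P. \<Sum>m\<in>P. T F G H k l m - T F H G k m l + T G H F l m k)"
      unfolding 1 2 3 by (simp add: sum.distrib sum_subtractf)
    then show ?thesis by (simp add: 0)
  qed
  ultimately show ?thesis by (simp add: algebra_simps)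
qed

end

section \<open>Weighted norms of coefficient families and the bracket estimate\<close>

context poisson_scale
begin

text \<open>The norm of the theorem on a ball, as a bound for all finite partial sums. This form
  also suits the coefficients of the full perturbation, which may have infinitely many
  modes.\<close>

definition nb :: "real \<Rightarrow> real \<Rightarrow> ('z \<Rightarrow> 'v \<Rightarrow> complex) \<Rightarrow> real \<Rightarrow> bool" where
  "nb r s F c \<longleftrightarrow> (\<forall>x\<in>B r. \<forall>P. finite P \<longrightarrow> (\<Sum>k\<in>P. cmod (F k x) * exp (wt k * s)) \<le> c)"

lemma nbI: "(\<And>x P. x \<in> B r \<Longrightarrow> finite P \<Longrightarrow> (\<Sum>k\<in>P. cmod (F k x) * exp (wt k * s)) \<le> c) \<Longrightarrow> nb r s F c"
  by (simp add: nb_def)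

lemma nbD: "nb r s F c \<Longrightarrow> x \<in> B r \<Longrightarrow> finite P \<Longrightarrow> (\<Sum>k\<in>P. cmod (F k x) * exp (wt k * s)) \<le> c"
  by (simp add: nb_def)

lemma nb_dom:
  assumes "nb r s F c" and "\<And>k x. x \<in> B r \<Longrightarrow> cmod (G k x) \<le> cmod (F k x)"
  shows "nb r s G c"
proof (rule nbI)
  fix x and P :: "'z set" assume x: "x \<in> B r" and P: "finite P"
  have "(\<Sum>k\<in>P. cmod (G k x) * exp (wt k * s)) \<le> (\<Sum>k\<in>P. cmod (F k x) * exp (wt k * s))"
    using assms(2)[OF x] by (intro sum_mono mult_right_mono) auto
  then show "(\<Sum>k\<in>P. cmod (G k x) * exp (wt k * s)) \<le> c"
    using nbD[OF assms(1) x P] by simp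
qed

lemma nb_eqon: "nb r s F c \<Longrightarrow> eqon (B r) F G \<Longrightarrow> nb r s G c"
  by (rule nb_dom) (auto simp: eqon_def)

lemma nb_mono:
  assumes "nb r s F c" "r' \<le> r" "s' \<le> s" "c \<le> c'"
  shows "nb r' s' F c'"
proof (rule nbI)
  fix x and P :: "'z set" assume x: "x \<in> B r'" and P: "finite P"
  have "(\<Sum>k\<in>P. cmod (F k x) * exp (wt k * s')) \<le> (\<Sum>k\<in>P. cmod (F k x) * exp (wt k * s))"
    using assms(3) by (intro sum_mono mult_left_mono) (auto intro: mult_left_mono)
  also have "\<dots> \<le> c"
    using x assms(2) by (intro nbD[OF assms(1) _ P]) auto
  finally show "(\<Sum>k\<in>P. cmod (F k x) * exp (wt k * s')) \<le> c'" using assms(4) by simp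
qed

lemma nb_cmult:
  assumes "nb r s F c" "cmod a \<le> b"
  shows "nb r s (\<lambda>k x. a * F k x) (b * c)"
proof (rule nbI)
  fix x and P :: "'z set" assume x: "x \<in> B r" and P: "finite P"
  have "(\<Sum>k\<in>P. cmod (a * F k x) * exp (wt k * s)) = cmod a * (\<Sum>k\<in>P. cmod (F k x) * exp (wt k * s))"
    by (simp add: norm_mult sum_distrib_left mult.assoc)
  also have "\<dots> \<le> b * c"
    using nbD[OF assms(1) x P] assms(2)
    by (intro mult_mono) (auto intro!: sum_nonneg intro: order_trans[OF norm_ge_zero])
  finally show "(\<Sum>k\<in>P. cmod (a * F k x) * exp (wt k * s)) \<le> b * c" .
qed

lemma nb_add:
  assumes "nb r s F c" "nb r s G d"
  shows "nb r s (\<lambda>k x. F k x + G k x) (c + d)"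
proof (rule nbI)
  fix x and P :: "'z set" assume x: "x \<in> B r" and P: "finite P"
  have "(\<Sum>k\<in>P. cmod (F k x + G k x) * exp (wt k * s))
     \<le> (\<Sum>k\<in>P. cmod (F k x) * exp (wt k * s) + cmod (G k x) * exp (wt k * s))"
    by (intro sum_mono) (simp add: norm_triangle_ineq flip: distrib_right)
  then show "(\<Sum>k\<in>P. cmod (F k x + G k x) * exp (wt k * s)) \<le> c + d"
    using nbD[OF assms(1) x P] nbD[OF assms(2) x P] by (simp add: sum.distrib)
qed

lemma nb_diff:
  assumes "nb r s F c" "nb r s G d"
  shows "nb r s (\<lambda>k x. F k x - G k x) (c + d)"
  using nb_add[OF assms(1) nb_cmult[OF assms(2), of "-1" 1]] by simp

lemma nb_sum:
  assumes "finite I" "\<And>i. i \<in> I \<Longrightarrow> nb r s (F i) (c i)"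
  shows "nb r s (\<lambda>k x. \<Sum>i\<in>I. F i k x) (\<Sum>i\<in>I. c i)"
  using assms
proof (induction rule: finite_induct)
  case empty
  show ?case by (simp add: nb_def)
next
  case (insert i I)
  then show ?case using nb_add[of r s "F i" "c i" "\<lambda>k x. \<Sum>i\<in>I. F i k x"] by simp
qed

text \<open>Unimodular phases turn the sum of moduli of derivatives at x into the derivative of one
  function, a combination of the F k with weights of modulus at most exp (wt k * s). That function
  is bounded by c, so one Cauchy estimate covers all modes at once.\<close>

lemma nb_dd:
  assumes F: "nb r s F c" "\<And>k. holo (F k) (B r)" and x: "x \<in> B r'" and "r' < r" and P: "finite P"
  shows "(\<Sum>k\<in>P. cmod (dd v (F k) x) * exp (wt k * s)) \<le> c * norm v / (r - r')"
proof -
  define a where "a k = of_real (exp (wt k * s)) * cnj (sgn (dd v (F k) x))" for k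
  have an: "cmod (a k) \<le> exp (wt k * s)" for k
    by (simp add: a_def norm_mult norm_sgn)
  define G where "G y = (\<Sum>k\<in>P. a k * F k y)" for y
  have sg: "cnj (sgn z) * z = of_real (cmod z)" for z
    by (cases "z = 0") (simp_all add: sgn_eq complex_norm_square[symmetric] mult.commute power2_eq_square)
  have G: "holo G (B r)" unfolding G_def by (intro holo_sum holo_cmult F)
  have xr: "x \<in> B r" using x \<open>r' < r\<close> by auto
  have "dd v G x = (\<Sum>k\<in>P. a k * dd v (F k) x)"
    unfolding G_def using xr by (simp add: dd_sum[OF holo_cmult[OF F(2)]] dd_cmult[OF F(2)])
  also have "\<dots> = of_real (\<Sum>k\<in>P. cmod (dd v (F k) x) * exp (wt k * s))"
    unfolding a_def mult.assoc sg by (simp add: mult.commute)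
  finally have dG: "dd v G x = of_real (\<Sum>k\<in>P. cmod (dd v (F k) x) * exp (wt k * s))" .
  have "cmod (G y) \<le> c" if "y \<in> B r" for y
  proof -
    have "cmod (a k * F k y) \<le> cmod (F k y) * exp (wt k * s)" for k
      using mult_right_mono[OF an[of k] norm_ge_zero[of "F k y"]] by (simp add: norm_mult mult.commute)
    then have "cmod (G y) \<le> (\<Sum>k\<in>P. cmod (F k y) * exp (wt k * s))"
      unfolding G_def by (intro order_trans[OF norm_sum] sum_mono)
    then show ?thesis using nbD[OF F(1) that P] by simp
  qed
  from dd_bound[OF G this, of x "r - r'" v] x \<open>r' < r\<close>
  have "cmod (dd v G x) \<le> c * norm v / (r - r')" by simp
  moreover have "cmod (dd v G x) = (\<Sum>k\<in>P. cmod (dd v (F k) x) * exp (wt k * s))"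
    unfolding dG norm_of_real by (intro abs_of_nonneg sum_nonneg) auto
  ultimately show ?thesis by simp
qed

text \<open>This is t \<le> exp (t - 1) at t = wt k * (s - s'): an angle derivative is paid for by
  narrowing the strip.\<close>

lemma wt_exp_le:
  assumes "s' < s"
  shows "wt k * exp (wt k * s') \<le> exp (wt k * s) / (exp 1 * (s - s'))"
proof -
  have "wt k * (s - s') \<le> exp (wt k * (s - s') - 1)"
    using exp_ge_add_one_self[of "wt k * (s - s') - 1"] by simp
  then have "wt k * (s - s') * exp 1 * exp (wt k * s') \<le> exp (wt k * (s - s') - 1) * exp 1 * exp (wt k * s')"
    by (intro mult_right_mono) auto
  also have "\<dots> = exp (wt k * s)" by (simp flip: exp_add add: algebra_simps)
  finally show ?thesis using assms by (simp add: field_simps)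
qed

lemma nb_wt:
  assumes F: "nb r s F c" and x: "x \<in> B r" and s: "s' < s" and P: "finite P"
  shows "(\<Sum>k\<in>P. cmod (F k x) * (wt k * exp (wt k * s'))) \<le> c / (exp 1 * (s - s'))"
proof -
  have "(\<Sum>k\<in>P. cmod (F k x) * (wt k * exp (wt k * s'))) \<le> (\<Sum>k\<in>P. cmod (F k x) * (exp (wt k * s) / (exp 1 * (s - s'))))"
    by (intro sum_mono mult_left_mono wt_exp_le s) auto
  also have "\<dots> = (\<Sum>k\<in>P. cmod (F k x) * exp (wt k * s)) / (exp 1 * (s - s'))"
    by (simp add: sum_divide_distrib)
  also have "\<dots> \<le> c / (exp 1 * (s - s'))"
    using s by (intro divide_right_mono nbD[OF F x P]) auto
  finally show ?thesis .
qed

text \<open>In each half of the bracket one factor is differentiated in the actions, which costs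
  radius by \<open>nb_dd\<close>, and the other is multiplied by its mode, which costs strip by
  \<open>nb_wt\<close>. The losses of the two factors are kept apart because in iterated brackets
  they are very unequal.\<close>

lemma br_bound:
  assumes F: "nb r1 s1 F c" "tp (B r1) F" and G: "nb r2 s2 G d" "tp (B r2) G"
    and r: "r' < r1" "r' < r2" and s: "s' < s1" "s' < s2" "0 \<le> s'" and c: "0 \<le> c" "0 \<le> d"
  shows "nb r' s' (br F G) (c * d * (1 / (exp 1 * (s1 - s') * (r2 - r')) + 1 / (exp 1 * (s2 - s') * (r1 - r'))))"
proof (rule nbI)
  fix x and P :: "'z set" assume x: "x \<in> B r'" and P: "finite P"
  let ?A = "supp F" and ?C = "(\<lambda>(p, k). p - k) ` (P \<times> supp F)"
  have A: "finite ?A" using F finite_supp by blast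
  have C: "finite ?C" using A P by simp
  let ?e = "\<lambda>k. exp (wt k * s')"
  have x1: "x \<in> B r1" "x \<in> B r2" using x r by auto
  have G': "nb r2 s' G d" "nb r1 s' F c" using nb_mono[OF G(1)] nb_mono[OF F(1)] s by auto
  have step: "cmod (br F G p x) * ?e p \<le> (\<Sum>k\<in>?A. (cmod (F k x) * cmod (dd (dir k) (G (p - k)) x)
      + cmod (G (p - k) x) * cmod (dd (dir (p - k)) (F k) x)) * (?e k * ?e (p - k)))" for p
  proof -
    \<comment> \<open>Subadditivity of wt makes the weight submultiplicative; this uses 0 \<le>
      s'.\<close>
    have ep: "?e p \<le> ?e k * ?e (p - k)" for k
    proof -
      have "wt p \<le> wt k + wt (p - k)" using wt_add[of k "p - k"] by simp
      then have "wt p * s' \<le> (wt k + wt (p - k)) * s'" using s by (intro mult_right_mono) auto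
      then show ?thesis by (simp add: algebra_simps flip: exp_add)
    qed
    have "cmod (br F G p x) \<le> (\<Sum>k\<in>?A. cmod (F k x) * cmod (dd (dir k) (G (p - k)) x)
      + cmod (G (p - k) x) * cmod (dd (dir (p - k)) (F k) x))"
      unfolding br_def
      by (auto simp: norm_mult intro!: order_trans[OF norm_sum] sum_mono order_trans[OF norm_triangle_ineq4])
    then have "cmod (br F G p x) * ?e p \<le> (\<Sum>k\<in>?A. cmod (F k x) * cmod (dd (dir k) (G (p - k)) x)
      + cmod (G (p - k) x) * cmod (dd (dir (p - k)) (F k) x)) * ?e p"
      by (intro mult_right_mono) auto
    also have "\<dots> \<le> (\<Sum>k\<in>?A. (cmod (F k x) * cmod (dd (dir k) (G (p - k)) x)
      + cmod (G (p - k) x) * cmod (dd (dir (p - k)) (F k) x)) * (?e k * ?e (p - k)))"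
      unfolding sum_distrib_right by (intro sum_mono mult_left_mono ep) auto
    finally show ?thesis .
  qed
  have "(\<Sum>p\<in>P. cmod (br F G p x) * ?e p) \<le> (\<Sum>p\<in>P. \<Sum>k\<in>?A. (cmod (F k x) * cmod (dd (dir k) (G (p - k)) x)
      + cmod (G (p - k) x) * cmod (dd (dir (p - k)) (F k) x)) * (?e k * ?e (p - k)))"
    by (intro sum_mono step)
  also have "\<dots> = (\<Sum>k\<in>?A. \<Sum>p\<in>P. (cmod (F k x) * cmod (dd (dir k) (G (p - k)) x)
      + cmod (G (p - k) x) * cmod (dd (dir (p - k)) (F k) x)) * (?e k * ?e (p - k)))"
    by (rule sum.swap)
  also have "\<dots> \<le> (\<Sum>k\<in>?A. \<Sum>l\<in>?C. (cmod (F k x) * cmod (dd (dir k) (G l) x)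
      + cmod (G l x) * cmod (dd (dir l) (F k) x)) * (?e k * ?e l))"
  proof (intro sum_mono)
    fix k assume k: "k \<in> ?A"
    let ?h = "\<lambda>l. (cmod (F k x) * cmod (dd (dir k) (G l) x) + cmod (G l x) * cmod (dd (dir l) (F k) x)) * (?e k * ?e l)"
    have "(\<Sum>p\<in>P. ?h (p - k)) = (\<Sum>l\<in>(\<lambda>p. p - k) ` P. ?h l)"
      by (subst sum.reindex) (auto simp: inj_on_def o_def)
    also have "\<dots> \<le> (\<Sum>l\<in>?C. ?h l)"
      using k by (intro sum_mono2 C) auto
    finally show "(\<Sum>p\<in>P. ?h (p - k)) \<le> (\<Sum>l\<in>?C. ?h l)" .
  qed
  also have "\<dots> = (\<Sum>k\<in>?A. cmod (F k x) * ?e k * (\<Sum>l\<in>?C. cmod (dd (dir k) (G l) x) * ?e l))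
      + (\<Sum>l\<in>?C. cmod (G l x) * ?e l * (\<Sum>k\<in>?A. cmod (dd (dir l) (F k) x) * ?e k))"
    by (simp only: distrib_right sum.distrib sum_distrib_left mult.assoc)
       (subst (2) sum.swap, simp add: mult.commute mult.left_commute)
  also have "\<dots> \<le> (\<Sum>k\<in>?A. cmod (F k x) * ?e k * (d * wt k / (r2 - r')))
      + (\<Sum>l\<in>?C. cmod (G l x) * ?e l * (c * wt l / (r1 - r')))"
  proof (intro add_mono sum_mono mult_left_mono)
    fix k
    show "(\<Sum>l\<in>?C. cmod (dd (dir k) (G l) x) * ?e l) \<le> d * wt k / (r2 - r')"
      by (rule order_trans[OF nb_dd[OF G'(1) tp_holo[OF G(2)] x r(2) C]])
         (use r c in \<open>auto intro!: divide_right_mono mult_left_mono norm_dir\<close>)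
    show "(\<Sum>l\<in>?A. cmod (dd (dir k) (F l) x) * ?e l) \<le> c * wt k / (r1 - r')"
      by (rule order_trans[OF nb_dd[OF G'(2) tp_holo[OF F(2)] x r(1) A]])
         (use r c in \<open>auto intro!: divide_right_mono mult_left_mono norm_dir\<close>)
  qed auto
  also have "\<dots> = d / (r2 - r') * (\<Sum>k\<in>?A. cmod (F k x) * (wt k * ?e k))
      + c / (r1 - r') * (\<Sum>l\<in>?C. cmod (G l x) * (wt l * ?e l))"
    unfolding sum_distrib_left by (intro arg_cong2[of _ _ _ _ "(+)"] sum.cong) auto
  also have "\<dots> \<le> d / (r2 - r') * (c / (exp 1 * (s1 - s'))) + c / (r1 - r') * (d / (exp 1 * (s2 - s')))"
    using r c by (intro add_mono mult_left_mono nb_wt[OF F(1) x1(1) s(1) A] nb_wt[OF G(1) x1(2) s(2) C]) auto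
  also have "\<dots> = c * d * (1 / (exp 1 * (s1 - s') * (r2 - r')) + 1 / (exp 1 * (s2 - s') * (r1 - r')))"
    by (simp add: algebra_simps)
  finally show "(\<Sum>p\<in>P. cmod (br F G p x) * ?e p) \<le> c * d * (1 / (exp 1 * (s1 - s') * (r2 - r')) + 1 / (exp 1 * (s2 - s') * (r1 - r')))" .
qed

end

section \<open>Truncated Lie series\<close>

context poisson_scale
begin

text \<open>The n-th term of the Lie series: the n-fold bracket with X times e^n / n!, the factorial
  being spread over the recursion. The values e = 1 and e = -1 belong to the time-one flow and its
  inverse.\<close>

primrec lt :: "complex \<Rightarrow> ('z \<Rightarrow> 'v \<Rightarrow> complex) \<Rightarrow> nat \<Rightarrow> ('z \<Rightarrow> 'v \<Rightarrow> complex) \<Rightarrow> 'z \<Rightarrow> 'v \<Rightarrow> complex" where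
  "lt e X 0 F = F"
| "lt e X (Suc n) F = (\<lambda>k x. e / of_nat (Suc n) * br (lt e X n F) X k x)"

definition lie :: "complex \<Rightarrow> ('z \<Rightarrow> 'v \<Rightarrow> complex) \<Rightarrow> nat \<Rightarrow> ('z \<Rightarrow> 'v \<Rightarrow> complex) \<Rightarrow> 'z \<Rightarrow> 'v \<Rightarrow> complex" where
  "lie e X N F = (\<lambda>k x. \<Sum>n\<le>N. lt e X n F k x)"

lemma tp_lt:
  assumes "open S" "tp S X" "tp S F"
  shows "tp S (lt e X n F)"
proof (induction n)
  case (Suc n)
  then show ?case unfolding lt.simps by (intro tp_cmult tp_br assms)
qed (simp add: assms)

lemma nb_le: "nb r s F c \<Longrightarrow> c \<le> c' \<Longrightarrow> nb r s F c'"
  by (rule nb_mono) auto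

lemma tp_lie: "open S \<Longrightarrow> tp S X \<Longrightarrow> tp S F \<Longrightarrow> tp S (lie e X N F)"
  unfolding lie_def by (intro tp_sum tp_lt)

lemma lt_cong:
  assumes "open S" "tp S X" "tp S F" "tp S G" "eqon S F G"
  shows "eqon S (lt e X n F) (lt e X n G)"
proof (induction n)
  case (Suc n)
  have "eqon S (br (lt e X n F) X) (br (lt e X n G) X)"
    using assms by (intro br_cong Suc finite_supp[where S = S] tp_lt) (auto simp: eqon_def)
  then show ?case by (simp add: eqon_def)
qed (use assms in simp)

lemma lt_add:
  assumes "open S" "tp S X" "tp S F" "tp S G"
  shows "eqon S (lt e X n (\<lambda>k x. F k x + G k x)) (\<lambda>k x. lt e X n F k x + lt e X n G k x)"
proof (induction n)
  case (Suc n)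
  have "eqon S (br (lt e X n (\<lambda>k x. F k x + G k x)) X) (br (\<lambda>k x. lt e X n F k x + lt e X n G k x) X)"
    using assms by (intro br_cong Suc finite_supp[where S = S] tp_lt tp_add) (auto simp: eqon_def)
  then show ?case
    using assms
    by (simp add: eqon_def br_add_left[OF tp_lt[OF assms(1,2,3)] tp_lt[OF assms(1,2,4)]] distrib_left add_divide_distrib)
qed (simp add: eqon_def)

lemma lt_cmult:
  assumes "open S" "tp S X" "tp S F"
  shows "eqon S (lt e X n (\<lambda>k x. a * F k x)) (\<lambda>k x. a * lt e X n F k x)"
proof (induction n)
  case (Suc n)
  have "eqon S (br (lt e X n (\<lambda>k x. a * F k x)) X) (br (\<lambda>k x. a * lt e X n F k x) X)"
    using assms by (intro br_cong Suc finite_supp[where S = S] tp_lt tp_cmult) (auto simp: eqon_def)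
  then show ?case
    using assms by (simp add: eqon_def br_cmult_left[OF tp_lt[OF assms]] mult.left_commute)
qed (simp add: eqon_def)

lemma lt_diff:
  assumes "open S" "tp S X" "tp S F" "tp S G"
  shows "eqon S (lt e X n (\<lambda>k x. F k x - G k x)) (\<lambda>k x. lt e X n F k x - lt e X n G k x)"
  using lt_add[OF assms(1-3) tp_cmult[OF assms(4), of "-1"], of e n] lt_cmult[OF assms(1,2,4), of e n "-1"]
  by (simp add: eqon_def)

lemma lt_zero: "lt e X n (\<lambda>k x. 0) k x = 0"
proof (induction n arbitrary: k x)
  case (Suc n)
  then have "lt e X n (\<lambda>k x. 0) = (\<lambda>k x. 0)" by blast
  then show ?case by simp
qed simp

lemma lt_sum:
  assumes "open S" "tp S X" "\<And>i. i \<in> I \<Longrightarrow> tp S (F i)"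
  shows "eqon S (lt e X n (\<lambda>k x. \<Sum>i\<in>I. F i k x)) (\<lambda>k x. \<Sum>i\<in>I. lt e X n (F i) k x)"
  using assms(3)
proof (induction I rule: infinite_finite_induct)
  case (insert i I)
  then show ?case
    using lt_add[OF assms(1,2), of "F i" "\<lambda>k x. \<Sum>i\<in>I. F i k x" e n] tp_sum[of I S F]
    by (auto simp: eqon_def)
qed (auto simp: eqon_def lt_zero)

text \<open>One bracket followed by n brackets is a term of order n + 1; the factor repairs the
  factorial and the power of e.\<close>

lemma lt_br:
  assumes "open S" "tp S X" "tp S H" "e \<noteq> 0"
  shows "eqon S (lt e X n (br H X)) (\<lambda>k x. of_nat (Suc n) / e * lt e X (Suc n) H k x)"
proof (induction n)
  case 0
  then show ?case using assms(4) by (simp add: eqon_def)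
next
  case (Suc n)
  let ?L = "lt e X (Suc n) H"
  have tL: "tp S ?L" by (rule tp_lt[OF assms(1-3)])
  have "eqon S (br (lt e X n (br H X)) X) (br (\<lambda>k x. of_nat (Suc n) / e * ?L k x) X)"
    using assms by (intro br_cong Suc finite_supp[where S = S] tp_lt tp_br tp_cmult) (auto simp: eqon_def)
  from eqonD[OF this] br_cmult_left[OF tL, of _ "of_nat (Suc n) / e" X]
  have "br (lt e X n (br H X)) X p x = of_nat (Suc n) / e * br ?L X p x" if "x \<in> S" for p x
    using that by metis
  then show ?case
    using assms(4) unfolding eqon_def lt.simps(2)[of e X "Suc n"] lt.simps(2)[of e X n "br H X"]
    by (simp del: lt.simps of_nat_Suc)
qed

text \<open>The coefficient form of \<open>{exp (- ad) F, H} = exp (- ad) {F, exp ad H}\<close>: comparing terms with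
  equally many brackets makes the identity exact.\<close>

lemma br_lt:
  assumes S: "open S" and X: "tp S X" and F: "tp S F" and H: "tp S H" and x: "x \<in> S"
  shows "br (lt (-1) X a F) H p x = (\<Sum>c\<le>a. lt (-1) X c (br F (lt 1 X (a - c) H)) p x)"
  using H x
proof (induction a arbitrary: H p x)
  case 0
  then show ?case by simp
next
  case (Suc a)
  let ?A = "lt (-1) X" and ?B = "lt 1 X"
  note H = Suc.prems(1) and x = Suc.prems(2)
  note tps = S X F H
  define g where "g c = ?A c (br F (?B (Suc a - c) H)) p x" for c
  have hx: "tp S (br H X)" by (rule tp_br[OF S H X])
  \<comment> \<open>The Jacobi identity moves the last X either outside or onto H; the induction
    hypothesis, for general H, then applies to both parts.\<close>
  have "br (br (?A a F) X) H p x = br (br (?A a F) H) X p x + br (?A a F) (br X H) p x"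
    by (rule br_jacobi[OF S x tp_lt[OF S X F] X H])
  also have "br (?A a F) (br X H) p x = br (?A a F) (\<lambda>k x. -1 * br H X k x) p x"
    by (intro eqonD[OF br_cong[OF S] x] finite_supp[OF tp_lt[OF S X F]])
       (auto simp: eqon_def br_antisym[OF finite_supp[OF X] finite_supp[OF H]])
  also have "\<dots> = - br (?A a F) (br H X) p x"
    by (subst br_cmult_right[OF hx x tp_lt[OF S X F], of "-1"]) simp
  also have "br (?A a F) (br H X) p x = (\<Sum>c\<le>a. of_nat (Suc a - c) * g c)"
    unfolding Suc.IH[OF hx x]
  proof (intro sum.cong refl)
    fix c assume c: "c \<in> {..a}"
    have 1: "eqon S (br F (?B (a - c) (br H X))) (br F (\<lambda>k x. of_nat (Suc (a - c)) / 1 * ?B (Suc (a - c)) H k x))"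
      by (intro br_cong[OF S] lt_br tps finite_supp[OF F]) (auto simp: eqon_def)
    have 2: "eqon S (br F (\<lambda>k x. of_nat (Suc (a - c)) / 1 * ?B (Suc (a - c)) H k x))
       (\<lambda>k x. of_nat (Suc (a - c)) * br F (?B (Suc (a - c)) H) k x)"
      using br_cmult_right[OF tp_lt[OF S X H] _ F] by (simp add: eqon_def del: lt.simps of_nat_Suc)
    have "?A c (br F (?B (a - c) (br H X))) p x
        = ?A c (\<lambda>k x. of_nat (Suc (a - c)) * br F (?B (Suc (a - c)) H) k x) p x"
      by (rule eqonD[OF lt_cong[OF S X] x])
         (use 1 2 in \<open>auto simp: eqon_def simp del: lt.simps of_nat_Suc intro!: tp_br tp_lt tp_cmult hx tps\<close>)
    also have "\<dots> = of_nat (Suc (a - c)) * ?A c (br F (?B (Suc (a - c)) H)) p x"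
      by (rule eqonD[OF lt_cmult x]) (intro tp_br tp_lt tps)+
    finally show "?A c (br F (?B (a - c) (br H X))) p x = of_nat (Suc a - c) * g c"
      using c by (simp add: g_def Suc_diff_le del: lt.simps of_nat_Suc)
  qed
  also have "br (br (?A a F) H) X p x = br (\<lambda>k x. \<Sum>c\<le>a. ?A c (br F (?B (a - c) H)) k x) X p x"
    by (rule eqonD[OF br_cong[OF S] x])
       (auto simp: eqon_def Suc.IH[OF H] intro!: finite_supp[where S = S] tp_br tp_sum tp_lt tps)
  also have "\<dots> = (\<Sum>c\<le>a. br (?A c (br F (?B (a - c) H))) X p x)"
    by (rule br_sum_left[OF _ x]) (intro tp_br tp_lt tps)
  also have "\<dots> = (\<Sum>c\<le>a. - of_nat (Suc c) * g (Suc c))"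
    by (intro sum.cong refl) (simp add: g_def del: of_nat_Suc)
  finally have "br (br (?A a F) X) H p x = - ((\<Sum>c\<le>a. of_nat (Suc c) * g (Suc c)) + (\<Sum>c\<le>a. of_nat (Suc a - c) * g c))"
    by (simp add: sum_negf del: of_nat_Suc)
  \<comment> \<open>Both sums may run over 0..Suc a, since the added terms have coefficient 0. The
    coefficients c and Suc a - c then add up to Suc a, which cancels the denominator in the
    definition of \<open>lt\<close>.\<close>
  also have "(\<Sum>c\<le>a. of_nat (Suc c) * g (Suc c)) = (\<Sum>c\<le>Suc a. of_nat c * g c)"
    by (subst sum.atMost_Suc_shift) (simp del: of_nat_Suc)
  also have "(\<Sum>c\<le>a. of_nat (Suc a - c) * g c) = (\<Sum>c\<le>Suc a. of_nat (Suc a - c) * g c)"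
    by simp
  also have "(\<Sum>c\<le>Suc a. of_nat c * g c) + (\<Sum>c\<le>Suc a. of_nat (Suc a - c) * g c) = (\<Sum>c\<le>Suc a. of_nat (Suc a) * g c)"
    unfolding sum.distrib[symmetric]
    by (intro sum.cong refl) (simp add: distrib_right[symmetric] of_nat_add[symmetric] del: of_nat_Suc of_nat_add)
  also have "(\<Sum>c\<le>Suc a. of_nat (Suc a) * g c) = of_nat (Suc a) * (\<Sum>c\<le>Suc a. g c)"
    by (rule sum_distrib_left[symmetric])
  finally have "br (br (?A a F) X) H p x = - of_nat (Suc a) * (\<Sum>c\<le>Suc a. g c)"
    by (simp only: mult_minus_left)
  moreover have "br (?A (Suc a) F) H p x = -1 / of_nat (Suc a) * br (br (?A a F) X) H p x"
    unfolding lt.simps by (rule br_cmult_left[OF tp_br[OF S tp_lt[OF S X F] X] x])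
  ultimately show ?case
    unfolding g_def by (simp del: of_nat_Suc lt.simps sum.atMost_Suc)
qed

text \<open>Summing \<open>br_lt\<close> over a \<le> N gives the pairs with c + b \<le> N, while
  the composition of two truncated series gives the whole square. The difference is the corner c + b
  > N, whose terms all contain more than N brackets with X and can be made small.\<close>

lemma br_lie:
  assumes S: "open S" and X: "tp S X" and F: "tp S F" and H: "tp S H"
  shows "eqon S (br (lie (-1) X N F) H) (\<lambda>p x. lie (-1) X N (br F (lie 1 X N H)) p x
     - (\<Sum>c\<le>N. \<Sum>b\<le>N. if N < c + b then lt (-1) X c (br F (lt 1 X b H)) p x else 0))"
proof (rule eqonI)
  fix p x assume x: "x \<in> S"
  let ?A = "lt (-1) X" and ?B = "lt 1 X"
  let ?f = "\<lambda>c b. ?A c (br F (?B b H)) p x"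
  have "br (lie (-1) X N F) H p x = (\<Sum>a\<le>N. br (?A a F) H p x)"
    unfolding lie_def by (rule br_sum_left[OF tp_lt[OF S X F] x])
  also have "\<dots> = (\<Sum>a\<le>N. \<Sum>c\<le>a. ?f c (a - c))"
    by (simp add: br_lt[OF S X F H x])
  also have "\<dots> = (\<Sum>(c, b)\<in>{(c, b). c + b \<le> N}. ?f c b)"
    by (rule sum.triangle_reindex_eq[symmetric])
  also have "\<dots> = (\<Sum>(c, b)\<in>{..N} \<times> {..N}. if c + b \<le> N then ?f c b else 0)"
    by (rule sum.mono_neutral_cong_left) (auto split: if_splits)
  also have "\<dots> = (\<Sum>c\<le>N. \<Sum>b\<le>N. if c + b \<le> N then ?f c b else 0)"
    by (simp add: sum.cartesian_product)
  finally have 1: "br (lie (-1) X N F) H p x = (\<Sum>c\<le>N. \<Sum>b\<le>N. if c + b \<le> N then ?f c b else 0)" .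
  have "lie (-1) X N (br F (lie 1 X N H)) p x = (\<Sum>c\<le>N. ?A c (\<lambda>k y. \<Sum>b\<le>N. br F (?B b H) k y) p x)"
    unfolding lie_def
  proof (intro sum.cong refl eqonD[OF lt_cong[OF S X] x])
    show "eqon S (br F (\<lambda>k x. \<Sum>n\<le>N. lt 1 X n H k x)) (\<lambda>k y. \<Sum>b\<le>N. br F (?B b H) k y)"
      by (auto simp: eqon_def br_sum_right[OF tp_lt[OF S X H] _ F])
  qed (intro tp_br tp_sum tp_lt S X F H)+
  also have "\<dots> = (\<Sum>c\<le>N. \<Sum>b\<le>N. ?f c b)"
    by (intro sum.cong refl eqonD[OF lt_sum[OF S X] x] tp_br tp_lt S X F H)
  finally have 2: "lie (-1) X N (br F (lie 1 X N H)) p x = (\<Sum>c\<le>N. \<Sum>b\<le>N. ?f c b)" .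
  show "br (lie (-1) X N F) H p x = lie (-1) X N (br F (lie 1 X N H)) p x
     - (\<Sum>c\<le>N. \<Sum>b\<le>N. if N < c + b then ?f c b else 0)"
    unfolding 1 2 sum_subtractf[symmetric] by (intro sum.cong refl) auto
qed

text \<open>A form of Stirling's bound, by induction from (1 + 1 / n)^n \<le> exp 1. It is the
  origin of the factor (exp 1)^2 per bracket below.\<close>

lemma power_le_fact_exp:
  assumes "n \<ge> 1" shows "real n ^ n \<le> fact n * exp (real n - 1)"
  using assms
proof (induction n rule: nat_induct_at_least)
  case (Suc n)
  have "(1 + 1 / real n) ^ n \<le> exp (1 / real n) ^ n"
    by (intro power_mono exp_ge_add_one_self) auto
  also have "\<dots> = exp 1" using Suc.hyps by (simp flip: exp_of_nat_mult)
  finally have e: "(1 + 1 / real n) ^ n \<le> exp 1" .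
  have "(1 + 1 / real n) * real n = real (Suc n)" using Suc.hyps by (simp add: field_simps)
  then have "real (Suc n) ^ Suc n = real (Suc n) * ((1 + 1 / real n) * real n) ^ n"
    by (simp only: power_Suc)
  also have "\<dots> = real (Suc n) * ((1 + 1 / real n) ^ n * real n ^ n)"
    by (simp add: power_mult_distrib)
  also have "\<dots> \<le> real (Suc n) * (exp 1 * (fact n * exp (real n - 1)))"
    by (intro mult_left_mono mult_mono e Suc.IH) auto
  also have "\<dots> = fact (Suc n) * exp (real (Suc n) - 1)"
    by (simp add: exp_diff field_simps)
  finally show ?case .
qed simp

text \<open>The losses \<delta> and \<sigma> are divided into n equal levels and every bracket
  descends one level. As X is known on the full domain, its distance from level j + 1 is j + 1
  levels, which gains a factor 1 / (j + 1). Together with the 1 / (m + 1) of the series this gives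
  two factorials. The free initial level i allows a run of brackets to start after another
  one.\<close>

lemma lt_level:
  assumes X: "tp (B r) X" "nb r s X g" and F: "tp (B r) F"
    and Fi: "nb (r - real i * (\<delta> / n)) (s - real i * (\<sigma> / n)) F c"
    and pos: "\<delta> > 0" "\<sigma> > 0" "\<sigma> \<le> s" "n > 0" "c \<ge> 0" "g \<ge> 0" "cmod e = 1" and le: "real (i + m) \<le> n"
  shows "nb (r - real (i + m) * (\<delta> / n)) (s - real (i + m) * (\<sigma> / n)) (lt e X m F)
     (c * (2 * n\<^sup>2 * g / (exp 1 * \<delta> * \<sigma>)) ^ m * fact i / (fact (i + m) * fact m))"
  using le
proof (induction m)
  case 0
  then show ?case using Fi by simp
next
  case (Suc m)
  let ?Y = "2 * n\<^sup>2 * g / (exp 1 * \<delta> * \<sigma>)"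
  let ?d = "c * ?Y ^ m * fact i / (fact (i + m) * fact m)"
  define j where "j = real (i + m)"
  have j: "j \<ge> 0" "j + 1 \<le> n" using Suc.prems by (auto simp: j_def)
  have Yd: "?d \<ge> 0" using pos by simp
  let ?r1 = "r - j * (\<delta> / n)" and ?s1 = "s - j * (\<sigma> / n)"
    and ?r' = "r - (j + 1) * (\<delta> / n)" and ?s' = "s - (j + 1) * (\<sigma> / n)"
  have r1: "?r1 \<le> r" using j pos by simp
  have n1: "nb ?r1 ?s1 (lt e X m F) ?d" using Suc unfolding j_def by simp
  have t1: "tp (B ?r1) (lt e X m F)"
    by (rule tp_subset[OF tp_lt[OF _ X(1) F]]) (use r1 in auto)
  have s'0: "0 \<le> ?s'"
  proof -
    have "(j + 1) * (\<sigma> / n) \<le> n * (\<sigma> / n)" using j pos by (intro mult_right_mono) auto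
    then show ?thesis using pos by simp
  qed
  have "nb ?r' ?s' (br (lt e X m F) X) (?d * g * (1 / (exp 1 * (?s1 - ?s') * (r - ?r')) + 1 / (exp 1 * (s - ?s') * (?r1 - ?r'))))"
    by (rule br_bound[OF n1 t1 X(2,1)]) (use j pos s'0 Yd in \<open>auto simp: divide_strict_right_mono\<close>)
  then have "nb ?r' ?s' (lt e X (Suc m) F) (1 / real (Suc m) * (?d * g * (1 / (exp 1 * (?s1 - ?s') * (r - ?r')) + 1 / (exp 1 * (s - ?s') * (?r1 - ?r')))))"
    unfolding lt.simps by (rule nb_cmult) (use pos in \<open>simp add: norm_divide del: of_nat_Suc\<close>)
  also have "1 / real (Suc m) * (?d * g * (1 / (exp 1 * (?s1 - ?s') * (r - ?r')) + 1 / (exp 1 * (s - ?s') * (?r1 - ?r'))))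
     = c * ?Y ^ Suc m * fact i / (fact (i + Suc m) * fact (Suc m))"
  proof -
    have a: "?s1 - ?s' = \<sigma> / n" "r - ?r' = (j + 1) * (\<delta> / n)" "s - ?s' = (j + 1) * (\<sigma> / n)" "?r1 - ?r' = \<delta> / n"
      by (simp_all add: algebra_simps add_divide_distrib)
    have f: "fact (i + Suc m) = (j + 1) * fact (i + m)" by (simp add: j_def)
    \<comment> \<open>The two terms of \<open>br_bound\<close> coincide: in each, one loss is a
      single level and the other is j + 1 levels.\<close>
    have "g * (1 / (exp 1 * (\<sigma> / n) * ((j + 1) * (\<delta> / n))) + 1 / (exp 1 * ((j + 1) * (\<sigma> / n)) * (\<delta> / n))) = ?Y / (j + 1)"
      using pos j by (simp add: field_simps power2_eq_square)
    then have "?d * g * (1 / (exp 1 * (?s1 - ?s') * (r - ?r')) + 1 / (exp 1 * (s - ?s') * (?r1 - ?r'))) = ?d * (?Y / (j + 1))"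
      unfolding a by (simp only: mult.assoc)
    then show ?thesis
      unfolding f by (simp del: of_nat_Suc) (simp add: field_simps)
  qed
  finally show ?case by (simp add: j_def algebra_simps del: lt.simps)
qed

text \<open>With as many levels as brackets the estimate is p^n times the square of n^n / n!, and
  \<open>power_le_fact_exp\<close> leaves a geometric sequence of ratio (exp 1)^2 * p.\<close>

lemma lt_bound:
  assumes X: "tp (B r) X" "nb r s X g" and F: "tp (B r) F" "nb r s F c"
    and pos: "\<delta> > 0" "\<sigma> > 0" "\<sigma> \<le> s" "c \<ge> 0" "g \<ge> 0" "cmod e = 1" and p: "p = 2 * g / (exp 1 * \<delta> * \<sigma>)" and "n \<ge> 1"
  shows "nb (r - \<delta>) (s - \<sigma>) (lt e X n F) (c * (p * ((exp 1)\<^sup>2 * p) ^ (n - 1)))"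
proof -
  have n: "real n > 0" using \<open>n \<ge> 1\<close> by simp
  have p0: "p \<ge> 0" using pos p by simp
  have "nb (r - real (0 + n) * (\<delta> / real n)) (s - real (0 + n) * (\<sigma> / real n)) (lt e X n F)
     (c * (2 * (real n)\<^sup>2 * g / (exp 1 * \<delta> * \<sigma>)) ^ n * fact 0 / (fact (0 + n) * fact n))"
    by (rule lt_level[OF X F(1)]) (use F pos n in auto)
  then have "nb (r - \<delta>) (s - \<sigma>) (lt e X n F) (c * (2 * (real n)\<^sup>2 * g / (exp 1 * \<delta> * \<sigma>)) ^ n / (fact n * fact n))"
    using n by simp
  moreover have "c * (2 * (real n)\<^sup>2 * g / (exp 1 * \<delta> * \<sigma>)) ^ n / (fact n * fact n) \<le> c * (p * ((exp 1)\<^sup>2 * p) ^ (n - 1))"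
  proof -
    have "(2 * (real n)\<^sup>2 * g / (exp 1 * \<delta> * \<sigma>)) ^ n / (fact n * fact n) = p ^ n * (real n ^ n / fact n)\<^sup>2"
      unfolding p by (simp add: power_mult_distrib power_divide power2_eq_square power_mult[symmetric] mult.commute)
    also have "\<dots> \<le> p ^ n * (exp (real n - 1))\<^sup>2"
      using power_le_fact_exp[OF \<open>n \<ge> 1\<close>] p0
      by (intro mult_left_mono power_mono) (auto simp: pos_divide_le_eq mult.commute)
    also have "\<dots> = p * ((exp 1)\<^sup>2 * p) ^ (n - 1)"
    proof -
      obtain m where m: "n = Suc m" using \<open>n \<ge> 1\<close> by (cases n) auto
      have "(exp (real m))\<^sup>2 = ((exp 1)\<^sup>2) ^ m"
        using exp_of_nat_mult[of m "1::real"] by (simp flip: power_mult add: mult.commute)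
      then show ?thesis by (simp add: m power_mult_distrib)
    qed
    finally show ?thesis using pos by (metis mult_left_mono times_divide_eq_right)
  qed
  ultimately show ?thesis by (rule nb_le)
qed

text \<open>The families may change from term to term, as they do in the remainder of a normal form
  step. Since the sum is bounded by a geometric series, the bound is independent of N.\<close>

lemma lie_sum_bound:
  assumes X: "tp (B r) X" "nb r s X g" and F: "\<And>n. tp (B r) (F n)" "\<And>n. nb r s (F n) c"
    and pos: "\<delta> > 0" "\<sigma> > 0" "\<sigma> \<le> s" "c \<ge> 0" "g \<ge> 0" "cmod e = 1"
    and p: "p = 2 * g / (exp 1 * \<delta> * \<sigma>)" "(exp 1)\<^sup>2 * p < 1"
  shows "nb (r - \<delta>) (s - \<sigma>) (\<lambda>k x. \<Sum>n=1..N. lt e X n (F n) k x) (c * (p / (1 - (exp 1)\<^sup>2 * p)))"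
proof -
  let ?z = "(exp 1)\<^sup>2 * p"
  have p0: "p \<ge> 0" "?z \<ge> 0" using pos p by simp_all
  have "nb (r - \<delta>) (s - \<sigma>) (\<lambda>k x. \<Sum>n=1..N. lt e X n (F n) k x) (\<Sum>n=1..N. c * (p * ?z ^ (n - 1)))"
    by (intro nb_sum lt_bound[OF X F pos p(1)]) auto
  moreover have "(\<Sum>n=1..N. c * (p * ?z ^ (n - 1))) \<le> c * (p / (1 - ?z))"
  proof -
    have "(\<Sum>n=1..N. ?z ^ (n - 1)) = (\<Sum>n<N. ?z ^ n)"
      by (rule sum.reindex_bij_witness[of _ Suc "\<lambda>n. n - 1"]) auto
    also have "\<dots> \<le> 1 / (1 - ?z)"
      using sum_le_suminf[of "\<lambda>n. ?z ^ n" "{..<N}"] p0 p(2) by (simp add: suminf_geometric summable_geometric)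
    finally have "c * p * (\<Sum>n=1..N. ?z ^ (n - 1)) \<le> c * p * (1 / (1 - ?z))"
      using pos p0 by (intro mult_left_mono) auto
    then show ?thesis by (simp add: sum_distrib_left mult.assoc)
  qed
  ultimately show ?thesis by (rule nb_le)
qed

lemma lie_bound:
  assumes X: "tp (B r) X" "nb r s X g" and F: "tp (B r) F" "nb r s F c"
    and pos: "\<delta> > 0" "\<sigma> > 0" "\<sigma> \<le> s" "c \<ge> 0" "g \<ge> 0" "cmod e = 1"
    and p: "p = 2 * g / (exp 1 * \<delta> * \<sigma>)" "(exp 1)\<^sup>2 * p < 1"
  shows "nb (r - \<delta>) (s - \<sigma>) (\<lambda>k x. lie e X N F k x - F k x) (c * (p / (1 - (exp 1)\<^sup>2 * p)))"
proof -
  have "(\<lambda>k x. lie e X N F k x - F k x) = (\<lambda>k x. \<Sum>n=1..N. lt e X n F k x)"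
  proof -
    have "{..N} = insert 0 {1..N}" by auto
    then show ?thesis unfolding lie_def by simp
  qed
  then show ?thesis using lie_sum_bound[OF X F pos p, of N] by simp
qed

text \<open>For the corner terms of \<open>br_lie\<close>: b brackets of G with X, one with F, and i
  further ones with X share i + b + 1 levels.\<close>

lemma lt_br_lt_bound:
  assumes X: "tp (B r) X" "nb r s X g" and F: "tp (B r) F" "nb r s F c" and G: "tp (B r) G" "nb r s G d"
    and pos: "\<delta> > 0" "\<sigma> > 0" "\<sigma> \<le> s" "c \<ge> 0" "d \<ge> 0" "g \<ge> 0" "cmod e = 1" "cmod e' = 1"
    and q: "q = 2 / (exp 1 * \<delta> * \<sigma>)"
  shows "nb (r - \<delta>) (s - \<sigma>) (lt e X i (br F (lt e' X b G)))
     (c * d * q * (real (i + b + 1) * (2 * (exp 1)\<^sup>2 * (g * q)) ^ (i + b)))"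
proof -
  define n where "n = b + 1 + i"
  have n: "real n > 0" by (simp add: n_def)
  have q0: "q \<ge> 0" using pos q by simp
  let ?Y = "2 * (real n)\<^sup>2 * g / (exp 1 * \<delta> * \<sigma>)"
  let ?d = "d * ?Y ^ b / (fact b * fact b)"
  have d0: "?d \<ge> 0" using pos by simp
  have "nb (r - real (0 + b) * (\<delta> / real n)) (s - real (0 + b) * (\<sigma> / real n)) (lt e' X b G)
     (d * ?Y ^ b * fact 0 / (fact (0 + b) * fact b))"
    by (rule lt_level[OF X G(1)]) (use G pos n in \<open>auto simp: n_def\<close>)
  then have G1: "nb (r - real b * (\<delta> / real n)) (s - real b * (\<sigma> / real n)) (lt e' X b G) ?d"
    by simp
  let ?r1 = "r - real b * (\<delta> / n)" and ?s1 = "s - real b * (\<sigma> / n)"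
    and ?r' = "r - real (b + 1) * (\<delta> / n)" and ?s' = "s - real (b + 1) * (\<sigma> / n)"
  have t1: "tp (B ?r1) (lt e' X b G)"
    by (rule tp_subset[OF tp_lt[OF _ X(1) G(1)]]) (use pos in \<open>auto intro!: subset_ball\<close>)
  have s'0: "0 \<le> ?s'"
  proof -
    have "real (b + 1) * (\<sigma> / n) \<le> n * (\<sigma> / n)" using pos n by (intro mult_right_mono) (auto simp: n_def)
    then show ?thesis using pos n by simp
  qed
  have "nb ?r' ?s' (br F (lt e' X b G)) (c * ?d * (1 / (exp 1 * (s - ?s') * (?r1 - ?r')) + 1 / (exp 1 * (?s1 - ?s') * (r - ?r'))))"
    by (rule br_bound[OF F(2,1) G1 t1]) (use pos s'0 d0 n in \<open>auto simp: divide_strict_right_mono\<close>)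
  moreover have "1 / (exp 1 * (s - ?s') * (?r1 - ?r')) + 1 / (exp 1 * (?s1 - ?s') * (r - ?r')) = q * (real n)\<^sup>2 / (real b + 1)"
  proof -
    have a: "?s1 - ?s' = \<sigma> / n" "r - ?r' = (real b + 1) * (\<delta> / n)" "s - ?s' = (real b + 1) * (\<sigma> / n)" "?r1 - ?r' = \<delta> / n"
      by (simp_all add: algebra_simps add_divide_distrib)
    show ?thesis unfolding a q using pos n by (simp add: field_simps power2_eq_square)
  qed
  ultimately have F1: "nb ?r' ?s' (br F (lt e' X b G)) (c * ?d * (q * (real n)\<^sup>2 / (real b + 1)))"
    by (simp only:)
  have t2: "tp (B r) (br F (lt e' X b G))" by (intro tp_br tp_lt X F G) auto
  have "nb (r - real (b + 1 + i) * (\<delta> / real n)) (s - real (b + 1 + i) * (\<sigma> / real n)) (lt e X i (br F (lt e' X b G)))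
    (c * ?d * (q * (real n)\<^sup>2 / (real b + 1)) * ?Y ^ i * fact (b + 1) / (fact (b + 1 + i) * fact i))"
    by (rule lt_level[OF X t2 F1]) (use pos d0 q0 n in \<open>auto simp: n_def\<close>)
  then have "nb (r - \<delta>) (s - \<sigma>) (lt e X i (br F (lt e' X b G)))
     (c * ?d * (q * (real n)\<^sup>2 / (real b + 1)) * ?Y ^ i * fact (b + 1) / (fact n * fact i))"
    using n unfolding n_def[symmetric] by simp
  moreover have "c * ?d * (q * (real n)\<^sup>2 / (real b + 1)) * ?Y ^ i * fact (b + 1) / (fact n * fact i)
     \<le> c * d * q * (real (i + b + 1) * (2 * (exp 1)\<^sup>2 * (g * q)) ^ (i + b))"
  proof -
    have fb: "fact (b + 1) = (real b + 1) * fact b" by simp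
    have Y: "?Y = (real n)\<^sup>2 * (g * q)" unfolding q by simp
    have gen: "c * (d * u / (fb * fb)) * (q * m / b1) * v * (b1 * fb) / (fn * fi)
        = c * d * q * (m * (v * u) * (1 / (fb * fi)) / fn)"
      if "fb \<noteq> 0" "b1 \<noteq> 0" "fi \<noteq> 0" "fn \<noteq> 0" for u v m fb b1 fi fn :: real
      using that by (simp add: field_simps)
    have "c * ?d * (q * (real n)\<^sup>2 / (real b + 1)) * ?Y ^ i * fact (b + 1) / (fact n * fact i)
       = c * d * q * ((real n)\<^sup>2 * ?Y ^ (i + b) * (1 / (fact b * fact i)) / fact n)"
      unfolding fb power_add by (rule gen) auto
    also have "\<dots> \<le> c * d * q * ((real n)\<^sup>2 * ?Y ^ (i + b) * (2 ^ (i + b) * real n / fact n) / fact n)"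
    proof (intro mult_left_mono divide_right_mono)
      \<comment> \<open>The two runs contribute fact b * fact i instead of one factorial of i + b. A
        binomial coefficient, at most 2^(i + b), makes up the difference; hence the extra factor 2
        per bracket and the smallness condition on 2 * (exp 1)^2 * p.\<close>
      have "real (fact (i + b)) = real (fact b * fact i * (i + b choose b))"
        using binomial_fact_lemma[of b "i + b"] by simp
      also have "\<dots> \<le> fact b * fact i * 2 ^ (i + b)"
        using binomial_le_pow2[of "i + b" b] by (simp flip: of_nat_power add: mult_left_mono)
      finally have "fact (i + b) \<le> (fact b * fact i * 2 ^ (i + b) :: real)" by simp
      then have "1 / (fact b * fact i) \<le> (2 ^ (i + b) / fact (i + b) :: real)"
        by (simp add: field_simps)
      also have "\<dots> = 2 ^ (i + b) * real n / fact n"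
        by (simp add: n_def add.commute)
      finally show "1 / (fact b * fact i) \<le> 2 ^ (i + b) * real n / fact n" .
    qed (use pos q0 in auto)
    also have "\<dots> = c * d * q * (real n * (2 * (g * q)) ^ (i + b) * (real n ^ n / fact n)\<^sup>2)"
    proof -
      have "(real n)\<^sup>2 * ((real n)\<^sup>2) ^ (i + b) = ((real n)\<^sup>2) ^ n"
        by (simp add: n_def add.commute)
      also have "\<dots> = (real n ^ n)\<^sup>2"
        by (metis power_mult mult.commute)
      finally have "(real n)\<^sup>2 * ((real n)\<^sup>2) ^ (i + b) = (real n ^ n)\<^sup>2" .
      then show ?thesis unfolding Y
        by (simp add: power_mult_distrib power_divide power2_eq_square[of "fact n"] field_simps)
    qed
    also have "\<dots> \<le> c * d * q * (real n * (2 * (g * q)) ^ (i + b) * (exp (real n - 1))\<^sup>2)"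
      using power_le_fact_exp[of n] pos q0
      by (intro mult_left_mono power_mono) (auto simp: pos_divide_le_eq mult.commute n_def)
    also have "(exp (real n - 1))\<^sup>2 = ((exp 1)\<^sup>2) ^ (i + b)"
    proof -
      have "exp (real n - 1) = exp 1 ^ (i + b)"
        using exp_of_nat_mult[of "i + b" "1::real"] by (simp add: n_def add.commute)
      then show ?thesis by (metis power_mult mult.commute)
    qed
    also have "c * d * q * (real n * (2 * (g * q)) ^ (i + b) * ((exp 1)\<^sup>2) ^ (i + b))
        = c * d * q * (real (i + b + 1) * (2 * (exp 1)\<^sup>2 * (g * q)) ^ (i + b))"
    proof -
      have "(2 * (g * q)) ^ (i + b) * ((exp 1)\<^sup>2) ^ (i + b) = (2 * (exp 1)\<^sup>2 * (g * q)) ^ (i + b)"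
        by (simp add: power_mult_distrib[symmetric] mult_ac)
      moreover have "real n = real (i + b + 1)" by (simp add: n_def)
      ultimately show ?thesis by (simp only: mult.assoc)
    qed
    finally show ?thesis .
  qed
  ultimately show ?thesis by (rule nb_le)
qed

end

section \<open>The iteration\<close>

text \<open>Selects the truncation order: there are (N + 1)^2 corner terms, each bounded by twice A
  * (2 * N + 1) * w^N.\<close>

lemma polynomial_times_power_small:
  fixes w A \<zeta> :: real
  assumes "0 < w" "w < 1" "\<zeta> > 0"
  obtains N :: nat where "N \<ge> 1" "(real N + 1)\<^sup>2 * (2 * (A * ((2 * real N + 1) * w ^ N))) \<le> \<zeta>"
proof -
  have "(\<lambda>N. (real N + 1)\<^sup>2 * (2 * (A * ((2 * real N + 1) * w ^ N)))) \<longlonglongrightarrow> 0"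
    using assms(1,2) by real_asymp
  then have "\<forall>\<^sub>F N in sequentially. (real N + 1)\<^sup>2 * (2 * (A * ((2 * real N + 1) * w ^ N))) < \<zeta>"
    using assms(3) by (rule order_tendstoD)
  then have "\<forall>\<^sub>F N in sequentially. N \<ge> 1 \<and> (real N + 1)\<^sup>2 * (2 * (A * ((2 * real N + 1) * w ^ N))) < \<zeta>"
    using eventually_ge_at_top[of 1] by eventually_elim simp
  then obtain N :: nat where "N \<ge> 1" "(real N + 1)\<^sup>2 * (2 * (A * ((2 * real N + 1) * w ^ N))) < \<zeta>"
    using eventually_happens'[OF sequentially_bot] by blast
  then show thesis by (intro that) auto
qed

section \<open>One step of the normal form\<close>

context poisson_scale
begin

definition mode0 :: "('v \<Rightarrow> complex) \<Rightarrow> 'z \<Rightarrow> 'v \<Rightarrow> complex" where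
  "mode0 h = (\<lambda>k x. if k = 0 then h x else 0)"

definition ham :: "('v \<Rightarrow> complex) \<Rightarrow> ('z \<Rightarrow> 'v \<Rightarrow> complex) \<Rightarrow> 'z \<Rightarrow> 'v \<Rightarrow> complex" where
  "ham h f = (\<lambda>k x. mode0 h k x + f k x)"

lemma holo_if: "(P \<Longrightarrow> holo f S) \<Longrightarrow> (\<not> P \<Longrightarrow> holo g S) \<Longrightarrow> holo (\<lambda>x. if P then f x else g x) S"
  by (cases P) simp_all

lemma tp_mode0: "holo h S \<Longrightarrow> tp S (mode0 h)"
  by (rule tpI[of "{0}"]) (auto simp: mode0_def intro: holo_if)

lemma tp_ham: "holo h S \<Longrightarrow> tp S f \<Longrightarrow> tp S (ham h f)"
  unfolding ham_def by (intro tp_add tp_mode0)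

lemma br_mode0:
  assumes "holo (G p) S" "x \<in> S"
  shows "br (mode0 h) G p x = - (\<i> * G p x * dd (dir p) h x)"
proof -
  have "supp (mode0 h) \<subseteq> {0}" by (auto simp: supp_def mode0_def)
  then have "br (mode0 h) G p x = \<i> * (h x * dd (dir 0) (G p) x - G p x * dd (dir p) h x)"
    using br_eq[of "{0}" "mode0 h" G p x] by (simp add: mode0_def cong: if_cong)
  then show ?thesis using dd_zero_dir[OF assms] by (simp add: mult.assoc)
qed

definition hcut :: "real \<Rightarrow> ('z \<Rightarrow> 'v \<Rightarrow> complex) \<Rightarrow> 'z \<Rightarrow> 'v \<Rightarrow> complex" where
  "hcut K f = (\<lambda>k x. if k \<noteq> 0 \<and> wt k \<le> K then f k x else 0)"

lemma tp_hcut: "tp S f \<Longrightarrow> tp S (hcut K f)"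
  by (rule tpI[of "supp f"]) (auto simp: hcut_def finite_supp not_supp intro: holo_if tp_holo)

lemma nb_hcut: "nb r s f c \<Longrightarrow> nb r s (hcut K f) c"
  by (erule nb_dom) (simp add: hcut_def)

definition gen :: "real \<Rightarrow> ('v \<Rightarrow> complex) \<Rightarrow> ('z \<Rightarrow> 'v \<Rightarrow> complex) \<Rightarrow> 'z \<Rightarrow> 'v \<Rightarrow> complex" where
  "gen K h f = (\<lambda>k x. if k \<noteq> 0 \<and> wt k \<le> K then f k x / (\<i> * dd (dir k) h x) else 0)"

text \<open>The first bracket of h with X is the known family - \<open>hcut K f\<close>. Thus the
  series of the integrable part, which is not small, is expressed by terms of a family as small as
  f, with one bracket fewer.\<close>

lemma lt_one_Suc_mode0:
  assumes S: "open S" and X: "tp S X" and h: "holo h S" and f: "tp S f"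
    and hX: "eqon S (br (mode0 h) X) (\<lambda>k x. - hcut K f k x)"
  shows "eqon S (lt 1 X (Suc m) (mode0 h)) (\<lambda>k x. - (1 / of_nat (Suc m)) * lt 1 X m (hcut K f) k x)"
proof (rule eqonI)
  fix p x assume x: "x \<in> S"
  have tf: "tp S (\<lambda>k x. -1 * hcut K f k x)" by (intro tp_cmult tp_hcut f)
  have "lt 1 X m (br (mode0 h) X) p x = of_nat (Suc m) / 1 * lt 1 X (Suc m) (mode0 h) p x"
    by (rule eqonD[OF lt_br x]) (intro S X tp_mode0 h | simp)+
  moreover have "lt 1 X m (br (mode0 h) X) p x = lt 1 X m (\<lambda>k x. -1 * hcut K f k x) p x"
    by (rule eqonD[OF lt_cong[OF S X tp_br[OF S tp_mode0[OF h] X] tf] x]) (use hX in \<open>simp add: eqon_def\<close>)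
  moreover have "lt 1 X m (\<lambda>k x. -1 * hcut K f k x) p x = -1 * lt 1 X m (hcut K f) p x"
    by (rule eqonD[OF lt_cmult[OF S X tp_hcut[OF f]] x])
  ultimately show "lt 1 X (Suc m) (mode0 h) p x = - (1 / of_nat (Suc m)) * lt 1 X m (hcut K f) p x"
    by (simp del: of_nat_Suc lt.simps add: field_simps)
qed

text \<open>The generator \<open>gen K h f\<close> solves \<open>{h, X} = - hcut K f\<close>, so that the Lie series removes the
  modes up to \<open>K\<close> at first order; the mean value of \<open>f\<close> is absorbed into \<open>h\<close>.\<close>

lemma normal_form_step:
  assumes h: "holo h (B r)" and f: "tp (B r) f" "nb r s f \<epsilon>" and e: "\<epsilon> > 0"
    and dv: "\<And>k x. x \<in> B r \<Longrightarrow> k \<noteq> 0 \<Longrightarrow> wt k \<le> K \<Longrightarrow> a \<le> cmod (dd (dir k) h x)"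
    and pos: "a > 0" "\<delta> > 0" "\<sigma> > 0" "\<sigma> \<le> s" "\<delta> < r"
    and p: "p = 2 * (\<epsilon> / a) / (exp 1 * \<delta> * \<sigma>)" "2 * ((exp 1)\<^sup>2 * p) < 1"
    and q: "q = p / (1 - (exp 1)\<^sup>2 * p)" and C: "C \<ge> 0" and z: "\<zeta> > 0"
  obtains h' f' where "holo h' (B r)" "tp (B r) f'"
    "nb (r - \<delta>) (s - \<sigma>) f' ((exp (- K * \<sigma>) + q) * \<epsilon>)"
    "\<And>x v. x \<in> B (r - \<delta>) \<Longrightarrow> cmod (dd v h' x - dd v h x) \<le> \<epsilon> * norm v / \<delta>"
    "\<And>R S G y. R \<le> r \<Longrightarrow> S \<le> s \<Longrightarrow> \<sigma> \<le> S \<Longrightarrow> tp (B R) G \<Longrightarrow> nb R S G C \<Longrightarrow> y \<ge> 0 \<Longrightarrow>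
       nb R S (br G (ham h' f')) y \<Longrightarrow>
       \<exists>G'. tp (B R) G' \<and> nb (R - \<delta>) (S - \<sigma>) (\<lambda>k x. G' k x - G k x) (C * q) \<and>
         nb (R - \<delta>) (S - \<sigma>) (br G' (ham h f)) ((1 + q) * y + \<zeta>)"
proof -
  define X where "X = gen K h f"
  define g where "g = \<epsilon> / a"
  define q0 where "q0 = 2 / (exp 1 * \<delta> * \<sigma>)"
  define w where "w = 2 * (exp 1)\<^sup>2 * (g * q0)"
  have g: "g > 0" using e pos by (simp add: g_def)
  have q0: "q0 > 0" using pos by (simp add: q0_def)
  have pg: "p = 2 * g / (exp 1 * \<delta> * \<sigma>)" "p = g * q0" by (simp_all add: p g_def q0_def)
  have w: "0 < w" "w < 1" using g q0 p(2) pg(2) by (simp_all add: w_def)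
  have z1: "(exp 1)\<^sup>2 * p < 1" "p > 0" using p(2) g q0 pg(2) by (auto simp: mult.assoc)
  have q_pos: "q \<ge> 0" using z1 by (simp add: q)
  \<comment> \<open>The order depends on \<zeta> and C, whereas the bound for the new perturbation
    is uniform in it.\<close>
  obtain N :: nat where N: "N \<ge> 1" "(real N + 1)\<^sup>2 * (2 * ((C * \<epsilon> * q0) * ((2 * real N + 1) * w ^ N))) \<le> \<zeta>"
    using polynomial_times_power_small[OF w z] by blast
  have S: "open (B r)" by simp
  have nz: "dd (dir k) h x \<noteq> 0" if "x \<in> B r" "k \<noteq> 0" "wt k \<le> K" for k x
    using dv[OF that] pos by auto
  have X: "tp (B r) X"
  proof (rule tpI[of "supp f"])
    show "holo (X k) (B r)" for k
    proof (cases "k \<noteq> 0 \<and> wt k \<le> K")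
      case True
      then have "X k = (\<lambda>x. f k x / (\<i> * dd (dir k) h x))" by (auto simp: X_def gen_def)
      then show ?thesis
        using True nz by (auto intro!: holo_divide holo_cmult holo_dd h tp_holo[OF f(1)])
    next
      case False
      then have "X k = (\<lambda>x. 0)" by (auto simp: X_def gen_def)
      then show ?thesis by simp
    qed
  qed (use f in \<open>auto simp: finite_supp X_def gen_def not_supp\<close>)
  have nX: "nb r s X g"
  proof -
    have "nb r s (\<lambda>k x. of_real (1 / a) * f k x) ((1 / a) * \<epsilon>)"
      by (rule nb_cmult[OF f(2)]) (use pos in \<open>simp add: norm_divide\<close>)
    then have "nb r s X ((1 / a) * \<epsilon>)"
    proof (rule nb_dom)
      fix k x assume x: "x \<in> B r"
      show "cmod (X k x) \<le> cmod (of_real (1 / a) * f k x)"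
        using dv[OF x, of k] pos
        by (auto simp: X_def gen_def norm_divide norm_mult intro!: divide_left_mono mult_pos_pos)
    qed
    then show ?thesis by (simp add: g_def)
  qed
  have hX: "eqon (B r) (br (mode0 h) X) (\<lambda>k x. - hcut K f k x)"
  proof (rule eqonI)
    fix k x assume x: "x \<in> B r"
    show "br (mode0 h) X k x = - hcut K f k x"
      unfolding br_mode0[OF tp_holo[OF X] x] using nz[OF x, of k]
      by (simp add: X_def gen_def hcut_def field_simps)
  qed
  have ltH: "lt 1 X (Suc m) (ham h f) k x = lt 1 X (Suc m) f k x - 1 / of_nat (Suc m) * lt 1 X m (hcut K f) k x"
    if x: "x \<in> B r" for m k x
  proof -
    have "lt 1 X (Suc m) (ham h f) k x = lt 1 X (Suc m) (mode0 h) k x + lt 1 X (Suc m) f k x"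
      unfolding ham_def by (rule eqonD[OF lt_add[OF S X tp_mode0[OF h] f(1)] x])
    then show ?thesis
      using eqonD[OF lt_one_Suc_mode0[OF S X h f(1) hX] x, of m k] by (simp del: lt.simps of_nat_Suc)
  qed
  \<comment> \<open>Collects the terms with exactly m brackets: the m-th one of f and, from the (m +
    1)-st one of h, the cut family. The truncated series of h ends at order N, so nothing of it is
    left for m = N.\<close>
  define G where "G m = (\<lambda>k x. f k x - (if m < N then 1 / of_nat (Suc m) else 0) * hcut K f k x)" for m
  have tG: "tp (B r) (G m)" for m unfolding G_def by (intro tp_diff tp_cmult tp_hcut f)
  have nG: "nb r s (G m) \<epsilon>" for m
    using f(2)
  proof (rule nb_dom)
    fix k x
    show "cmod (G m k x) \<le> cmod (f k x)"
    proof (cases "m < N \<and> k \<noteq> 0 \<and> wt k \<le> K")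
      case True
      then have "G m k x = of_real (1 - 1 / real (Suc m)) * f k x"
        by (simp add: G_def hcut_def algebra_simps)
      moreover have "\<bar>1 - 1 / real (Suc m)\<bar> \<le> 1" by (simp add: abs_if)
      ultimately show ?thesis by (simp only: norm_mult norm_of_real) (simp add: mult_left_le_one_le)
    qed (auto simp: G_def hcut_def)
  qed
  have ltG: "lt 1 X m (G m) k x = lt 1 X m f k x - (if m < N then 1 / of_nat (Suc m) else 0) * lt 1 X m (hcut K f) k x"
    if x: "x \<in> B r" for m k x
    unfolding G_def eqonD[OF lt_diff[OF S X f(1) tp_cmult[OF tp_hcut[OF f(1)]]] x]
    by (simp only: eqonD[OF lt_cmult[OF S X tp_hcut[OF f(1)]] x])
  define h' where "h' x = h x + f 0 x" for x
  define tail where "tail k x = (if k = 0 then 0 else f k x - hcut K f k x)" for k x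
  define f' where "f' k x = tail k x + (\<Sum>m=1..N. lt 1 X m (G m) k x)" for k x
  have h': "holo h' (B r)" unfolding h'_def by (intro holo_add h tp_holo[OF f(1)])
  have tt: "tp (B r) tail"
  proof (rule tpI[of "supp f"])
    show "holo (tail k) (B r)" for k
      using tp_holo[OF f(1), of k] tp_holo[OF tp_hcut[OF f(1)], of K k]
      by (cases "k = 0") (auto simp: tail_def[abs_def] intro: holo_diff)
  qed (use f in \<open>auto simp: finite_supp tail_def hcut_def not_supp\<close>)
  have f': "tp (B r) f'" unfolding f'_def by (intro tp_add tp_sum tp_lt S X tG tt)
  \<comment> \<open>The new Hamiltonian is exactly the truncated transform of the old one: its
    remainder f' contains everything except the new integrable part, so no truncation error appears
    here.\<close>
  have T: "eqon (B r) (lie 1 X N (ham h f)) (ham h' f')"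
  proof (rule eqonI)
    fix k x assume x: "x \<in> B r"
    obtain N' where N': "N = Suc N'" using N(1) by (cases N) auto
    have "lie 1 X N (ham h f) k x = ham h f k x + (\<Sum>m\<le>N'. lt 1 X (Suc m) (ham h f) k x)"
      unfolding lie_def N' by (subst sum.atMost_Suc_shift) simp
    also have "(\<Sum>m\<le>N'. lt 1 X (Suc m) (ham h f) k x)
        = (\<Sum>m\<le>N'. lt 1 X (Suc m) f k x) - (\<Sum>m\<le>N'. 1 / of_nat (Suc m) * lt 1 X m (hcut K f) k x)"
      by (simp add: ltH[OF x] sum_subtractf del: lt.simps of_nat_Suc)
    also have "(\<Sum>m\<le>N'. lt 1 X (Suc m) f k x) = (\<Sum>m=1..N. lt 1 X m f k x)"
      unfolding N' by (rule sum.reindex_bij_witness[of _ "\<lambda>m. m - 1" Suc]) auto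
    also have "(\<Sum>m\<le>N'. 1 / of_nat (Suc m) * lt 1 X m (hcut K f) k x)
        = hcut K f k x + (\<Sum>m=1..N. (if m < N then 1 / of_nat (Suc m) else 0) * lt 1 X m (hcut K f) k x)"
    proof -
      have "(\<Sum>m=1..N. (if m < N then 1 / of_nat (Suc m) else 0) * lt 1 X m (hcut K f) k x)
          = (\<Sum>m=1..N'. 1 / of_nat (Suc m) * lt 1 X m (hcut K f) k x)"
        unfolding N' by (rule sum.mono_neutral_cong_right) (auto simp del: of_nat_Suc)
      moreover have "{..N'} = insert 0 {1..N'}" by auto
      ultimately show ?thesis by (simp del: of_nat_Suc) simp
    qed
    finally have "lie 1 X N (ham h f) k x = ham h f k x - hcut K f k x + (\<Sum>m=1..N. lt 1 X m (G m) k x)"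
      by (simp add: ltG[OF x] sum_subtractf del: of_nat_Suc)
    then show "lie 1 X N (ham h f) k x = ham h' f' k x"
      by (simp add: ham_def mode0_def h'_def f'_def tail_def hcut_def)
  qed
  have nf': "nb (r - \<delta>) (s - \<sigma>) f' ((exp (- K * \<sigma>) + q) * \<epsilon>)"
  proof -
    \<comment> \<open>Modes of order above K gain exp (- K * \<sigma>) from the narrowing of the
      strip.\<close>
    have "nb (r - \<delta>) (s - \<sigma>) tail (exp (- K * \<sigma>) * \<epsilon>)"
    proof (rule nbI)
      fix x and P :: "'z set" assume x: "x \<in> B (r - \<delta>)" and P: "finite P"
      have x': "x \<in> B r" using x pos by auto
      have "cmod (tail k x) * exp (wt k * (s - \<sigma>)) \<le> exp (- K * \<sigma>) * (cmod (f k x) * exp (wt k * s))" for k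
      proof (cases "k \<noteq> 0 \<and> wt k > K")
        case True
        then have "wt k * (s - \<sigma>) \<le> - K * \<sigma> + wt k * s" using pos by (simp add: algebra_simps)
        then have "exp (wt k * (s - \<sigma>)) \<le> exp (- K * \<sigma>) * exp (wt k * s)" by (simp flip: exp_add)
        then have "cmod (f k x) * exp (wt k * (s - \<sigma>)) \<le> cmod (f k x) * (exp (- K * \<sigma>) * exp (wt k * s))"
          by (intro mult_left_mono) auto
        then show ?thesis using True by (simp add: tail_def hcut_def mult_ac)
      qed (auto simp: tail_def hcut_def)
      then have "(\<Sum>k\<in>P. cmod (tail k x) * exp (wt k * (s - \<sigma>)))
          \<le> exp (- K * \<sigma>) * (\<Sum>k\<in>P. cmod (f k x) * exp (wt k * s))"
        unfolding sum_distrib_left by (intro sum_mono)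
      also have "\<dots> \<le> exp (- K * \<sigma>) * \<epsilon>"
        by (intro mult_left_mono nbD[OF f(2) x' P]) auto
      finally show "(\<Sum>k\<in>P. cmod (tail k x) * exp (wt k * (s - \<sigma>))) \<le> exp (- K * \<sigma>) * \<epsilon>" .
    qed
    moreover have "nb (r - \<delta>) (s - \<sigma>) (\<lambda>k x. \<Sum>m=1..N. lt 1 X m (G m) k x) (\<epsilon> * q)"
      unfolding q by (rule lie_sum_bound[OF X nX tG nG]) (use pos g e z1 pg in auto)
    ultimately show ?thesis
      unfolding f'_def using nb_add by (fastforce simp: algebra_simps)
  qed
  have dh': "cmod (dd v h' x - dd v h x) \<le> \<epsilon> * norm v / \<delta>" if x: "x \<in> B (r - \<delta>)" for x v
  proof -
    have x': "x \<in> B r" using x pos by auto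
    have "dd v h' x - dd v h x = dd v (f 0) x"
      unfolding h'_def dd_add[OF h tp_holo[OF f(1)] x'] by simp
    moreover have "cmod (dd v (f 0) x) \<le> \<epsilon> * norm v / \<delta>"
    proof (rule dd_bound[OF tp_holo[OF f(1)] _ x pos(2)])
      fix y assume y: "y \<in> B r"
      have "cmod (f 0 y) * 1 \<le> cmod (f 0 y) * exp (wt 0 * s)"
        using pos by (intro mult_left_mono) (auto simp: less_imp_le)
      then show "cmod (f 0 y) \<le> \<epsilon>" using nbD[OF f(2) y, of "{0}"] by simp
    qed
    ultimately show ?thesis by simp
  qed
  show thesis
  proof (rule that[OF h' f' nf' dh'])
    fix R S Ga y
    assume R: "R \<le> r" and Ss: "S \<le> s" "\<sigma> \<le> S" and Ga: "tp (B R) Ga" "nb R S Ga C" and y: "y \<ge> 0"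
      and br: "nb R S (br Ga (ham h' f')) y"
    have sub: "B R \<subseteq> B r" using R by auto
    have XR: "tp (B R) X" "nb R S X g"
      using tp_subset[OF X sub] nb_mono[OF nX R Ss(1)] by auto
    have fR: "tp (B R) f" "nb R S f \<epsilon>" "tp (B R) (hcut K f)" "nb R S (hcut K f) \<epsilon>"
      using tp_subset[OF f(1) sub] nb_mono[OF f(2) R Ss(1)] tp_subset[OF tp_hcut[OF f(1)] sub]
        nb_mono[OF nb_hcut[OF f(2)] R Ss(1)] by auto
    have hR: "tp (B R) (ham h f)" "tp (B R) (ham h' f')"
      using tp_subset[OF tp_ham[OF h f(1)] sub] tp_subset[OF tp_ham[OF h' f'] sub] by auto
    have oR: "open (B R)" by simp
    \<comment> \<open>By \<open>br_lie\<close> the bracket of G' with the old Hamiltonian is the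
      inverse series applied to the bracket of Ga with the new one, up to the corner terms. No
      coordinates are transformed back.\<close>
    define G' where "G' = lie (-1) X N Ga"
    have tG': "tp (B R) G'" unfolding G'_def by (rule tp_lie[OF oR XR(1) Ga(1)])
    have tT: "tp (B R) (lie 1 X N (ham h f))" by (rule tp_lie[OF oR XR(1) hR(1)])
    have n1: "nb (R - \<delta>) (S - \<sigma>) (\<lambda>k x. G' k x - Ga k x) (C * q)"
      unfolding G'_def q by (rule lie_bound[OF XR Ga]) (use pos Ss C g z1 pg in auto)
    let ?err = "\<lambda>k x. \<Sum>c\<le>N. \<Sum>b\<le>N. if N < c + b then lt (-1) X c (br Ga (lt 1 X b (ham h f))) k x else 0"
    let ?bb = "2 * ((C * \<epsilon> * q0) * ((2 * real N + 1) * w ^ N))"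
    have bb: "?bb \<ge> 0" using C e q0 w by simp
    have errb: "nb (R - \<delta>) (S - \<sigma>) (lt (-1) X c (br Ga (lt 1 X b (ham h f)))) ?bb"
      if cb: "c \<le> N" "b \<le> N" "N < c + b" for c b
    proof -
      \<comment> \<open>In a corner term c \<le> N < c + b forces b \<ge> 1, so the integrable part
        occurs only under a bracket with X and can be replaced by \<open>hcut K f\<close>. This
        costs one bracket, and c + b' \<ge> N still holds.\<close>
      obtain b' where b': "b = Suc b'" using cb by (cases b) auto
      let ?T1 = "lt (-1) X c (br Ga (lt 1 X b f))" and ?T2 = "lt (-1) X c (br Ga (lt 1 X b' (hcut K f)))"
      have pw: "(real (c + j) + 1) * w ^ (c + j) \<le> (2 * real N + 1) * w ^ N" if "j \<le> N" "N \<le> c + j" for j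
        using that cb w by (intro mult_mono power_decreasing) auto
      have 1: "nb (R - \<delta>) (S - \<sigma>) ?T1 (C * \<epsilon> * q0 * (real (c + b + 1) * w ^ (c + b)))"
        unfolding w_def by (rule lt_br_lt_bound[OF XR Ga fR(1,2)]) (use pos Ss C e g in \<open>auto simp: q0_def\<close>)
      have 2: "nb (R - \<delta>) (S - \<sigma>) ?T2 (C * \<epsilon> * q0 * (real (c + b' + 1) * w ^ (c + b')))"
        unfolding w_def by (rule lt_br_lt_bound[OF XR Ga fR(3,4)]) (use pos Ss C e g in \<open>auto simp: q0_def\<close>)
      have one: "nb (R - \<delta>) (S - \<sigma>) ?T1 (C * \<epsilon> * q0 * ((2 * real N + 1) * w ^ N))"
        by (rule nb_le[OF 1]) (use pw[of b] cb C e q0 in \<open>auto intro!: mult_left_mono simp: add.commute\<close>)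
      have two: "nb (R - \<delta>) (S - \<sigma>) ?T2 (C * \<epsilon> * q0 * ((2 * real N + 1) * w ^ N))"
        by (rule nb_le[OF 2]) (use pw[of b'] cb b' C e q0 in \<open>auto intro!: mult_left_mono simp: add.commute\<close>)
      have "nb (R - \<delta>) (S - \<sigma>) (\<lambda>k x. (1 / of_nat (Suc b')) * ?T2 k x) (1 * (C * \<epsilon> * q0 * ((2 * real N + 1) * w ^ N)))"
        by (rule nb_cmult[OF two]) (simp add: norm_divide del: of_nat_Suc)
      from nb_diff[OF one this]
      have "nb (R - \<delta>) (S - \<sigma>) (\<lambda>k x. ?T1 k x - (1 / of_nat (Suc b')) * ?T2 k x) ?bb"
        by (simp only: mult_2 mult_1_left)
      moreover have "eqon (B (R - \<delta>)) (\<lambda>k x. ?T1 k x - (1 / of_nat (Suc b')) * ?T2 k x)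
         (lt (-1) X c (br Ga (lt 1 X b (ham h f))))"
      proof (rule eqonI)
        fix k x assume "x \<in> B (R - \<delta>)"
        then have x: "x \<in> B R" using pos by auto
        let ?F1 = "br Ga (lt 1 X b f)" and ?F2 = "br Ga (lt 1 X b' (hcut K f))"
        have t: "tp (B R) ?F1" "tp (B R) ?F2" "tp (B R) (lt 1 X b f)" "tp (B R) (lt 1 X b' (hcut K f))"
          by (intro tp_br tp_lt oR Ga XR fR)+
        have "eqon (B R) (br Ga (lt 1 X b (ham h f))) (\<lambda>k x. ?F1 k x - (1 / of_nat (Suc b')) * ?F2 k x)"
        proof (rule eqonI)
          fix k x assume x: "x \<in> B R"
          have "br Ga (lt 1 X b (ham h f)) k x
             = br Ga (\<lambda>k x. lt 1 X b f k x + (- (1 / of_nat (Suc b'))) * lt 1 X b' (hcut K f) k x) k x"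
          proof (rule eqonD[OF br_cong[OF oR] x])
            show "eqon (B R) (lt 1 X b (ham h f)) (\<lambda>k x. lt 1 X b f k x + (- (1 / of_nat (Suc b'))) * lt 1 X b' (hcut K f) k x)"
            proof (rule eqonI)
              fix k x assume "x \<in> B R"
              then have "x \<in> B r" using sub by auto
              then show "lt 1 X b (ham h f) k x = lt 1 X b f k x + (- (1 / of_nat (Suc b'))) * lt 1 X b' (hcut K f) k x"
                unfolding b' by (simp add: ltH del: lt.simps of_nat_Suc)
            qed
          qed (auto simp: eqon_def finite_supp[OF Ga(1)])
          also have "\<dots> = ?F1 k x + (- (1 / of_nat (Suc b'))) * ?F2 k x"
            by (simp only: br_add_right[OF t(3) tp_cmult[OF t(4)] x Ga(1)] br_cmult_right[OF t(4) x Ga(1)])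
          finally show "br Ga (lt 1 X b (ham h f)) k x = ?F1 k x - (1 / of_nat (Suc b')) * ?F2 k x" by simp
        qed
        then have "lt (-1) X c (br Ga (lt 1 X b (ham h f))) k x
           = lt (-1) X c (\<lambda>k x. ?F1 k x - (1 / of_nat (Suc b')) * ?F2 k x) k x"
          by (intro eqonD[OF lt_cong[OF oR XR(1)] x] tp_br tp_lt tp_diff tp_cmult oR Ga XR fR hR)
        also have "\<dots> = ?T1 k x - lt (-1) X c (\<lambda>k x. (1 / of_nat (Suc b')) * ?F2 k x) k x"
          by (rule eqonD[OF lt_diff[OF oR XR(1) t(1) tp_cmult[OF t(2)]] x])
        also have "\<dots> = ?T1 k x - (1 / of_nat (Suc b')) * ?T2 k x"
          by (simp only: eqonD[OF lt_cmult[OF oR XR(1) t(2)] x])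
        finally show "?T1 k x - (1 / of_nat (Suc b')) * ?T2 k x = lt (-1) X c (br Ga (lt 1 X b (ham h f))) k x" by simp
      qed
      ultimately show ?thesis by (rule nb_eqon)
    qed
    have nerr: "nb (R - \<delta>) (S - \<sigma>) ?err \<zeta>"
    proof -
      have "nb (R - \<delta>) (S - \<sigma>) ?err (\<Sum>c\<le>N. \<Sum>b\<le>N. ?bb)"
      proof (intro nb_sum finite_atMost)
        fix c b assume cb: "c \<in> {..N}" "b \<in> {..N}"
        show "nb (R - \<delta>) (S - \<sigma>) (\<lambda>k x. if N < c + b then lt (-1) X c (br Ga (lt 1 X b (ham h f))) k x else 0) ?bb"
          using errb[of c b] cb bb by (cases "N < c + b") (auto simp: nb_def)
      qed
      moreover have "(\<Sum>c\<le>N. \<Sum>b\<le>N. ?bb) \<le> \<zeta>"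
        using N(2) by (simp add: power2_eq_square mult.assoc add.commute)
      ultimately show ?thesis by (rule nb_le)
    qed
    let ?L = "lie (-1) X N (br Ga (ham h' f'))"
    have tb: "tp (B R) (br Ga (ham h' f'))" by (intro tp_br oR Ga hR)
    have "nb (R - \<delta>) (S - \<sigma>) (\<lambda>k x. ?L k x - br Ga (ham h' f') k x) (y * q)"
      unfolding q by (rule lie_bound[OF XR tb br]) (use pos Ss y g z1 pg in auto)
    from nb_add[OF this nb_mono[OF br, of "R - \<delta>" "S - \<sigma>" y]]
    have "nb (R - \<delta>) (S - \<sigma>) ?L (y * q + y)" using pos by simp
    from nb_diff[OF this nerr]
    have "nb (R - \<delta>) (S - \<sigma>) (\<lambda>k x. ?L k x - ?err k x) ((1 + q) * y + \<zeta>)"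
      by (simp add: algebra_simps)
    moreover have "eqon (B (R - \<delta>)) (\<lambda>k x. ?L k x - ?err k x) (br G' (ham h f))"
    proof (rule eqonI)
      fix k x assume "x \<in> B (R - \<delta>)"
      then have x: "x \<in> B R" using pos by auto
      have TR: "eqon (B R) (lie 1 X N (ham h f)) (ham h' f')"
        using T sub by (auto simp: eqon_def)
      have "lie (-1) X N (br Ga (lie 1 X N (ham h f))) k x = ?L k x"
        unfolding lie_def[of "-1"]
        by (intro sum.cong refl eqonD[OF lt_cong[OF oR XR(1)] x] tp_br tT hR oR Ga br_cong finite_supp[OF Ga(1)] TR)
           (simp add: eqon_def)
      then show "?L k x - ?err k x = br G' (ham h f) k x"
        unfolding G'_def eqonD[OF br_lie[OF oR XR(1) Ga(1) hR(1)] x] by simp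
    qed
    ultimately have "nb (R - \<delta>) (S - \<sigma>) (br G' (ham h f)) ((1 + q) * y + \<zeta>)" by (rule nb_eqon)
    with tG' n1 show "\<exists>G'. tp (B R) G' \<and> nb (R - \<delta>) (S - \<sigma>) (\<lambda>k x. G' k x - Ga k x) (C * q) \<and>
         nb (R - \<delta>) (S - \<sigma>) (br G' (ham h f)) ((1 + q) * y + \<zeta>)" by blast
  qed
qed

end

section \<open>Induction on the number of steps\<close>

context poisson_scale
begin

text \<open>The radii lost while normalising and again while transporting \<open>L\<close> back form geometric
  series, since the perturbation shrinks by \<open>1/4\<close> and the loss \<open>\<delta>\<close> by \<open>1/2\<close> at each step.\<close>

lemma approximate_integral:
  assumes L: "holo L (B rmax)" "\<And>x. x \<in> B rmax \<Longrightarrow> cmod (L x) \<le> \<Lambda>"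
      "\<And>x u. x \<in> B rmax \<Longrightarrow> cmod (dd u L x) \<le> norm u"
    and par: "a > 0" "\<sigma> > 0" "s' > 0" "K > 0" "\<Lambda> \<ge> 0"
    and h: "holo h (B r)" and f: "tp (B r) f" "nb r s f \<epsilon>" and pos: "\<epsilon> > 0" "\<delta> > 0" "4 * \<delta> < r" "r \<le> rmax"
    and dv: "\<And>k x. x \<in> B r \<Longrightarrow> k \<noteq> 0 \<Longrightarrow> wt k \<le> K \<Longrightarrow> a + 2 * K * \<epsilon> / \<delta> \<le> cmod (dd (dir k) h x)"
    and p: "p = 2 * (\<epsilon> / a) / (exp 1 * \<delta> * \<sigma>)" "2 * ((exp 1)\<^sup>2 * p) < 1"
    and \<beta>: "p / (1 - (exp 1)\<^sup>2 * p) \<le> \<beta>" "exp (- K * \<sigma>) + \<beta> \<le> 1 / 4"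
    and s: "2 * real m * \<sigma> + s' \<le> s" and z: "\<zeta> > 0"
  shows "\<exists>G. tp (B (r - 4 * \<delta>)) G
    \<and> nb (r - 4 * \<delta>) (s - 2 * real m * \<sigma> - s') (\<lambda>k x. G k x - mode0 L k x) ((exp (2 * \<beta>) - 1) * \<Lambda>)
    \<and> nb (r - 4 * \<delta>) (s - 2 * real m * \<sigma> - s') (br G (ham h f)) (exp (2 * \<beta>) * (\<epsilon> / 4 ^ m / (exp 1 * s')) + \<zeta>)"
  using h f pos dv p \<beta> s z
proof (induction m arbitrary: h r f s \<epsilon> \<delta> p \<beta> \<zeta>)
  case (0 h r f s \<epsilon> \<delta> p \<beta> \<zeta>)
  let ?r = "r - 4 * \<delta>"
  have "p > 0" using 0 par by simp
  moreover have "(exp 1)\<^sup>2 * p < 1"    using 0(10) mult_pos_pos[OF _ \<open>p > 0\<close>, of "(exp 1)\<^sup>2"] by simp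
  ultimately have b0: "\<beta> \<ge> 0" using 0 by (meson divide_nonneg_pos diff_gt_0_iff_gt less_imp_le order_trans)
  have sub: "B ?r \<subseteq> B rmax" "B ?r \<subseteq> B r" using 0 by auto
  have tL: "tp (B ?r) (mode0 L)" by (rule tp_mode0[OF holo_subset[OF L(1) sub(1)]])
  have "nb ?r (s - s') (\<lambda>k x. mode0 L k x - mode0 L k x) ((exp (2 * \<beta>) - 1) * \<Lambda>)"
    using b0 par by (simp add: nb_def)
  \<comment> \<open>L and h are functions of the actions and commute, so only the bracket of L with
    f remains; the strip s' pays for the angle derivative of f.\<close>
  moreover have "nb ?r (s - s') (br (mode0 L) (ham h f)) (exp (2 * \<beta>) * (\<epsilon> / (exp 1 * s')) + \<zeta>)"
  proof (rule nbI)
    fix x and P :: "'z set" assume x: "x \<in> B ?r" and P: "finite P"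
    have xr: "x \<in> B r" "x \<in> B rmax" using x sub by auto
    have "cmod (br (mode0 L) (ham h f) k x) * exp (wt k * (s - s')) \<le> cmod (f k x) * (wt k * exp (wt k * (s - s')))" for k
    proof -
      have "cmod (br (mode0 L) (ham h f) k x) = cmod (ham h f k x) * cmod (dd (dir k) L x)"
        using br_mode0[OF tp_holo[OF tp_ham[OF 0(1,2)]] xr(1)] by (simp add: norm_mult)
      also have "\<dots> \<le> cmod (f k x) * wt k"
      proof (cases "k = 0")
        case True
        then show ?thesis using dd_zero_dir[OF L(1) xr(2)] by simp
      next
        case False
        have "cmod (dd (dir k) L x) \<le> wt k" using L(3)[OF xr(2)] norm_dir order_trans by blast
        then show ?thesis using False by (simp add: ham_def mode0_def mult_left_mono)
      qed
      finally show ?thesis by (simp add: mult_right_mono mult.assoc[symmetric])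
    qed
    then have "(\<Sum>k\<in>P. cmod (br (mode0 L) (ham h f) k x) * exp (wt k * (s - s')))
      \<le> (\<Sum>k\<in>P. cmod (f k x) * (wt k * exp (wt k * (s - s'))))" by (intro sum_mono)
    also have "\<dots> \<le> \<epsilon> / (exp 1 * (s - (s - s')))"
      using par by (intro nb_wt[OF 0(3) xr(1) _ P]) simp
    also have "\<dots> \<le> exp (2 * \<beta>) * (\<epsilon> / (exp 1 * s')) + \<zeta>"
    proof -
      have "1 * (\<epsilon> / (exp 1 * s')) \<le> exp (2 * \<beta>) * (\<epsilon> / (exp 1 * s'))"
        using b0 0 par by (intro mult_right_mono) auto
      then show ?thesis using 0 by simp
    qed
    finally show "(\<Sum>k\<in>P. cmod (br (mode0 L) (ham h f) k x) * exp (wt k * (s - s'))) \<le> exp (2 * \<beta>) * (\<epsilon> / (exp 1 * s')) + \<zeta>" .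
  qed
  ultimately show ?case using tL by (intro exI[of _ "mode0 L"]) simp
next
  case (Suc m h r f s \<epsilon> \<delta> p \<beta> \<zeta>)
  note h = Suc.prems(1) and f = Suc.prems(2,3) and pos = Suc.prems(4-7) and dv = Suc.prems(8)
    and p = Suc.prems(9,10) and \<beta> = Suc.prems(11,12) and s = Suc.prems(13) and z = Suc.prems(14)
  define q where "q = p / (1 - (exp 1)\<^sup>2 * p)"
  have p0: "p > 0" using pos par p(1) by simp
  have E2: "(exp 1)\<^sup>2 * p > 0" using p0 by simp
  have z1: "(exp 1)\<^sup>2 * p < 1" using p(2) E2 by linarith
  have q: "q > 0" "q \<le> \<beta>" using p0 z1 \<beta> by (simp_all add: q_def)
  have e1: "1 + \<beta> \<le> exp \<beta>" "exp \<beta> * exp \<beta> = exp (2 * \<beta>)" "1 \<le> exp \<beta>"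
    using exp_ge_add_one_self[of \<beta>] q by (auto simp flip: exp_add)
  have dv': "a \<le> cmod (dd (dir k) h x)" if "x \<in> B r" "k \<noteq> 0" "wt k \<le> K" for k x
  proof -
    have "0 \<le> 2 * K * \<epsilon> / \<delta>" using pos par by simp
    then show ?thesis using dv[OF that] by linarith
  qed
  \<comment> \<open>Bound for the function returned by the inner levels: \<Lambda> for L plus the
    deviation (exp \<beta> - 1) * \<Lambda>.\<close>
  define C where "C = exp \<beta> * \<Lambda>"
  have C: "C \<ge> 0" using par by (simp add: C_def)
  have sg: "\<sigma> \<le> s"
  proof -
    have "1 * \<sigma> \<le> (2 * real (Suc m)) * \<sigma>" using par by (intro mult_right_mono) auto
    then show ?thesis using s par by linarith
  qed
  obtain h' f' where h': "holo h' (B r)" and f': "tp (B r) f'"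
    "nb (r - \<delta>) (s - \<sigma>) f' ((exp (- K * \<sigma>) + q) * \<epsilon>)"
    and dh: "\<And>x v. x \<in> B (r - \<delta>) \<Longrightarrow> cmod (dd v h' x - dd v h x) \<le> \<epsilon> * norm v / \<delta>"
    and step: "\<And>R S G y. R \<le> r \<Longrightarrow> S \<le> s \<Longrightarrow> \<sigma> \<le> S \<Longrightarrow> tp (B R) G \<Longrightarrow> nb R S G C \<Longrightarrow> y \<ge> 0 \<Longrightarrow>
       nb R S (br G (ham h' f')) y \<Longrightarrow>
       \<exists>G'. tp (B R) G' \<and> nb (R - \<delta>) (S - \<sigma>) (\<lambda>k x. G' k x - G k x) (C * q) \<and>
         nb (R - \<delta>) (S - \<sigma>) (br G' (ham h f)) ((1 + q) * y + \<zeta> / 2)"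
  proof (rule normal_form_step[of h r f s \<epsilon> K a \<delta> \<sigma> p q C "\<zeta> / 2"])
    fix h' f'
    assume "holo h' (B r)" "tp (B r) f'" "nb (r - \<delta>) (s - \<sigma>) f' ((exp (- K * \<sigma>) + q) * \<epsilon>)"
      "\<And>x v. x \<in> B (r - \<delta>) \<Longrightarrow> cmod (dd v h' x - dd v h x) \<le> \<epsilon> * norm v / \<delta>"
      "\<And>R S G y. R \<le> r \<Longrightarrow> S \<le> s \<Longrightarrow> \<sigma> \<le> S \<Longrightarrow> tp (B R) G \<Longrightarrow> nb R S G C \<Longrightarrow> y \<ge> 0 \<Longrightarrow>
       nb R S (br G (ham h' f')) y \<Longrightarrow>
       \<exists>G'. tp (B R) G' \<and> nb (R - \<delta>) (S - \<sigma>) (\<lambda>k x. G' k x - G k x) (C * q) \<and>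
         nb (R - \<delta>) (S - \<sigma>) (br G' (ham h f)) ((1 + q) * y + \<zeta> / 2)"
    then show thesis by (rule that)
  qed (use h f pos par dv' p q_def C z sg in auto)
  define \<zeta>' where "\<zeta>' = \<zeta> / (2 * (1 + q))"
  have z': "\<zeta>' > 0" "(1 + q) * \<zeta>' = \<zeta> / 2" using z q by (simp_all add: \<zeta>'_def field_simps)
  have sub: "B (r - \<delta>) \<subseteq> B r" using pos by auto
  \<comment> \<open>Quartering \<epsilon> and halving \<delta> halves p, hence also the admissible
    \<beta>. The inner levels then contribute exp \<beta>, and transport through this level
    contributes at most another exp \<beta>.\<close>
  have "\<exists>G. tp (B (r - \<delta> - 4 * (\<delta> / 2))) G
    \<and> nb (r - \<delta> - 4 * (\<delta> / 2)) (s - \<sigma> - 2 * real m * \<sigma> - s') (\<lambda>k x. G k x - mode0 L k x) ((exp (2 * (\<beta> / 2)) - 1) * \<Lambda>)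
    \<and> nb (r - \<delta> - 4 * (\<delta> / 2)) (s - \<sigma> - 2 * real m * \<sigma> - s') (br G (ham h' f')) (exp (2 * (\<beta> / 2)) * ((\<epsilon> / 4) / 4 ^ m / (exp 1 * s')) + \<zeta>')"
  proof (rule Suc.IH[where p = "p / 2"])
    show "holo h' (B (r - \<delta>))" "tp (B (r - \<delta>)) f'"
      using holo_subset[OF h' sub] tp_subset[OF f'(1) sub] by auto
    show "nb (r - \<delta>) (s - \<sigma>) f' (\<epsilon> / 4)"
    proof (rule nb_le[OF f'(2)])
      have "(exp (- K * \<sigma>) + q) * \<epsilon> \<le> (1 / 4) * \<epsilon>" using q \<beta> pos by (intro mult_right_mono) auto
      then show "(exp (- K * \<sigma>) + q) * \<epsilon> \<le> \<epsilon> / 4" by simp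
    qed
    \<comment> \<open>Of the margin 2 * K * \<epsilon> / \<delta> above a, one half is used up by
      the change from h to h'. The other half is the margin of the next level, because (\<epsilon> /
      4) / (\<delta> / 2) is half of \<epsilon> / \<delta>.\<close>
    show "a + 2 * K * (\<epsilon> / 4) / (\<delta> / 2) \<le> cmod (dd (dir k) h' x)"
      if x: "x \<in> B (r - \<delta>)" and k: "k \<noteq> 0" "wt k \<le> K" for k x
    proof -
      have "a + 2 * K * \<epsilon> / \<delta> \<le> cmod (dd (dir k) h x)" using x k sub by (intro dv) auto
      moreover have "cmod (dd (dir k) h' x - dd (dir k) h x) \<le> K * \<epsilon> / \<delta>"
      proof -
        have "norm (dir k) \<le> K" using norm_dir[of k] k by simp
        then have "\<epsilon> * norm (dir k) / \<delta> \<le> K * \<epsilon> / \<delta>"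
          using pos by (intro divide_right_mono) (auto simp: mult.commute mult_right_mono)
        then show ?thesis using dh[OF x, of "dir k"] by linarith
      qed
      moreover have "cmod (dd (dir k) h x) \<le> cmod (dd (dir k) h' x) + cmod (dd (dir k) h' x - dd (dir k) h x)"
        by (metis norm_minus_commute norm_triangle_sub)
      ultimately have "a + 2 * K * \<epsilon> / \<delta> - K * \<epsilon> / \<delta> \<le> cmod (dd (dir k) h' x)" by linarith
      then show ?thesis by simp
    qed
    show "p / 2 = 2 * (\<epsilon> / 4 / a) / (exp 1 * (\<delta> / 2) * \<sigma>)" unfolding p(1) by simp
    show "2 * ((exp 1)\<^sup>2 * (p / 2)) < 1" using z1 by simp
    show "p / 2 / (1 - (exp 1)\<^sup>2 * (p / 2)) \<le> \<beta> / 2"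
    proof -
      have "p / 2 / (1 - (exp 1)\<^sup>2 * (p / 2)) \<le> p / 2 / (1 - (exp 1)\<^sup>2 * p)"
        using p0 z1 E2 by (intro divide_left_mono mult_pos_pos) auto
      also have "\<dots> = q / 2" by (simp add: q_def)
      finally show ?thesis using q by simp
    qed
    show "exp (- K * \<sigma>) + \<beta> / 2 \<le> 1 / 4" using \<beta> q by linarith
    show "2 * real m * \<sigma> + s' \<le> s - \<sigma>" using s par by (simp add: algebra_simps)
  qed (use pos z' in auto)
  moreover have "r - \<delta> - 4 * (\<delta> / 2) = r - 3 * \<delta>" by simp
  moreover define S where "S = s - \<sigma> - 2 * real m * \<sigma> - s'"
  ultimately obtain G where G: "tp (B (r - 3 * \<delta>)) G"
    "nb (r - 3 * \<delta>) S (\<lambda>k x. G k x - mode0 L k x) ((exp \<beta> - 1) * \<Lambda>)"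
    "nb (r - 3 * \<delta>) S (br G (ham h' f')) (exp \<beta> * (\<epsilon> / 4 / 4 ^ m / (exp 1 * s')) + \<zeta>')"
    by auto
  let ?R = "r - 3 * \<delta>"
  have S: "S \<le> s" "\<sigma> \<le> S"
    using s par by (simp_all add: S_def algebra_simps)
  have nL: "nb ?R S (mode0 L) \<Lambda>"
  proof (rule nbI)
    fix x and P :: "'z set" assume x: "x \<in> B ?R" and P: "finite P"
    have x': "x \<in> B rmax" using x pos by auto
    have "(\<Sum>k\<in>P. cmod (mode0 L k x) * exp (wt k * S)) = (\<Sum>k\<in>P. if k = 0 then cmod (L x) else 0)"
      by (intro sum.cong) (auto simp: mode0_def)
    then show "(\<Sum>k\<in>P. cmod (mode0 L k x) * exp (wt k * S)) \<le> \<Lambda>"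
      using L(2)[OF x'] P par by (simp add: sum.delta)
  qed
  have nG: "nb ?R S G C"
    using nb_add[OF G(2) nL] by (simp add: C_def algebra_simps)
  let ?y = "exp \<beta> * (\<epsilon> / 4 / 4 ^ m / (exp 1 * s')) + \<zeta>'"
  have y: "?y \<ge> 0" using pos par z' by (intro add_nonneg_nonneg) auto
  have Rr: "?R \<le> r" using pos by simp
  obtain G' where G': "tp (B ?R) G'" "nb (?R - \<delta>) (S - \<sigma>) (\<lambda>k x. G' k x - G k x) (C * q)"
    "nb (?R - \<delta>) (S - \<sigma>) (br G' (ham h f)) ((1 + q) * ?y + \<zeta> / 2)"
    using step[OF Rr S G(1) nG y G(3)] by blast
  have R': "?R - \<delta> = r - 4 * \<delta>" "S - \<sigma> = s - 2 * real (Suc m) * \<sigma> - s'"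
    by (simp_all add: S_def algebra_simps)
  have "tp (B (r - 4 * \<delta>)) G'" by (rule tp_subset[OF G'(1)]) (use pos in auto)
  moreover have "nb (r - 4 * \<delta>) (s - 2 * real (Suc m) * \<sigma> - s') (\<lambda>k x. G' k x - mode0 L k x) ((exp (2 * \<beta>) - 1) * \<Lambda>)"
  proof -
    have "nb (?R - \<delta>) (S - \<sigma>) (\<lambda>k x. G k x - mode0 L k x) ((exp \<beta> - 1) * \<Lambda>)"
      by (rule nb_mono[OF G(2)]) (use pos par in auto)
    from nb_add[OF G'(2) this]
    have "nb (?R - \<delta>) (S - \<sigma>) (\<lambda>k x. G' k x - mode0 L k x) (C * q + (exp \<beta> - 1) * \<Lambda>)" by simp
    \<comment> \<open>By q \<le> \<beta> and 1 + \<beta> \<le> exp \<beta> the deviations of this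
      level and of the inner ones fit together, which is why they are measured by
      exponentials.\<close>
    moreover have "C * q + (exp \<beta> - 1) * \<Lambda> \<le> (exp (2 * \<beta>) - 1) * \<Lambda>"
    proof -
      have "exp \<beta> * q + (exp \<beta> - 1) \<le> exp \<beta> * \<beta> + (exp \<beta> - 1)"
        using q by simp
      also have "\<dots> = exp \<beta> * (1 + \<beta>) - 1" by (simp add: algebra_simps)
      also have "\<dots> \<le> exp \<beta> * exp \<beta> - 1" using e1 by (intro diff_right_mono mult_left_mono) auto
      finally have "(exp \<beta> * q + (exp \<beta> - 1)) * \<Lambda> \<le> (exp (2 * \<beta>) - 1) * \<Lambda>"
        using par e1 by (intro mult_right_mono) auto
      then show ?thesis by (simp add: C_def algebra_simps)
    qed
    ultimately have "nb (?R - \<delta>) (S - \<sigma>) (\<lambda>k x. G' k x - mode0 L k x) ((exp (2 * \<beta>) - 1) * \<Lambda>)"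
      by (rule nb_le)
    then show ?thesis unfolding R' .
  qed
  moreover have "nb (r - 4 * \<delta>) (s - 2 * real (Suc m) * \<sigma> - s') (br G' (ham h f)) (exp (2 * \<beta>) * (\<epsilon> / 4 ^ Suc m / (exp 1 * s')) + \<zeta>)"
  proof -
    define Y where "Y = \<epsilon> / 4 ^ Suc m / (exp 1 * s')"
    have Y: "Y \<ge> 0" using pos par by (simp add: Y_def)
    have yY: "?y = exp \<beta> * Y + \<zeta>'" by (simp add: Y_def)
    have "1 + q \<le> exp \<beta>" using q e1(1) by linarith
    then have "(1 + q) * (exp \<beta> * Y) \<le> exp \<beta> * (exp \<beta> * Y)"
      using Y by (intro mult_right_mono) auto
    then have "(1 + q) * ?y + \<zeta> / 2 \<le> exp (2 * \<beta>) * Y + \<zeta>"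
      unfolding yY distrib_left z'(2) e1(2)[symmetric] by (simp add: mult.assoc)
    from nb_le[OF G'(3) this] show ?thesis unfolding R' Y_def .
  qed
  ultimately show ?case by blast
qed

end

section \<open>Drift along trajectories\<close>

lemma vector_derivative_bound_interval:
  fixes W :: "real \<Rightarrow> 'a::real_normed_vector"
  assumes "convex S" "\<And>t. t \<in> S \<Longrightarrow> \<exists>W'. (W has_vector_derivative W') (at t within S) \<and> norm W' \<le> c"
    and "a \<in> S" "b \<in> S"
  shows "norm (W b - W a) \<le> c * \<bar>b - a\<bar>"
proof -
  obtain W' where W': "\<And>t. t \<in> S \<Longrightarrow> (W has_vector_derivative W' t) (at t within S)"
    "\<And>t. t \<in> S \<Longrightarrow> norm (W' t) \<le> c"
    using assms(2) by metis
  have "norm (W b - W a) \<le> c * norm (b - a)"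
  proof (rule differentiable_bound[OF assms(1) _ _ assms(4,3)])
    show "(W has_derivative (\<lambda>h. h *\<^sub>R W' t)) (at t within S)" if "t \<in> S" for t
      using W'(1)[OF that] by (simp add: has_vector_derivative_def)
    show "onorm (\<lambda>h. h *\<^sub>R W' t) \<le> c" if "t \<in> S" for t
      using W'(2)[OF that] by (intro onorm_le) (simp add: mult.commute[of c] mult_left_mono)
  qed
  then show ?thesis by simp
qed

text \<open>\<open>emb\<close> embeds the real actions, \<open>kr k\<close> is the mode \<open>k\<close> as a real vector, and \<open>cip v\<close> extends
  the inner product with \<open>v\<close> to a complex linear form.\<close>

locale torus_space = poisson_scale sc dir wt x0
  for sc :: "complex \<Rightarrow> 'v::euclidean_space \<Rightarrow> 'v" and dir :: "'z::ab_group_add \<Rightarrow> 'v"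
    and wt :: "'z \<Rightarrow> real" and x0 :: 'v +
  fixes emb :: "'q::euclidean_space \<Rightarrow> 'v" and kr :: "'z \<Rightarrow> 'q" and cip :: "'q \<Rightarrow> 'v \<Rightarrow> complex"
  assumes linear_emb: "linear emb" and norm_emb: "norm (emb v) = norm v"
    and dir_emb: "dir k = emb (kr k)"
    and kr_Basis: "b \<in> Basis \<Longrightarrow> \<exists>k. kr k = b"
    and kr_int: "b \<in> Basis \<Longrightarrow> kr k \<bullet> b \<in> \<int>"
    and kr_eq_0: "kr k = 0 \<Longrightarrow> k = 0"
    and cip_add: "cip v (z + z') = cip v z + cip v z'"
    and cip_sc: "cip v (sc c z) = c * cip v z"
    and norm_cip: "cmod (cip v z) \<le> norm v * norm z"
    and cip_emb: "cip v (emb x) = complex_of_real (v \<bullet> x)"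
begin

section \<open>Evaluation of coefficient families at real angles\<close>

definition ek :: "'z \<Rightarrow> 'q \<Rightarrow> complex" where
  "ek k \<theta> = exp (\<i> * of_real (kr k \<bullet> \<theta>))"

lemma norm_ek [simp]: "cmod (ek k \<theta>) = 1"
  by (simp add: ek_def)

lemma kr_add: "kr (k + l) = kr k + kr l"
proof -
  have "emb (kr (k + l) - (kr k + kr l)) = 0"
    using dir_add[of k l] by (simp add: dir_emb linear_diff[OF linear_emb] linear_add[OF linear_emb])
  then show ?thesis using norm_emb[of "kr (k + l) - (kr k + kr l)"] by simp
qed

lemma norm_kr: "norm (kr k) \<le> wt k"
  using norm_dir[of k] by (simp add: dir_emb norm_emb)

lemma ek_add: "ek (k + l) \<theta> = ek k \<theta> * ek l \<theta>"
  by (simp add: ek_def kr_add inner_add_left distrib_left exp_add)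

lemma emb_euclidean: "emb v = (\<Sum>b\<in>Basis. (v \<bullet> b) *\<^sub>R emb b)"
proof -
  have "emb v = emb (\<Sum>b\<in>Basis. (v \<bullet> b) *\<^sub>R b)" by (simp add: euclidean_representation)
  then show ?thesis by (simp add: linear_sum[OF linear_emb] linear_scale[OF linear_emb] o_def)
qed

lemma dd_sum_dir:
  assumes "holo F S" "x \<in> S" "finite I"
  shows "dd (\<Sum>i\<in>I. t i *\<^sub>R v i) F x = (\<Sum>i\<in>I. of_real (t i) * dd (v i) F x)"
  using assms(3)
  by (induction rule: finite_induct)
     (simp_all add: dd_zero_dir[OF assms(1,2)] holo_has_derivative(3)[OF assms(1,2)] dd_scaleR_dir[OF assms(1,2)])

lemma dd_emb:
  assumes "holo F S" "x \<in> S"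
  shows "dd (emb v) F x = (\<Sum>b\<in>Basis. of_real (v \<bullet> b) * dd (emb b) F x)"
  by (subst emb_euclidean) (rule dd_sum_dir[OF assms finite_Basis])

definition trig :: "('z \<Rightarrow> 'v \<Rightarrow> complex) \<Rightarrow> 'v \<Rightarrow> 'q \<Rightarrow> complex" where
  "trig F z \<theta> = (\<Sum>k\<in>supp F. F k z * ek k \<theta>)"

lemma trig_eq:
  assumes "finite Q" "supp F \<subseteq> Q"
  shows "trig F z \<theta> = (\<Sum>k\<in>Q. F k z * ek k \<theta>)"
  unfolding trig_def by (rule sum.mono_neutral_left) (auto simp: assms not_supp)

lemma norm_trig_le:
  assumes "nb r s F c" "z \<in> B r" "0 \<le> s" "finite (supp F)"
  shows "cmod (trig F z \<theta>) \<le> c"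
proof -
  have "cmod (trig F z \<theta>) \<le> (\<Sum>k\<in>supp F. cmod (F k z))"
    unfolding trig_def by (intro sum_norm_le) (simp add: norm_mult)
  also have "\<dots> \<le> (\<Sum>k\<in>supp F. cmod (F k z) * exp (wt k * s))"
    using assms(3) by (intro sum_mono) (simp add: mult_le_cancel_left1)
  also have "\<dots> \<le> c" by (rule nbD[OF assms(1,2,4)])
  finally show ?thesis .
qed

text \<open>Since \<open>ek\<close> is multiplicative, the convolution over k + l = p is undone: the
  bracket of coefficients becomes a sum over independent modes k and l, which can be compared with a
  time derivative.\<close>

lemma trig_br:
  assumes S: "open S" "z \<in> S" and G: "tp S G" and f: "tp S f" and h: "holo h S"
  shows "trig (br G (ham h f)) z \<theta> = (\<Sum>k\<in>supp G. \<i> * G k z * dd (dir k) h z * ek k \<theta>)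
    + (\<Sum>k\<in>supp G. \<Sum>l\<in>supp f. \<i> * (G k z * dd (dir k) (f l) z - f l z * dd (dir l) (G k) z) * ek k \<theta> * ek l \<theta>)"
proof -
  define Q where "Q = supp G \<union> (\<lambda>(k, l). k + l) ` (supp G \<times> supp f) \<union> supp (br G (ham h f))"
  have fin: "finite (supp G)" "finite (supp f)" "finite Q"
    using finite_supp[OF G] finite_supp[OF f] finite_supp[OF tp_br[OF S(1) G tp_ham[OF h f]]]
    by (auto simp: Q_def)
  define u where "u k l = G k z * dd (dir k) (f l) z - f l z * dd (dir l) (G k) z" for k l
  have 1: "br G (mode0 h) p z = \<i> * G p z * dd (dir p) h z" for p
    using br_antisym[OF fin(1) finite_supp[OF tp_mode0[OF h]]] br_mode0[where G = G and p = p and S = S and x = z and h = h]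
      tp_holo[OF G] S by simp
  have 2: "br G f p z = \<i> * (\<Sum>k\<in>supp G. \<Sum>l\<in>supp f. if k + l = p then u k l else 0)" for p
    unfolding u_def by (rule br_eq2) (use fin in auto)
  have "trig (br G (ham h f)) z \<theta> = (\<Sum>p\<in>Q. br G (ham h f) p z * ek p \<theta>)"
    by (rule trig_eq) (use fin in \<open>auto simp: Q_def\<close>)
  also have "\<dots> = (\<Sum>p\<in>Q. \<i> * G p z * dd (dir p) h z * ek p \<theta>)
     + (\<Sum>p\<in>Q. (\<Sum>k\<in>supp G. \<Sum>l\<in>supp f. if k + l = p then \<i> * u k l * ek p \<theta> else 0))"
  proof -
    have "\<i> * (\<Sum>k\<in>supp G. \<Sum>l\<in>supp f. if k + l = p then u k l else 0) * ek p \<theta>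
      = (\<Sum>k\<in>supp G. \<Sum>l\<in>supp f. if k + l = p then \<i> * u k l * ek p \<theta> else 0)" for p
      unfolding sum_distrib_left sum_distrib_right by (intro sum.cong refl) simp
    then show ?thesis
      unfolding ham_def br_add_right[OF tp_mode0[OF h] f S(2) G] 1 2 sum.distrib[symmetric]
      by (simp only: distrib_right)
  qed
  also have "(\<Sum>p\<in>Q. \<i> * G p z * dd (dir p) h z * ek p \<theta>) = (\<Sum>k\<in>supp G. \<i> * G k z * dd (dir k) h z * ek k \<theta>)"
    by (rule sum.mono_neutral_right) (use fin in \<open>auto simp: Q_def not_supp\<close>)
  also have "(\<Sum>p\<in>Q. (\<Sum>k\<in>supp G. \<Sum>l\<in>supp f. if k + l = p then \<i> * u k l * ek p \<theta> else 0))
     = (\<Sum>k\<in>supp G. \<Sum>l\<in>supp f. \<Sum>p\<in>Q. if k + l = p then \<i> * u k l * ek p \<theta> else 0)"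
  proof -
    have "(\<Sum>p\<in>Q. (\<Sum>k\<in>supp G. \<Sum>l\<in>supp f. if k + l = p then \<i> * u k l * ek p \<theta> else 0))
      = (\<Sum>k\<in>supp G. \<Sum>p\<in>Q. \<Sum>l\<in>supp f. if k + l = p then \<i> * u k l * ek p \<theta> else 0)"
      by (rule sum.swap)
    also have "\<dots> = (\<Sum>k\<in>supp G. \<Sum>l\<in>supp f. \<Sum>p\<in>Q. if k + l = p then \<i> * u k l * ek p \<theta> else 0)"
      by (intro sum.cong refl sum.swap)
    finally show ?thesis .
  qed
  also have "\<dots> = (\<Sum>k\<in>supp G. \<Sum>l\<in>supp f. \<i> * u k l * ek k \<theta> * ek l \<theta>)"
  proof (intro sum.cong refl)
    fix k l assume "k \<in> supp G" "l \<in> supp f"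
    then have "k + l \<in> Q" by (auto simp: Q_def)
    then show "(\<Sum>p\<in>Q. if k + l = p then \<i> * u k l * ek p \<theta> else 0) = \<i> * u k l * ek k \<theta> * ek l \<theta>"
      using fin by (simp add: sum.delta ek_add)
  qed
  finally show ?thesis by (simp only: u_def)
qed

text \<open>The derivative of \<open>trig G\<close> along the flow is \<open>trig (br G (ham h f))\<close> up to the contribution
  of the part of \<open>g\<close> that the trigonometric polynomial \<open>f\<close> does not capture.\<close>

lemma trig_derivative:
  assumes h: "holo h (B R)" and f: "tp (B R) f" and g: "holo (g \<theta>) (B R)"
    and tail: "\<And>z. z \<in> B R \<Longrightarrow> cmod (g \<theta> z - trig f z \<theta>) \<le> \<eta>"
    and G: "tp (B R) G" "nb R S G c" and y: "nb R S (br G (ham h f)) y"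
    and RS: "R1 < R" "0 < S" "0 \<le> c" "0 \<le> \<eta>'" and z: "z = emb x" "z \<in> B R1"
    and t': "\<And>k. complex_of_real (kr k \<bullet> \<theta>') = dd (dir k) h z + dd (dir k) (g \<theta>) z"
    and x': "\<And>b. b \<in> Basis \<Longrightarrow> cmod (of_real (x' \<bullet> b) + (\<Sum>k\<in>supp f. \<i> * of_real (kr k \<bullet> b) * f k z * ek k \<theta>)) \<le> \<eta>'"
  shows "cmod (\<Sum>k\<in>supp G. (dd (emb x') (G k) z + G k z * (\<i> * of_real (kr k \<bullet> \<theta>'))) * ek k \<theta>)
     \<le> y + (\<eta> / (R - R1) * (c / (exp 1 * S)) + real DIM('q) * \<eta>' * (c / (R - R1)))"
proof -
  have zR: "z \<in> B R" using z RS by auto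
  \<comment> \<open>The error in the velocity of the actions when g is replaced by the polynomial f.
    The corresponding error in the velocity of the angles is a derivative of
    \<open>tl\<close>.\<close>
  define \<tau> where "\<tau> b = of_real (x' \<bullet> b) + (\<Sum>k\<in>supp f. \<i> * of_real (kr k \<bullet> b) * f k z * ek k \<theta>)" for b
  define tl where "tl w = g \<theta> w - trig f w \<theta>" for w
  have htr: "holo (\<lambda>w. trig f w \<theta>) (B R)"
    unfolding trig_def by (intro holo_sum holo_mult tp_holo[OF f] holo_const)
  have htl: "holo tl (B R)" unfolding tl_def by (intro holo_diff g htr)
  have dg: "dd v (g \<theta>) z = (\<Sum>l\<in>supp f. dd v (f l) z * ek l \<theta>) + dd v tl z" for v
  proof -
    have "dd v (\<lambda>w. trig f w \<theta>) z = (\<Sum>l\<in>supp f. dd v (\<lambda>w. f l w * ek l \<theta>) z)"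
      unfolding trig_def by (rule dd_sum[OF _ zR]) (intro holo_mult tp_holo[OF f] holo_const)
    also have "\<dots> = (\<Sum>l\<in>supp f. dd v (f l) z * ek l \<theta>)"
      by (intro sum.cong refl) (simp add: dd_mult[OF tp_holo[OF f] holo_const zR])
    finally show ?thesis unfolding tl_def dd_diff[OF g htr zR] by simp
  qed
  have dG: "dd (emb x') (G k) z = (\<Sum>b\<in>Basis. \<tau> b * dd (emb b) (G k) z)
     - (\<Sum>l\<in>supp f. \<i> * f l z * ek l \<theta> * dd (dir l) (G k) z)" for k
  proof -
    have dl: "dd (dir l) (G k) z = (\<Sum>b\<in>Basis. of_real (kr l \<bullet> b) * dd (emb b) (G k) z)" for l
      unfolding dir_emb by (rule dd_emb[OF tp_holo[OF G(1)] zR])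
    have "(\<Sum>l\<in>supp f. \<i> * f l z * ek l \<theta> * dd (dir l) (G k) z)
      = (\<Sum>l\<in>supp f. \<Sum>b\<in>Basis. \<i> * of_real (kr l \<bullet> b) * f l z * ek l \<theta> * dd (emb b) (G k) z)"
      by (simp add: dl sum_distrib_left mult_ac)
    also have "\<dots> = (\<Sum>b\<in>Basis. (\<Sum>l\<in>supp f. \<i> * of_real (kr l \<bullet> b) * f l z * ek l \<theta>) * dd (emb b) (G k) z)"
      by (subst sum.swap) (simp add: sum_distrib_right)
    finally show ?thesis
      by (subst dd_emb[OF tp_holo[OF G(1)] zR]) (simp add: \<tau>_def distrib_right sum.distrib)
  qed
  have "(\<Sum>k\<in>supp G. (dd (emb x') (G k) z + G k z * (\<i> * of_real (kr k \<bullet> \<theta>'))) * ek k \<theta>)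
    = (\<Sum>k\<in>supp G. \<i> * G k z * dd (dir k) h z * ek k \<theta>
       + (\<Sum>l\<in>supp f. \<i> * (G k z * dd (dir k) (f l) z - f l z * dd (dir l) (G k) z) * ek k \<theta> * ek l \<theta>)
       + (\<i> * G k z * dd (dir k) tl z * ek k \<theta> + (\<Sum>b\<in>Basis. \<tau> b * dd (emb b) (G k) z) * ek k \<theta>))"
  proof (intro sum.cong refl)
    fix k
    have "(\<Sum>l\<in>supp f. \<i> * (G k z * dd (dir k) (f l) z - f l z * dd (dir l) (G k) z) * ek k \<theta> * ek l \<theta>)
      = \<i> * G k z * ek k \<theta> * (\<Sum>l\<in>supp f. dd (dir k) (f l) z * ek l \<theta>)
        - ek k \<theta> * (\<Sum>l\<in>supp f. \<i> * f l z * ek l \<theta> * dd (dir l) (G k) z)"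
      by (simp add: sum_distrib_left sum_subtractf[symmetric] algebra_simps)
    then show "(dd (emb x') (G k) z + G k z * (\<i> * of_real (kr k \<bullet> \<theta>'))) * ek k \<theta>
      = \<i> * G k z * dd (dir k) h z * ek k \<theta>
       + (\<Sum>l\<in>supp f. \<i> * (G k z * dd (dir k) (f l) z - f l z * dd (dir l) (G k) z) * ek k \<theta> * ek l \<theta>)
       + (\<i> * G k z * dd (dir k) tl z * ek k \<theta> + (\<Sum>b\<in>Basis. \<tau> b * dd (emb b) (G k) z) * ek k \<theta>)"
      unfolding dG t' dg by (simp add: algebra_simps)
  qed
  also have "\<dots> = trig (br G (ham h f)) z \<theta>
    + ((\<Sum>k\<in>supp G. \<i> * G k z * dd (dir k) tl z * ek k \<theta>)
      + (\<Sum>k\<in>supp G. (\<Sum>b\<in>Basis. \<tau> b * dd (emb b) (G k) z) * ek k \<theta>))"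
    unfolding trig_br[OF open_ball zR G(1) f h] sum.distrib by (rule refl)
  finally have eq: "(\<Sum>k\<in>supp G. (dd (emb x') (G k) z + G k z * (\<i> * of_real (kr k \<bullet> \<theta>'))) * ek k \<theta>)
    = trig (br G (ham h f)) z \<theta>
    + ((\<Sum>k\<in>supp G. \<i> * G k z * dd (dir k) tl z * ek k \<theta>)
      + (\<Sum>k\<in>supp G. (\<Sum>b\<in>Basis. \<tau> b * dd (emb b) (G k) z) * ek k \<theta>))" .
  have fG: "finite (supp G)" by (rule finite_supp[OF G(1)])
  have b1: "cmod (trig (br G (ham h f)) z \<theta>) \<le> y"
    by (rule norm_trig_le[OF y zR]) (use RS in \<open>auto intro!: finite_supp[where S = "B R"] tp_br tp_ham G f h\<close>)
  have et: "\<eta> \<ge> 0" using tail[OF zR] norm_ge_zero order_trans by blast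
  have b2: "cmod (\<Sum>k\<in>supp G. \<i> * G k z * dd (dir k) tl z * ek k \<theta>) \<le> \<eta> / (R - R1) * (c / (exp 1 * S))"
  proof -
    have d: "cmod (dd (dir k) tl z) \<le> \<eta> / (R - R1) * wt k" for k
    proof -
      have "cmod (dd (dir k) tl z) \<le> \<eta> * norm (dir k) / (R - R1)"
        by (rule dd_bound[OF htl]) (use tail z RS in \<open>auto simp: tl_def\<close>)
      also have "\<dots> \<le> \<eta> * wt k / (R - R1)"
        using et RS norm_dir by (intro divide_right_mono mult_left_mono) auto
      finally show ?thesis by simp
    qed
    have "cmod (\<Sum>k\<in>supp G. \<i> * G k z * dd (dir k) tl z * ek k \<theta>) \<le> (\<Sum>k\<in>supp G. cmod (G k z) * (\<eta> / (R - R1) * wt k))"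
      by (intro sum_norm_le) (simp add: norm_mult mult_left_mono[OF d] del: times_divide_eq_left)
    also have "\<dots> = \<eta> / (R - R1) * (\<Sum>k\<in>supp G. cmod (G k z) * (wt k * exp (wt k * 0)))"
      by (simp add: sum_distrib_left mult_ac)
    also have "\<dots> \<le> \<eta> / (R - R1) * (c / (exp 1 * (S - 0)))"
      using et RS by (intro mult_left_mono nb_wt[OF G(2) zR _ fG]) auto
    finally show ?thesis by simp
  qed
  have b3: "cmod (\<Sum>k\<in>supp G. (\<Sum>b\<in>Basis. \<tau> b * dd (emb b) (G k) z) * ek k \<theta>) \<le> real DIM('q) * \<eta>' * (c / (R - R1))"
  proof -
    have "cmod (\<Sum>k\<in>supp G. (\<Sum>b\<in>Basis. \<tau> b * dd (emb b) (G k) z) * ek k \<theta>)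
      \<le> (\<Sum>k\<in>supp G. \<Sum>b\<in>Basis. \<eta>' * cmod (dd (emb b) (G k) z))"
    proof (intro sum_norm_le)
      fix k
      have "cmod (\<Sum>b\<in>Basis. \<tau> b * dd (emb b) (G k) z) \<le> (\<Sum>b\<in>Basis. \<eta>' * cmod (dd (emb b) (G k) z))"
        using x' by (intro sum_norm_le) (simp add: norm_mult mult_right_mono \<tau>_def)
      then show "cmod ((\<Sum>b\<in>Basis. \<tau> b * dd (emb b) (G k) z) * ek k \<theta>) \<le> (\<Sum>b\<in>Basis. \<eta>' * cmod (dd (emb b) (G k) z))"
        by (simp add: norm_mult)
    qed
    also have "\<dots> = (\<Sum>b\<in>Basis. \<eta>' * (\<Sum>k\<in>supp G. cmod (dd (emb b) (G k) z) * exp (wt k * 0)))"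
      by (subst sum.swap) (simp add: sum_distrib_left)
    also have "\<dots> \<le> (\<Sum>b\<in>(Basis :: 'q set). \<eta>' * (c / (R - R1)))"
    proof (intro sum_mono mult_left_mono)
      fix b :: 'q assume b: "b \<in> Basis"
      have n0: "nb R 0 G c" by (rule nb_mono[OF G(2)]) (use RS in auto)
      have "(\<Sum>k\<in>supp G. cmod (dd (emb b) (G k) z) * exp (wt k * 0)) \<le> c * norm (emb b) / (R - R1)"
        by (rule nb_dd[OF n0 tp_holo[OF G(1)] z(2) RS(1) fG])
      then show "(\<Sum>k\<in>supp G. cmod (dd (emb b) (G k) z) * exp (wt k * 0)) \<le> c / (R - R1)"
        using b by (simp add: norm_emb)
    qed (rule RS)
    finally show ?thesis by simp
  qed
  show ?thesis
    unfolding eq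
    using norm_triangle_mono[OF b1 norm_triangle_mono[OF b2 b3]] by simp
qed

lemma has_vector_derivative_emb_comp:
  assumes "holo F S" "emb (x t) \<in> S" "(x has_vector_derivative x') (at t within T)"
  shows "((\<lambda>t. F (emb (x t))) has_vector_derivative dd (emb x') F (emb (x t))) (at t within T)"
proof -
  have "((\<lambda>t. emb (x t)) has_derivative (\<lambda>s. emb (s *\<^sub>R x'))) (at t within T)"
    using assms(3) linear_emb unfolding has_vector_derivative_def
    by (intro bounded_linear.has_derivative[of emb]) (simp_all add: linear_conv_bounded_linear)
  from has_derivative_compose[OF this holo_has_derivative(1)[OF assms(1,2)]]
  show ?thesis
    unfolding has_vector_derivative_def
    by (simp add: linear_scale[OF linear_emb] dd_scaleR_dir[OF assms(1,2)] scaleR_conv_of_real)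
qed

lemma has_vector_derivative_ek:
  assumes "(\<theta> has_vector_derivative \<theta>') (at t within T)"
  shows "((\<lambda>t. ek k (\<theta> t)) has_vector_derivative (\<i> * of_real (kr k \<bullet> \<theta>') * ek k (\<theta> t))) (at t within T)"
proof -
  have 1: "((\<lambda>t. \<i> * complex_of_real (kr k \<bullet> \<theta> t)) has_vector_derivative (\<i> * of_real (kr k \<bullet> \<theta>'))) (at t within T)"
    by (intro has_vector_derivative_mult_right has_vector_derivative_of_real)
       (simp add: has_real_derivative_iff_has_vector_derivative
        bounded_linear.has_vector_derivative[OF bounded_linear_inner_right assms])
  show ?thesis
    using field_vector_diff_chain_within[OF 1 DERIV_subset[OF DERIV_exp]] unfolding ek_def o_def by simp
qed

lemma has_vector_derivative_trig:
  assumes "tp S G" "emb (x t) \<in> S" "(x has_vector_derivative x') (at t within T)"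
    "(\<theta> has_vector_derivative \<theta>') (at t within T)"
  shows "((\<lambda>t. trig G (emb (x t)) (\<theta> t)) has_vector_derivative
    (\<Sum>k\<in>supp G. (dd (emb x') (G k) (emb (x t)) + G k (emb (x t)) * (\<i> * of_real (kr k \<bullet> \<theta>'))) * ek k (\<theta> t))) (at t within T)"
  unfolding trig_def
proof (rule has_vector_derivative_sum)
  fix k
  have "((\<lambda>t. G k (emb (x t)) * ek k (\<theta> t)) has_vector_derivative
     (G k (emb (x t)) * (\<i> * of_real (kr k \<bullet> \<theta>') * ek k (\<theta> t)) + dd (emb x') (G k) (emb (x t)) * ek k (\<theta> t))) (at t within T)"
    by (rule has_vector_derivative_mult[OF
        has_vector_derivative_emb_comp[OF tp_holo[OF assms(1)], where x = x and t = t, OF assms(2,3)]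
        has_vector_derivative_ek[OF assms(4)]])
  then show "((\<lambda>t. G k (emb (x t)) * ek k (\<theta> t)) has_vector_derivative
     ((dd (emb x') (G k) (emb (x t)) + G k (emb (x t)) * (\<i> * of_real (kr k \<bullet> \<theta>'))) * ek k (\<theta> t))) (at t within T)"
    by (simp add: algebra_simps)
qed

end

section \<open>Fourier series on the torus\<close>

definition cube :: "'q::euclidean_space set" where
  "cube = cbox 0 ((2 * pi) *\<^sub>R One)"

lemma inner_One: "b \<in> Basis \<Longrightarrow> One \<bullet> b = (1::real)"
  using inner_sum_left_Basis[of b "\<lambda>_. 1"] by simp

lemma mem_cube: "x \<in> cube \<longleftrightarrow> (\<forall>b\<in>Basis. 0 \<le> x \<bullet> b \<and> x \<bullet> b \<le> 2 * pi)"
  by (simp add: cube_def mem_box inner_One)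

lemma continuous_on_exp_inner: "continuous_on S (\<lambda>\<theta>. exp (\<i> * complex_of_real (\<kappa> \<bullet> \<theta>)))"
  by (intro continuous_intros)

lemma integral_exp_interval:
  assumes "m \<in> \<int>" "m \<noteq> 0"
  shows "integral {0..2 * pi} (\<lambda>x. exp (\<i> * complex_of_real (m * x))) = 0"
proof -
  let ?F = "\<lambda>x. exp (\<i> * complex_of_real (m * x)) / (\<i> * complex_of_real m)"
  have alg: "- (\<i> * (w * \<i>)) = w" for w :: complex by (simp add: complex_eq_iff)
  have "((\<lambda>x. exp (\<i> * complex_of_real (m * x))) has_integral (?F (2 * pi) - ?F 0)) {0..2 * pi}"
  proof (rule fundamental_theorem_of_calculus)
    fix x assume "x \<in> {0..2 * pi}"
    have "((\<lambda>z. exp (\<i> * (of_real m * z)) / (\<i> * complex_of_real m)) has_field_derivative exp (\<i> * (of_real m * of_real x))) (at (of_real x))"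
      using assms(2) by (auto intro!: derivative_eq_intros simp: alg)
    then show "(?F has_vector_derivative exp (\<i> * complex_of_real (m * x))) (at x within {0..2 * pi})"
      using has_vector_derivative_real_field by fastforce
  qed simp
  moreover have "exp (\<i> * complex_of_real (m * (2 * pi))) = 1"
  proof -
    obtain j where "m = of_int j" using assms(1) by (auto elim: Ints_cases)
    then show ?thesis using exp_integer_2pi[of "of_int j"] by (simp add: mult_ac)
  qed
  ultimately show ?thesis by (simp add: integral_unique)
qed

text \<open>By Fubini the integral factors over the coordinates, and a coordinate with a nonzero
  integral frequency contributes 0.\<close>

lemma integral_exp_cube:
  fixes \<kappa> :: "'q::euclidean_space"
  assumes int: "\<And>b. b \<in> Basis \<Longrightarrow> \<kappa> \<bullet> b \<in> \<int>"
  shows "integral cube (\<lambda>\<theta>. exp (\<i> * complex_of_real (\<kappa> \<bullet> \<theta>))) = (if \<kappa> = 0 then (2 * pi) ^ DIM('q) else 0)"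
proof (cases "\<kappa> = 0")
  case True
  have "measure lborel (cube :: 'q set) = (2 * pi) ^ DIM('q)"
    unfolding cube_def by (subst content_cbox) (auto simp: inner_One)
  then show ?thesis using True by (simp add: cube_def scaleR_conv_of_real)
next
  case False
  then obtain b0 where b0: "b0 \<in> Basis" "\<kappa> \<bullet> b0 \<noteq> 0" by (metis euclidean_eqI inner_zero_left)
  interpret product_sigma_finite "\<lambda>b::'q. lborel :: real measure" by standard
  define u where "u b x = indicator {0..2 * pi} x *\<^sub>R exp (\<i> * complex_of_real ((\<kappa> \<bullet> b) * x))" for b x
  have iu: "integrable lborel (u b)" for b
    unfolding u_def[abs_def] by (rule borel_integrable_compact) (simp, intro continuous_intros)
  have u0: "integral\<^sup>L lborel (u b0) = 0"
  proof -
    have "(LINT x:{0..2 * pi}|lborel. exp (\<i> * complex_of_real ((\<kappa> \<bullet> b0) * x))) = 0"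
    proof -
      have "set_integrable lborel {0..2 * pi} (\<lambda>x. exp (\<i> * complex_of_real ((\<kappa> \<bullet> b0) * x)))"
        using iu[of b0] unfolding u_def[abs_def] set_integrable_def .
      from set_borel_integral_eq_integral(2)[OF this] show ?thesis
        using integral_exp_interval[OF int[OF b0(1)] b0(2)] by simp
    qed
    then show ?thesis unfolding set_lebesgue_integral_def u_def[abs_def] .
  qed
  have si: "set_integrable lborel cube (\<lambda>\<theta>. exp (\<i> * complex_of_real (\<kappa> \<bullet> \<theta>)))"
    unfolding cube_def set_integrable_def
    by (rule borel_integrable_compact) (auto intro!: continuous_on_exp_inner)
  have "integral cube (\<lambda>\<theta>. exp (\<i> * complex_of_real (\<kappa> \<bullet> \<theta>)))
      = (\<integral>\<theta>. indicator cube \<theta> *\<^sub>R exp (\<i> * complex_of_real (\<kappa> \<bullet> \<theta>)) \<partial>lborel)"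
    using set_borel_integral_eq_integral(2)[OF si] by (simp add: set_lebesgue_integral_def)
  also have "\<dots> = (\<integral>x. (\<Prod>b\<in>Basis. u b (x b)) \<partial>(\<Pi>\<^sub>M b\<in>(Basis :: 'q set). lborel))"
  proof -
    have m: "(\<lambda>\<theta>. indicator cube \<theta> *\<^sub>R exp (\<i> * complex_of_real (\<kappa> \<bullet> \<theta>))) \<in> borel_measurable (borel :: 'q measure)"
      using borel_measurable_integrable[OF si[unfolded set_integrable_def]] by simp
    have "(\<integral>\<theta>. indicator cube \<theta> *\<^sub>R exp (\<i> * complex_of_real (\<kappa> \<bullet> \<theta>)) \<partial>lborel)
      = (\<integral>x. indicator cube (\<Sum>b\<in>Basis. x b *\<^sub>R b) *\<^sub>R exp (\<i> * complex_of_real (\<kappa> \<bullet> (\<Sum>b\<in>Basis. x b *\<^sub>R b))) \<partial>(\<Pi>\<^sub>M b\<in>(Basis :: 'q set). lborel))"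
      by (subst lborel_eq, rule integral_distr) (use m in auto)
    also have "\<dots> = (\<integral>x. (\<Prod>b\<in>Basis. u b (x b)) \<partial>(\<Pi>\<^sub>M b\<in>(Basis :: 'q set). lborel))"
    proof (intro Bochner_Integration.integral_cong refl)
      fix x :: "'q \<Rightarrow> real"
      have "indicator cube (\<Sum>b\<in>(Basis :: 'q set). x b *\<^sub>R b) = (\<Prod>b\<in>(Basis :: 'q set). indicator {0..2 * pi} (x b) :: real)"
      proof (cases "\<forall>b\<in>(Basis :: 'q set). x b \<in> {0..2 * pi}")
        case True
        then have "(\<Prod>b\<in>(Basis :: 'q set). indicator {0..2 * pi} (x b) :: real) = 1"
          by (intro prod.neutral) (simp add: indicator_def)
        moreover have "(\<Sum>b\<in>(Basis :: 'q set). x b *\<^sub>R b) \<in> cube" using True by (simp add: mem_cube)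
        ultimately show ?thesis by simp
      next
        case False
        then obtain b where b: "b \<in> Basis" "x b \<notin> {0..2 * pi}" by blast
        then have "(\<Prod>b\<in>(Basis :: 'q set). indicator {0..2 * pi} (x b) :: real) = 0"
          by (intro prod_zero) (auto intro: bexI[of _ b])
        moreover have "(\<Sum>b\<in>(Basis :: 'q set). x b *\<^sub>R b) \<notin> cube" using b by (auto simp: mem_cube)
        ultimately show ?thesis by simp
      qed
      moreover have "\<kappa> \<bullet> (\<Sum>b\<in>Basis. x b *\<^sub>R b) = (\<Sum>b\<in>Basis. (\<kappa> \<bullet> b) * x b)"
        by (simp add: inner_sum_right mult.commute)
      ultimately show "indicator cube (\<Sum>b\<in>Basis. x b *\<^sub>R b) *\<^sub>R exp (\<i> * complex_of_real (\<kappa> \<bullet> (\<Sum>b\<in>Basis. x b *\<^sub>R b))) = (\<Prod>b\<in>Basis. u b (x b))"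
        by (simp add: u_def exp_sum sum_distrib_left prod.distrib scaleR_conv_of_real)
    qed
    finally show ?thesis .
  qed
  also have "\<dots> = (\<Prod>b\<in>Basis. integral\<^sup>L lborel (u b))"
    by (rule product_integral_prod) (auto intro: iu)
  also have "\<dots> = 0" using b0(1) u0 by (intro prod_zero) auto
  finally show ?thesis using False by simp
qed

text \<open>A nonnegative trigonometric polynomial with maximum 1. For a in the interior of the cube
  it attains 1 on the cube at a alone, so its powers concentrate at a.\<close>

definition bump :: "'q::euclidean_space \<Rightarrow> 'q \<Rightarrow> real" where
  "bump a \<theta> = (\<Prod>b\<in>Basis. (1 + cos ((\<theta> - a) \<bullet> b)) / 2)"

lemma bump_orthogonal:
  fixes g :: "'q::euclidean_space \<Rightarrow> complex"
  assumes cont: "continuous_on cube g"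
    and zero: "\<And>\<kappa>. (\<And>b. b \<in> Basis \<Longrightarrow> \<kappa> \<bullet> b \<in> \<int>) \<Longrightarrow> integral cube (\<lambda>\<theta>. g \<theta> * exp (\<i> * complex_of_real (\<kappa> \<bullet> \<theta>))) = 0"
  shows "integral cube (\<lambda>\<theta>. g \<theta> * of_real (bump a \<theta> ^ N)) = 0"
proof -
  \<comment> \<open>All integral frequencies are carried along because a factor of the bump shifts
    \<kappa> by 0, b and - b.\<close>
  define Pr where "Pr \<phi> \<longleftrightarrow> continuous_on UNIV \<phi> \<and> (\<forall>\<kappa>. (\<forall>b\<in>Basis. \<kappa> \<bullet> b \<in> \<int>) \<longrightarrow>
    integral cube (\<lambda>\<theta>. g \<theta> * \<phi> \<theta> * exp (\<i> * complex_of_real (\<kappa> \<bullet> \<theta>))) = 0)" for \<phi> :: "'q \<Rightarrow> complex"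
  have step: "Pr (\<lambda>\<theta>. \<phi> \<theta> * of_real ((1 + cos ((\<theta> - a) \<bullet> b)) / 2))" if "Pr \<phi>" and b: "b \<in> Basis" for \<phi> b
    unfolding Pr_def
  proof (intro conjI allI impI)
    have c\<phi>: "continuous_on S \<phi>" for S
      using that(1) continuous_on_subset unfolding Pr_def by blast
    show "continuous_on UNIV (\<lambda>\<theta>. \<phi> \<theta> * of_real ((1 + cos ((\<theta> - a) \<bullet> b)) / 2))"
      by (intro continuous_intros c\<phi>) auto
    fix \<kappa> :: 'q assume \<kappa>: "\<forall>b\<in>Basis. \<kappa> \<bullet> b \<in> \<int>"
    let ?E = "\<lambda>\<kappa> \<theta>. g \<theta> * \<phi> \<theta> * exp (\<i> * complex_of_real (\<kappa> \<bullet> \<theta>))"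
    have E0: "(?E \<kappa>' has_integral 0) cube" if "\<forall>b\<in>Basis. \<kappa>' \<bullet> b \<in> \<int>" for \<kappa>'
    proof -
      have "continuous_on cube (?E \<kappa>')" by (intro continuous_intros cont c\<phi>)
      then have i: "?E \<kappa>' integrable_on cube" unfolding cube_def by (rule integrable_continuous)
      have "integral cube (?E \<kappa>') = 0" using \<open>Pr \<phi>\<close> that unfolding Pr_def by blast
      then show ?thesis using integrable_integral[OF i] by (simp only:)
    qed
    have ib: "c \<bullet> b \<in> \<int>" if "c \<in> Basis" for c using b that by (cases "c = b") (auto simp: inner_Basis)
    have HI: "((\<lambda>\<theta>. (1 / 2) * ?E \<kappa> \<theta> + ((1 / 4) * exp (- \<i> * of_real (a \<bullet> b))) * ?E (\<kappa> + b) \<theta>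
        + ((1 / 4) * exp (\<i> * of_real (a \<bullet> b))) * ?E (\<kappa> - b) \<theta>) has_integral
        (1 / 2) * 0 + ((1 / 4) * exp (- \<i> * of_real (a \<bullet> b))) * 0 + ((1 / 4) * exp (\<i> * of_real (a \<bullet> b))) * 0) cube"
      by (intro has_integral_add has_integral_mult_right E0)
         (use \<kappa> ib in \<open>auto simp: inner_add_left inner_diff_left inner_commute[of b]\<close>)
    have eq: "(1 / 2) * ?E \<kappa> \<theta> + ((1 / 4) * exp (- \<i> * of_real (a \<bullet> b))) * ?E (\<kappa> + b) \<theta>
        + ((1 / 4) * exp (\<i> * of_real (a \<bullet> b))) * ?E (\<kappa> - b) \<theta>
        = g \<theta> * (\<phi> \<theta> * of_real ((1 + cos ((\<theta> - a) \<bullet> b)) / 2)) * exp (\<i> * complex_of_real (\<kappa> \<bullet> \<theta>))" for \<theta>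
    proof -
      have 1: "exp (\<i> * complex_of_real ((\<kappa> + b) \<bullet> \<theta>)) = exp (\<i> * complex_of_real (\<kappa> \<bullet> \<theta>)) * exp (\<i> * of_real (b \<bullet> \<theta>))"
        and 2: "exp (\<i> * complex_of_real ((\<kappa> - b) \<bullet> \<theta>)) = exp (\<i> * complex_of_real (\<kappa> \<bullet> \<theta>)) * exp (- \<i> * of_real (b \<bullet> \<theta>))"
        by (simp_all add: inner_add_left inner_diff_left algebra_simps flip: exp_add)
      have 3: "complex_of_real (cos ((\<theta> - a) \<bullet> b)) = (exp (- \<i> * of_real (a \<bullet> b)) * exp (\<i> * of_real (b \<bullet> \<theta>))
          + exp (\<i> * of_real (a \<bullet> b)) * exp (- \<i> * of_real (b \<bullet> \<theta>))) / 2"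
        unfolding cos_of_real[symmetric] cos_exp_eq
        by (simp add: inner_diff_left inner_commute[of b] algebra_simps flip: exp_add)
      show ?thesis unfolding 1 2 of_real_divide of_real_add 3 by (simp add: algebra_simps)
    qed
    show "integral cube (\<lambda>\<theta>. g \<theta> * (\<phi> \<theta> * of_real ((1 + cos ((\<theta> - a) \<bullet> b)) / 2)) * exp (\<i> * complex_of_real (\<kappa> \<bullet> \<theta>))) = 0"
      using integral_unique[OF HI] unfolding eq by simp
  qed
  have prod_step: "Pr (\<lambda>\<theta>. \<phi> \<theta> * of_real (\<Prod>b\<in>A. (1 + cos ((\<theta> - a) \<bullet> b)) / 2))" if "Pr \<phi>" "finite A" "A \<subseteq> Basis" for \<phi> A
    using that(2,3)
  proof (induction rule: finite_induct)
    case empty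
    then show ?case using that(1) by simp
  next
    case (insert c A)
    have "Pr (\<lambda>\<theta>. \<phi> \<theta> * of_real (\<Prod>b\<in>A. (1 + cos ((\<theta> - a) \<bullet> b)) / 2) * of_real ((1 + cos ((\<theta> - a) \<bullet> c)) / 2))"
      by (rule step) (use insert in auto)
    then show ?case by (simp only: prod.insert[OF insert.hyps] of_real_mult mult_ac)
  qed
  have "Pr (\<lambda>\<theta>. of_real (bump a \<theta> ^ N))"
  proof (induction N)
    case 0
    then show ?case using zero by (simp add: Pr_def)
  next
    case (Suc N)
    from prod_step[OF this finite_Basis order_refl] show ?case
      by (simp only: bump_def[symmetric] power_Suc of_real_mult mult_ac)
  qed
  from this[unfolded Pr_def, THEN conjunct2, rule_format, of 0] show ?thesis by simp
qed

text \<open>If g a \<noteq> 0, the real part u of cnj (g a) * g exceeds some c > 0 near a. Testing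
  against powers of the bump gives integral 0, yet a small box near a contributes at least a
  multiple of \<rho>'^N, while outside the neighbourhood the integrand is at most a multiple of
  \<rho>^N with \<rho> < \<rho>'.\<close>

lemma fourier_uniqueness:
  fixes g :: "'q::euclidean_space \<Rightarrow> complex"
  assumes cont: "continuous_on cube g"
    and zero: "\<And>\<kappa>. (\<And>b. b \<in> Basis \<Longrightarrow> \<kappa> \<bullet> b \<in> \<int>) \<Longrightarrow> integral cube (\<lambda>\<theta>. g \<theta> * exp (\<i> * complex_of_real (\<kappa> \<bullet> \<theta>))) = 0"
    and a: "a \<in> box 0 ((2 * pi) *\<^sub>R One)"
  shows "g a = 0"
proof (rule ccontr)
  assume ga: "g a \<noteq> 0"
  define W where "W = bump a"
  define u where "u \<theta> = Re (cnj (g a) * g \<theta>)" for \<theta>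
  define c where "c = (cmod (g a))\<^sup>2 / 2"
  have c: "c > 0" using ga by (simp add: c_def)
  have ua: "u a = 2 * c" by (simp add: u_def c_def complex_mult_cnj cmod_power2 mult.commute)
  have aC: "a \<in> cube" using a box_subset_cbox by (auto simp: cube_def)
  have contW: "continuous_on S W" for S unfolding W_def bump_def[abs_def] by (intro continuous_intros) auto
  have contu: "continuous_on cube u" unfolding u_def by (intro continuous_intros cont)
  have pc: "0 \<le> (1 + cos y) / 2" for y :: real
  proof -
    have "0 \<le> (1 + c) / 2" if "- 1 \<le> c" for c :: real using that by simp
    then show ?thesis using cos_ge_minus_one by blast
  qed
  have pc': "(1 + cos y) / 2 \<le> 1" for y :: real
  proof -
    have "(1 + c) / 2 \<le> 1" if "c \<le> 1" for c :: real using that by simp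
    then show ?thesis using cos_le_one by blast
  qed
  have W0: "0 \<le> W \<theta>" for \<theta>
    unfolding W_def bump_def by (intro prod_nonneg pc)
  have Wa: "W a = 1" by (simp add: W_def bump_def)
  have W1: "W \<theta> < 1" if \<theta>: "\<theta> \<in> cube" "\<theta> \<noteq> a" for \<theta>
  proof -
    obtain b where b: "b \<in> Basis" "(\<theta> - a) \<bullet> b \<noteq> 0"
      using \<theta>(2) by (metis euclidean_eqI inner_zero_left eq_iff_diff_eq_0)
    have "0 < a \<bullet> b" "a \<bullet> b < 2 * pi" "0 \<le> \<theta> \<bullet> b" "\<theta> \<bullet> b \<le> 2 * pi"
      using a \<theta>(1) b by (auto simp: mem_box mem_cube)
    \<comment> \<open>Here a has to be interior: for a on the boundary a translate of a by a period
      would be a second maximum.\<close>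
    then have lt: "\<bar>(\<theta> - a) \<bullet> b\<bar> < 2 * pi" by (simp add: inner_diff_left)
    have "cos ((\<theta> - a) \<bullet> b) \<noteq> 1"
    proof
      assume "cos ((\<theta> - a) \<bullet> b) = 1"
      then obtain n :: int where n: "(\<theta> - a) \<bullet> b = of_int n * 2 * pi" by (auto simp: cos_one_2pi_int)
      then have "\<bar>real_of_int n\<bar> < 1" using lt by (simp add: abs_mult)
      then have "n = 0" by linarith
      then show False using b n by simp
    qed
    then have "cos ((\<theta> - a) \<bullet> b) < 1" using cos_le_one less_le by blast
    then have q: "(1 + cos ((\<theta> - a) \<bullet> b)) / 2 < 1" by simp
    have "W \<theta> = (1 + cos ((\<theta> - a) \<bullet> b)) / 2 * (\<Prod>b\<in>Basis - {b}. (1 + cos ((\<theta> - a) \<bullet> b)) / 2)"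
      unfolding W_def bump_def by (rule prod.remove) (use b in auto)
    also have "\<dots> \<le> (1 + cos ((\<theta> - a) \<bullet> b)) / 2 * 1"
      by (intro mult_left_mono prod_le_1 conjI pc pc')
    finally show ?thesis using q by simp
  qed
  obtain \<delta> where \<delta>: "\<delta> > 0" "\<And>\<theta>. \<theta> \<in> cube \<Longrightarrow> dist \<theta> a < \<delta> \<Longrightarrow> \<bar>u \<theta> - u a\<bar> < c"
    using contu aC c unfolding continuous_on_iff dist_real_def by meson
  define K where "K = (cube :: 'q set) - ball a \<delta>"
  have K: "compact K" unfolding K_def cube_def by (intro compact_diff) auto
  obtain \<rho> where \<rho>: "0 \<le> \<rho>" "\<rho> < 1" "\<And>\<theta>. \<theta> \<in> K \<Longrightarrow> W \<theta> \<le> \<rho>"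
  proof (cases "K = {}")
    case True
    then show thesis using that[of 0] by auto
  next
    case False
    then obtain x where x: "x \<in> K" "\<And>y. y \<in> K \<Longrightarrow> W y \<le> W x"
      using continuous_attains_sup[OF K False contW] by blast
    from x(1) have "x \<in> cube" "x \<noteq> a" using \<delta>(1) by (auto simp: K_def)
    then have "W x < 1" by (rule W1)
    then show thesis by (rule that[OF W0]) (rule x(2))
  qed
  \<comment> \<open>Any value strictly between \<rho> and the maximum 1 separates the two
    exponential rates.\<close>
  define \<rho>' where "\<rho>' = (1 + \<rho>) / 2"
  have \<rho>': "\<rho> < \<rho>'" "\<rho>' < 1" "0 < \<rho>'" using \<rho> by (auto simp: \<rho>'_def)
  have "open ({\<theta>. \<rho>' < W \<theta>} \<inter> (ball a \<delta> \<inter> box 0 ((2 * pi) *\<^sub>R One)))"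
    by (intro open_Int open_ball open_box open_Collect_less continuous_intros contW)
  moreover have "a \<in> {\<theta>. \<rho>' < W \<theta>} \<inter> (ball a \<delta> \<inter> box 0 ((2 * pi) *\<^sub>R One))"
    using \<rho>' Wa \<delta> a by auto
  ultimately obtain l h where lh: "cbox l h \<subseteq> {\<theta>. \<rho>' < W \<theta>} \<inter> (ball a \<delta> \<inter> box 0 ((2 * pi) *\<^sub>R One))" "\<forall>i\<in>Basis. l \<bullet> i < h \<bullet> i"
    by (rule open_contains_cbox)
  have subC: "cbox l h \<subseteq> cube"
    using lh(1) box_subset_cbox by (fastforce simp: cube_def)
  have cont_pos: "measure lborel (cbox l h) > 0" using lh(2) by (simp add: content_pos_lt)
  obtain Mx where Mx: "\<And>\<theta>. \<theta> \<in> cube \<Longrightarrow> \<bar>u \<theta>\<bar> \<le> Mx" "Mx > 0"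
  proof -
    have "compact (u ` cube)" using contu by (intro compact_continuous_image) (auto simp: cube_def)
    then obtain B where "B > 0" "\<forall>x\<in>u ` cube. norm x \<le> B" using compact_imp_bounded bounded_pos by blast
    then show thesis using that[of B] by auto
  qed
  have main: "c * \<rho>' ^ N * measure lborel (cbox l h) \<le> Mx * \<rho> ^ N * measure lborel (cube :: 'q set)" for N
  proof -
    have i0: "((\<lambda>\<theta>. u \<theta> * W \<theta> ^ N) has_integral 0) cube"
    proof -
      have "continuous_on cube (\<lambda>\<theta>. g \<theta> * of_real (W \<theta> ^ N))" by (intro continuous_intros cont contW)
      then have i: "(\<lambda>\<theta>. g \<theta> * of_real (W \<theta> ^ N)) integrable_on cube" unfolding cube_def by (rule integrable_continuous)
      have "integral cube (\<lambda>\<theta>. g \<theta> * of_real (W \<theta> ^ N)) = 0"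
        unfolding W_def by (rule bump_orthogonal[OF cont zero])
      then have "((\<lambda>\<theta>. g \<theta> * of_real (W \<theta> ^ N)) has_integral 0) cube"
        using integrable_integral[OF i] by (simp only:)
      then have "((\<lambda>\<theta>. Re (cnj (g a) * (g \<theta> * of_real (W \<theta> ^ N)))) has_integral Re (cnj (g a) * 0)) cube"
        by (intro has_integral_Re has_integral_mult_right)
      then show ?thesis by (simp add: u_def algebra_simps del: of_real_power)
    qed
    have i1: "((\<lambda>\<theta>. (if \<theta> \<in> cbox l h then c * \<rho>' ^ N else 0) - Mx * \<rho> ^ N) has_integral
        (c * \<rho>' ^ N * measure lborel (cbox l h) - Mx * \<rho> ^ N * measure lborel (cube :: 'q set))) cube"
    proof (intro has_integral_diff)
      have "((\<lambda>\<theta>. c * \<rho>' ^ N) has_integral (c * \<rho>' ^ N * measure lborel (cbox l h))) (cbox l h)"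
        using has_integral_const[of "c * \<rho>' ^ N" l h] by (simp add: mult.commute)
      then show "((\<lambda>\<theta>. if \<theta> \<in> cbox l h then c * \<rho>' ^ N else 0) has_integral (c * \<rho>' ^ N * measure lborel (cbox l h))) cube"
        by (subst has_integral_restrict[OF subC])
      show "((\<lambda>\<theta>. Mx * \<rho> ^ N) has_integral (Mx * \<rho> ^ N * measure lborel (cube :: 'q set))) (cube :: 'q set)"
        unfolding cube_def by (rule has_integral_eq_rhs[OF has_integral_const]) simp
    qed
    have "c * \<rho>' ^ N * measure lborel (cbox l h) - Mx * \<rho> ^ N * measure lborel (cube :: 'q set) \<le> 0"
    proof (rule has_integral_le[OF i1 i0])
      fix \<theta> :: 'q assume \<theta>: "\<theta> \<in> cube"
      have MN: "0 \<le> Mx * \<rho> ^ N" using Mx \<rho> by simp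
      show "(if \<theta> \<in> cbox l h then c * \<rho>' ^ N else 0) - Mx * \<rho> ^ N \<le> u \<theta> * W \<theta> ^ N"
      proof (cases "dist \<theta> a < \<delta>")
        case True
        have uc: "u \<theta> \<ge> c" using \<delta>(2)[OF \<theta> True] ua by linarith
        show ?thesis
        proof (cases "\<theta> \<in> cbox l h")
          case True
          then have "\<rho>' \<le> W \<theta>" using lh(1) by force
          then have "c * \<rho>' ^ N \<le> u \<theta> * W \<theta> ^ N"
            using uc c \<rho>' by (intro mult_mono power_mono) auto
          then show ?thesis using True MN by simp
        next
          case False
          have "0 \<le> u \<theta> * W \<theta> ^ N" using uc c W0 by simp
          then show ?thesis using False MN by simp
        qed
      next
        case False
        then have "\<theta> \<in> K" using \<theta> by (simp add: K_def dist_commute)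
        then have "W \<theta> ^ N \<le> \<rho> ^ N" using \<rho> W0 by (intro power_mono) auto
        then have "\<bar>u \<theta>\<bar> * W \<theta> ^ N \<le> Mx * \<rho> ^ N" using Mx \<theta> W0 by (intro mult_mono) auto
        moreover have "- (\<bar>u \<theta>\<bar> * W \<theta> ^ N) \<le> u \<theta> * W \<theta> ^ N"
          using W0[of \<theta>] by (simp add: abs_if mult_le_0_iff)
        moreover have "\<theta> \<notin> cbox l h" using False lh(1) by (auto simp: dist_commute)
        ultimately show ?thesis by simp
      qed
    qed
    then show ?thesis by simp
  qed
  have "(\<lambda>N. (\<rho> / \<rho>') ^ N) \<longlonglongrightarrow> 0"
    using \<rho> \<rho>' by (intro LIMSEQ_power_zero) auto
  then have "(\<lambda>N. Mx * measure lborel (cube :: 'q set) * (\<rho> / \<rho>') ^ N) \<longlonglongrightarrow> 0"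
    by (rule tendsto_mult_right_zero)
  then have "\<forall>\<^sub>F N in sequentially. Mx * measure lborel (cube :: 'q set) * (\<rho> / \<rho>') ^ N < c * measure lborel (cbox l h)"
    using c cont_pos by (intro order_tendstoD) auto
  then obtain N where "Mx * measure lborel (cube :: 'q set) * (\<rho> / \<rho>') ^ N < c * measure lborel (cbox l h)"
    using eventually_happens'[OF sequentially_bot] by blast
  then have "Mx * measure lborel (cube :: 'q set) * (\<rho> / \<rho>') ^ N * \<rho>' ^ N < c * measure lborel (cbox l h) * \<rho>' ^ N"
    using \<rho>' by (intro mult_strict_right_mono) auto
  then have "Mx * \<rho> ^ N * measure lborel (cube :: 'q set) < c * \<rho>' ^ N * measure lborel (cbox l h)"
    using \<rho>' by (simp add: power_divide mult_ac)
  then show False using main[of N] by linarith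
qed

lemma has_sum_norm_le:
  fixes f :: "'a \<Rightarrow> 'b::real_normed_vector"
  assumes "(f has_sum s) A" "\<And>Q. finite Q \<Longrightarrow> Q \<subseteq> A \<Longrightarrow> norm (sum f Q) \<le> c"
  shows "norm s \<le> c"
proof (rule tendsto_upperbound)
  show "((\<lambda>Q. norm (sum f Q)) \<longlongrightarrow> norm s) (finite_subsets_at_top A)"
    using assms(1) unfolding has_sum_def by (rule tendsto_norm)
  show "\<forall>\<^sub>F Q in finite_subsets_at_top A. norm (sum f Q) \<le> c"
    using assms(2) by (intro eventually_finite_subsets_at_top_weakI) auto
qed simp

lemma norm_exp_i_diff_le: "cmod (exp (\<i> * complex_of_real x) - exp (\<i> * complex_of_real y)) \<le> \<bar>x - y\<bar>"
proof -
  have "exp (\<i> * complex_of_real x) - exp (\<i> * complex_of_real y)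
     = exp (\<i> * complex_of_real y) * (exp (\<i> * complex_of_real (x - y)) - 1)"
    by (simp add: algebra_simps flip: exp_add)
  also have "cmod \<dots> = 2 * \<bar>sin ((x - y) / 2)\<bar>"
    unfolding norm_mult dist_exp_i_1 by simp
  also have "\<dots> \<le> \<bar>x - y\<bar>"
    using abs_sin_x_le_abs_x[of "(x - y) / 2"] by simp
  finally show ?thesis .
qed

section \<open>Fourier series indexed by the modes\<close>

context torus_space
begin

lemma kr_zero [simp]: "kr 0 = 0"
  using kr_add[of 0 0] by simp

lemma kr_minus: "kr (- k) = - kr k"
  using kr_add[of "- k" k] by (simp add: eq_neg_iff_add_eq_0)

lemma kr_diff: "kr (k - l) = kr k - kr l"
  using kr_add[of k "- l"] by (simp add: kr_minus)

lemma kr_surj: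
  assumes "\<And>b. b \<in> Basis \<Longrightarrow> \<kappa> \<bullet> b \<in> \<int>"
  obtains k where "kr k = \<kappa>"
proof -
  have mult: "\<exists>k. kr k = of_int j *\<^sub>R b" if b: "b \<in> Basis" for j b
  proof -
    obtain k where k: "kr k = b" using kr_Basis[OF b] by blast
    show ?thesis
    proof (induction j rule: int_induct[where k = 0])
      case base
      then show ?case by (intro exI[of _ 0]) simp
    next
      case (step1 i)
      then obtain l where "kr l = of_int i *\<^sub>R b" by blast
      then show ?case using k by (intro exI[of _ "l + k"]) (simp add: kr_add algebra_simps)
    next
      case (step2 i)
      then obtain l where "kr l = of_int i *\<^sub>R b" by blast
      then show ?case using k by (intro exI[of _ "l - k"]) (simp add: kr_diff algebra_simps)
    qed
  qed
  have "\<exists>k. kr k = (\<Sum>b\<in>A. (\<kappa> \<bullet> b) *\<^sub>R b)" if "finite A" "A \<subseteq> Basis" for A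
    using that
  proof (induction rule: finite_induct)
    case empty
    then show ?case by (intro exI[of _ 0]) simp
  next
    case (insert c A)
    then obtain l where l: "kr l = (\<Sum>b\<in>A. (\<kappa> \<bullet> b) *\<^sub>R b)" by auto
    obtain j where "\<kappa> \<bullet> c = of_int j" using assms[of c] insert by (auto elim: Ints_cases)
    then obtain k where "kr k = (\<kappa> \<bullet> c) *\<^sub>R c" using mult[of c j] insert by auto
    then show ?case using l insert by (intro exI[of _ "k + l"]) (simp add: kr_add)
  qed
  from this[OF finite_Basis order_refl] show thesis
    using that by (auto simp: euclidean_representation)
qed

definition fcoef :: "('q \<Rightarrow> complex) \<Rightarrow> 'z \<Rightarrow> complex" where
  "fcoef g k = integral cube (\<lambda>\<theta>. g \<theta> * exp (- \<i> * of_real (kr k \<bullet> \<theta>))) / (2 * pi) ^ DIM('q)"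

lemma continuous_on_ek: "continuous_on S (ek k)"
  unfolding ek_def[abs_def] by (intro continuous_intros)

text \<open>Absolute summability makes the series converge uniformly to a continuous periodic S with
  the same coefficients as g. The difference vanishes inside the cube by uniqueness, on the cube by
  continuity, and everywhere by periodicity.\<close>

lemma fourier_has_sum:
  assumes cont: "continuous_on UNIV g" and per: "\<And>\<theta> b. b \<in> Basis \<Longrightarrow> g (\<theta> + (2 * pi) *\<^sub>R b) = g \<theta>"
    and sm: "(\<lambda>k. cmod (fcoef g k)) summable_on UNIV"
  shows "((\<lambda>k. fcoef g k * ek k \<theta>) has_sum g \<theta>) UNIV"
proof -
  define S where "S \<theta> = (\<Sum>\<^sub>\<infinity>k. fcoef g k * ek k \<theta>)" for \<theta>
  have ul: "uniform_limit UNIV (\<lambda>X \<theta>. \<Sum>k\<in>X. fcoef g k * ek k \<theta>) S (finite_subsets_at_top UNIV)"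
    unfolding S_def by (rule Weierstrass_m_test_general[OF _ sm]) (simp add: norm_mult)
  have contS: "continuous_on UNIV S"
    by (rule uniform_limit_theorem[OF always_eventually ul])
       (auto intro!: continuous_intros continuous_on_ek)
  have perS: "S (\<theta> + (2 * pi) *\<^sub>R b) = S \<theta>" if b: "b \<in> Basis" for \<theta> b
  proof -
    have "ek k (\<theta> + (2 * pi) *\<^sub>R b) = ek k \<theta>" for k
    proof -
      obtain j where "kr k \<bullet> b = of_int j" using kr_int[OF b] by (auto elim: Ints_cases)
      then have "exp (\<i> * complex_of_real (kr k \<bullet> ((2 * pi) *\<^sub>R b))) = 1"
        using exp_integer_2pi[of "of_int j"] by (simp add: mult_ac)
      then show ?thesis by (simp add: ek_def inner_add_right distrib_left exp_add)
    qed
    then show ?thesis by (simp add: S_def)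
  qed
  define F where "F \<theta> = g \<theta> - S \<theta>" for \<theta>
  have contF: "continuous_on T F" for T
    unfolding F_def by (intro continuous_intros continuous_on_subset[OF cont] continuous_on_subset[OF contS]) auto
  have perF: "F (\<theta> + (2 * pi) *\<^sub>R b) = F \<theta>" if "b \<in> Basis" for \<theta> b
    using per perS that by (simp add: F_def)
  have zero: "integral cube (\<lambda>\<theta>. F \<theta> * exp (\<i> * complex_of_real (\<kappa> \<bullet> \<theta>))) = 0"
    if \<kappa>: "\<And>b. b \<in> Basis \<Longrightarrow> \<kappa> \<bullet> b \<in> \<int>" for \<kappa>
  proof -
    obtain j where j: "kr j = - \<kappa>" using kr_surj[of "- \<kappa>"] \<kappa> by auto
    let ?e = "\<lambda>\<theta>. exp (\<i> * complex_of_real (\<kappa> \<bullet> \<theta>))"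
    have e: "?e \<theta> = exp (- \<i> * of_real (kr j \<bullet> \<theta>))" for \<theta> by (simp add: j)
    have ig: "((\<lambda>\<theta>. g \<theta> * ?e \<theta>) has_integral fcoef g j * (2 * pi) ^ DIM('q)) cube"
    proof -
      have "(\<lambda>\<theta>. g \<theta> * ?e \<theta>) integrable_on cube"
        unfolding cube_def
        by (intro integrable_continuous continuous_intros continuous_on_subset[OF cont]) auto
      then show ?thesis unfolding fcoef_def e[symmetric] by (simp add: integrable_integral)
    qed
    have ie: "integral cube (\<lambda>\<theta>. (\<Sum>k\<in>X. fcoef g k * ek k \<theta>) * ?e \<theta>) = fcoef g j * (2 * pi) ^ DIM('q)"
      if X: "finite X" "j \<in> X" for X
    proof -
      have kk: "ek k \<theta> * ?e \<theta> = exp (\<i> * complex_of_real ((kr k - kr j) \<bullet> \<theta>))" for k \<theta>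
        by (simp add: ek_def j inner_add_left algebra_simps flip: exp_add)
      have "((\<lambda>\<theta>. \<Sum>k\<in>X. fcoef g k * (ek k \<theta> * ?e \<theta>)) has_integral (\<Sum>k\<in>X. fcoef g k * (if k = j then (2 * pi) ^ DIM('q) else 0))) cube"
      proof (intro has_integral_sum X has_integral_mult_right)
        fix k
        have "(\<lambda>\<theta>. exp (\<i> * complex_of_real ((kr k - kr j) \<bullet> \<theta>))) integrable_on cube"
          unfolding cube_def by (intro integrable_continuous continuous_on_exp_inner)
        moreover have "integral cube (\<lambda>\<theta>. exp (\<i> * complex_of_real ((kr k - kr j) \<bullet> \<theta>))) = (if k = j then (2 * pi) ^ DIM('q) else 0)"
        proof -
          have "kr k - kr j = 0 \<longleftrightarrow> k = j"
            using kr_eq_0[of "k - j"] by (auto simp: kr_diff)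
          then show ?thesis
            by (subst integral_exp_cube) (auto simp: inner_diff_left kr_int)
        qed
        ultimately show "((\<lambda>\<theta>. ek k \<theta> * ?e \<theta>) has_integral (if k = j then (2 * pi) ^ DIM('q) else 0)) cube"
          unfolding kk by (metis integrable_integral)
      qed
      moreover have "(\<Sum>k\<in>X. fcoef g k * (if k = j then (2 * pi) ^ DIM('q) else 0)) = fcoef g j * (2 * pi) ^ DIM('q)"
      proof -
        have "(\<Sum>k\<in>X. fcoef g k * (if k = j then (2 * pi) ^ DIM('q) else 0))
          = (\<Sum>k\<in>X. if k = j then fcoef g j * (2 * pi) ^ DIM('q) else 0)"
          by (intro sum.cong) auto
        then show ?thesis using X by simp
      qed
      ultimately show ?thesis
        by (simp add: integral_unique sum_distrib_right mult.assoc)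
    qed
    have "bounded (range S)"
    proof -
      have "cmod (S \<theta>) \<le> (\<Sum>\<^sub>\<infinity>k. cmod (fcoef g k))" for \<theta>
        unfolding S_def using norm_infsum_bound[of "\<lambda>k. fcoef g k * ek k \<theta>" UNIV] sm by (simp add: norm_mult)
      then show ?thesis unfolding bounded_iff by blast
    qed
    have ule: "uniform_limit cube (\<lambda>X \<theta>. (\<Sum>k\<in>X. fcoef g k * ek k \<theta>) * ?e \<theta>) (\<lambda>\<theta>. S \<theta> * ?e \<theta>) (finite_subsets_at_top UNIV)"
    proof (rule uniform_lim_mult)
      show "uniform_limit cube (\<lambda>X \<theta>. \<Sum>k\<in>X. fcoef g k * ek k \<theta>) S (finite_subsets_at_top UNIV)"
        by (rule uniform_limit_on_subset[OF ul]) simp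
      show "uniform_limit cube (\<lambda>X. ?e) ?e (finite_subsets_at_top UNIV)" by (rule uniform_limit_const)
      show "bounded (S ` cube)" by (rule bounded_subset[OF \<open>bounded (range S)\<close>]) auto
      show "bounded (?e ` cube)" unfolding bounded_iff by (intro exI[of _ 1]) auto
    qed
    obtain I J where IJ: "\<And>X. ((\<lambda>\<theta>. (\<Sum>k\<in>X. fcoef g k * ek k \<theta>) * ?e \<theta>) has_integral I X) cube"
      "((\<lambda>\<theta>. S \<theta> * ?e \<theta>) has_integral J) cube" "(I \<longlongrightarrow> J) (finite_subsets_at_top UNIV)"
    proof (rule uniform_limit_integral_cbox[OF ule[unfolded cube_def]])
      show "continuous_on (cbox 0 ((2 * pi) *\<^sub>R One)) (\<lambda>\<theta>. (\<Sum>k\<in>X. fcoef g k * ek k \<theta>) * ?e \<theta>)" for X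
        by (intro continuous_intros continuous_on_ek)
    qed (auto simp: cube_def)
    have "\<forall>\<^sub>F X in finite_subsets_at_top UNIV. I X = fcoef g j * (2 * pi) ^ DIM('q)"
      unfolding eventually_finite_subsets_at_top
    proof (intro exI[of _ "{j}"] conjI allI impI)
      fix X assume "finite X \<and> {j} \<subseteq> X \<and> X \<subseteq> UNIV"
      then show "I X = fcoef g j * (2 * pi) ^ DIM('q)"
        using ie[of X] integral_unique[OF IJ(1)[of X]] by simp
    qed auto
    then have "(I \<longlongrightarrow> fcoef g j * (2 * pi) ^ DIM('q)) (finite_subsets_at_top UNIV)"
      by (rule tendsto_eventually)
    then have "J = fcoef g j * (2 * pi) ^ DIM('q)"
      using IJ(3) by (intro tendsto_unique[OF _ IJ(3)]) auto
    with IJ(2) have "((\<lambda>\<theta>. g \<theta> * ?e \<theta> - S \<theta> * ?e \<theta>) has_integral 0) cube"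
      using has_integral_diff[OF ig IJ(2)] by simp
    then show ?thesis by (simp add: F_def left_diff_distrib integral_unique)
  qed
  have F0: "F a = 0" if "a \<in> box 0 ((2 * pi) *\<^sub>R One)" for a
    by (rule fourier_uniqueness[OF contF zero that])
  have cl: "closure (box 0 ((2 * pi) *\<^sub>R One)) = (cube :: 'q set)"
    unfolding cube_def by (rule closure_box) (auto simp: box_ne_empty inner_One)
  have Fc: "F a = 0" if "a \<in> cube" for a
    by (rule continuous_constant_on_closure[of "box 0 ((2 * pi) *\<^sub>R One)" F])
       (use that F0 cl contF in auto)
  have shift: "F (\<theta> + (2 * pi * of_int j) *\<^sub>R b) = F \<theta>" if "b \<in> Basis" for \<theta> j b
  proof (induction j rule: int_induct[where k = 0])
    case (step1 i)
    then show ?case using perF[OF that, of "\<theta> + (2 * pi * of_int i) *\<^sub>R b"] by (simp add: algebra_simps)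
  next
    case (step2 i)
    then show ?case using perF[OF that, of "\<theta> + (2 * pi * of_int (i - 1)) *\<^sub>R b"] by (simp add: algebra_simps)
  qed simp
  have shifts: "F (\<theta> + (\<Sum>b\<in>A. (2 * pi * of_int (n b)) *\<^sub>R b)) = F \<theta>" if "finite A" "A \<subseteq> Basis" for A n \<theta>
    using that
  proof (induction rule: finite_induct)
    case (insert c A)
    then show ?case
      using shift[of c "\<theta> + (\<Sum>b\<in>A. (2 * pi * of_int (n b)) *\<^sub>R b)" "n c"] by (simp add: algebra_simps)
  qed simp
  \<comment> \<open>The number of periods that brings the coordinate b into the interval from 0 to 2
    * pi.\<close>
  define n where "n b = - \<lfloor>(\<theta> \<bullet> b) / (2 * pi)\<rfloor>" for b
  have "\<theta> + (\<Sum>b\<in>Basis. (2 * pi * of_int (n b)) *\<^sub>R b) \<in> cube"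
    unfolding mem_cube
  proof
    fix b :: 'q assume b: "b \<in> Basis"
    let ?y = "\<theta> \<bullet> b / (2 * pi)"
    have "(\<theta> + (\<Sum>b\<in>Basis. (2 * pi * of_int (n b)) *\<^sub>R b)) \<bullet> b = \<theta> \<bullet> b + 2 * pi * of_int (n b)"
      unfolding inner_add_left inner_sum_left_Basis[OF b] by (rule refl)
    also have "\<dots> = 2 * pi * (?y - of_int \<lfloor>?y\<rfloor>)" by (simp add: n_def right_diff_distrib)
    finally have "(\<theta> + (\<Sum>b\<in>Basis. (2 * pi * of_int (n b)) *\<^sub>R b)) \<bullet> b = 2 * pi * (?y - of_int \<lfloor>?y\<rfloor>)" .
    moreover have "0 \<le> y - of_int \<lfloor>y\<rfloor>" "y - of_int \<lfloor>y\<rfloor> \<le> 1" for y :: real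
      by linarith+
    ultimately show "0 \<le> (\<theta> + (\<Sum>b\<in>Basis. (2 * pi * of_int (n b)) *\<^sub>R b)) \<bullet> b
      \<and> (\<theta> + (\<Sum>b\<in>Basis. (2 * pi * of_int (n b)) *\<^sub>R b)) \<bullet> b \<le> 2 * pi"
      using mult_left_mono[of "?y - of_int \<lfloor>?y\<rfloor>" 1 "2 * pi"] by (simp only: mult_1_right) simp
  qed
  from Fc[OF this] have "g \<theta> = S \<theta>" using shifts[OF finite_Basis order_refl, of \<theta> n] by (simp add: F_def)
  moreover have "(\<lambda>k. fcoef g k * ek k \<theta>) summable_on UNIV"
    by (rule abs_summable_summable) (use sm in \<open>simp add: norm_mult\<close>)
  ultimately show ?thesis by (simp add: S_def has_sum_infsum)
qed

lemma fcoef_bound: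
  assumes "continuous_on cube g" "\<And>\<theta>. \<theta> \<in> cube \<Longrightarrow> cmod (g \<theta>) \<le> c"
  shows "cmod (fcoef g k) \<le> c"
proof -
  have c: "0 \<le> c"
    using order_trans[OF norm_ge_zero assms(2)[of 0]] by (simp add: mem_cube)
  have i: "(\<lambda>\<theta>. g \<theta> * exp (- \<i> * of_real (kr k \<bullet> \<theta>))) integrable_on cube"
    unfolding cube_def by (intro integrable_continuous continuous_intros) (use assms(1) in \<open>simp add: cube_def\<close>)
  have "cmod (integral cube (\<lambda>\<theta>. g \<theta> * exp (- \<i> * of_real (kr k \<bullet> \<theta>)))) \<le> c * measure lborel (cube :: 'q set)"
    unfolding cube_def
    by (rule has_integral_bound[OF c integrable_integral])
       (use i assms(2) in \<open>auto simp: cube_def norm_mult\<close>)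
  moreover have "measure lborel (cube :: 'q set) = (2 * pi) ^ DIM('q)"
    unfolding cube_def by (subst content_cbox) (auto simp: inner_One)
  ultimately show ?thesis by (simp add: fcoef_def norm_divide norm_power norm_mult divide_le_eq)
qed

lemma fcoef_linear:
  assumes "continuous_on cube g" "continuous_on cube g'"
  shows "fcoef (\<lambda>\<theta>. c * g \<theta> + c' * g' \<theta>) k = c * fcoef g k + c' * fcoef g' k"
proof -
  have i: "(\<lambda>\<theta>. u \<theta> * exp (- \<i> * of_real (kr k \<bullet> \<theta>))) integrable_on cube" if "continuous_on cube u" for u
    unfolding cube_def by (intro integrable_continuous continuous_intros) (use that in \<open>simp add: cube_def\<close>)
  let ?e = "\<lambda>\<theta>. exp (- \<i> * complex_of_real (kr k \<bullet> \<theta>))"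
  have "((\<lambda>\<theta>. c * (g \<theta> * ?e \<theta>) + c' * (g' \<theta> * ?e \<theta>)) has_integral
      (c * integral cube (\<lambda>\<theta>. g \<theta> * ?e \<theta>) + c' * integral cube (\<lambda>\<theta>. g' \<theta> * ?e \<theta>))) cube"
    by (intro has_integral_add has_integral_mult_right integrable_integral i assms)
  then have "integral cube (\<lambda>\<theta>. (c * g \<theta> + c' * g' \<theta>) * ?e \<theta>)
      = c * integral cube (\<lambda>\<theta>. g \<theta> * ?e \<theta>) + c' * integral cube (\<lambda>\<theta>. g' \<theta> * ?e \<theta>)"
    by (intro integral_unique) (simp add: distrib_right mult.assoc)
  then show ?thesis by (simp add: fcoef_def add_divide_distrib)
qed

text \<open>Differentiation under the integral: on the compact product of the cube and a closed ball
  g is bounded, so the Taylor remainder of \<open>holo_taylor\<close> is quadratic uniformly in the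
  angle and survives integration.\<close>

lemma fcoef_holo:
  assumes S: "open S" and g: "\<And>\<theta>. holo (g \<theta>) S"
    and cont: "continuous_on (cube \<times> S) (\<lambda>(\<theta>, z). g \<theta> z)"
    and contd: "\<And>z v. z \<in> S \<Longrightarrow> continuous_on cube (\<lambda>\<theta>. dd v (g \<theta>) z)"
  shows "holo (\<lambda>z. fcoef (\<lambda>\<theta>. g \<theta> z) k) S"
  unfolding holomorphic_wrt_def
proof
  fix x assume x: "x \<in> S"
  obtain R where R: "R > 0" "cball x R \<subseteq> S" using S x open_contains_cball by blast
  let ?I = "(\<lambda>(\<theta>, z). g \<theta> z) ` (cube \<times> cball x R)"
  have "compact ?I"
    by (intro compact_continuous_image continuous_on_subset[OF cont] compact_Times)
       (use R in \<open>auto simp: cube_def\<close>)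
  then have "bounded ?I" by (rule compact_imp_bounded)
  then obtain C where C0: "\<And>y. y \<in> ?I \<Longrightarrow> cmod y \<le> C"
    unfolding bounded_iff by blast
  have C: "cmod (g \<theta> z) \<le> C" if "\<theta> \<in> cube" "z \<in> cball x R" for \<theta> z
    by (rule C0) (rule image_eqI[of _ _ "(\<theta>, z)"], use that in auto)
  define D where "D w = fcoef (\<lambda>\<theta>. dd w (g \<theta>) x) k" for w
  have contz: "continuous_on cube (\<lambda>\<theta>. g \<theta> z)" if "z \<in> S" for z
  proof -
    have "continuous_on cube (\<lambda>\<theta>. case (\<theta>, z) of (\<theta>, z) \<Rightarrow> g \<theta> z)"
      by (rule continuous_on_compose2[OF cont])
         (use that in \<open>auto intro: continuous_on_Pair continuous_on_const continuous_on_id\<close>)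
    then show ?thesis by simp
  qed
  have Dadd: "D (v + w) = D v + D w" for v w
    using fcoef_linear[OF contd[OF x, of v] contd[OF x, of w], of 1 1 k]
    by (simp add: D_def holo_has_derivative(3)[OF g x])
  have Dsc: "D (sc c w) = c * D w" for c w
    using fcoef_linear[OF contd[OF x, of w] contd[OF x, of w], of c 0 k]
    by (simp add: D_def holo_has_derivative(2)[OF g x])
  have lin: "bounded_linear D"
    unfolding linear_conv_bounded_linear[symmetric]
  proof
    show "D (t *\<^sub>R b) = t *\<^sub>R D b" for t b
      using Dsc[of "of_real t" b] by (simp add: sc_of_real scaleR_conv_of_real)
  qed (rule Dadd)
  define A where "A = 8 * C / R\<^sup>2"
  have est: "cmod (fcoef (\<lambda>\<theta>. g \<theta> (x + w)) k - fcoef (\<lambda>\<theta>. g \<theta> x) k - D w) \<le> A * (norm w)\<^sup>2"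
    if w: "norm w \<le> R / 4" for w
  proof -
    have xw: "x + w \<in> S" using w R by (auto simp: dist_norm intro!: subsetD[OF R(2)])
    have "fcoef (\<lambda>\<theta>. g \<theta> (x + w) - g \<theta> x - dd w (g \<theta>) x) k = fcoef (\<lambda>\<theta>. g \<theta> (x + w)) k - fcoef (\<lambda>\<theta>. g \<theta> x) k - D w"
      using fcoef_linear[OF contz[OF xw] contz[OF x], of 1 "-1" k]
        fcoef_linear[OF continuous_on_diff[OF contz[OF xw] contz[OF x]] contd[OF x, of w], of 1 "-1" k]
      by (simp add: D_def)
    moreover have "cmod (fcoef (\<lambda>\<theta>. g \<theta> (x + w) - g \<theta> x - dd w (g \<theta>) x) k) \<le> A * (norm w)\<^sup>2"
    proof (rule fcoef_bound)
      show "continuous_on cube (\<lambda>\<theta>. g \<theta> (x + w) - g \<theta> x - dd w (g \<theta>) x)"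
        by (intro continuous_intros contz contd x xw)
      fix \<theta> :: 'q assume \<theta>: "\<theta> \<in> cube"
      show "cmod (g \<theta> (x + w) - g \<theta> x - dd w (g \<theta>) x) \<le> A * (norm w)\<^sup>2"
        unfolding A_def
      proof (rule holo_taylor)
        show "holo (g \<theta>) (ball x R)" by (rule holo_subset[OF g]) (use R ball_subset_cball in blast)
        show "cmod (g \<theta> z) \<le> C" if "z \<in> ball x R" for z using C[OF \<theta>, of z] that by auto
      qed (use w R in auto)
    qed
    ultimately show ?thesis by simp
  qed
  have "((\<lambda>z. fcoef (\<lambda>\<theta>. g \<theta> z) k) has_derivative D) (at x)"
  proof (rule has_derivativeI_sandwich[of "R / 4"])
    show "norm (fcoef (\<lambda>\<theta>. g \<theta> y) k - fcoef (\<lambda>\<theta>. g \<theta> x) k - D (y - x)) / norm (y - x) \<le> A * norm (y - x)"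
      if "y \<noteq> x" "dist y x < R / 4" for y
    proof -
      have "norm (fcoef (\<lambda>\<theta>. g \<theta> y) k - fcoef (\<lambda>\<theta>. g \<theta> x) k - D (y - x)) / norm (y - x) \<le> A * (norm (y - x))\<^sup>2 / norm (y - x)"
        using est[of "y - x"] that by (intro divide_right_mono) (auto simp: dist_norm)
      then show ?thesis using that by (simp add: power2_eq_square)
    qed
    have "((\<lambda>y. A * norm (y - x)) \<longlongrightarrow> A * norm (x - x)) (at x)" by (intro tendsto_intros)
    then show "((\<lambda>y. A * norm (y - x)) \<longlongrightarrow> 0) (at x)" by simp
  qed (use R lin in auto)
  then show "\<exists>F'. ((\<lambda>z. fcoef (\<lambda>\<theta>. g \<theta> z) k) has_derivative F') (at x) \<and> (\<forall>c v. F' (sc c v) = c * F' v)"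
    using Dsc by blast
qed

lemma fourier_tail:
  assumes hs: "\<And>\<theta>. ((\<lambda>k. a k * ek k \<theta>) has_sum g \<theta>) UNIV" and P: "finite P"
    and bd: "\<And>Q. finite Q \<Longrightarrow> Q \<inter> P = {} \<Longrightarrow> (\<Sum>k\<in>Q. cmod (a k)) \<le> c"
  shows "cmod (g \<theta> - (\<Sum>k\<in>P. a k * ek k \<theta>)) \<le> c"
proof (rule has_sum_norm_le)
  show "((\<lambda>k. a k * ek k \<theta>) has_sum (g \<theta> - (\<Sum>k\<in>P. a k * ek k \<theta>))) (UNIV - P)"
    by (rule has_sum_Diff[OF hs has_sum_finite[OF P]]) simp
  fix Q assume Q: "finite Q" "Q \<subseteq> UNIV - P"
  have "cmod (\<Sum>k\<in>Q. a k * ek k \<theta>) \<le> (\<Sum>k\<in>Q. cmod (a k))"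
    by (intro sum_norm_le) (simp add: norm_mult)
  also have "\<dots> \<le> c" using Q by (intro bd) auto
  finally show "cmod (\<Sum>k\<in>Q. a k * ek k \<theta>) \<le> c" .
qed

text \<open>Each exponential is Lipschitz with constant at most wt k. The estimate takes the place
  of termwise differentiation of the infinite series in the angles.\<close>

lemma fourier_tail_lipschitz:
  assumes hs: "\<And>\<theta>. ((\<lambda>k. a k * ek k \<theta>) has_sum g \<theta>) UNIV" and P: "finite P"
    and bd: "\<And>Q. finite Q \<Longrightarrow> Q \<inter> P = {} \<Longrightarrow> (\<Sum>k\<in>Q. cmod (a k) * wt k) \<le> c"
  shows "cmod ((g \<theta> - (\<Sum>k\<in>P. a k * ek k \<theta>)) - (g \<theta>' - (\<Sum>k\<in>P. a k * ek k \<theta>'))) \<le> c * norm (\<theta> - \<theta>')"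
proof (rule has_sum_norm_le)
  show "((\<lambda>k. a k * ek k \<theta> - a k * ek k \<theta>') has_sum
     ((g \<theta> - (\<Sum>k\<in>P. a k * ek k \<theta>)) - (g \<theta>' - (\<Sum>k\<in>P. a k * ek k \<theta>')))) (UNIV - P)"
  proof -
    have "((\<lambda>k. a k * ek k \<theta>) has_sum (g \<theta> - (\<Sum>k\<in>P. a k * ek k \<theta>))) (UNIV - P)" for \<theta>
      by (rule has_sum_Diff[OF hs has_sum_finite[OF P]]) simp
    from has_sum_add[OF this[of \<theta>] has_sum_uminus[THEN iffD2, of "\<lambda>k. a k * ek k \<theta>'"], of "- (g \<theta>' - (\<Sum>k\<in>P. a k * ek k \<theta>'))"]
      this[of \<theta>']
    show ?thesis by (simp add: algebra_simps)
  qed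
  fix Q assume Q: "finite Q" "Q \<subseteq> UNIV - P"
  have "cmod (\<Sum>k\<in>Q. a k * ek k \<theta> - a k * ek k \<theta>') \<le> (\<Sum>k\<in>Q. cmod (a k) * wt k * norm (\<theta> - \<theta>'))"
  proof (intro sum_norm_le)
    fix k
    have "cmod (ek k \<theta> - ek k \<theta>') \<le> \<bar>kr k \<bullet> \<theta> - kr k \<bullet> \<theta>'\<bar>"
      unfolding ek_def by (rule norm_exp_i_diff_le)
    also have "\<dots> = \<bar>kr k \<bullet> (\<theta> - \<theta>')\<bar>" by (simp add: inner_diff_right)
    also have "\<dots> \<le> norm (kr k) * norm (\<theta> - \<theta>')" by (rule Cauchy_Schwarz_ineq2)
    also have "\<dots> \<le> wt k * norm (\<theta> - \<theta>')" by (intro mult_right_mono norm_kr) simp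
    finally have "cmod (a k) * cmod (ek k \<theta> - ek k \<theta>') \<le> cmod (a k) * (wt k * norm (\<theta> - \<theta>'))"
      by (intro mult_left_mono) auto
    then show "cmod (a k * ek k \<theta> - a k * ek k \<theta>') \<le> cmod (a k) * wt k * norm (\<theta> - \<theta>')"
      by (simp add: right_diff_distrib[symmetric] norm_mult mult.assoc)
  qed
  also have "\<dots> = (\<Sum>k\<in>Q. cmod (a k) * wt k) * norm (\<theta> - \<theta>')" by (simp add: sum_distrib_right)
  also have "\<dots> \<le> c * norm (\<theta> - \<theta>')" using Q by (intro mult_right_mono bd) auto
  finally show "cmod (\<Sum>k\<in>Q. a k * ek k \<theta> - a k * ek k \<theta>') \<le> c * norm (\<theta> - \<theta>')" .
qed

end

section \<open>Continuation of solutions of ordinary differential equations\<close>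

definition locally_lipschitz_on :: "'a::metric_space set \<Rightarrow> ('a \<Rightarrow> 'b::metric_space) \<Rightarrow> bool" where
  "locally_lipschitz_on W X \<longleftrightarrow>
     (\<forall>x\<in>W. \<exists>e>0. \<exists>L. cball x e \<subseteq> W \<and> (\<forall>y\<in>cball x e. \<forall>z\<in>cball x e. dist (X y) (X z) \<le> L * dist y z))"

text \<open>The integral operator is a contraction on bounded continuous functions on the whole line
  with values in a closed ball; clamping time to the interval turns a solution candidate into such a
  function.\<close>

lemma picard_lindeloef:
  fixes X :: "'a::euclidean_space \<Rightarrow> 'a"
  assumes X: "locally_lipschitz_on W X" and x: "x \<in> W"
  obtains \<tau> u where "\<tau> > 0" "u b = x" "\<And>t. t \<in> {b..b + \<tau>} \<Longrightarrow> u t \<in> W"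
    "\<And>t. t \<in> {b..b + \<tau>} \<Longrightarrow> (u has_vector_derivative X (u t)) (at t within {b..b + \<tau>})"
proof -
  obtain e L0 where e: "e > 0" "cball x e \<subseteq> W"
    and L0: "\<And>y z. y \<in> cball x e \<Longrightarrow> z \<in> cball x e \<Longrightarrow> dist (X y) (X z) \<le> L0 * dist y z"
    using X x unfolding locally_lipschitz_on_def by metis
  define L where "L = max L0 1"
  have L: "L \<ge> 1" "\<And>y z. y \<in> cball x e \<Longrightarrow> z \<in> cball x e \<Longrightarrow> dist (X y) (X z) \<le> L * dist y z"
    using L0 order_trans[OF L0 mult_right_mono] by (auto simp: L_def)
  define M where "M = norm (X x) + L * e"
  have M: "M > 0" using L e by (simp add: M_def add_nonneg_pos)
  have XM: "norm (X y) \<le> M" if "y \<in> cball x e" for y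
  proof -
    have "dist (X y) (X x) \<le> L * dist y x" using L(2)[OF that, of x] e by simp
    also have "\<dots> \<le> L * e" using that L(1) by (intro mult_left_mono) (auto simp: dist_commute)
    finally have "dist (X y) (X x) \<le> L * e" .
    then show ?thesis using norm_triangle_ineq2[of "X y" "X x"] by (simp add: M_def dist_norm)
  qed
  have contX: "continuous_on (cball x e) X"
    by (rule lipschitz_on_continuous_on[where L = L]) (use L in \<open>auto simp: lipschitz_on_def\<close>)
  \<comment> \<open>The first bound keeps the iterates in the ball, the second makes the contraction
    constant 1 / 2.\<close>
  define \<tau> where "\<tau> = min (e / M) (1 / (2 * L))"
  have \<tau>: "\<tau> > 0" "M * \<tau> \<le> e" "L * \<tau> \<le> 1 / 2"
    using M L e by (auto simp: \<tau>_def min_def field_simps)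
  define s :: "(real \<Rightarrow>\<^sub>C 'a) set" where "s = PiC UNIV (\<lambda>_. cball x e)"
  define f where "f v t = x + integral {b..t} (\<lambda>r. X (apply_bcontfun v r))" for v t
  define P where "P v = Bcontfun (\<lambda>t. f v (clamp b (b + \<tau>) t))" for v
  have in_s: "apply_bcontfun v t \<in> cball x e" if "v \<in> s" for v t
    using that unfolding s_def mem_PiC_iff by auto
  have contXv: "continuous_on T (\<lambda>r. X (apply_bcontfun v r))" if "v \<in> s" for v T
    by (rule continuous_on_compose2[OF contX]) (use in_s[OF that] in \<open>auto intro: continuous_on_apply_bcontfun\<close>)
  have contf: "continuous_on {b..b + \<tau>} (f v)" if "v \<in> s" for v
    unfolding f_def[abs_def]
    by (intro continuous_intros indefinite_integral_continuous_1 integrable_continuous_real contXv that)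
  have cl: "clamp b (b + \<tau>) t \<in> {b..b + \<tau>}" for t
    using clamp_in_interval[of b "b + \<tau>" t] \<tau> by simp
  have f_in: "f v t \<in> cball x e" if "v \<in> s" "t \<in> {b..b + \<tau>}" for v t
  proof -
    have "norm (integral {b..t} (\<lambda>r. X (apply_bcontfun v r))) \<le> M * (t - b)"
      using that in_s by (intro integral_bound contXv XM) auto
    also have "\<dots> \<le> M * \<tau>" using that M by (intro mult_left_mono) auto
    finally show ?thesis using \<tau> by (simp add: f_def dist_norm)
  qed
  have P_apply: "apply_bcontfun (P v) t = f v (clamp b (b + \<tau>) t)" if v: "v \<in> s" for v t
  proof -
    have "(\<lambda>t. f v (clamp b (b + \<tau>) t)) \<in> bcontfun"
      unfolding bcontfun_def
    proof (intro CollectI conjI)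
      show "continuous_on UNIV (\<lambda>t. f v (clamp b (b + \<tau>) t))"
        by (rule clamp_continuous_on) (use contf[OF v] in simp)
      show "bounded (range (\<lambda>t. f v (clamp b (b + \<tau>) t)))"
        by (rule bounded_subset[OF bounded_cball[of x e]]) (use f_in[OF v cl] in auto)
    qed
    then show ?thesis by (simp add: P_def Bcontfun_inverse)
  qed
  have "\<exists>!v\<in>s. P v = v"
  proof (rule Banach_fix[where c = "1 / 2"])
    show "complete s" unfolding s_def by (intro complete_eq_closed[THEN iffD2] closed_PiC) auto
    have "const_bcontfun x \<in> s" unfolding s_def mem_PiC_iff using e by auto
    then show "s \<noteq> {}" by blast
    show "P ` s \<subseteq> s"
      unfolding s_def using P_apply f_in cl by (auto simp: mem_PiC_iff s_def)
    show "dist (P v) (P w) \<le> 1 / 2 * dist v w" if v: "v \<in> s" and w: "w \<in> s" for v w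
    proof (rule dist_bound)
      fix t
      let ?t = "clamp b (b + \<tau>) t"
      have "f v ?t - f w ?t = integral {b..?t} (\<lambda>r. X (apply_bcontfun v r) - X (apply_bcontfun w r))"
        unfolding f_def by (subst Henstock_Kurzweil_Integration.integral_diff)
          (auto intro!: integrable_continuous_real contXv v w)
      also have "norm \<dots> \<le> L * dist v w * (?t - b)"
      proof (rule integral_bound)
        show "continuous_on {b..?t} (\<lambda>r. X (apply_bcontfun v r) - X (apply_bcontfun w r))"
          by (intro continuous_intros contXv v w)
        fix r
        have "norm (X (apply_bcontfun v r) - X (apply_bcontfun w r)) \<le> L * dist (apply_bcontfun v r) (apply_bcontfun w r)"
          using L(2)[OF in_s[OF v] in_s[OF w]] by (simp add: dist_norm)
        also have "\<dots> \<le> L * dist v w" using L dist_bounded[of v r w] by (intro mult_left_mono) auto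
        finally show "norm (X (apply_bcontfun v r) - X (apply_bcontfun w r)) \<le> L * dist v w" .
      qed (use cl[of t] in auto)
      also have "\<dots> \<le> L * dist v w * \<tau>" using cl[of t] L by (intro mult_left_mono) auto
      also have "\<dots> = L * \<tau> * dist v w" by simp
      also have "\<dots> \<le> 1 / 2 * dist v w" using \<tau> by (intro mult_right_mono) auto
      finally show "dist (apply_bcontfun (P v) t) (apply_bcontfun (P w) t) \<le> 1 / 2 * dist v w"
        by (simp add: P_apply v w dist_norm)
    qed
  qed auto
  then obtain v where v: "v \<in> s" "P v = v" by blast
  have veq: "apply_bcontfun v t = f v t" if "t \<in> {b..b + \<tau>}" for t
    using P_apply[OF v(1), of t] clamp_cancel_cbox[of t b "b + \<tau>"] that v(2) by simp
  show thesis
  proof (rule that[of \<tau> "apply_bcontfun v"])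
    show "apply_bcontfun v b = x" using veq[of b] \<tau> by (simp add: f_def)
    show "apply_bcontfun v t \<in> W" for t using in_s[OF v(1)] e by blast
    fix t assume t: "t \<in> {b..b + \<tau>}"
    have "((\<lambda>t. x + integral {b..t} (\<lambda>r. X (apply_bcontfun v r))) has_vector_derivative 0 + X (apply_bcontfun v t))
        (at t within {b..b + \<tau>})"
      by (intro has_vector_derivative_add has_vector_derivative_const integral_has_vector_derivative contXv v t)
    then have d: "((\<lambda>t. x + integral {b..t} (\<lambda>r. X (apply_bcontfun v r))) has_vector_derivative X (apply_bcontfun v t))
        (at t within {b..b + \<tau>})" by simp
    have "apply_bcontfun v r = x + integral {b..r} (\<lambda>r. X (apply_bcontfun v r))" if "r \<in> {b..b + \<tau>}" for r
      using veq[OF that] by (simp add: f_def)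
    from has_vector_derivative_transform[OF t this d]
    show "(apply_bcontfun v has_vector_derivative X (apply_bcontfun v t)) (at t within {b..b + \<tau>})" .
  qed (rule \<tau>)
qed

lemma has_vector_derivative_within_Un:
  "(f has_vector_derivative D) (at x within S) \<Longrightarrow> (f has_vector_derivative D) (at x within T)
    \<Longrightarrow> (f has_vector_derivative D) (at x within S \<union> T)"
  unfolding has_vector_derivative_def has_derivative_at_within by (auto intro: Lim_Un)

definition ode_solution :: "('a::real_normed_vector \<Rightarrow> 'a) \<Rightarrow> 'a set \<Rightarrow> real set \<Rightarrow> (real \<Rightarrow> 'a) \<Rightarrow> bool" where
  "ode_solution X W S y \<longleftrightarrow> is_interval S \<and> (\<forall>t\<in>S. y t \<in> W \<and> (y has_vector_derivative X (y t)) (at t within S))"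

text \<open>Let b be the supremum of S. If b lies in S, a local solution starting at b is glued on.
  If not, the bound m makes y Lipschitz up to b, so y has a limit there, and closedness of C keeps
  the limit in the domain of the field.\<close>

lemma ode_extend_right:
  fixes X :: "'a::euclidean_space \<Rightarrow> 'a"
  assumes X: "locally_lipschitz_on W X" and sol: "ode_solution X W S y" and S0: "0 \<in> S"
    and C: "closed C" "C \<subseteq> W" "\<And>z. z \<in> C \<Longrightarrow> norm (X z) \<le> m" "\<And>t. t \<in> S \<Longrightarrow> \<bar>t\<bar> \<le> T \<Longrightarrow> y t \<in> C"
    and nsub: "\<not> {0..T} \<subseteq> S"
  obtains S' y' where "ode_solution X W S' y'" "S \<subseteq> S'" "S' \<noteq> S" "\<And>t. t \<in> S \<Longrightarrow> y' t = y t"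
proof -
  obtain c where c: "0 \<le> c" "c \<le> T" "c \<notin> S"
    using nsub unfolding subset_iff atLeastAtMost_iff by blast
  have iv: "is_interval S" using sol by (simp add: ode_solution_def)
  have Sc: "t < c" if "t \<in> S" for t
  proof (rule ccontr)
    assume "\<not> t < c"
    then have "c \<in> S" using iv S0 that c(1) unfolding is_interval_1 by (metis not_less)
    then show False using c by simp
  qed
  have bdd: "bdd_above S" using Sc by (meson bdd_above.I less_imp_le)
  define b where "b = Sup S"
  have b0: "0 \<le> b" unfolding b_def by (rule cSup_upper[OF S0 bdd])
  have bT: "b \<le> T" unfolding b_def using Sc c S0 by (intro cSup_least) fastforce+
  have le_b: "t \<le> b" if "t \<in> S" for t unfolding b_def by (rule cSup_upper[OF that bdd])
  have mem: "t \<in> S" if t: "0 \<le> t" "t < b" for t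
  proof -
    obtain r where "r \<in> S" "t < r" using t S0 bdd unfolding b_def by (metis less_cSup_iff empty_iff)
    then show ?thesis using iv S0 t unfolding is_interval_1 by (metis less_imp_le)
  qed
  have yW: "y t \<in> W" "(y has_vector_derivative X (y t)) (at t within S)" if "t \<in> S" for t
    using sol that by (auto simp: ode_solution_def)
  show thesis
  proof (cases "b \<in> S")
    case True
    obtain \<tau> u where u: "\<tau> > 0" "u b = y b" "\<And>t. t \<in> {b..b + \<tau>} \<Longrightarrow> u t \<in> W"
      "\<And>t. t \<in> {b..b + \<tau>} \<Longrightarrow> (u has_vector_derivative X (u t)) (at t within {b..b + \<tau>})"
      using picard_lindeloef[OF X yW(1)[OF True], of b] by blast
    define S' where "S' = S \<union> {b..b + \<tau>}"
    define y' where "y' t = (if t \<le> b then y t else u t)" for t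
    have y'S: "y' t = y t" if "t \<in> S" for t using le_b[OF that] by (simp add: y'_def)
    have y'u: "y' t = u t" if "t \<in> {b..b + \<tau>}" for t using that u(2) by (cases "t = b") (auto simp: y'_def)
    show thesis
    proof (rule that[of S' y'])
      have "is_interval S'"
        unfolding is_interval_1 S'_def
      proof (intro ballI allI impI)
        fix p q r assume p: "p \<in> S \<union> {b..b + \<tau>}" and q: "q \<in> S \<union> {b..b + \<tau>}" and r: "p \<le> r \<and> r \<le> q"
        show "r \<in> S \<union> {b..b + \<tau>}"
        proof (cases "r \<le> b")
          case rb: True
          show ?thesis
          proof (cases "p \<in> S")
            case True
            then show ?thesis using iv \<open>b \<in> S\<close> r rb unfolding is_interval_1 by blast
          next
            case False
            then show ?thesis using p r rb by auto
          qed
        next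
          case False
          then show ?thesis using q r le_b[of q] u(1) by fastforce
        qed
      qed
      moreover have "y' t \<in> W \<and> (y' has_vector_derivative X (y' t)) (at t within S')" if t: "t \<in> S'" for t
      proof -
        have dS: "(y' has_vector_derivative X (y' t)) (at t within S)" if "t \<in> S"
          using has_vector_derivative_transform[OF that y'S yW(2)[OF that]] y'S[OF that] by simp
        have dT: "(y' has_vector_derivative X (y' t)) (at t within {b..b + \<tau>})" if "t \<in> {b..b + \<tau>}"
          using has_vector_derivative_transform[OF that y'u u(4)[OF that]] y'u[OF that] by simp
        consider "t < b" | "t = b" | "t > b" by linarith
        then show ?thesis
        proof cases
          case 1
          then have tS: "t \<in> S" using t by (auto simp: S'_def)
          have "at t within S' = at t within S"
            by (rule at_within_nhd[of _ "{..<b}"]) (use 1 in \<open>auto simp: S'_def\<close>)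
          then show ?thesis using dS[OF tS] yW(1)[OF tS] y'S[OF tS] by simp
        next
          case 2
          then have "t \<in> {b..b + \<tau>}" "t \<in> S" using u(1) True by auto
          then show ?thesis
            unfolding S'_def using dS dT yW(1) y'S has_vector_derivative_within_Un by metis
        next
          case 3
          then have tT: "t \<in> {b..b + \<tau>}" using t le_b by (fastforce simp: S'_def)
          have "at t within S' = at t within {b..b + \<tau>}"
            by (rule at_within_nhd[of _ "{b<..}"]) (use 3 le_b in \<open>auto simp: S'_def not_le[symmetric]\<close>)
          then show ?thesis using dT[OF tT] u(3)[OF tT] y'u[OF tT] by simp
        qed
      qed
      ultimately show "ode_solution X W S' y'" by (simp add: ode_solution_def)
      show "S \<subseteq> S'" by (auto simp: S'_def)
      have "b + \<tau> \<notin> S" using le_b[of "b + \<tau>"] u(1) by auto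
      moreover have "b + \<tau> \<in> S'" using u(1) by (simp add: S'_def)
      ultimately show "S' \<noteq> S" by blast
    qed (rule y'S)
  next
    case False
    then have "b \<noteq> 0" using S0 by blast
    then have bpos: "b > 0" using b0 by simp
    let ?I = "{0..<b}"
    have IS: "?I \<subseteq> S" using mem by auto
    have yC: "y t \<in> C" if "t \<in> ?I" for t using that IS bT by (intro C(4)) auto
    have "norm (X (y 0)) \<le> m" using bpos by (intro C(3) yC) auto
    then have m0: "0 \<le> m" using norm_ge_zero order_trans by blast
    have dI: "(y has_vector_derivative X (y t)) (at t within ?I)" if "t \<in> ?I" for t
      using has_vector_derivative_within_subset[OF yW(2) IS] that IS by blast
    have "norm (y s - y t) \<le> m * norm (s - t)" if "s \<in> ?I" "t \<in> ?I" for s t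
    proof (rule differentiable_bound[of ?I])
      show "(y has_derivative (\<lambda>h. h *\<^sub>R X (y t))) (at t within ?I)" if "t \<in> ?I" for t
        using dI[OF that] by (simp add: has_vector_derivative_def)
      show "onorm (\<lambda>h. h *\<^sub>R X (y t)) \<le> m" if "t \<in> ?I" for t
        using C(3)[OF yC[OF that]] by (intro onorm_le) (simp add: mult.commute[of m] mult_left_mono)
    qed (use that in auto)
    then have lip: "m-lipschitz_on ?I y" using m0 by (auto simp: lipschitz_on_def dist_norm)
    obtain g where g: "uniformly_continuous_on (closure ?I) g" "\<And>t. t \<in> ?I \<Longrightarrow> y t = g t"
      using uniformly_continuous_on_extension_on_closure[OF lipschitz_on_uniformly_continuous[OF lip]] by metis
    have clI: "closure ?I = {0..b}" using bpos by simp
    have contg: "continuous_on {0..b} g" using uniformly_continuous_imp_continuous[OF g(1)] clI by simp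
    have gC: "g t \<in> C" if "t \<in> {0..b}" for t
    proof -
      have "g ` closure ?I \<subseteq> closure (g ` ?I)"
        by (rule continuous_image_closure_subset[OF _ order_refl]) (use contg clI in simp)
      moreover have "closure (g ` ?I) \<subseteq> C"
        by (rule closure_minimal[OF _ C(1)]) (use yC g(2) in fastforce)
      ultimately show ?thesis using that clI by blast
    qed
    have contX: "continuous_on W X"
    proof (rule continuous_at_imp_continuous_on, rule ballI)
      fix x assume "x \<in> W"
      then obtain e L where e: "e > 0" "\<And>y z. y \<in> cball x e \<Longrightarrow> z \<in> cball x e \<Longrightarrow> dist (X y) (X z) \<le> L * dist y z"
        using X unfolding locally_lipschitz_on_def by metis
      have "(max L 0)-lipschitz_on (cball x e) X"
        unfolding lipschitz_on_def using order_trans[OF e(2) mult_right_mono] by auto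
      then have "continuous_on (cball x e) X" by (rule lipschitz_on_continuous_on)
      then show "isCont X x" using e(1) by (intro continuous_on_interior) auto
    qed
    have contXg: "continuous_on {0..b} (\<lambda>t. X (g t))"
      by (rule continuous_on_compose2[OF contX contg]) (use gC C(2) in auto)
    \<comment> \<open>The continuous extension g satisfies the integral equation before b, hence
      also at b by continuity. This yields the one-sided derivative at the added point.\<close>
    define h where "h t = g 0 + integral {0..t} (\<lambda>r. X (g r))" for t
    have hcont: "continuous_on {0..b} h"
      unfolding h_def by (intro continuous_intros indefinite_integral_continuous_1 integrable_continuous_real contXg)
    have gh: "g t = h t" if t: "t \<in> {0..b}" for t
    proof -
      have "g t - h t = 0"
      proof (rule continuous_constant_on_closure[of ?I "\<lambda>t. g t - h t"])
        show "continuous_on (closure ?I) (\<lambda>t. g t - h t)" unfolding clI by (intro continuous_intros contg hcont)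
        fix r assume r: "r \<in> ?I"
        have "((\<lambda>s. X (g s)) has_integral (y r - y 0)) {0..r}"
        proof (rule fundamental_theorem_of_calculus)
          fix s assume s: "s \<in> {0..r}"
          then have sI: "s \<in> ?I" using r by auto
          have "(y has_vector_derivative X (y s)) (at s within {0..r})"
            by (rule has_vector_derivative_within_subset[OF dI[OF sI]]) (use r in auto)
          then show "(y has_vector_derivative X (g s)) (at s within {0..r})" using g(2)[OF sI] by simp
        qed (use r in auto)
        then show "g r - h r = 0"
          using g(2)[OF r] g(2)[of 0] bpos by (simp add: h_def integral_unique)
      qed (use t clI in auto)
      then show ?thesis by simp
    qed
    have dg: "(g has_vector_derivative X (g t)) (at t within {0..b})" if t: "t \<in> {0..b}" for t
    proof -
      have "(h has_vector_derivative 0 + X (g t)) (at t within {0..b})"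
        unfolding h_def by (intro has_vector_derivative_add has_vector_derivative_const integral_has_vector_derivative contXg t)
      then have "(h has_vector_derivative X (g t)) (at t within {0..b})" by simp
      from has_vector_derivative_transform[OF t gh this] show ?thesis .
    qed
    define S' where "S' = insert b S"
    define y' where "y' t = (if t = b then g b else y t)" for t
    have y'S: "y' t = y t" if "t \<in> S" for t using that False by (auto simp: y'_def)
    have y'g: "y' t = g t" if "t \<in> {0..b}" for t using that g(2)[of t] by (auto simp: y'_def)
    show thesis
    proof (rule that[of S' y'])
      have "is_interval S'"
        unfolding is_interval_1 S'_def
      proof (intro ballI allI impI)
        fix p q r assume p: "p \<in> insert b S" and q: "q \<in> insert b S" and r: "p \<le> r \<and> r \<le> q"
        have "q \<le> b" using q le_b by auto
        then have "r \<le> b" using r by simp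
        show "r \<in> insert b S"
        proof (cases "r = b \<or> p = b")
          case True
          then show ?thesis using r \<open>r \<le> b\<close> by auto
        next
          case nb: False
          then have pS: "p \<in> S" using p by auto
          show ?thesis
          proof (cases "0 \<le> r")
            case True
            then show ?thesis using mem[of r] nb \<open>r \<le> b\<close> by auto
          next
            case False
            then show ?thesis using iv pS S0 r unfolding is_interval_1 by (metis insertCI linear)
          qed
        qed
      qed
      moreover have "y' t \<in> W \<and> (y' has_vector_derivative X (y' t)) (at t within S')" if t: "t \<in> S'" for t
      proof (cases "t = b")
        case True
        then have tb: "t \<in> {0..b}" using bpos by auto
        have "(y' has_vector_derivative X (y' t)) (at t within {0..b})"
          using has_vector_derivative_transform[OF tb y'g dg[OF tb]] y'g[OF tb] by simp
        moreover have "at t within S' = at t within {0..b}"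
        proof (rule at_within_nhd[of _ "{0<..}"])
          show "S' \<inter> {0<..} - {t} = {0..b} \<inter> {0<..} - {t}"
            using True le_b mem by (force simp: S'_def)
        qed (use True bpos in auto)
        ultimately show ?thesis using gC[OF tb] C(2) y'g[OF tb] by auto
      next
        case tb: False
        then have tS: "t \<in> S" using t by (auto simp: S'_def)
        have "(y' has_vector_derivative X (y' t)) (at t within S)"
          using has_vector_derivative_transform[OF tS y'S yW(2)[OF tS]] y'S[OF tS] by simp
        moreover have "at t within S' = at t within S"
          by (rule at_within_nhd[of _ "- {b}"]) (use tb in \<open>auto simp: S'_def\<close>)
        ultimately show ?thesis using yW(1)[OF tS] y'S[OF tS] by simp
      qed
      ultimately show "ode_solution X W S' y'" by (simp add: ode_solution_def)
      show "S \<subseteq> S'" "S' \<noteq> S" using False by (auto simp: S'_def)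
    qed (rule y'S)
  qed
qed

lemma ode_solution_reflect:
  assumes "ode_solution X W S y"
  shows "ode_solution (\<lambda>z. - X z) W (uminus ` S) (\<lambda>t. y (- t))"
  unfolding ode_solution_def
proof (intro conjI ballI)
  show "is_interval (uminus ` S)"
    using assms by (simp add: ode_solution_def)
  fix t assume "t \<in> uminus ` S"
  then have t: "- t \<in> S" by auto
  then show "y (- t) \<in> W" using assms by (simp add: ode_solution_def)
  have "((\<lambda>t. - t) has_vector_derivative - 1) (at t within uminus ` S)"
    by (rule has_vector_derivative_minus[OF has_vector_derivative_id])
  moreover have "(y has_vector_derivative X (y (- t))) (at (- t) within uminus ` uminus ` S)"
    using assms t by (simp add: ode_solution_def image_image)
  ultimately have "((y \<circ> (\<lambda>t. - t)) has_vector_derivative (- 1) *\<^sub>R X (y (- t))) (at t within uminus ` S)"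
    by (rule vector_diff_chain_within)
  then show "((\<lambda>t. y (- t)) has_vector_derivative - X (y (- t))) (at t within uminus ` S)"
    by (simp add: o_def)
qed

text \<open>Maximality excludes the extension on the right; the left half is the right half for the
  reversed field.\<close>

lemma ode_maximal_contains:
  fixes X :: "'a::euclidean_space \<Rightarrow> 'a"
  assumes X: "locally_lipschitz_on W X" and sol: "ode_solution X W S y" and S0: "0 \<in> S"
    and C: "closed C" "C \<subseteq> W" "\<And>z. z \<in> C \<Longrightarrow> norm (X z) \<le> m" "\<And>t. t \<in> S \<Longrightarrow> \<bar>t\<bar> \<le> T \<Longrightarrow> y t \<in> C"
    and max: "\<And>S' y'. ode_solution X W S' y' \<Longrightarrow> S \<subseteq> S' \<Longrightarrow> (\<And>t. t \<in> S \<Longrightarrow> y' t = y t) \<Longrightarrow> S' = S"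
  shows "{- T..T} \<subseteq> S"
proof -
  have right: "{0..T} \<subseteq> S"
  proof (rule ccontr)
    assume n: "\<not> {0..T} \<subseteq> S"
    obtain S' y' where "ode_solution X W S' y'" "S \<subseteq> S'" "S' \<noteq> S" "\<And>t. t \<in> S \<Longrightarrow> y' t = y t"
    proof (rule ode_extend_right[OF X sol S0 C n])
      fix S' y' assume "ode_solution X W S' y'" "S \<subseteq> S'" "S' \<noteq> S" "\<And>t. t \<in> S \<Longrightarrow> y' t = y t"
      then show thesis by (rule that)
    qed
    then show False using max by blast
  qed
  have left: "{0..T} \<subseteq> uminus ` S"
  proof (rule ccontr)
    assume n: "\<not> {0..T} \<subseteq> uminus ` S"
    have X': "locally_lipschitz_on W (\<lambda>z. - X z)"
      using X by (simp add: locally_lipschitz_on_def dist_minus)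
    have S0': "0 \<in> uminus ` S" using image_eqI[of 0 uminus 0 S] S0 by simp
    have C3': "\<And>z. z \<in> C \<Longrightarrow> norm (- X z) \<le> m" using C(3) by simp
    have C4': "y (- t) \<in> C" if "t \<in> uminus ` S" "\<bar>t\<bar> \<le> T" for t
      using C(4)[of "- t"] that by auto
    obtain S' y' where S': "ode_solution (\<lambda>z. - X z) W S' y'" "uminus ` S \<subseteq> S'" "S' \<noteq> uminus ` S"
      "\<And>t. t \<in> uminus ` S \<Longrightarrow> y' t = y (- t)"
    proof (rule ode_extend_right[OF X' ode_solution_reflect[OF sol] S0' C(1,2) C3' C4' n])
      fix S' y' assume "ode_solution (\<lambda>z. - X z) W S' y'" "uminus ` S \<subseteq> S'" "S' \<noteq> uminus ` S"
        "\<And>t. t \<in> uminus ` S \<Longrightarrow> y' t = y (- t)"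
      then show thesis by (rule that)
    qed
    have "ode_solution X W (uminus ` S') (\<lambda>t. y' (- t))"
      using ode_solution_reflect[OF S'(1)] by simp
    moreover have "S \<subseteq> uminus ` S'"
      using image_mono[OF S'(2), of uminus] by (simp add: image_image)
    moreover have "y' (- t) = y t" if "t \<in> S" for t using S'(4)[of "- t"] that by simp
    ultimately have "uminus ` S' = S" by (rule max)
    then have "S' = uminus ` S" by (auto simp: image_image)
    then show False using S'(3) by simp
  qed
  show ?thesis
  proof
    fix t assume t: "t \<in> {- T..T}"
    show "t \<in> S"
    proof (cases "0 \<le> t")
      case True
      then show ?thesis using right t by auto
    next
      case False
      then have "- t \<in> uminus ` S" using left t by auto
      then show ?thesis by auto
    qed
  qed
qed

section \<open>Measure of the resonant set\<close>

text \<open>Fubini with the coordinate b0 integrated first: each slice lies in an interval of length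
  2 * \<delta> / \<bar>v \<bullet> b0\<bar>, and the other coordinates range over a cube.\<close>

lemma emeasure_slab:
  fixes v b0 :: "'a::euclidean_space"
  assumes b0: "b0 \<in> Basis" "v \<bullet> b0 \<noteq> 0" and d: "\<delta> \<ge> 0" and \<rho>: "\<rho> \<ge> 0"
  shows "emeasure lborel {x. (\<forall>b\<in>Basis. \<bar>x \<bullet> b\<bar> \<le> \<rho>) \<and> \<bar>v \<bullet> x + c\<bar> \<le> \<delta>}
    \<le> ennreal (2 * \<delta> / \<bar>v \<bullet> b0\<bar>) * ennreal (2 * \<rho>) ^ (DIM('a) - 1)"
proof -
  let ?S = "{x. (\<forall>b\<in>Basis. \<bar>x \<bullet> b\<bar> \<le> \<rho>) \<and> \<bar>v \<bullet> x + c\<bar> \<le> \<delta>}"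
  define w where "w = v \<bullet> b0"
  define I where "I = (Basis :: 'a set) - {b0}"
  have I: "finite I" "b0 \<notin> I" "insert b0 I = Basis" "I \<subseteq> Basis" using b0 by (auto simp: I_def)
  interpret product_sigma_finite "\<lambda>b::'a. lborel :: real measure" by standard
  let ?P = "\<lambda>J. Pi\<^sub>M J (\<lambda>b::'a. lborel :: real measure)"
  define sm where "sm x = (\<Sum>b\<in>Basis. x b *\<^sub>R b)" for x :: "'a \<Rightarrow> real"
  have "?S = (\<Inter>b\<in>Basis. {x. \<bar>x \<bullet> b\<bar> \<le> \<rho>}) \<inter> {x. \<bar>v \<bullet> x + c\<bar> \<le> \<delta>}" by auto
  moreover have "closed \<dots>"
    by (intro closed_Int closed_INT ballI closed_Collect_le continuous_intros)
  ultimately have mS: "?S \<in> sets borel" by simp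
  have msm: "sm \<in> measurable (?P Basis) borel" unfolding sm_def by measurable
  define r where "r x = (\<Sum>b\<in>I. x b * (v \<bullet> b)) + c" for x
  have pw: "indicator ?S (sm (x(b0 := y))) \<le> (indicator {y. \<bar>w * y + r x\<bar> \<le> \<delta>} y :: ennreal) * (\<Prod>b\<in>I. indicator {- \<rho>..\<rho>} (x b))" for x y
  proof (cases "sm (x(b0 := y)) \<in> ?S")
    case True
    have cb: "sm (x(b0 := y)) \<bullet> b = (if b = b0 then y else x b)" if "b \<in> Basis" for b
      using that unfolding sm_def by (simp add: inner_sum_left_Basis)
    have "v \<bullet> sm (x(b0 := y)) = (\<Sum>b\<in>insert b0 I. (x(b0 := y)) b * (v \<bullet> b))"
      unfolding sm_def I(3) by (simp add: inner_sum_right)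
    also have "\<dots> = w * y + (\<Sum>b\<in>I. (x(b0 := y)) b * (v \<bullet> b))"
      by (subst sum.insert[OF I(1,2)]) (simp add: w_def mult.commute)
    also have "(\<Sum>b\<in>I. (x(b0 := y)) b * (v \<bullet> b)) = (\<Sum>b\<in>I. x b * (v \<bullet> b))"
      using I(2) by (intro sum.cong) auto
    finally have vs: "v \<bullet> sm (x(b0 := y)) = w * y + (\<Sum>b\<in>I. x b * (v \<bullet> b))" .
    have "\<bar>v \<bullet> sm (x(b0 := y)) + c\<bar> \<le> \<delta>" using True by blast
    then have "\<bar>w * y + r x\<bar> \<le> \<delta>" unfolding vs r_def by (simp only: add.assoc)
    moreover have "x b \<in> {- \<rho>..\<rho>}" if "b \<in> I" for b
    proof -
      have "b \<in> Basis" "b \<noteq> b0" using that by (auto simp: I_def)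
      moreover have "\<bar>sm (x(b0 := y)) \<bullet> b\<bar> \<le> \<rho>" using True \<open>b \<in> Basis\<close> by blast
      ultimately have "\<bar>x b\<bar> \<le> \<rho>" unfolding cb[OF \<open>b \<in> Basis\<close>] by simp
      then show ?thesis by auto
    qed
    then have "(\<Prod>b\<in>I. indicator {- \<rho>..\<rho>} (x b)) = (1 :: ennreal)"
      by (intro prod.neutral) simp
    ultimately show ?thesis using True by simp
  qed simp
  have slab1: "emeasure lborel {y. \<bar>w * y + t\<bar> \<le> \<delta>} \<le> ennreal (2 * \<delta> / \<bar>w\<bar>)" for t
  proof -
    have "{y. \<bar>w * y + t\<bar> \<le> \<delta>} \<subseteq> {- t / w - \<delta> / \<bar>w\<bar>..- t / w + \<delta> / \<bar>w\<bar>}"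
    proof
      fix y assume "y \<in> {y. \<bar>w * y + t\<bar> \<le> \<delta>}"
      moreover have wn: "w \<noteq> 0" using b0 by (simp add: w_def)
      then have "w * y + t = (y - (- t / w)) * w" by (simp add: field_simps)
      ultimately have "\<bar>y - (- t / w)\<bar> * \<bar>w\<bar> \<le> \<delta>" by (simp only: abs_mult[symmetric] mem_Collect_eq)
      then have "\<bar>y - (- t / w)\<bar> \<le> \<delta> / \<bar>w\<bar>" using wn by (intro pos_le_divide_eq[THEN iffD2]) auto
      then show "y \<in> {- t / w - \<delta> / \<bar>w\<bar>..- t / w + \<delta> / \<bar>w\<bar>}" unfolding abs_le_iff by auto
    qed
    then have "emeasure lborel {y. \<bar>w * y + t\<bar> \<le> \<delta>} \<le> emeasure lborel {- t / w - \<delta> / \<bar>w\<bar>..- t / w + \<delta> / \<bar>w\<bar>}"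
      by (rule emeasure_mono) simp
    also have "\<dots> = ennreal (2 * \<delta> / \<bar>w\<bar>)" using d by (subst emeasure_lborel_Icc) auto
    finally show ?thesis .
  qed
  have "emeasure lborel ?S = (\<integral>\<^sup>+ z. indicator ?S z \<partial>lborel)"
    using mS by simp
  also have "\<dots> = (\<integral>\<^sup>+ x. indicator ?S (sm x) \<partial>?P Basis)"
    unfolding sm_def by (subst lborel_eq, rule nn_integral_distr) (use msm mS in \<open>auto simp: sm_def[abs_def]\<close>)
  also have "\<dots> = (\<integral>\<^sup>+ x. (\<integral>\<^sup>+ y. indicator ?S (sm (x(b0 := y))) \<partial>lborel) \<partial>?P I)"
  proof -
    have "(\<lambda>x. indicator ?S (sm x) :: ennreal) \<in> borel_measurable (?P (insert b0 I))"
      unfolding I(3) using measurable_compose[OF msm borel_measurable_indicator[OF mS]] .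
    from product_nn_integral_insert[OF I(1,2) this] show ?thesis unfolding I(3) .
  qed
  also have "\<dots> \<le> (\<integral>\<^sup>+ x. ennreal (2 * \<delta> / \<bar>w\<bar>) * (\<Prod>b\<in>I. indicator {- \<rho>..\<rho>} (x b)) \<partial>?P I)"
  proof (rule nn_integral_mono)
    fix x
    have mset: "{y. \<bar>w * y + r x\<bar> \<le> \<delta>} \<in> sets lborel"
    proof -
      have "closed {y. \<bar>w * y + r x\<bar> \<le> \<delta>}" by (intro closed_Collect_le continuous_intros)
      then show ?thesis by simp
    qed
    have "(\<integral>\<^sup>+ y. indicator ?S (sm (x(b0 := y))) \<partial>lborel)
      \<le> (\<integral>\<^sup>+ y. indicator {y. \<bar>w * y + r x\<bar> \<le> \<delta>} y * (\<Prod>b\<in>I. indicator {- \<rho>..\<rho>} (x b)) \<partial>lborel)"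
      by (intro nn_integral_mono pw)
    also have "\<dots> = emeasure lborel {y. \<bar>w * y + r x\<bar> \<le> \<delta>} * (\<Prod>b\<in>I. indicator {- \<rho>..\<rho>} (x b))"
      using mset by (subst nn_integral_multc) auto
    also have "\<dots> \<le> ennreal (2 * \<delta> / \<bar>w\<bar>) * (\<Prod>b\<in>I. indicator {- \<rho>..\<rho>} (x b))"
      by (intro mult_right_mono slab1) simp
    finally show "(\<integral>\<^sup>+ y. indicator ?S (sm (x(b0 := y))) \<partial>lborel) \<le> ennreal (2 * \<delta> / \<bar>w\<bar>) * (\<Prod>b\<in>I. indicator {- \<rho>..\<rho>} (x b))" .
  qed
  also have "\<dots> = ennreal (2 * \<delta> / \<bar>w\<bar>) * (\<integral>\<^sup>+ x. (\<Prod>b\<in>I. indicator {- \<rho>..\<rho>} (x b)) \<partial>?P I)"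
    by (rule nn_integral_cmult) measurable
  also have "(\<integral>\<^sup>+ x. (\<Prod>b\<in>I. indicator {- \<rho>..\<rho>} (x b)) \<partial>?P I) = (\<Prod>b\<in>I. \<integral>\<^sup>+ y. indicator {- \<rho>..\<rho>} y \<partial>lborel)"
    by (rule product_nn_integral_prod[OF I(1)]) simp
  also have "\<dots> = ennreal (2 * \<rho>) ^ (DIM('a) - 1)"
    using \<rho> b0 by (simp add: I_def card_Diff_singleton)
  finally show ?thesis by (simp add: w_def)
qed

lemma measure_slab:
  fixes v :: "real ^ 'n" and i :: 'n
  assumes vi: "v $ i \<noteq> 0" and d: "\<delta> \<ge> 0" and \<rho>: "\<rho> \<ge> 0"
  shows "measure lebesgue {x. (\<forall>j. \<bar>x $ j\<bar> \<le> \<rho>) \<and> \<bar>v \<bullet> x + c\<bar> \<le> \<delta>} \<le> 2 * \<delta> * (2 * \<rho>) ^ (CARD('n) - 1) / \<bar>v $ i\<bar>"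
    and "{x. (\<forall>j. \<bar>x $ j\<bar> \<le> \<rho>) \<and> \<bar>v \<bullet> x + c\<bar> \<le> \<delta>} \<in> lmeasurable"
proof -
  let ?S = "{x. (\<forall>j. \<bar>x $ j\<bar> \<le> \<rho>) \<and> \<bar>v \<bullet> x + c\<bar> \<le> \<delta>}"
  have cl: "closed ?S"
    by (intro closed_Collect_conj closed_Collect_all closed_Collect_le continuous_intros)
  moreover have "bounded ?S"
    by (rule bounded_subset[OF bounded_cbox[of "\<chi> j. - \<rho>" "\<chi> j. \<rho>"]]) (auto simp: mem_box_cart abs_le_iff minus_le_iff)
  ultimately have "compact ?S" by (simp add: compact_eq_bounded_closed)
  then show S: "?S \<in> lmeasurable" by (rule lmeasurable_compact)
  have "?S = {x. (\<forall>b\<in>Basis. \<bar>x \<bullet> b\<bar> \<le> \<rho>) \<and> \<bar>v \<bullet> x + c\<bar> \<le> \<delta>}"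
    by (auto simp: Basis_vec_def inner_axis)
  then have "emeasure lborel ?S \<le> ennreal (2 * \<delta> / \<bar>v \<bullet> axis i 1\<bar>) * ennreal (2 * \<rho>) ^ (DIM(real ^ 'n) - 1)"
    using emeasure_slab[of "axis i 1" v \<delta> \<rho> c] vi d \<rho> by (simp add: axis_in_Basis_iff inner_axis)
  also have "\<dots> = ennreal (2 * \<delta> * (2 * \<rho>) ^ (CARD('n) - 1) / \<bar>v $ i\<bar>)"
    using d \<rho> by (simp add: inner_axis ennreal_mult'[symmetric] ennreal_power)
  finally have "emeasure lebesgue ?S \<le> ennreal (2 * \<delta> * (2 * \<rho>) ^ (CARD('n) - 1) / \<bar>v $ i\<bar>)"
    using cl by (simp add: emeasure_completion)
  then show "measure lebesgue ?S \<le> 2 * \<delta> * (2 * \<rho>) ^ (CARD('n) - 1) / \<bar>v $ i\<bar>"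
    using S d \<rho> by (simp add: emeasure_eq_measure2)
qed

section \<open>Lattice sums\<close>

lemma l1_nonneg: "0 \<le> l1 k"
  by (simp add: l1_def sum_nonneg)

lemma abs_le_l1: "\<bar>real_of_int (k $ i)\<bar> \<le> l1 k"
  unfolding l1_def by (rule member_le_sum) auto

lemma l1_ge_1:
  assumes "k \<noteq> 0" shows "1 \<le> l1 k"
proof -
  obtain i where "k $ i \<noteq> 0" using assms by (auto simp: vec_eq_iff)
  then have "1 \<le> \<bar>real_of_int (k $ i)\<bar>" by linarith
  then show ?thesis using abs_le_l1[of k i] by simp
qed

lemma l1_max_coordinate:
  fixes k :: "int ^ 'n"
  obtains i where "l1 k \<le> CARD('n) * \<bar>real_of_int (k $ i)\<bar>"
proof -
  define g where "g i = \<bar>real_of_int (k $ i)\<bar>" for i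
  have "finite (range g)" "range g \<noteq> {}" by auto
  from Max_in[OF this] obtain i where i: "Max (range g) = g i" by blast
  have "l1 k \<le> (\<Sum>j\<in>(UNIV :: 'n set). Max (range g))"
    unfolding l1_def g_def[symmetric] by (intro sum_mono Max_ge) auto
  then have "l1 k \<le> CARD('n) * g i" unfolding i by simp
  then show thesis unfolding g_def by (rule that)
qed

text \<open>Comparison with an integral: by the mean value theorem each term after the first is at
  most a difference of the primitive - x powr (- s) / s, and the differences telescope.\<close>

lemma powr_sum_le:
  fixes s :: real
  assumes "s > 0"
  shows "(\<Sum>j=1..N. real j powr (- 1 - s)) \<le> 1 + 1 / s"
proof (cases "N = 0")
  case False
  have "(\<Sum>j=1..N. real j powr (- 1 - s)) \<le> 1 + 1 / s - real N powr (- s) / s" if "N \<ge> 1" for N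
    using that
  proof (induction N rule: nat_induct_at_least)
    case base
    then show ?case by simp
  next
    case (Suc N)
    have "\<exists>z. real N < z \<and> z < real (Suc N) \<and>
      (- (real (Suc N) powr (- s) / s)) - (- (real N powr (- s) / s)) = (real (Suc N) - real N) * z powr (- s - 1)"
      by (rule MVT2) (use Suc.hyps assms in \<open>auto intro!: derivative_eq_intros\<close>)
    then obtain z where z: "real N < z" "z < real (Suc N)"
      "real N powr (- s) / s - real (Suc N) powr (- s) / s = z powr (- s - 1)"
      by auto
    have A: "real (Suc N) powr (- 1 - s) \<le> z powr (- 1 - s)"
      using z assms Suc.hyps by (intro powr_mono2') auto
    note A
    moreover have "- s - 1 = - 1 - s" by simp
    moreover have "(\<Sum>j=1..Suc N. real j powr (- 1 - s)) = (\<Sum>j=1..N. real j powr (- 1 - s)) + real (Suc N) powr (- 1 - s)"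
      by simp
    ultimately show ?case using z(3) Suc.IH by (simp only:)
  qed
  from this[of N] show ?thesis using False assms by (smt (verit) One_nat_def Suc_leI divide_nonneg_pos neq0_conv powr_ge_zero)
qed (use assms in simp)

definition zsum :: "real \<Rightarrow> real" where
  "zsum s = 1 + 2 * (1 + 1 / s)"

lemma sum_int_powr_le:
  assumes "s > 0"
  shows "(\<Sum>j\<in>{- int N..int N}. max 1 \<bar>real_of_int j\<bar> powr (- 1 - s)) \<le> zsum s"
proof -
  let ?g = "\<lambda>j. max 1 \<bar>real_of_int j\<bar> powr (- 1 - s)"
  have u: "{- int N..int N} = insert 0 (int ` {1..N} \<union> (\<lambda>j. - int j) ` {1..N})"
  proof (rule set_eqI)
    fix x show "x \<in> {- int N..int N} \<longleftrightarrow> x \<in> insert 0 (int ` {1..N} \<union> (\<lambda>j. - int j) ` {1..N})"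
    proof (cases x rule: int_cases3)
      case (pos n)
      then show ?thesis by (auto simp: image_iff)
    next
      case (neg n)
      then show ?thesis by (auto simp: image_iff)
    qed auto
  qed
  have "(\<Sum>j\<in>{- int N..int N}. ?g j) = ?g 0 + ((\<Sum>j\<in>int ` {1..N}. ?g j) + (\<Sum>j\<in>(\<lambda>j. - int j) ` {1..N}. ?g j))"
    unfolding u by (subst sum.insert) (auto intro!: sum.union_disjoint)
  also have "(\<Sum>j\<in>int ` {1..N}. ?g j) = (\<Sum>j=1..N. real j powr (- 1 - s))"
    by (subst sum.reindex) (auto simp: inj_on_def intro!: sum.cong)
  also have "(\<Sum>j\<in>(\<lambda>j. - int j) ` {1..N}. ?g j) = (\<Sum>j=1..N. real j powr (- 1 - s))"
    by (subst sum.reindex) (auto simp: inj_on_def intro!: sum.cong)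
  finally show ?thesis using powr_sum_le[OF assms, of N] by (simp add: zsum_def)
qed

definition ibox :: "nat \<Rightarrow> (int ^ 'k) set" where
  "ibox N = {k. \<forall>i. k $ i \<in> {- int N..int N}}"

lemma ibox_mono: "ibox N \<subseteq> (ibox (Suc N) :: (int ^ 'k) set)"
proof
  fix k :: "int ^ 'k" assume "k \<in> ibox N"
  then have "- int N \<le> k $ i \<and> k $ i \<le> int N" for i by (simp add: ibox_def)
  then have "- int (Suc N) \<le> k $ i \<and> k $ i \<le> int (Suc N)" for i by (smt (verit) of_nat_Suc)
  then show "k \<in> ibox (Suc N)" by (simp add: ibox_def)
qed

lemma ibox_eq: "ibox N = vec_lambda ` (Pi\<^sub>E (UNIV :: 'k::finite set) (\<lambda>_. {- int N..int N}))"
proof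
  show "ibox N \<subseteq> vec_lambda ` (Pi\<^sub>E (UNIV :: 'k set) (\<lambda>_. {- int N..int N}))"
    by (auto simp: ibox_def image_iff intro!: bexI[of _ "vec_nth _"])
qed (auto simp: ibox_def PiE_iff)

lemma finite_ibox: "finite (ibox N :: (int ^ 'k::finite) set)"
  unfolding ibox_eq by (intro finite_imageI finite_PiE) auto

lemma sum_ibox_prod:
  "(\<Sum>k\<in>(ibox N :: (int ^ 'k::finite) set). \<Prod>i\<in>UNIV. g (k $ i)) = (\<Sum>j\<in>{- int N..int N}. g j :: real) ^ CARD('k)"
proof -
  have "(\<Sum>k\<in>(ibox N :: (int ^ 'k) set). \<Prod>i\<in>UNIV. g (k $ i))
      = (\<Sum>h\<in>Pi\<^sub>E (UNIV :: 'k set) (\<lambda>_. {- int N..int N}). \<Prod>i\<in>UNIV. g (h i))"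
    unfolding ibox_eq by (subst sum.reindex) (auto simp: inj_on_def vec_lambda_inject)
  also have "\<dots> = (\<Prod>i\<in>(UNIV :: 'k set). \<Sum>j\<in>{- int N..int N}. g j)"
    by (rule prod_sum_PiE[symmetric]) auto
  finally show ?thesis by simp
qed

text \<open>One factor \<open>l1 k\<close> absorbs a single coordinate of \<open>k\<close>; the remaining coordinates are bounded
  by \<open>l1 k + l1 l\<close>, which is why \<open>\<tau> > n + m - 1\<close> suffices.\<close>

lemma resonance_weight_le:
  fixes k :: "int ^ 'n" and l :: "int ^ 'm"
  assumes k: "k \<noteq> 0" and s: "s > 0" and \<tau>: "\<tau> = real CARD('n) + real CARD('m) - 1 + (real CARD('n) + real CARD('m)) * s"
  shows "(l1 k + l1 l) powr (- \<tau>) / l1 k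
    \<le> (\<Prod>i\<in>UNIV. max 1 \<bar>real_of_int (k $ i)\<bar> powr (- 1 - s)) * (\<Prod>j\<in>UNIV. max 1 \<bar>real_of_int (l $ j)\<bar> powr (- 1 - s))"
proof -
  define N where "N = l1 k + l1 l"
  have k1: "1 \<le> l1 k" by (rule l1_ge_1[OF k])
  have N: "1 \<le> N" "l1 k \<le> N" using k1 l1_nonneg[of l] by (auto simp: N_def)
  define a where "a i = max 1 \<bar>real_of_int (k $ i)\<bar>" for i
  define b where "b j = max 1 \<bar>real_of_int (l $ j)\<bar>" for j
  have a: "1 \<le> a i" "a i \<le> l1 k" "a i \<le> N" for i
    using abs_le_l1[of k i] k1 N by (auto simp: a_def)
  have b: "1 \<le> b j" "b j \<le> N" for j
    using abs_le_l1[of l j] l1_nonneg[of k] N by (auto simp: b_def N_def)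
  \<comment> \<open>Any coordinate of k serves. Since l1 k \<ge> 1, its factor is bounded by l1 k
    times a power of exponent s only.\<close>
  obtain i0 :: 'n where True by blast
  have "(\<Prod>i\<in>UNIV. a i powr (1 + s)) = a i0 powr (1 + s) * (\<Prod>i\<in>UNIV - {i0}. a i powr (1 + s))"
    by (rule prod.remove) auto
  also have "\<dots> \<le> (l1 k * N powr s) * (\<Prod>i\<in>UNIV - {i0}. N powr (1 + s))"
  proof (intro mult_mono prod_mono conjI)
    have "a i0 powr (1 + s) = a i0 * a i0 powr s" using a(1)[of i0] by (simp add: powr_add)
    also have "\<dots> \<le> l1 k * N powr s"
      using a[of i0] s by (intro mult_mono powr_mono2) auto
    finally show "a i0 powr (1 + s) \<le> l1 k * N powr s" .
    show "a i powr (1 + s) \<le> N powr (1 + s)" for i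
      using a[of i] s by (intro powr_mono2) auto
  qed (use k1 in \<open>auto intro: prod_nonneg\<close>)
  finally have pa: "(\<Prod>i\<in>UNIV. a i powr (1 + s)) \<le> l1 k * N powr s * (N powr (1 + s)) ^ (CARD('n) - 1)"
    by (simp add: card_Diff_singleton)
  have pb: "(\<Prod>j\<in>UNIV. b j powr (1 + s)) \<le> (N powr (1 + s)) ^ CARD('m)"
  proof -
    have "(\<Prod>j\<in>UNIV. b j powr (1 + s)) \<le> (\<Prod>j\<in>(UNIV :: 'm set). N powr (1 + s))"
      using b s by (intro prod_mono conjI powr_mono2) (auto intro: order_trans[OF zero_le_one])
    then show ?thesis by simp
  qed
  have pos: "0 < (\<Prod>i\<in>UNIV. a i powr (1 + s))" "0 < (\<Prod>j\<in>UNIV. b j powr (1 + s))"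
  proof -
    have "a i \<noteq> 0" "b j \<noteq> 0" for i j using a(1)[of i] b(1)[of j] by linarith+
    then show "0 < (\<Prod>i\<in>UNIV. a i powr (1 + s))" "0 < (\<Prod>j\<in>UNIV. b j powr (1 + s))"
      by (simp_all add: prod_pos)
  qed
  have "(\<Prod>i\<in>UNIV. a i powr (1 + s)) * (\<Prod>j\<in>UNIV. b j powr (1 + s))
     \<le> (l1 k * N powr s * (N powr (1 + s)) ^ (CARD('n) - 1)) * (N powr (1 + s)) ^ CARD('m)"
    using pa pb pos k1 by (intro mult_mono) auto
  also have "\<dots> = l1 k * N powr \<tau>"
  proof -
    have "(N powr (1 + s)) ^ j = N powr (real j * (1 + s))" for j
      using N by (simp add: powr_realpow[symmetric] powr_powr mult.commute)
    then have "(l1 k * N powr s * (N powr (1 + s)) ^ (CARD('n) - 1)) * (N powr (1 + s)) ^ CARD('m)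
      = l1 k * N powr (s + real (CARD('n) - 1) * (1 + s) + real CARD('m) * (1 + s))"
      by (simp add: powr_add mult.assoc)
    also have "s + real (CARD('n) - 1) * (1 + s) + real CARD('m) * (1 + s) = \<tau>"
      unfolding \<tau> by (simp add: of_nat_diff Suc_leI algebra_simps)
    finally show ?thesis .
  qed
  finally have main: "(\<Prod>i\<in>UNIV. a i powr (1 + s)) * (\<Prod>j\<in>UNIV. b j powr (1 + s)) \<le> l1 k * N powr \<tau>" .
  have "N powr (- \<tau>) / l1 k = inverse (l1 k * N powr \<tau>)"
    by (simp add: powr_minus divide_inverse)
  also have "\<dots> \<le> inverse ((\<Prod>i\<in>UNIV. a i powr (1 + s)) * (\<Prod>j\<in>UNIV. b j powr (1 + s)))"
    using main pos by (intro le_imp_inverse_le) auto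
  also have "\<dots> = (\<Prod>i\<in>UNIV. a i powr (- 1 - s)) * (\<Prod>j\<in>UNIV. b j powr (- 1 - s))"
  proof -
    have "inverse (c powr (1 + s)) = c powr (- 1 - s)" for c
      by (simp add: powr_minus[symmetric])
    then show ?thesis unfolding inverse_mult_distrib prod_inversef[symmetric] o_def by (simp only:)
  qed
  finally show ?thesis by (simp add: N_def a_def b_def)
qed

text \<open>The frequencies range in a cube, where a resonance with k \<noteq> 0 is a slab. Dividing
  by the largest coordinate of k makes the slab have measure of order \<gamma> times the weight over
  l1 k, and these numbers are summable by \<open>resonance_weight_le\<close>. The strict inequality
  makes the resonant sets open.\<close>

lemma resonant_measure:
  fixes \<omega> :: "real ^ 'n \<Rightarrow> real ^ 'n" and \<alpha> :: "real ^ 'm" and D :: "(real ^ 'n) set"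
  assumes D: "open D" "bounded D" and cont: "continuous_on D \<omega>" and \<rho>: "\<And>x. x \<in> D \<Longrightarrow> norm (\<omega> x) \<le> \<rho>" "0 \<le> \<rho>"
    and mc: "\<And>A. A \<in> sets lebesgue \<Longrightarrow> emeasure lebesgue (\<omega> -` A \<inter> D) \<le> ennreal (inverse mbar) * emeasure lebesgue A"
    and mbar: "mbar > 0" and \<tau>: "\<tau> > real CARD('n) + real CARD('m) - 1"
  obtains C where "\<And>\<gamma>. \<gamma> > 0 \<Longrightarrow>
     {x \<in> D. \<exists>k l. k \<noteq> 0 \<and> \<bar>ivec k \<bullet> \<omega> x + ivec l \<bullet> \<alpha>\<bar> < \<gamma> * (l1 k + l1 l) powr (- \<tau>)} \<in> lmeasurable \<and>
     measure lebesgue {x \<in> D. \<exists>k l. k \<noteq> 0 \<and> \<bar>ivec k \<bullet> \<omega> x + ivec l \<bullet> \<alpha>\<bar> < \<gamma> * (l1 k + l1 l) powr (- \<tau>)} \<le> C * \<gamma>"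
proof -
  \<comment> \<open>The surplus of \<tau> is shared equally by all coordinates, so that each carries
    a convergent sum with exponent 1 + s.\<close>
  define s where "s = (\<tau> - (real CARD('n) + real CARD('m) - 1)) / (real CARD('n) + real CARD('m))"
  have cpos: "real CARD('n) + real CARD('m) > 0" by (simp add: add_pos_pos)
  have s: "s > 0" "\<tau> = real CARD('n) + real CARD('m) - 1 + (real CARD('n) + real CARD('m)) * s"
    using \<tau> cpos by (simp_all add: s_def)
  define c0 where "c0 = inverse mbar * (2 * (2 * \<rho>) ^ (CARD('n) - 1) * CARD('n))"
  have c0: "c0 \<ge> 0" using mbar \<rho> by (simp add: c0_def)
  define C where "C = c0 * zsum s ^ (CARD('n) + CARD('m))"
  show thesis
  proof (rule that[of C])
    fix \<gamma> :: real assume \<gamma>: "\<gamma> > 0"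
    define wgt where "wgt k l = (l1 k + l1 l) powr (- \<tau>)" for k :: "int ^ 'n" and l :: "int ^ 'm"
    define A where "A k l = {x \<in> D. \<bar>ivec k \<bullet> \<omega> x + ivec l \<bullet> \<alpha>\<bar> < \<gamma> * wgt k l}" for k l
    \<comment> \<open>Finite boxes of modes suffice for the estimate: the bound is uniform in N and
      passes to the increasing union.\<close>
    define F where "F N = (\<Union>(k, l)\<in>(ibox N - {0}) \<times> ibox N. A k l)" for N
    have oA: "open (A k l)" for k l
    proof -
      have "open (D \<inter> (\<lambda>x. \<bar>ivec k \<bullet> \<omega> x + ivec l \<bullet> \<alpha>\<bar>) -` {..< \<gamma> * wgt k l})"
        by (intro continuous_open_preimage continuous_intros cont D)
      moreover have "A k l = D \<inter> (\<lambda>x. \<bar>ivec k \<bullet> \<omega> x + ivec l \<bullet> \<alpha>\<bar>) -` {..< \<gamma> * wgt k l}"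
        by (auto simp: A_def)
      ultimately show ?thesis by simp
    qed
    have eA: "emeasure lebesgue (A k l) \<le> ennreal (c0 * \<gamma> * (wgt k l / l1 k))" if k: "k \<noteq> 0" for k l
    proof -
      obtain i where i: "l1 k \<le> CARD('n) * \<bar>real_of_int (k $ i)\<bar>" by (rule l1_max_coordinate)
      have ki: "ivec k $ i \<noteq> 0" using i l1_ge_1[OF k] by (auto simp: ivec_def)
      let ?S = "{y. (\<forall>j. \<bar>y $ j\<bar> \<le> \<rho>) \<and> \<bar>ivec k \<bullet> y + ivec l \<bullet> \<alpha>\<bar> \<le> \<gamma> * wgt k l}"
      have d0: "0 \<le> \<gamma> * wgt k l" using \<gamma> by (simp add: wgt_def)
      have S: "?S \<in> lmeasurable" by (rule measure_slab(2)[OF ki d0 \<rho>(2)])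
      have "A k l \<subseteq> \<omega> -` ?S \<inter> D"
      proof
        fix x assume x: "x \<in> A k l"
        then have xD: "x \<in> D" by (simp add: A_def)
        have "\<bar>\<omega> x $ j\<bar> \<le> \<rho>" for j
          by (rule order_trans[OF component_le_norm_cart \<rho>(1)[OF xD]])
        then show "x \<in> \<omega> -` ?S \<inter> D" using x by (simp add: A_def)
      qed
      moreover have "\<omega> -` ?S \<inter> D \<in> sets lebesgue"
      proof -
        have "closed ?S" by (intro closed_Collect_conj closed_Collect_all closed_Collect_le continuous_intros)
        then have "open (D \<inter> \<omega> -` (- ?S))" by (intro continuous_open_preimage cont D) (simp add: open_Compl)
        moreover have "\<omega> -` ?S \<inter> D = D - (D \<inter> \<omega> -` (- ?S))" by blast
        ultimately show ?thesis using D(1) by (simp add: sets.Diff borel_open)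
      qed
      ultimately have "emeasure lebesgue (A k l) \<le> emeasure lebesgue (\<omega> -` ?S \<inter> D)"
        by (rule emeasure_mono)
      also have "\<dots> \<le> ennreal (inverse mbar) * emeasure lebesgue ?S"
        by (rule mc) (use S in \<open>auto intro: fmeasurableD\<close>)
      also have "\<dots> = ennreal (inverse mbar * measure lebesgue ?S)"
        using S mbar by (simp add: emeasure_eq_measure2 ennreal_mult)
      also have "\<dots> \<le> ennreal (c0 * \<gamma> * (wgt k l / l1 k))"
      proof (rule ennreal_leI)
        have "measure lebesgue ?S \<le> 2 * (\<gamma> * wgt k l) * (2 * \<rho>) ^ (CARD('n) - 1) / \<bar>ivec k $ i\<bar>"
          by (rule measure_slab(1)[OF ki d0 \<rho>(2)])
        also have "\<dots> \<le> 2 * (\<gamma> * wgt k l) * (2 * \<rho>) ^ (CARD('n) - 1) / (l1 k / CARD('n))"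
          using i l1_ge_1[OF k] ki \<gamma> \<rho>(2)
          by (intro divide_left_mono mult_nonneg_nonneg mult_pos_pos) (auto simp: ivec_def field_simps wgt_def)
        finally have "inverse mbar * measure lebesgue ?S \<le> inverse mbar * (2 * (\<gamma> * wgt k l) * (2 * \<rho>) ^ (CARD('n) - 1) / (l1 k / CARD('n)))"
          using mbar by (intro mult_left_mono) auto
        then show "inverse mbar * measure lebesgue ?S \<le> c0 * \<gamma> * (wgt k l / l1 k)"
          by (simp add: c0_def mult_ac)
      qed
      finally show ?thesis .
    qed
    have AS: "A k l \<in> sets lebesgue" for k l using oA[of k l] by (simp add: borel_open)
    have wn: "0 \<le> c0 * \<gamma> * (wgt k l / l1 k)" for k l
      using c0 \<gamma> l1_nonneg[of k] by (simp add: wgt_def)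
    have eF: "emeasure lebesgue (F N) \<le> ennreal (C * \<gamma>)" for N
    proof -
      let ?P = "(ibox N - {0}) \<times> ibox N :: ((int ^ 'n) \<times> (int ^ 'm)) set"
      have fin: "finite ?P" by (intro finite_cartesian_product finite_Diff finite_ibox)
      have "emeasure lebesgue (F N) \<le> (\<Sum>kl\<in>?P. emeasure lebesgue (case kl of (k, l) \<Rightarrow> A k l))"
        unfolding F_def by (rule emeasure_subadditive_finite[OF fin]) (use AS in auto)
      also have "\<dots> \<le> (\<Sum>(k, l)\<in>?P. ennreal (c0 * \<gamma> * (wgt k l / l1 k)))"
        using eA by (intro sum_mono) auto
      also have "\<dots> = ennreal (\<Sum>(k, l)\<in>?P. c0 * \<gamma> * (wgt k l / l1 k))"
        unfolding case_prod_beta by (rule sum_ennreal) (rule wn)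
      also have "\<dots> \<le> ennreal (C * \<gamma>)"
      proof (rule ennreal_leI)
        let ?g = "\<lambda>j. max 1 \<bar>real_of_int j\<bar> powr (- 1 - s)"
        have "(\<Sum>(k, l)\<in>?P. wgt k l / l1 k) \<le> (\<Sum>(k, l)\<in>?P. (\<Prod>i\<in>UNIV. ?g (k $ i)) * (\<Prod>j\<in>UNIV. ?g (l $ j)))"
          unfolding wgt_def using resonance_weight_le[OF _ s] by (intro sum_mono) auto
        also have "\<dots> \<le> (\<Sum>(k, l)\<in>(ibox N :: (int ^ 'n) set) \<times> (ibox N :: (int ^ 'm) set). (\<Prod>i\<in>UNIV. ?g (k $ i)) * (\<Prod>j\<in>UNIV. ?g (l $ j)))"
          by (rule sum_mono2) (auto simp: finite_ibox prod_nonneg)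
        also have "\<dots> = (\<Sum>k\<in>(ibox N :: (int ^ 'n) set). \<Prod>i\<in>UNIV. ?g (k $ i)) * (\<Sum>l\<in>(ibox N :: (int ^ 'm) set). \<Prod>j\<in>UNIV. ?g (l $ j))"
          by (simp add: sum_product sum.cartesian_product)
        also have "\<dots> = (\<Sum>j\<in>{- int N..int N}. ?g j) ^ (CARD('n) + CARD('m))"
          unfolding sum_ibox_prod[of ?g N] power_add by (rule refl)
        also have "\<dots> \<le> zsum s ^ (CARD('n) + CARD('m))"
          by (intro power_mono sum_int_powr_le s sum_nonneg) auto
        finally have "c0 * \<gamma> * (\<Sum>(k, l)\<in>?P. wgt k l / l1 k) \<le> c0 * \<gamma> * zsum s ^ (CARD('n) + CARD('m))"
          using c0 \<gamma> by (intro mult_left_mono) auto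
        then show "(\<Sum>(k, l)\<in>?P. c0 * \<gamma> * (wgt k l / l1 k)) \<le> C * \<gamma>"
          by (simp add: C_def sum_distrib_left case_prod_beta mult_ac)
      qed
      finally show ?thesis .
    qed
    let ?R = "{x \<in> D. \<exists>k l. k \<noteq> 0 \<and> \<bar>ivec k \<bullet> \<omega> x + ivec l \<bullet> \<alpha>\<bar> < \<gamma> * (l1 k + l1 l) powr (- \<tau>)}"
    have RF: "?R = (\<Union>N. F N)"
    proof
      show "?R \<subseteq> (\<Union>N. F N)"
      proof
        fix x assume "x \<in> ?R"
        then obtain k l where kl: "k \<noteq> 0" "x \<in> A k l" by (auto simp: A_def wgt_def)
        obtain N :: nat where N: "l1 k + l1 l \<le> real N" using real_arch_simple by blast
        have "\<bar>real_of_int (k $ i)\<bar> \<le> real N" "\<bar>real_of_int (l $ j)\<bar> \<le> real N" for i j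
          using N abs_le_l1[of k i] abs_le_l1[of l j] l1_nonneg[of k] l1_nonneg[of l] by linarith+
        then have "\<bar>k $ i\<bar> \<le> int N" "\<bar>l $ j\<bar> \<le> int N" for i j
          by (metis of_int_abs of_int_le_iff of_int_of_nat_eq)+
        then have "k \<in> ibox N" "l \<in> ibox N" by (auto simp: ibox_def abs_le_iff minus_le_iff)
        then show "x \<in> (\<Union>N. F N)" using kl by (auto simp: F_def)
      qed
      show "(\<Union>N. F N) \<subseteq> ?R" by (auto simp: F_def A_def wgt_def)
    qed
    have oF: "open (F N)" for N unfolding F_def by (rule open_UN) (auto simp: oA)
    have inc: "incseq F"
    proof (rule incseq_SucI)
      show "F N \<le> F (Suc N)" for N
        unfolding F_def by (rule UN_mono) (auto dest: subsetD[OF ibox_mono])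
    qed
    have "F N \<in> sets lebesgue" for N using oF[of N] by (simp add: borel_open)
    then have "range F \<subseteq> sets lebesgue" by blast
    from SUP_emeasure_incseq[OF this inc]
    have "emeasure lebesgue (\<Union>N. F N) = (SUP N. emeasure lebesgue (F N))" by (rule sym)
    also have "\<dots> \<le> ennreal (C * \<gamma>)" by (intro SUP_least eF)
    finally have e: "emeasure lebesgue ?R \<le> ennreal (C * \<gamma>)" unfolding RF .
    have oR: "open ?R" unfolding RF by (rule open_UN) (simp add: oF)
    have "?R \<in> sets lebesgue" by (intro sets_completionI_sets) (simp only: sets_lborel borel_open oR)
    moreover have "emeasure lebesgue ?R < \<infinity>"
      using le_less_trans[OF e ennreal_less_top] by (simp only: infinity_ennreal_def)
    ultimately have meas: "?R \<in> lmeasurable" by (rule fmeasurableI)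
    have "0 \<le> zsum s" unfolding zsum_def using s(1) by simp
    then have "0 \<le> C * \<gamma>" unfolding C_def using c0 \<gamma> by (intro mult_nonneg_nonneg zero_le_power) auto
    then have "measure lebesgue ?R \<le> C * \<gamma>"
      unfolding measure_def using e by (intro enn2real_leI)
    with meas show "?R \<in> lmeasurable \<and> measure lebesgue ?R \<le> C * \<gamma>" by (rule conjI)
  qed
qed

section \<open>Motion near a point without small divisors\<close>

text \<open>A bootstrap: at the first time at which the distance c is reached, the assumption holds
  up to that time and gives a distance less than c. Segments from 0 treat both directions of time
  together.\<close>

lemma confinement:
  fixes x :: "real \<Rightarrow> 'a::real_normed_vector"
  assumes S: "is_interval S" "0 \<in> S" and x: "continuous_on S x" and c: "c > 0" and t: "t \<in> S"
    and step: "\<And>t'. t' \<in> closed_segment 0 t \<Longrightarrow>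
      (\<And>s. s \<in> closed_segment 0 t' \<Longrightarrow> norm (x s - x 0) \<le> c) \<Longrightarrow> norm (x t' - x 0) < c"
  shows "norm (x t - x 0) \<le> c"
proof (rule ccontr)
  assume n: "\<not> norm (x t - x 0) \<le> c"
  \<comment> \<open>The segment from 0 to t is parametrised by the unit interval, so that the first
    exit is a minimum even for negative t.\<close>
  define \<phi> where "\<phi> \<sigma> = norm (x (\<sigma> * t) - x 0)" for \<sigma>
  have seg: "\<sigma> * t \<in> closed_segment 0 t" if "\<sigma> \<in> {0..1}" for \<sigma>
    unfolding in_segment using that by (intro exI[of _ \<sigma>]) simp
  have sub: "closed_segment 0 t \<subseteq> S"
    using closed_segment_subset[OF S(2) t] S(1) by (simp add: is_interval_convex_1)
  have cont: "continuous_on {0..1} \<phi>"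
    unfolding \<phi>_def[abs_def]
    by (intro continuous_intros continuous_on_compose2[OF x]) (use seg sub in blast)
  define A where "A = {0..1} \<inter> \<phi> -` {c..}"
  have "closed A" unfolding A_def by (intro continuous_closed_preimage cont) auto
  moreover have "bounded A" unfolding A_def by (rule bounded_subset[OF bounded_closed_interval[of 0 1]]) auto
  ultimately have "compact A" by (simp add: compact_eq_bounded_closed)
  moreover have "1 \<in> A" using n by (simp add: A_def \<phi>_def)
  ultimately obtain \<sigma>0 where \<sigma>0: "\<sigma>0 \<in> A" and min: "\<And>\<sigma>. \<sigma> \<in> A \<Longrightarrow> \<sigma>0 \<le> \<sigma>"
    using compact_attains_inf[of A] by auto
  have s01: "0 \<le> \<sigma>0" "\<sigma>0 \<le> 1" "c \<le> \<phi> \<sigma>0" using \<sigma>0 by (auto simp: A_def)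
  have eq: "\<phi> \<sigma>0 = c"
  proof -
    have "\<phi> 0 \<le> c" using c by (simp add: \<phi>_def)
    then obtain \<sigma>1 where 1: "0 \<le> \<sigma>1" "\<sigma>1 \<le> \<sigma>0" "\<phi> \<sigma>1 = c"
      using IVT'[of \<phi> 0 c \<sigma>0] s01 continuous_on_subset[OF cont, of "{0..\<sigma>0}"] by auto
    then have "\<sigma>1 \<in> A" using s01 by (simp add: A_def)
    from min[OF this] 1 show ?thesis by simp
  qed
  have "norm (x s - x 0) \<le> c" if s: "s \<in> closed_segment 0 (\<sigma>0 * t)" for s
  proof (rule ccontr)
    assume gt: "\<not> norm (x s - x 0) \<le> c"
    obtain w where w: "0 \<le> w" "w \<le> 1" "s = (w * \<sigma>0) * t" using s by (auto simp: in_segment)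
    have le: "w * \<sigma>0 \<le> \<sigma>0" using mult_right_mono[OF w(2) s01(1)] by simp
    have "\<phi> (w * \<sigma>0) > c" using gt w by (simp add: \<phi>_def)
    moreover from this have "w * \<sigma>0 \<in> A" using w s01 le by (simp add: A_def)
    then have "w * \<sigma>0 = \<sigma>0" using min le by (intro antisym)
    ultimately show False using eq by simp
  qed
  from step[OF seg this] s01 have "\<phi> \<sigma>0 < c" by (simp add: \<phi>_def)
  with eq show False by simp
qed

lemma vector_derivative_norm_le:
  fixes G :: "real \<Rightarrow> 'a::real_normed_vector"
  assumes "(G has_vector_derivative d) (at 0)" "\<And>s. norm (G s - G 0) \<le> C * \<bar>s\<bar>"
  shows "norm d \<le> C"
proof -
  have "((\<lambda>s. norm (G (0 + s) - G 0 - s *\<^sub>R d) / norm s) \<longlongrightarrow> 0) (at 0)"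
    using assms(1) unfolding has_vector_derivative_def has_derivative_at by blast
  moreover have "\<forall>\<^sub>F s in at 0. norm d - C \<le> norm (G (0 + s) - G 0 - s *\<^sub>R d) / norm s"
  proof (rule eventually_at_filter[THEN iffD2], rule always_eventually, intro allI impI)
    fix s :: real assume s: "s \<noteq> 0"
    have "norm (s *\<^sub>R d) - norm (G s - G 0) \<le> norm (G s - G 0 - s *\<^sub>R d)"
      by (metis norm_minus_commute norm_triangle_ineq2)
    then have "(norm d - C) * \<bar>s\<bar> \<le> norm (G s - G 0 - s *\<^sub>R d)"
      using assms(2)[of s] by (simp add: algebra_simps)
    then show "norm d - C \<le> norm (G (0 + s) - G 0 - s *\<^sub>R d) / norm s"
      using s by (simp add: pos_le_divide_eq)
  qed
  ultimately have "norm d - C \<le> 0" by (rule tendsto_lowerbound) simp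
  then show ?thesis by simp
qed

lemma exp_one_ge: "27 / 10 \<le> exp (1::real)"
proof -
  have "(1 + 1/8 + (1/8)\<^sup>2 / 2) ^ 8 \<le> (exp (1/8::real)) ^ 8"
    by (rule power_mono[OF exp_lower_Taylor_quadratic]) (auto simp: power2_eq_square)
  also have "\<dots> = exp 1" by (simp flip: exp_of_nat_mult)
  finally show ?thesis by (simp add: power2_eq_square power_numeral_reduce)
qed

text \<open>As exp (4 / 3) \<le> 4, at least u / 8 steps with gain 4 yield exp (u / 6). This is the
  source of the 6 in the stability time.\<close>

lemma four_power_ge:
  assumes "u \<le> 8 * real m"
  shows "exp (u / 6) \<le> (4::real) ^ m"
proof -
  have "exp (4::real) = exp 1 ^ 4" by (simp flip: exp_of_nat_mult)
  also have "\<dots> \<le> (272/100) ^ 4" using e_less_272 by (intro power_mono) auto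
  also have "\<dots> \<le> 4 ^ 3" by (simp add: power_numeral_reduce)
  finally have "exp (4/3::real) ^ 3 \<le> 4 ^ 3" by (simp flip: exp_of_nat_mult)
  then have e: "exp (4/3::real) \<le> 4" by (rule power_le_imp_le_base[of _ 2, unfolded numeral_2_eq_2[symmetric], simplified])  simp
  have "exp (u / 6) \<le> exp (real m * (4/3))" using assms by simp
  also have "\<dots> = exp (4/3) ^ m" by (rule exp_of_nat_mult)
  also have "\<dots> \<le> 4 ^ m" by (intro power_mono e) simp
  finally show ?thesis .
qed

context torus_space
begin

text \<open>The derivative of the whole sum is given, and subtracting that of finitely many terms
  leaves the derivative of a tail, which is bounded by the Lipschitz constant of the tail.\<close>

lemma fourier_derivative_tail:
  assumes hs: "\<And>\<theta>. ((\<lambda>k. a k * ek k \<theta>) has_sum g \<theta>) UNIV" and P: "finite P"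
    and bd: "\<And>Q. finite Q \<Longrightarrow> Q \<inter> P = {} \<Longrightarrow> (\<Sum>k\<in>Q. cmod (a k) * wt k) \<le> c"
    and d: "((\<lambda>s. g (\<theta> + s *\<^sub>R v)) has_vector_derivative d) (at 0)"
  shows "cmod (d - (\<Sum>k\<in>P. \<i> * of_real (kr k \<bullet> v) * a k * ek k \<theta>)) \<le> c * norm v"
proof (rule vector_derivative_norm_le)
  let ?G = "\<lambda>s. g (\<theta> + s *\<^sub>R v) - (\<Sum>k\<in>P. a k * ek k (\<theta> + s *\<^sub>R v))"
  have "((\<lambda>s. \<theta> + s *\<^sub>R v) has_vector_derivative v) (at 0)"
    by (auto intro!: derivative_eq_intros simp: has_vector_derivative_def)
  from has_vector_derivative_ek[OF this]
  have "((\<lambda>s. ek k (\<theta> + s *\<^sub>R v)) has_vector_derivative \<i> * of_real (kr k \<bullet> v) * ek k \<theta>) (at 0)" for k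
    by simp
  then have "((\<lambda>s. \<Sum>k\<in>P. a k * ek k (\<theta> + s *\<^sub>R v)) has_vector_derivative
      (\<Sum>k\<in>P. a k * (\<i> * of_real (kr k \<bullet> v) * ek k \<theta>))) (at 0)"
    by (intro has_vector_derivative_sum has_vector_derivative_mult_right)
  from has_vector_derivative_diff[OF d this] show "(?G has_vector_derivative (d - (\<Sum>k\<in>P. \<i> * of_real (kr k \<bullet> v) * a k * ek k \<theta>))) (at 0)"
    by (simp add: mult_ac)
  show "cmod (?G s - ?G 0) \<le> c * norm v * \<bar>s\<bar>" for s
    using fourier_tail_lipschitz[OF hs P bd, of "\<theta> + s *\<^sub>R v" "\<theta> + 0 *\<^sub>R v"] by (simp add: mult_ac)
qed

end

text \<open>A is the size of the divisors at the centre; a third of it must survive on the ball of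
  radius 3/4 * \<rho>. The relation between \<epsilon>, A, \<rho> and K makes the contraction
  constants pure numbers. \<open>thd\<close> and \<open>xd\<close> are Hamilton's equations tested
  in a direction, h being the whole unperturbed part and g the perturbation with the angles as
  parameters.\<close>

locale resonance_free_motion = torus_space sc dir wt x0 emb kr cip
  for sc :: "complex \<Rightarrow> 'v::euclidean_space \<Rightarrow> 'v" and dir :: "'z::ab_group_add \<Rightarrow> 'v"
    and wt :: "'z \<Rightarrow> real" and x0 :: 'v
    and emb :: "'q::euclidean_space \<Rightarrow> 'v" and kr :: "'z \<Rightarrow> 'q" and cip :: "'q \<Rightarrow> 'v \<Rightarrow> complex" +
  fixes s0 \<epsilon> \<rho> K A :: real and h :: "'v \<Rightarrow> complex" and F :: "'z \<Rightarrow> 'v \<Rightarrow> complex" and g :: "'q \<Rightarrow> 'v \<Rightarrow> complex"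
    and S :: "real set" and x \<theta> x' \<theta>' :: "real \<Rightarrow> 'q"
  assumes par: "s0 > 0" "\<epsilon> > 0" "\<rho> > 0" "K > 0" "A > 0" and eps: "\<epsilon> = 3 * A * \<rho> / (2048 * K)"
    and h: "holo h (B \<rho>)" and F: "\<And>k. holo (F k) (B \<rho>)" "nb \<rho> s0 F \<epsilon>"
    and g: "\<And>\<theta>. holo (g \<theta>) (B \<rho>)" "\<And>z \<theta>. z \<in> B \<rho> \<Longrightarrow> ((\<lambda>k. F k z * ek k \<theta>) has_sum g \<theta> z) UNIV"
    and dv: "\<And>k z. z \<in> B (3/4 * \<rho>) \<Longrightarrow> k \<noteq> 0 \<Longrightarrow> wt k \<le> K \<Longrightarrow> A / 3 \<le> cmod (dd (dir k) h z)"
    and S: "is_interval S" "0 \<in> S" and x0: "x0 = emb (x 0)"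
    and x: "\<And>t. t \<in> S \<Longrightarrow> (x has_vector_derivative x' t) (at t within S)"
    and th: "\<And>t. t \<in> S \<Longrightarrow> (\<theta> has_vector_derivative \<theta>' t) (at t within S)"
    and thd: "\<And>t k. t \<in> S \<Longrightarrow> emb (x t) \<in> B \<rho> \<Longrightarrow>
      complex_of_real (kr k \<bullet> \<theta>' t) = dd (dir k) h (emb (x t)) + dd (dir k) (g (\<theta> t)) (emb (x t))"
    and xd: "\<And>t v. t \<in> S \<Longrightarrow> emb (x t) \<in> B \<rho> \<Longrightarrow>
      ((\<lambda>s. g (\<theta> t + s *\<^sub>R v) (emb (x t))) has_vector_derivative - complex_of_real (x' t \<bullet> v)) (at 0)"
begin

lemma mem_B: "emb (x t) \<in> B R \<longleftrightarrow> norm (x t - x 0) < R"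
  by (simp add: x0 dist_norm norm_minus_commute norm_emb flip: linear_diff[OF linear_emb])

lemma continuous_x: "continuous_on S x"
  unfolding continuous_on_eq_continuous_within using x has_vector_derivative_continuous by blast

lemma segment_subset: "t \<in> S \<Longrightarrow> closed_segment 0 t \<subseteq> S"
  using closed_segment_subset[OF S(2)] S(1) by (simp add: is_interval_convex_1)

lemma abs_segment: "s \<in> closed_segment 0 t \<Longrightarrow> \<bar>s\<bar> \<le> \<bar>t\<bar>" for s t :: real
  by (auto simp: closed_segment_eq_real_ivl split: if_splits)

lemma increment_bound:
  assumes "t \<in> S" "\<And>s. s \<in> closed_segment 0 t \<Longrightarrow> \<exists>w'. (w has_vector_derivative w') (at s within S) \<and> norm w' \<le> c"
  shows "norm (w t - w 0 :: 'b::real_normed_vector) \<le> c * \<bar>t\<bar>"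
proof -
  have "norm (w t - w 0) \<le> c * \<bar>t - 0\<bar>"
  proof (rule vector_derivative_bound_interval[OF convex_closed_segment])
    fix s assume s: "s \<in> closed_segment 0 t"
    from assms(2)[OF this] obtain w' where w': "(w has_vector_derivative w') (at s within S)" "norm w' \<le> c" by auto
    then show "\<exists>w'. (w has_vector_derivative w') (at s within closed_segment 0 t) \<and> norm w' \<le> c"
      using has_vector_derivative_within_subset[OF w'(1) segment_subset[OF assms(1)]] by blast
  qed auto
  then show ?thesis by simp
qed

text \<open>The derivative bound for the complete Fourier series is tested in the direction of the
  velocity itself, and one factor norm (x' t) is cancelled.\<close>

lemma speed_bound:
  assumes "t \<in> S" "emb (x t) \<in> B \<rho>"
  shows "norm (x' t) \<le> \<epsilon> / (exp 1 * s0)"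
proof -
  have bd: "(\<Sum>k\<in>Q. cmod (F k (emb (x t))) * wt k) \<le> \<epsilon> / (exp 1 * s0)" if "finite Q" for Q
    using nb_wt[OF F(2) assms(2) par(1) that] by simp
  have "cmod (- complex_of_real (x' t \<bullet> x' t)) \<le> \<epsilon> / (exp 1 * s0) * norm (x' t)"
    using fourier_derivative_tail[OF g(2)[OF assms(2)] finite.emptyI bd xd[OF assms], of "x' t"] by simp
  then have "norm (x' t) * norm (x' t) \<le> \<epsilon> / (exp 1 * s0) * norm (x' t)"
    by (simp add: dot_square_norm power2_eq_square norm_mult)
  then show ?thesis
    using par by (cases "x' t = 0") (auto intro: mult_right_le_imp_le[of _ "norm (x' t)"])
qed

text \<open>Speed times admissible time is \<rho> * exp (K * s0 / 6 - 1) / 5, and exp (3 / 2) / 5 <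
  9 / 10 makes 15 an admissible threshold for K * s0.\<close>

lemma drift_short:
  assumes u: "K * s0 \<le> 15" and t: "t \<in> S" "\<bar>t\<bar> \<le> s0 * \<rho> / (5 * \<epsilon>) * exp (K * s0 / 6)"
  shows "norm (x t - x 0) \<le> 9/10 * \<rho>"
proof (rule confinement[OF S continuous_x _ t(1)])
  show "0 < 9/10 * \<rho>" using par by simp
  fix t' assume t': "t' \<in> closed_segment 0 t" and c: "\<And>s. s \<in> closed_segment 0 t' \<Longrightarrow> norm (x s - x 0) \<le> 9/10 * \<rho>"
  have tS: "t' \<in> S" using t' segment_subset[OF t(1)] by blast
  have "norm (x t' - x 0) \<le> \<epsilon> / (exp 1 * s0) * \<bar>t'\<bar>"
  proof (rule increment_bound[OF tS])
    fix s assume s: "s \<in> closed_segment 0 t'"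
    then have sS: "s \<in> S" using segment_subset[OF tS] by blast
    have "emb (x s) \<in> B \<rho>" unfolding mem_B using c[OF s] par by simp
    then show "\<exists>w'. (x has_vector_derivative w') (at s within S) \<and> norm w' \<le> \<epsilon> / (exp 1 * s0)"
      using x[OF sS] speed_bound[OF sS] by blast
  qed
  also have "\<dots> \<le> \<epsilon> / (exp 1 * s0) * (s0 * \<rho> / (5 * \<epsilon>) * exp (K * s0 / 6))"
    using abs_segment[OF t'] t(2) par by (intro mult_left_mono) auto
  also have "\<dots> = \<rho> * (exp (K * s0 / 6) / (5 * exp 1))" using par by (simp add: field_simps)
  also have "\<dots> = \<rho> * (exp (K * s0 / 6 - 1) / 5)" by (simp add: exp_diff)
  also have "\<dots> < \<rho> * (9/10)"
  proof (rule mult_strict_left_mono)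
    have "exp (K * s0 / 6 - 1) \<le> exp (3/2)" using u by simp
    also have "\<dots> < 9/2"
    proof (rule power_less_imp_less_base)
      have "exp (3/2::real) ^ 2 = exp 1 ^ 3" by (simp flip: exp_of_nat_mult)
      also have "\<dots> \<le> (272/100) ^ 3" using e_less_272 by (intro power_mono) auto
      also have "\<dots> < (9/2)\<^sup>2" by (simp add: power_numeral_reduce)
      finally show "exp (3/2::real) ^ 2 < (9/2)\<^sup>2" .
    qed simp
    finally show "exp (K * s0 / 6 - 1) / 5 < 9/10" by simp
  qed (rule par)
  finally show "norm (x t' - x 0) < 9/10 * \<rho>" by simp
qed

lemma cip_has_derivative: "(cip v has_derivative cip v) (at z)"
proof (rule bounded_linear_imp_has_derivative, rule bounded_linear_intro[where K = "norm v"])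
  show "cip v (t *\<^sub>R w) = t *\<^sub>R cip v w" for t w
    using cip_sc[of v "of_real t" w] by (simp add: sc_of_real scaleR_conv_of_real)
  show "cmod (cip v w) \<le> norm w * norm v" for w using norm_cip[of v w] by (simp add: mult.commute)
qed (rule cip_add)

lemma cip_diff: "cip v (z - w) = cip v z - cip v w"
  using cip_add[of v "z - w" w] by simp

lemma cip_shift_holo: "holo (\<lambda>z. cip v (z - w)) Z" "dd u (\<lambda>z. cip v (z - w)) z = cip v u"
proof -
  have 1: "((\<lambda>z. cip v (z - w)) has_derivative cip v) (at z)" for z
    using has_derivative_diff[OF cip_has_derivative has_derivative_const] by (simp add: cip_diff)
  show "holo (\<lambda>z. cip v (z - w)) Z" unfolding holomorphic_wrt_def using 1 cip_sc by blast
  show "dd u (\<lambda>z. cip v (z - w)) z = cip v u" by (rule dd_eqI[OF 1 cip_sc])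
qed

text \<open>The displacement at t' is the value of the linear form L in its own direction. Its
  increment differs from that of the almost conserved function by at most two deviations, and the
  latter increment is at most bracket bound times T. The sum of all contributions is below 49/100 *
  \<rho>, which closes the bootstrap.\<close>

lemma drift_long:
  assumes u: "15 < K * s0" and t: "t \<in> S" "\<bar>t\<bar> \<le> s0 * \<rho> / (5 * \<epsilon>) * exp (K * s0 / 6)"
  shows "norm (x t - x 0) \<le> 49/100 * \<rho>"
proof (rule confinement[OF S continuous_x _ t(1)])
  show "0 < 49/100 * \<rho>" using par by simp
  fix t' assume t': "t' \<in> closed_segment 0 t" and conf: "\<And>s. s \<in> closed_segment 0 t' \<Longrightarrow> norm (x s - x 0) \<le> 49/100 * \<rho>"
  define T where "T = s0 * \<rho> / (5 * \<epsilon>) * exp (K * s0 / 6)"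
  have T: "T > 0" "\<bar>t'\<bar> \<le> T" using abs_segment[OF t'] t(2) par by (auto simp: T_def)
  have tS: "t' \<in> S" using t' segment_subset[OF t(1)] by blast
  have segS: "s \<in> S" if "s \<in> closed_segment 0 t'" for s using segment_subset[OF tS] that by blast
  \<comment> \<open>The number of steps: large enough for \<open>four_power_ge\<close> and small
    enough that the loss of strip, 4 / K per step, leaves room.\<close>
  define m where "m = nat \<lceil>K * s0 / 8\<rceil>"
  have m: "K * s0 / 8 \<le> real m" "real m < K * s0 / 8 + 1" using u unfolding m_def by linarith+
  \<comment> \<open>The m steps use less than s0 / 2 + 4 / K of the strip, and K * s0 > 15 bounds
    this by 23/30 * s0. The remaining 7/30 * s0 is kept for the angle derivative at the end of the
    iteration.\<close>
  define S1 where "S1 = s0 - 2 * real m * (2 / K) - 7/30 * s0"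
  have S1: "S1 > 0"
  proof -
    have "4 * real m < 23/30 * (K * s0)" using m u by simp
    then have "4 * real m / K < 23/30 * s0" using par by (simp add: field_simps)
    then show ?thesis by (simp add: S1_def)
  qed
  define c where "c = exp (2/25) * (3/4 * \<rho>)"
  have c: "c > 0" using par by (simp add: c_def)
  \<comment> \<open>The error in the time derivative of the almost conserved function per unit of
    \<kappa>, as \<open>trig_derivative\<close> will give it; c bounds that function.\<close>
  define E where "E = \<epsilon> / (\<rho>/2 - 495/1000*\<rho>) * (c / (exp 1 * S1))
    + real DIM('q) * (2 * \<epsilon> / (exp 1 * s0)) * (c / (\<rho>/2 - 495/1000*\<rho>))"
  have E: "E \<ge> 0" using par c S1 by (simp add: E_def)
  \<comment> \<open>Both truncation errors, of the Lie series and of the Fourier series, are at most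
    \<zeta>; over the time T they move the function by at most \<rho> / 100 together.\<close>
  define \<zeta> where "\<zeta> = \<rho> / (200 * T)"
  have z: "\<zeta> > 0" "\<zeta> * T = \<rho> / 200" using par T by (auto simp: \<zeta>_def)
  define \<kappa> where "\<kappa> = \<zeta> / (E + 1)"
  have kp: "\<kappa> > 0" "\<kappa> * E \<le> \<zeta>" using z E by (auto simp: \<kappa>_def field_simps)
  \<comment> \<open>Beyond order N one half of the strip suffices to gain the factor \<kappa>. The
    other half is left for the derivative in the angles.\<close>
  define N where "N = - 2 * ln \<kappa> / s0"
  define P where "P = {k. wt k \<le> N}"
  have P: "finite P" unfolding P_def by (rule finite_wt)
  have cut: "1 \<le> \<kappa> * exp (wt k * (s0 / 2))" if "k \<notin> P" for k
  proof -
    have "- ln \<kappa> \<le> wt k * (s0 / 2)" using that par by (simp add: P_def N_def field_simps)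
    then have "exp (- ln \<kappa>) \<le> exp (wt k * (s0 / 2))" by simp
    then show ?thesis using kp by (simp add: exp_minus field_simps)
  qed
  define f where "f k = (if k \<in> P then F k else (\<lambda>x. 0))" for k
  have suppf: "supp f \<subseteq> P" by (auto simp: f_def supp_def)
  have sub: "B (3/4 * \<rho>) \<subseteq> B \<rho>" "B (\<rho> / 2) \<subseteq> B \<rho>" using par by auto
  have tpf: "tp (B \<rho>) f" by (rule tpI[OF P]) (auto simp: f_def F(1))
  have nbf: "nb (3/4 * \<rho>) s0 f \<epsilon>"
    by (rule nb_dom[OF nb_mono[OF F(2)]]) (use par in \<open>auto simp: f_def\<close>)
  have tail: "cmod (g \<theta> z - trig f z \<theta>) \<le> \<kappa> * \<epsilon>" if z: "z \<in> B \<rho>" for \<theta> z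
  proof -
    have "trig f z \<theta> = (\<Sum>k\<in>P. F k z * ek k \<theta>)"
      unfolding trig_eq[OF P suppf] by (intro sum.cong) (auto simp: f_def)
    moreover have "cmod (g \<theta> z - (\<Sum>k\<in>P. F k z * ek k \<theta>)) \<le> \<kappa> * \<epsilon>"
    proof (rule fourier_tail[OF g(2)[OF z] P])
      fix Q assume Q: "finite Q" "Q \<inter> P = {}"
      have "(\<Sum>k\<in>Q. cmod (F k z)) \<le> (\<Sum>k\<in>Q. \<kappa> * (cmod (F k z) * exp (wt k * s0)))"
      proof (rule sum_mono)
        fix k assume k: "k \<in> Q"
        have "1 \<le> \<kappa> * exp (wt k * (s0 / 2))" using cut Q k by blast
        also have "\<dots> \<le> \<kappa> * exp (wt k * s0)" using kp par by (intro mult_left_mono) (auto intro: mult_left_mono)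
        finally show "cmod (F k z) \<le> \<kappa> * (cmod (F k z) * exp (wt k * s0))"
          using mult_left_mono[of 1 "\<kappa> * exp (wt k * s0)" "cmod (F k z)"] by (simp add: mult_ac)
      qed
      also have "\<dots> \<le> \<kappa> * \<epsilon>"
        unfolding sum_distrib_left[symmetric] using nbD[OF F(2) z Q(1)] kp by (intro mult_left_mono) auto
      finally show "(\<Sum>k\<in>Q. cmod (F k z)) \<le> \<kappa> * \<epsilon>" .
    qed
    ultimately show ?thesis by simp
  qed
  have speed: "cmod (of_real (x' s \<bullet> b) + (\<Sum>k\<in>supp f. \<i> * of_real (kr k \<bullet> b) * f k (emb (x s)) * ek k (\<theta> s)))
      \<le> \<kappa> * (2 * \<epsilon> / (exp 1 * s0))" if s: "s \<in> S" "emb (x s) \<in> B \<rho>" and b: "b \<in> Basis" for s b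
  proof -
    let ?z = "emb (x s)"
    have "(\<Sum>k\<in>supp f. \<i> * of_real (kr k \<bullet> b) * f k ?z * ek k (\<theta> s)) = (\<Sum>k\<in>P. \<i> * of_real (kr k \<bullet> b) * f k ?z * ek k (\<theta> s))"
      by (rule sum.mono_neutral_left[OF P suppf]) (auto simp: not_supp)
    also have "\<dots> = (\<Sum>k\<in>P. \<i> * of_real (kr k \<bullet> b) * F k ?z * ek k (\<theta> s))"
      by (intro sum.cong) (auto simp: f_def)
    finally have eq: "(\<Sum>k\<in>supp f. \<i> * of_real (kr k \<bullet> b) * f k ?z * ek k (\<theta> s)) = (\<Sum>k\<in>P. \<i> * of_real (kr k \<bullet> b) * F k ?z * ek k (\<theta> s))" .
    have "cmod (- complex_of_real (x' s \<bullet> b) - (\<Sum>k\<in>P. \<i> * of_real (kr k \<bullet> b) * F k ?z * ek k (\<theta> s))) \<le> \<kappa> * (2 * \<epsilon> / (exp 1 * s0)) * norm b"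
    proof (rule fourier_derivative_tail[OF g(2)[OF s(2)] P _ xd[OF s]])
      fix Q assume Q: "finite Q" "Q \<inter> P = {}"
      have "(\<Sum>k\<in>Q. cmod (F k ?z) * wt k) \<le> (\<Sum>k\<in>Q. \<kappa> * (cmod (F k ?z) * (wt k * exp (wt k * (s0 / 2)))))"
      proof (rule sum_mono)
        fix k assume k: "k \<in> Q"
        have "1 \<le> \<kappa> * exp (wt k * (s0 / 2))" using cut Q k by blast
        then show "cmod (F k ?z) * wt k \<le> \<kappa> * (cmod (F k ?z) * (wt k * exp (wt k * (s0 / 2))))"
          using mult_left_mono[of 1 "\<kappa> * exp (wt k * (s0 / 2))" "cmod (F k ?z) * wt k"] by (simp add: mult_ac)
      qed
      also have "\<dots> \<le> \<kappa> * (\<epsilon> / (exp 1 * (s0 - s0 / 2)))"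
        unfolding sum_distrib_left[symmetric]
        using nb_wt[OF F(2) s(2) _ Q(1), of "s0 / 2"] kp par by (intro mult_left_mono) auto
      finally show "(\<Sum>k\<in>Q. cmod (F k ?z) * wt k) \<le> \<kappa> * (2 * \<epsilon> / (exp 1 * s0))"
        using par by (simp add: field_simps)
    qed
    then show ?thesis using b unfolding eq by (subst norm_minus_cancel[symmetric]) simp
  qed
  show "norm (x t' - x 0) < 49/100 * \<rho>"
  proof (cases "x t' = x 0")
    case True
    then show ?thesis using par by simp
  next
    case False
    \<comment> \<open>The direction depends on the final time t' but is constant along the
      trajectory.\<close>
    define v where "v = (1 / norm (x t' - x 0)) *\<^sub>R (x t' - x 0)"
    have v: "norm v = 1" using False by (simp add: v_def)
    define L where "L z = cip v (z - x0)" for z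
    have Lh: "holo L Z" "dd w L z = cip v w" for Z w z unfolding L_def[abs_def] by (rule cip_shift_holo)+
    have Lb: "cmod (L z) \<le> 3/4 * \<rho>" if "z \<in> B (3/4 * \<rho>)" for z
      using norm_cip[of v "z - x0"] v that by (simp add: L_def dist_norm norm_minus_commute)
    have Lemb: "L (emb (x s)) = of_real (v \<bullet> (x s - x 0))" for s
      by (simp add: L_def x0 cip_emb flip: linear_diff[OF linear_emb])
    have e1: "27/10 \<le> exp (1::real)" "exp (1::real) \<le> 272/100" using exp_one_ge e_less_272 by auto
    have e25: "exp (2 / 25) \<le> (1 + 2/25 + (2/25)\<^sup>2 :: real)" by (rule exp_bound) auto
    define y where "y = exp (2/25) * (\<epsilon> / 4 ^ m / (exp 1 * (7/30 * s0))) + \<zeta>"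
    \<comment> \<open>With \<delta> = \<rho> / 16 the radius shrinks from 3/4 * \<rho> to \<rho> /
      2. The divisor margin is 3/64 * A, which leaves 55/192 * A of the given A / 3. With \<sigma> =
      2 / K the quantity p becomes 9 / (110 * exp 1), so \<beta> = 1 / 25 is admissible, and exp (-
      2) + 1 / 25 < 1 / 4.\<close>
    have "\<exists>G. tp (B (3/4 * \<rho> - 4 * (\<rho> / 16))) G
      \<and> nb (3/4 * \<rho> - 4 * (\<rho> / 16)) (s0 - 2 * real m * (2 / K) - 7/30 * s0) (\<lambda>k x. G k x - mode0 L k x) ((exp (2 * (1/25)) - 1) * (3/4 * \<rho>))
      \<and> nb (3/4 * \<rho> - 4 * (\<rho> / 16)) (s0 - 2 * real m * (2 / K) - 7/30 * s0) (br G (ham h f)) (exp (2 * (1/25)) * (\<epsilon> / 4 ^ m / (exp 1 * (7/30 * s0))) + \<zeta>)"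
    proof (rule approximate_integral[where rmax = "3/4 * \<rho>" and a = "55/192 * A" and K = K and p = "9 / (110 * exp 1)" and \<epsilon> = \<epsilon>])
      show "cmod (dd w L z) \<le> norm w" for w z using norm_cip[of v w] v by (simp add: Lh)
      show "tp (B (3/4 * \<rho>)) f" by (rule tp_subset[OF tpf sub(1)])
      show "holo h (B (3/4 * \<rho>))" by (rule holo_subset[OF h sub(1)])
      show "55/192 * A + 2 * K * \<epsilon> / (\<rho> / 16) \<le> cmod (dd (dir k) h z)" if "z \<in> B (3/4 * \<rho>)" "k \<noteq> 0" "wt k \<le> K" for k z
      proof -
        have "55/192 * A + 2 * K * \<epsilon> / (\<rho> / 16) = A / 3" using par by (simp add: eps field_simps)
        then show ?thesis using dv[OF that] by simp
      qed
      show "9 / (110 * exp 1) = 2 * (\<epsilon> / (55/192 * A)) / (exp 1 * (\<rho> / 16) * (2 / K))"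
        using par by (simp add: eps field_simps)
      have e2: "(exp 1)\<^sup>2 * (9 / (110 * exp 1)) = 9/110 * exp (1::real)" by (simp add: power2_eq_square)
      show "2 * ((exp 1)\<^sup>2 * (9 / (110 * exp 1))) < (1::real)" unfolding e2 using e1 by simp
      show "9 / (110 * exp 1) / (1 - (exp 1)\<^sup>2 * (9 / (110 * exp 1))) \<le> (1/25 :: real)"
      proof -
        have "9 / (110 * exp 1) / (1 - (exp 1)\<^sup>2 * (9 / (110 * exp 1))) \<le> 9 / (110 * (27/10)) / (1 - 9/110 * (272/100) :: real)"
          unfolding e2 using e1 by (intro frac_le divide_left_mono) auto
        also have "\<dots> \<le> 1/25" by simp
        finally show ?thesis .
      qed
      have "exp (- 2 :: real) \<le> 1 / (27/10)\<^sup>2"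
      proof -
        have "(27/10)\<^sup>2 \<le> exp (1::real) ^ 2" using e1 by (intro power_mono) auto
        also have "\<dots> = exp 2" by (simp flip: exp_of_nat_mult)
        finally show ?thesis by (simp add: exp_minus field_simps)
      qed
      then show "exp (- K * (2 / K)) + 1/25 \<le> 1/4" using par by (simp add: power2_eq_square)
      show "2 * real m * (2 / K) + 7/30 * s0 \<le> s0" using S1 by (simp add: S1_def)
      show "holo L (B (3/4 * \<rho>))" by (rule Lh(1))
      show "cmod (L z) \<le> 3/4 * \<rho>" if "z \<in> B (3/4 * \<rho>)" for z by (rule Lb[OF that])
      show "nb (3/4 * \<rho>) s0 f \<epsilon>" by (rule nbf)
    qed (use par z(1) in simp_all)
    then obtain G where G0: "tp (B (3/4 * \<rho> - 4 * (\<rho> / 16))) G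
      \<and> nb (3/4 * \<rho> - 4 * (\<rho> / 16)) (s0 - 2 * real m * (2 / K) - 7/30 * s0) (\<lambda>k x. G k x - mode0 L k x) ((exp (2 * (1/25)) - 1) * (3/4 * \<rho>))
      \<and> nb (3/4 * \<rho> - 4 * (\<rho> / 16)) (s0 - 2 * real m * (2 / K) - 7/30 * s0) (br G (ham h f)) (exp (2 * (1/25)) * (\<epsilon> / 4 ^ m / (exp 1 * (7/30 * s0))) + \<zeta>)"
..
    have r2: "3/4 * \<rho> - 4 * (\<rho> / 16) = \<rho> / 2" "2 * (1/25) = (2/25 :: real)" by simp_all
    have G: "tp (B (\<rho> / 2)) G" and Gd: "nb (\<rho> / 2) S1 (\<lambda>k x. G k x - mode0 L k x) ((exp (2/25) - 1) * (3/4 * \<rho>))"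
      and Gy: "nb (\<rho> / 2) S1 (br G (ham h f)) y"
      using G0 unfolding r2 S1_def y_def by (simp_all only:)
    have Gn: "nb (\<rho> / 2) S1 G c"
    proof -
      have "nb (\<rho> / 2) S1 (mode0 L) (3/4 * \<rho>)"
      proof (rule nbI)
        fix z Q assume z: "z \<in> B (\<rho> / 2)" and Q: "finite (Q :: 'z set)"
        have "(\<Sum>k\<in>Q. cmod (mode0 L k z) * exp (wt k * S1)) = (\<Sum>k\<in>Q. if k = 0 then cmod (L z) else 0)"
          by (intro sum.cong) (auto simp: mode0_def wt_zero)
        also have "\<dots> \<le> 3/4 * \<rho>" using Lb[of z] z Q par by (auto simp: sum.delta)
        finally show "(\<Sum>k\<in>Q. cmod (mode0 L k z) * exp (wt k * S1)) \<le> 3/4 * \<rho>" .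
      qed
      from nb_add[OF Gd this] show ?thesis by (simp add: c_def algebra_simps)
    qed
    define W where "W s = trig G (emb (x s)) (\<theta> s)" for s
    \<comment> \<open>The radius 495/1000 * \<rho> lies strictly between the confinement radius and
      \<rho> / 2, leaving a collar for Cauchy estimates.\<close>
    have inB: "emb (x s) \<in> B (495/1000 * \<rho>)" "emb (x s) \<in> B (\<rho> / 2)" "emb (x s) \<in> B \<rho>" if "s \<in> closed_segment 0 t'" for s
      unfolding mem_B using conf[OF that] par by simp_all
    have dev: "cmod (W s - L (emb (x s))) \<le> (exp (2/25) - 1) * (3/4 * \<rho>)" if s: "s \<in> closed_segment 0 t'" for s
    proof -
      let ?Q = "insert 0 (supp G)"
      have fin: "finite ?Q" using finite_supp[OF G] by simp
      have "W s = (\<Sum>k\<in>?Q. G k (emb (x s)) * ek k (\<theta> s))" unfolding W_def by (rule trig_eq[OF fin]) blast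
      moreover have "L (emb (x s)) = (\<Sum>k\<in>?Q. mode0 L k (emb (x s)) * ek k (\<theta> s))"
      proof -
        have "(\<Sum>k\<in>?Q. mode0 L k (emb (x s)) * ek k (\<theta> s)) = (\<Sum>k\<in>?Q. if k = 0 then L (emb (x s)) else 0)"
          by (intro sum.cong) (auto simp: mode0_def ek_def)
        then show ?thesis using fin by (simp only: sum.delta) simp
      qed
      ultimately have "W s - L (emb (x s)) = (\<Sum>k\<in>?Q. (G k (emb (x s)) - mode0 L k (emb (x s))) * ek k (\<theta> s))"
        by (simp only: sum_subtractf[symmetric] left_diff_distrib)
      also have "cmod \<dots> \<le> (\<Sum>k\<in>?Q. cmod (G k (emb (x s)) - mode0 L k (emb (x s))))"
        by (intro sum_norm_le) (simp add: norm_mult)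
      also have "\<dots> \<le> (\<Sum>k\<in>?Q. cmod (G k (emb (x s)) - mode0 L k (emb (x s))) * exp (wt k * S1))"
        using S1 by (intro sum_mono) (simp add: mult_le_cancel_left1)
      also have "\<dots> \<le> (exp (2/25) - 1) * (3/4 * \<rho>)" by (rule nbD[OF Gd inB(2)[OF s] fin])
      finally show ?thesis .
    qed
    have "cmod (W t' - W 0) \<le> (y + \<zeta>) * \<bar>t'\<bar>"
    proof (rule increment_bound[OF tS])
      fix s assume s: "s \<in> closed_segment 0 t'"
      let ?W = "\<Sum>k\<in>supp G. (dd (emb (x' s)) (G k) (emb (x s)) + G k (emb (x s)) * (\<i> * of_real (kr k \<bullet> \<theta>' s))) * ek k (\<theta> s)"
      have W: "(W has_vector_derivative ?W) (at s within S)"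
        unfolding W_def[abs_def]
        by (rule has_vector_derivative_trig[OF G inB(2)[OF s] x[OF segS[OF s]] th[OF segS[OF s]]])
      have b: "cmod ?W \<le> y + (\<kappa> * \<epsilon> / (\<rho>/2 - 495/1000*\<rho>) * (c / (exp 1 * S1))
          + real DIM('q) * (\<kappa> * (2 * \<epsilon> / (exp 1 * s0))) * (c / (\<rho>/2 - 495/1000*\<rho>)))"
      proof (rule trig_derivative[where g = g and f = f and h = h])
        show "holo h (B (\<rho> / 2))" "tp (B (\<rho> / 2)) f" "holo (g (\<theta> s)) (B (\<rho> / 2))"
          using holo_subset[OF h sub(2)] tp_subset[OF tpf sub(2)] holo_subset[OF g(1) sub(2)] by auto
        show "cmod (g (\<theta> s) z - trig f z (\<theta> s)) \<le> \<kappa> * \<epsilon>" if "z \<in> B (\<rho> / 2)" for z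
          using tail sub(2) that by blast
        show "complex_of_real (kr k \<bullet> \<theta>' s) = dd (dir k) h (emb (x s)) + dd (dir k) (g (\<theta> s)) (emb (x s))" for k
          by (rule thd[OF segS[OF s] inB(3)[OF s]])
        show "cmod (of_real (x' s \<bullet> b) + (\<Sum>k\<in>supp f. \<i> * of_real (kr k \<bullet> b) * f k (emb (x s)) * ek k (\<theta> s)))
          \<le> \<kappa> * (2 * \<epsilon> / (exp 1 * s0))" if "b \<in> Basis" for b by (rule speed[OF segS[OF s] inB(3)[OF s] that])
        show "tp (B (\<rho> / 2)) G" "nb (\<rho> / 2) S1 G c" "nb (\<rho> / 2) S1 (br G (ham h f)) y" by (rule G Gn Gy)+
        show "emb (x s) \<in> B (495/1000*\<rho>)" by (rule inB(1)[OF s])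
      qed (use par kp c S1 in auto)
      have E': "y + (\<kappa> * \<epsilon> / (\<rho>/2 - 495/1000*\<rho>) * (c / (exp 1 * S1))
          + real DIM('q) * (\<kappa> * (2 * \<epsilon> / (exp 1 * s0))) * (c / (\<rho>/2 - 495/1000*\<rho>))) = y + \<kappa> * E"
        by (simp add: E_def algebra_simps)
      have "cmod ?W \<le> y + \<zeta>" by (rule order_trans[OF b[unfolded E']]) (use kp in simp)
      then show "\<exists>w'. (W has_vector_derivative w') (at s within S) \<and> cmod w' \<le> y + \<zeta>"
        by (intro exI[of _ ?W] conjI W)
    qed
    also have "\<dots> \<le> (y + \<zeta>) * T"
      using T z par by (intro mult_left_mono) (auto simp: y_def intro!: add_nonneg_nonneg)
    \<comment> \<open>In the product with T everything except \<rho> * 6 / (7 * exp 1) cancels,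
      since 4^m beats exp (K * s0 / 6); the factor 6 / 7 is the inverse of 5 * 7 / 30.\<close>
    also have "\<dots> \<le> (1 + 2/25 + (2/25)\<^sup>2) * (6/7 / (27/10)) * \<rho> + \<rho> / 100"
    proof -
      have "(y + \<zeta>) * T = exp (2/25) * (\<epsilon> / 4 ^ m / (exp 1 * (7/30 * s0))) * T + 2 * (\<zeta> * T)"
        by (simp add: y_def algebra_simps)
      also have "exp (2/25) * (\<epsilon> / 4 ^ m / (exp 1 * (7/30 * s0))) * T
          = exp (2/25) * (6/7 / exp 1) * \<rho> * (exp (K * s0 / 6) / 4 ^ m)"
        using par by (simp add: T_def field_simps)
      also have "\<dots> \<le> exp (2/25) * (6/7 / exp 1) * \<rho> * 1"
        using four_power_ge[of "K * s0" m] m par by (intro mult_left_mono) auto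
      also have "\<dots> \<le> (1 + 2/25 + (2/25)\<^sup>2) * (6/7 / (27/10)) * \<rho> * 1"
        using e25 e1 par by (intro mult_right_mono mult_mono divide_left_mono) auto
      finally show ?thesis using z by simp
    qed
    finally have w: "cmod (W t' - W 0) \<le> (1 + 2/25 + (2/25)\<^sup>2) * (6/7 / (27/10)) * \<rho> + \<rho> / 100" .
    have dv2: "(exp (2/25) - 1) * (3/4 * \<rho>) \<le> (2/25 + (2/25)\<^sup>2) * (3/4 * \<rho>)"
      using e25 par by (intro mult_right_mono) auto
    have "L (emb (x t')) = of_real (norm (x t' - x 0))"
      using False by (simp add: Lemb v_def dot_square_norm power2_eq_square)
    moreover have "L (emb (x 0)) = 0" by (simp add: Lemb)
    ultimately have "norm (x t' - x 0) = cmod ((W t' - W 0) - (W t' - L (emb (x t'))) + (W 0 - L (emb (x 0))))" by simp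
    also have "\<dots> \<le> cmod (W t' - W 0) + cmod (W t' - L (emb (x t'))) + cmod (W 0 - L (emb (x 0)))"
      by (rule order_trans[OF norm_triangle_ineq add_right_mono[OF norm_triangle_ineq4]])
    also have "\<dots> \<le> ((1 + 2/25 + (2/25)\<^sup>2) * (6/7 / (27/10)) * \<rho> + \<rho> / 100)
        + (2/25 + (2/25)\<^sup>2) * (3/4 * \<rho>) + (2/25 + (2/25)\<^sup>2) * (3/4 * \<rho>)"
      by (intro add_mono w order_trans[OF dev dv2]) simp_all
    also have "\<dots> < 49/100 * \<rho>" using par by (simp add: power2_eq_square)
    finally show ?thesis .
  qed
qed

theorem drift:
  assumes "t \<in> S" "\<bar>t\<bar> \<le> s0 * \<rho> / (5 * \<epsilon>) * exp (K * s0 / 6)"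
  shows "norm (x t - x 0) \<le> 9/10 * \<rho>"
proof (cases "15 < K * s0")
  case True
  with drift_long[OF this assms] par show ?thesis by simp
next
  case False
  with drift_short[OF _ assms] show ?thesis by simp
qed

end

section \<open>The spaces of actions and of angles\<close>

definition scale2 :: "complex \<Rightarrow> (complex ^ 'n) \<times> (complex ^ 'm) \<Rightarrow> (complex ^ 'n) \<times> (complex ^ 'm)" where
  "scale2 c = (\<lambda>(I, J). (c *s I, c *s J))"

definition emb2 :: "(real ^ 'n) \<times> (real ^ 'm) \<Rightarrow> (complex ^ 'n) \<times> (complex ^ 'm)" where
  "emb2 = (\<lambda>(x, y). (cvec x, cvec y))"

definition mode2 :: "(int ^ 'n) \<times> (int ^ 'm) \<Rightarrow> (real ^ 'n) \<times> (real ^ 'm)" where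
  "mode2 = (\<lambda>(k, l). (ivec k, ivec l))"

definition dir2 :: "(int ^ 'n) \<times> (int ^ 'm) \<Rightarrow> (complex ^ 'n) \<times> (complex ^ 'm)" where
  "dir2 k = emb2 (mode2 k)"

definition wt2 :: "(int ^ 'n) \<times> (int ^ 'm) \<Rightarrow> real" where
  "wt2 = (\<lambda>(k, l). l1 k + l1 l)"

text \<open>Bilinear without conjugation, so that it is complex linear in the second argument and
  hence holomorphic.\<close>

definition cip2 :: "(real ^ 'n) \<times> (real ^ 'm) \<Rightarrow> (complex ^ 'n) \<times> (complex ^ 'm) \<Rightarrow> complex" where
  "cip2 = (\<lambda>(a, b) (z, w). (\<Sum>i\<in>UNIV. of_real (a $ i) * z $ i) + (\<Sum>j\<in>UNIV. of_real (b $ j) * w $ j))"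

lemma norm_vec_scale: "norm (c *s (z :: complex ^ 'n)) = cmod c * norm z"
  by (simp add: norm_vec_def norm_mult L2_set_right_distrib)

lemma norm_Pair_scale:
  assumes "norm a' = c * norm a" "norm b' = c * norm b" "0 \<le> (c :: real)"
  shows "norm (a', b') = c * norm (a, b)"
proof -
  have "norm (a', b') = sqrt (c\<^sup>2 * ((norm a)\<^sup>2 + (norm b)\<^sup>2))"
    by (simp add: norm_Pair assms power_mult_distrib distrib_left)
  then show ?thesis using assms(3) by (simp add: norm_Pair real_sqrt_mult)
qed

lemma vec_scale_real: "complex_of_real t *s (z :: complex ^ 'n) = t *\<^sub>R z"
  by (simp add: vec_eq_iff complex_eq_iff)

interpretation vec: complex_space "(*s) :: complex \<Rightarrow> complex ^ 'n \<Rightarrow> complex ^ 'n"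
  by unfold_locales (simp_all add: vector_sadd_rdistrib vector_add_ldistrib vector_smult_assoc vec_scale_real norm_vec_scale)

lemma complex_space_scale2: "complex_space (scale2 :: complex \<Rightarrow> (complex ^ 'n) \<times> (complex ^ 'm) \<Rightarrow> _)"
proof
  show "norm (scale2 a v) = cmod a * norm v" for a and v :: "(complex ^ 'n) \<times> (complex ^ 'm)"
    by (cases v) (simp add: scale2_def norm_Pair_scale norm_vec_scale)
qed (auto simp: scale2_def vector_sadd_rdistrib vector_add_ldistrib vector_smult_assoc vec_scale_real)

lemma complex_space_scale4: "complex_space (scale4 :: complex \<Rightarrow> ('n::finite, 'm::finite) phase \<Rightarrow> _)"
proof
  show "norm (scale4 a v) = cmod a * norm v" for a and v :: "('n, 'm) phase"
    by (cases v) (simp add: scale4_def norm_Pair_scale norm_vec_scale)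
qed (auto simp: scale4_def vector_sadd_rdistrib vector_add_ldistrib vector_smult_assoc vec_scale_real)

interpretation prd: complex_space "scale2 :: complex \<Rightarrow> (complex ^ 'n) \<times> (complex ^ 'm) \<Rightarrow> _"
  by (rule complex_space_scale2)

interpretation ph: complex_space "scale4 :: complex \<Rightarrow> ('n::finite, 'm::finite) phase \<Rightarrow> _"
  by (rule complex_space_scale4)

lemma norm_cvec: "norm (cvec x) = norm x"
  by (simp add: norm_vec_def cvec_def)

lemma cvec_add: "cvec (x + y) = cvec x + cvec y"
  by (simp add: cvec_def vec_eq_iff)

lemma cvec_scaleR: "cvec (t *\<^sub>R x) = t *\<^sub>R cvec x"
  by (simp add: cvec_def vec_eq_iff complex_eq_iff)

lemma cvec_zero [simp]: "cvec 0 = 0"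
  by (simp add: cvec_def vec_eq_iff)

lemma linear_cvec: "linear cvec"
  by (rule linearI) (simp_all add: cvec_add cvec_scaleR)

lemma linear_emb2: "linear (emb2 :: (real ^ 'n) \<times> (real ^ 'm) \<Rightarrow> _)"
  by (rule linearI) (auto simp: emb2_def cvec_add cvec_scaleR)

lemma norm_emb2: "norm (emb2 x) = norm x"
  by (cases x) (simp add: emb2_def norm_Pair norm_cvec)

lemma dist_emb2: "dist (emb2 x) (emb2 y) = dist x y"
  by (simp add: dist_norm norm_emb2 flip: linear_diff[OF linear_emb2])

lemma norm_ivec_le: "norm (ivec k) \<le> l1 k"
  unfolding l1_def by (rule order_trans[OF norm_le_l1_cart]) (simp add: ivec_def)

lemma Basis_pair_cases:
  assumes "b \<in> (Basis :: ((real ^ 'n) \<times> (real ^ 'm)) set)"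
  shows "(\<exists>i. b = (axis i 1, 0)) \<or> (\<exists>j. b = (0, axis j 1))"
  using assms by (auto simp: Basis_prod_def Basis_vec_def)

lemma ivec_axis: "ivec (axis i 1) = axis i 1" and ivec_zero [simp]: "ivec 0 = 0"
  by (simp_all add: ivec_def vec_eq_iff axis_def)

lemma abs_sum_mult_le: "(\<Sum>i\<in>UNIV. cmod (of_real (a $ i) * (z :: complex ^ 'n) $ i)) \<le> norm a * norm z"
  using L2_set_mult_ineq[of "\<lambda>i. \<bar>a $ i\<bar>" "\<lambda>i. cmod (z $ i)" UNIV] by (simp add: norm_mult norm_vec_def)

lemma norm_cip2: "cmod (cip2 v z) \<le> norm v * norm z"
proof (cases v; cases z)
  fix a :: "real ^ 'a" and b :: "real ^ 'b" and x y assume v: "v = (a, b)" and z: "z = (x, y)"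
  have "cmod (cip2 v z) \<le> norm a * norm x + norm b * norm y"
    unfolding v z cip2_def prod.case
    by (rule order_trans[OF norm_triangle_ineq add_mono]; rule order_trans[OF norm_sum abs_sum_mult_le])
  also have "\<dots> = (norm a, norm b) \<bullet> (norm x, norm y)" by simp
  also have "\<dots> \<le> norm (norm a, norm b) * norm (norm x, norm y)"
    by (rule norm_cauchy_schwarz)
  finally show ?thesis by (simp add: v z norm_Pair)
qed

lemma torus_space2:
  "torus_space scale2 dir2 wt2 emb2 mode2 (cip2 :: (real ^ 'n) \<times> (real ^ 'm) \<Rightarrow> _)"
proof
  fix k l :: "(int ^ 'n) \<times> (int ^ 'm)"
  show "dir2 (k + l) = dir2 k + dir2 l"
    by (cases k; cases l) (auto simp: dir2_def mode2_def emb2_def cvec_def ivec_def vec_eq_iff)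
  show "norm (dir2 k) \<le> wt2 k"
    by (cases k) (simp add: dir2_def norm_emb2 mode2_def wt2_def
        order_trans[OF norm_Pair_le add_mono[OF norm_ivec_le norm_ivec_le]])
  show "wt2 (k + l) \<le> wt2 k + wt2 l"
  proof (cases k; cases l)
    fix a b c d assume kl: "k = (a, b)" "l = (c, d)"
    have "l1 (x + y) \<le> l1 x + l1 y" for x y :: "int ^ 'q"
      unfolding l1_def sum.distrib[symmetric] by (intro sum_mono) simp
    from this[of a c] this[of b d] show ?thesis by (simp add: kl wt2_def)
  qed
  show "finite {k :: (int ^ 'n) \<times> (int ^ 'm). wt2 k \<le> R}" for R :: real
  proof -
    obtain N :: nat where N: "R \<le> real N" using real_arch_simple by blast
    have "{k. wt2 k \<le> R} \<subseteq> (ibox N \<times> ibox N :: ((int ^ 'n) \<times> (int ^ 'm)) set)"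
    proof
      fix k :: "(int ^ 'n) \<times> (int ^ 'm)" assume "k \<in> {k. wt2 k \<le> R}"
      moreover obtain a b where k: "k = (a, b)" by (cases k)
      ultimately have ab: "l1 a + l1 b \<le> real N" using N by (simp add: wt2_def)
      have "\<bar>real_of_int (a $ i)\<bar> \<le> real N" for i
        using ab abs_le_l1[of a i] l1_nonneg[of b] by linarith
      then have "\<bar>a $ i\<bar> \<le> int N" for i by (metis of_int_abs of_int_le_iff of_int_of_nat_eq)
      then have A: "a \<in> ibox N" by (simp add: ibox_def abs_le_iff minus_le_iff)
      have "\<bar>real_of_int (b $ i)\<bar> \<le> real N" for i
        using ab abs_le_l1[of b i] l1_nonneg[of a] by linarith
      then have "\<bar>b $ i\<bar> \<le> int N" for i by (metis of_int_abs of_int_le_iff of_int_of_nat_eq)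
      then have "b \<in> ibox N" by (simp add: ibox_def abs_le_iff minus_le_iff)
      with A show "k \<in> ibox N \<times> ibox N" by (simp add: k)
    qed
    then show ?thesis by (rule finite_subset) (intro finite_cartesian_product finite_ibox)
  qed
  show "wt2 (0 :: (int ^ 'n) \<times> (int ^ 'm)) = 0" by (simp add: wt2_def l1_def zero_prod_def)
  show "dir2 k = emb2 (mode2 k)" by (rule dir2_def)
  show "mode2 k = 0 \<Longrightarrow> k = 0"
    by (cases k) (auto simp: mode2_def ivec_def vec_eq_iff zero_prod_def)
next
  fix b :: "(real ^ 'n) \<times> (real ^ 'm)" assume "b \<in> Basis"
  then consider i where "b = (axis i 1, 0)" | j where "b = (0, axis j 1)" using Basis_pair_cases by blast
  then show "\<exists>k. mode2 k = b"
  proof cases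
    case 1
    then show ?thesis by (intro exI[of _ "(axis i 1, 0)"]) (simp add: mode2_def ivec_axis)
  next
    case 2
    then show ?thesis by (intro exI[of _ "(0, axis j 1)"]) (simp add: mode2_def ivec_axis)
  qed
next
  fix b :: "(real ^ 'n) \<times> (real ^ 'm)" and k :: "(int ^ 'n) \<times> (int ^ 'm)" assume "b \<in> Basis"
  then show "mode2 k \<bullet> b \<in> \<int>"
    using Basis_pair_cases[of b] by (cases k) (auto simp: mode2_def inner_axis ivec_def)
next
  fix v :: "(real ^ 'n) \<times> (real ^ 'm)" and z z' c
  show "cip2 v (z + z') = cip2 v z + cip2 v z'"
    by (cases v; cases z; cases z') (simp add: cip2_def distrib_left sum.distrib)
  show "cip2 v (scale2 c z) = c * cip2 v z"
    by (cases v; cases z) (simp add: cip2_def scale2_def distrib_left sum_distrib_left mult_ac)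
  show "cip2 v (emb2 x) = complex_of_real (v \<bullet> x)" for x
    by (cases v; cases x) (simp add: cip2_def emb2_def cvec_def inner_vec_def)
  show "cmod (cip2 v z) \<le> norm v * norm z" by (rule norm_cip2)
qed (simp_all add: linear_add[OF linear_emb2] linear_scale[OF linear_emb2] norm_emb2)

lemma cube_pair: "(cube :: ((real ^ 'n) \<times> (real ^ 'm)) set) = cbox 0 (\<chi> i. 2 * pi) \<times> cbox 0 (\<chi> j. 2 * pi)"
proof (rule set_eqI)
  fix x :: "(real ^ 'n) \<times> (real ^ 'm)"
  obtain a b where x: "x = (a, b)" by (cases x)
  have B: "(axis i 1, 0) \<in> (Basis :: ((real ^ 'n) \<times> (real ^ 'm)) set)"
    "(0, axis j 1) \<in> (Basis :: ((real ^ 'n) \<times> (real ^ 'm)) set)" for i j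
    by (auto simp: Basis_prod_def Basis_vec_def)
  have "x \<in> cube \<longleftrightarrow> (\<forall>i. 0 \<le> a $ i \<and> a $ i \<le> 2 * pi) \<and> (\<forall>j. 0 \<le> b $ j \<and> b $ j \<le> 2 * pi)"
  proof
    assume "x \<in> cube"
    then have "0 \<le> x \<bullet> b' \<and> x \<bullet> b' \<le> 2 * pi" if "b' \<in> Basis" for b' using that by (simp add: mem_cube)
    from this[OF B(1)] this[OF B(2)]
    show "(\<forall>i. 0 \<le> a $ i \<and> a $ i \<le> 2 * pi) \<and> (\<forall>j. 0 \<le> b $ j \<and> b $ j \<le> 2 * pi)"
      by (simp add: x inner_axis)
  next
    assume *: "(\<forall>i. 0 \<le> a $ i \<and> a $ i \<le> 2 * pi) \<and> (\<forall>j. 0 \<le> b $ j \<and> b $ j \<le> 2 * pi)"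
    show "x \<in> cube" unfolding mem_cube
    proof
      fix b' :: "(real ^ 'n) \<times> (real ^ 'm)" assume "b' \<in> Basis"
      from Basis_pair_cases[OF this] show "0 \<le> x \<bullet> b' \<and> x \<bullet> b' \<le> 2 * pi"
        using * by (auto simp: x inner_axis)
    qed
  qed
  then show "x \<in> cube \<longleftrightarrow> x \<in> cbox 0 (\<chi> i. 2 * pi) \<times> cbox 0 (\<chi> j. 2 * pi)"
    by (simp add: x mem_box_cart)
qed

section \<open>Neighbourhoods of the domain\<close>

lemma infdist_less_iff: "A \<noteq> {} \<Longrightarrow> infdist x A < r \<longleftrightarrow> (\<exists>a\<in>A. dist x a < r)"
  by (simp add: infdist_notempty cINF_less_iff)

lemma mem_V: "D \<noteq> {} \<Longrightarrow> I \<in> V r D \<longleftrightarrow> (\<exists>a\<in>D. dist I (cvec a) < r)"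
  by (simp add: V_def infdist_less_iff)

lemma mem_Vbar: "D \<noteq> {} \<Longrightarrow> (I, J) \<in> Vbar r D \<longleftrightarrow> (\<exists>a\<in>D. \<exists>b. dist (I, J) (cvec a, cvec b) < r)"
  unfolding Vbar_def by (simp add: infdist_less_iff)

lemma open_V: "open (V r D)"
  unfolding V_def by (intro open_Collect_less continuous_intros)

lemma open_Vbar: "open (Vbar r D)"
  unfolding Vbar_def by (intro open_Collect_less continuous_intros)

lemma ball_subset_Vbar:
  assumes "a \<in> D" shows "ball (emb2 (a, b)) r \<subseteq> Vbar r D"
proof
  fix z assume "z \<in> ball (emb2 (a, b)) r"
  then show "z \<in> Vbar r D"
    using assms mem_Vbar[of D "fst z" "snd z" r] by (auto simp: emb2_def dist_commute)
qed

lemma Vbar_fst: "D \<noteq> {} \<Longrightarrow> (I, J) \<in> Vbar r D \<Longrightarrow> I \<in> V r D"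
  unfolding mem_Vbar mem_V using order.strict_trans1[OF dist_fst_le[of "(I, J)" "(_, _)"]] by fastforce

lemma U_Vbar: "D \<noteq> {} \<Longrightarrow> I \<in> U r D \<Longrightarrow> (cvec I, cvec J) \<in> Vbar r D"
proof -
  assume D: "D \<noteq> {}" and I: "I \<in> U r D"
  obtain a where a: "a \<in> D" "dist (cvec I) (cvec a) < r" using I by (auto simp: U_def mem_V[OF D])
  then have "dist (cvec I, cvec J) (cvec a, cvec J) < r" by (simp add: dist_Pair_Pair)
  then show ?thesis unfolding mem_Vbar[OF D] using a(1) by blast
qed

lemma D_subset_U: "r > 0 \<Longrightarrow> a \<in> D \<Longrightarrow> a \<in> U r D"
  unfolding U_def mem_Collect_eq by (subst mem_V) (auto intro!: bexI[of _ a])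

section \<open>Variation of the frequency\<close>

lemma partial_eq: "partial F i = vec.dd (axis i 1) (F :: complex ^ 'n \<Rightarrow> complex)"
proof
  fix x :: "complex ^ 'n"
  have "s *s axis i 1 = (axis i s :: complex ^ 'n)" for s by (simp add: vec_eq_iff axis_def)
  then show "partial F i x = vec.dd (axis i 1) F x" by (simp add: partial_def vec.dd_def)
qed

lemma vec_dd_expand:
  assumes "vec.holo F S" "x \<in> S"
  shows "vec.dd c F x = (\<Sum>j\<in>UNIV. c $ j * vec.dd (axis j 1) F x)"
proof -
  have "vec.dd c F x = vec.dd (\<Sum>j\<in>UNIV. c $ j *s axis j 1) F x" by (simp only: basis_expansion)
  moreover
  have "vec.dd (\<Sum>j\<in>I. c $ j *s axis j 1) F x = (\<Sum>j\<in>I. c $ j * vec.dd (axis j 1) F x)" if "finite I" for I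
    using that by (induction rule: finite_induct)
      (simp_all add: vec.dd_zero_dir[OF assms] vec.holo_has_derivative(2,3)[OF assms])
  from this[OF finite] have "vec.dd (\<Sum>j\<in>UNIV. c $ j *s axis j 1) F x = (\<Sum>j\<in>UNIV. c $ j * vec.dd (axis j 1) F x)" .
  ultimately show ?thesis by (rule trans)
qed

text \<open>The mixed derivative is the bilinear pairing of w with the Hessian applied to c. Its
  modulus is bounded by Cauchy-Schwarz for the moduli of the coordinates.\<close>

lemma second_derivative_bound:
  assumes "open S" "vec.holo h S" "y \<in> S" "onorm (\<lambda>v. hessian h y *v v) \<le> M"
  shows "cmod (vec.dd w (vec.dd c h) y) \<le> M * norm c * norm w"
proof -
  have hd: "vec.holo (vec.dd v h) S" for v by (rule vec.holo_dd[OF assms(1,2)])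
  have comp: "vec.dd (axis i 1) (vec.dd c h) y = (hessian h y *v c) $ i" for i
  proof -
    have "vec.dd (axis i 1) (vec.dd c h) y = vec.dd (axis i 1) (\<lambda>x. \<Sum>j\<in>UNIV. c $ j * vec.dd (axis j 1) h x) y"
      by (rule vec.dd_cong[OF assms(1) _ assms(3)]) (rule vec_dd_expand[OF assms(2)])
    also have "\<dots> = (\<Sum>j\<in>UNIV. c $ j * vec.dd (axis i 1) (vec.dd (axis j 1) h) y)"
      by (subst vec.dd_sum[OF vec.holo_cmult[OF hd] assms(3)]) (simp add: vec.dd_cmult[OF hd assms(3)])
    finally show ?thesis by (simp add: matrix_vector_mult_def hessian_def partial_eq mult.commute)
  qed
  have "vec.dd w (vec.dd c h) y = (\<Sum>i\<in>UNIV. w $ i * (hessian h y *v c) $ i)"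
    by (subst vec_dd_expand[OF hd assms(3)]) (simp only: comp)
  also have "cmod \<dots> \<le> (\<Sum>i\<in>UNIV. \<bar>cmod (w $ i)\<bar> * \<bar>cmod ((hessian h y *v c) $ i)\<bar>)"
    by (rule order_trans[OF norm_sum]) (simp add: norm_mult)
  also have "\<dots> \<le> norm w * norm (hessian h y *v c)"
    unfolding norm_vec_def by (rule L2_set_mult_ineq)
  also have "\<dots> \<le> norm w * (onorm (\<lambda>v. hessian h y *v v) * norm c)"
    by (intro mult_left_mono onorm) auto
  also have "\<dots> \<le> norm w * (M * norm c)"
    using assms(4) by (intro mult_left_mono mult_right_mono) auto
  finally show ?thesis by (simp add: mult_ac)
qed

lemma derivative_variation:
  assumes S: "open S" "vec.holo h S" and H: "\<And>y. y \<in> S \<Longrightarrow> onorm (\<lambda>v. hessian h y *v v) \<le> M"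
    and seg: "closed_segment a b \<subseteq> S"
  shows "cmod (vec.dd c h b - vec.dd c h a) \<le> M * norm c * norm (b - a)"
proof -
  have hd: "vec.holo (vec.dd c h) S" by (rule vec.holo_dd[OF S])
  show ?thesis
  proof (rule differentiable_bound[OF convex_closed_segment])
    show "(vec.dd c h has_derivative (\<lambda>w. vec.dd w (vec.dd c h) y)) (at y within closed_segment a b)"
      if "y \<in> closed_segment a b" for y
      using vec.holo_has_derivative(1)[OF hd] seg that has_derivative_at_withinI by blast
    show "onorm (\<lambda>w. vec.dd w (vec.dd c h) y) \<le> M * norm c" if "y \<in> closed_segment a b" for y
    proof -
      have yS: "y \<in> S" using that seg by blast
      show ?thesis by (rule onorm_le) (rule second_derivative_bound[OF S yS H[OF yS]])
    qed
  qed auto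
qed

text \<open>As h is real at real points, the derivative in a real direction has imaginary part 0;
  hence the gradient of the real part carries the complete complex derivative.\<close>

lemma real_gradient_dd:
  assumes "open S" "vec.holo h S" "cvec I \<in> S" and re: "\<And>x. cvec x \<in> S \<Longrightarrow> h (cvec x) \<in> \<real>"
  shows "complex_of_real (v \<bullet> real_gradient h I) = vec.dd (cvec v) h (cvec I)"
proof -
  have comp: "complex_of_real (real_gradient h I $ i) = vec.dd (axis i 1) h (cvec I)" for i
  proof -
    let ?d = "vec.dd (axis i 1) h (cvec I)" and ?p = "\<lambda>s :: real. h (cvec I + complex_of_real s *s axis i 1)"
    have e: "cvec I + complex_of_real s *s axis i 1 = cvec (I + axis i s)" for s
      by (simp add: vec_eq_iff cvec_def axis_def)
    have d: "(?p has_vector_derivative ?d) (at 0)"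
      by (rule has_vector_derivative_real_field) (use vec.holo_line0[OF assms(2,3)] in simp)
    have "((\<lambda>s. Re (?p s)) has_real_derivative Re ?d) (at 0)"
      using bounded_linear.has_vector_derivative[OF bounded_linear_Re d]
      by (simp add: has_real_derivative_iff_has_vector_derivative)
    then have "real_gradient h I $ i = Re ?d"
      by (simp add: real_gradient_def gradient_def partial_def e DERIV_imp_deriv)
    moreover have "Im ?d = 0"
    proof -
      have d1: "((\<lambda>s. Im (?p s)) has_real_derivative Im ?d) (at 0)"
        using bounded_linear.has_vector_derivative[OF bounded_linear_Im d]
        by (simp add: has_real_derivative_iff_has_vector_derivative)
      have "((\<lambda>s. cvec I + complex_of_real s *s axis i 1) \<longlongrightarrow> cvec I + 0 *\<^sub>R axis i 1) (nhds 0)"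
        unfolding vec_scale_real by (intro tendsto_intros filterlim_ident)
      from topological_tendstoD[OF this assms(1)]
      have "\<forall>\<^sub>F s in nhds 0. cvec I + complex_of_real s *s axis i 1 \<in> S" using assms(3) by simp
      then have ev: "\<forall>\<^sub>F s in nhds 0. Im (?p s) = 0"
        by (rule eventually_mono) (use re in \<open>auto simp: e complex_is_Real_iff\<close>)
      then have "((\<lambda>s. 0) has_real_derivative Im ?d) (at (0::real))"
        using iffD1[OF DERIV_cong_ev[OF refl ev refl] d1] by simp
      from DERIV_unique[OF this DERIV_const] show ?thesis .
    qed
    ultimately show ?thesis by (simp add: complex_eq_iff)
  qed
  have "cvec v $ j = complex_of_real (v $ j)" for j by (simp add: cvec_def)
  then show ?thesis
    by (subst vec_dd_expand[OF assms(2,3)]) (simp add: inner_vec_def comp[symmetric])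
qed

section \<open>The Hamiltonian vector field\<close>

lemma (in complex_space) holo_locally_lipschitz:
  assumes "open S" "holo F S" "x \<in> S"
  shows "\<exists>e>0. \<exists>L. cball x e \<subseteq> S \<and> (\<forall>y\<in>cball x e. \<forall>z\<in>cball x e. cmod (F y - F z) \<le> L * dist y z)"
proof -
  obtain R C where R: "R > 0" "ball x R \<subseteq> S" "\<And>y. y \<in> ball x R \<Longrightarrow> cmod (F y) \<le> C" "C > 0"
    using holo_locally_bounded[OF assms] by blast
  have h: "holo F (ball x R)" by (rule holo_subset[OF assms(2) R(2)])
  have sub: "cball x (R / 4) \<subseteq> ball x R" using R(1) by auto
  have "cmod (F y - F z) \<le> C / (R / 2) * norm (y - z)" if "y \<in> cball x (R / 4)" "z \<in> cball x (R / 4)" for y z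
  proof (rule differentiable_bound[OF convex_cball[of x "R / 4"] _ _ that])
    fix w assume w: "w \<in> cball x (R / 4)"
    show "(F has_derivative (\<lambda>v. dd v F w)) (at w within cball x (R / 4))"
      using holo_has_derivative(1)[OF h] sub w has_derivative_at_withinI by blast
    show "onorm (\<lambda>v. dd v F w) \<le> C / (R / 2)"
    proof (rule onorm_le)
      fix v
      have "cmod (dd v F w) \<le> C * norm v / (R / 2)"
      proof (rule dd_bound)
        show "holo F (ball x R)" by (rule h)
        show "w \<in> ball x (R - R / 2)" using w R(1) by simp
      qed (use R in auto)
      then show "cmod (dd v F w) \<le> C / (R / 2) * norm v" by (simp add: mult_ac)
    qed
  qed
  then have "\<forall>y\<in>cball x (R / 4). \<forall>z\<in>cball x (R / 4). cmod (F y - F z) \<le> C / (R / 2) * dist y z"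
    unfolding dist_norm by blast
  moreover have "cball x (R / 4) \<subseteq> S" using sub R(2) by (rule subset_trans)
  moreover have "R / 4 > 0" using R(1) by simp
  ultimately show ?thesis by blast
qed

lemma locally_lipschitz_on_components:
  fixes X :: "'a::metric_space \<Rightarrow> 'b::euclidean_space"
  assumes "\<And>x b. x \<in> W \<Longrightarrow> b \<in> Basis \<Longrightarrow>
    \<exists>e>0. \<exists>L. cball x e \<subseteq> W \<and> (\<forall>y\<in>cball x e. \<forall>z\<in>cball x e. \<bar>X y \<bullet> b - X z \<bullet> b\<bar> \<le> L * dist y z)"
  shows "locally_lipschitz_on W X"
  unfolding locally_lipschitz_on_def
proof
  fix x assume x: "x \<in> W"
  define Q where "Q b e L \<longleftrightarrow> e > 0 \<and> cball x e \<subseteq> W \<and> (\<forall>y\<in>cball x e. \<forall>z\<in>cball x e. \<bar>X y \<bullet> b - X z \<bullet> b\<bar> \<le> L * dist y z)" for b e L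
  have "\<forall>b\<in>Basis. \<exists>e L. Q b e L" using assms[OF x] unfolding Q_def by blast
  then obtain e L where eL: "\<And>b. b \<in> Basis \<Longrightarrow> Q b (e b) (L b)" by metis
  define e0 where "e0 = Min (e ` Basis)"
  have e0: "e0 > 0" using eL by (auto simp: e0_def Q_def)
  have le: "e0 \<le> e b" if "b \<in> Basis" for b using that by (simp add: e0_def)
  have sub: "cball x e0 \<subseteq> cball x (e b)" if "b \<in> Basis" for b using le[OF that] by (intro subset_cball)
  have "cball x e0 \<subseteq> W" using sub[OF SOME_Basis] eL[OF SOME_Basis] by (auto simp: Q_def)
  moreover have "dist (X y) (X z) \<le> (\<Sum>b\<in>Basis. L b) * dist y z" if "y \<in> cball x e0" "z \<in> cball x e0" for y z
  proof -
    have "dist (X y) (X z) \<le> (\<Sum>b\<in>Basis. \<bar>(X y - X z) \<bullet> b\<bar>)" unfolding dist_norm by (rule norm_le_l1)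
    also have "\<dots> \<le> (\<Sum>b\<in>Basis. L b * dist y z)"
    proof (rule sum_mono)
      fix b :: 'b assume b: "b \<in> Basis"
      have "y \<in> cball x (e b)" "z \<in> cball x (e b)" using that sub[OF b] by auto
      then show "\<bar>(X y - X z) \<bullet> b\<bar> \<le> L b * dist y z"
        using eL[OF b] unfolding Q_def inner_diff_left by blast
    qed
    finally show ?thesis by (simp add: sum_distrib_right)
  qed
  ultimately show "\<exists>e>0. \<exists>L. cball x e \<subseteq> W \<and> (\<forall>y\<in>cball x e. \<forall>z\<in>cball x e. dist (X y) (X z) \<le> L * dist y z)"
    using e0 by blast
qed

lemma bounded_linear_cvec: "bounded_linear cvec"
  using linear_cvec by (simp add: linear_conv_bounded_linear)

lemma bounded_linear_cip2: "bounded_linear (cip2 v)"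
proof (rule bounded_linear_intro[where K = "norm v"])
  interpret torus_space scale2 dir2 wt2 "0 :: (complex ^ 'a) \<times> (complex ^ 'b)" emb2 mode2 cip2
    by (rule torus_space2)
  show "cip2 v (x + y) = cip2 v x + cip2 v y" for x y by (rule cip_add)
  show "cip2 v (t *\<^sub>R x) = t *\<^sub>R cip2 v x" for t x
    using cip_sc[of v "of_real t" x] by (simp add: prd.sc_of_real scaleR_conv_of_real)
  show "norm (cip2 v x) \<le> norm x * norm v" for x using norm_cip2[of v x] by (simp add: mult.commute)
qed

lemma cip2_scale: "cip2 v (scale2 c z) = c * cip2 v z"
proof -
  interpret torus_space scale2 dir2 wt2 "0 :: (complex ^ 'a) \<times> (complex ^ 'b)" emb2 mode2 cip2
    by (rule torus_space2)
  show ?thesis by (rule cip_sc)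
qed

definition emb4 :: "((real ^ 'n) \<times> (real ^ 'm)) \<times> ((real ^ 'n) \<times> (real ^ 'm)) \<Rightarrow> ('n::finite, 'm::finite) phase" where
  "emb4 = (\<lambda>(\<Theta>, x). (cvec (fst \<Theta>), cvec (snd \<Theta>), emb2 x))"

lemma emb4_add: "emb4 (p + q) = emb4 p + emb4 q"
  by (simp add: emb4_def case_prod_beta cvec_add linear_add[OF linear_emb2])

lemma emb4_scaleR: "emb4 (t *\<^sub>R p) = t *\<^sub>R emb4 p"
  by (simp add: emb4_def case_prod_beta cvec_scaleR linear_scale[OF linear_emb2])

lemma norm_emb4: "norm (emb4 p) = norm p"
  by (cases p; cases "fst p") (simp add: emb4_def norm_Pair norm_cvec norm_emb2)

lemma dist_emb4: "dist (emb4 p) (emb4 q) = dist p q"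
  using emb4_add[of "p - q" q] norm_emb4[of "p - q"] by (simp add: dist_norm)

lemma scale4_action: "scale4 c (0, 0, v) = (0, 0, scale2 c v)"
  by (cases v) (simp add: scale4_def scale2_def)

lemma emb4_action: "emb4 (0, v) = (0, 0, emb2 v)"
  by (simp add: emb4_def)

lemma open_strip: "open (strip s :: ((complex ^ 'n) \<times> (complex ^ 'm)) set)"
proof -
  have "strip s = (\<Inter>i. {p :: (complex ^ 'n) \<times> (complex ^ 'm). \<bar>Im (fst p $ i)\<bar> < s}) \<inter> (\<Inter>j. {p. \<bar>Im (snd p $ j)\<bar> < s})"
    by (auto simp: strip_def)
  also have "open \<dots>" by (intro open_Int open_INT ballI open_Collect_less continuous_intros) auto
  finally show ?thesis .
qed

locale perturbed_hamiltonian =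
  fixes D :: "(real ^ 'n) set" and h :: "complex ^ 'n \<Rightarrow> complex" and \<alpha> :: "real ^ 'm" and r0 s0 :: real
    and f :: "('n, 'm) phase \<Rightarrow> complex"
  assumes ne: "D \<noteq> {}" and r0: "r0 > 0" and s0: "s0 > 0" and hip: "analytic_integrable_part r0 D h"
    and pert: "analytic_perturbation r0 s0 D f"
begin

definition n2 :: "(complex ^ 'n) \<times> (complex ^ 'm) \<Rightarrow> complex" where
  "n2 z = h (fst z) + cip2 (0, \<alpha>) z"

text \<open>The angles are real parameters and only the actions are complex variables, in accordance
  with coefficient families that are functions of the actions.\<close>

definition g2 :: "(real ^ 'n) \<times> (real ^ 'm) \<Rightarrow> (complex ^ 'n) \<times> (complex ^ 'm) \<Rightarrow> complex" where
  "g2 \<Theta> z = f (cvec (fst \<Theta>), cvec (snd \<Theta>), z)"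

definition dom4 :: "('n, 'm) phase set" where
  "dom4 = (\<lambda>p. (fst p, fst (snd p))) -` strip s0 \<inter> (\<lambda>p. snd (snd p)) -` Vbar r0 D"

definition Hc :: "('n, 'm) phase \<Rightarrow> complex" where
  "Hc p = n2 (snd (snd p)) + f p"

lemma Hc_eq: "hamiltonian h \<alpha> f = Hc"
  by (auto simp: fun_eq_iff hamiltonian_def Hc_def n2_def cip2_def)

lemma open_dom4: "open dom4"
  unfolding dom4_def by (intro open_Int open_vimage open_strip open_Vbar continuous_intros)

lemma f_holo: "ph.holo f dom4"
proof -
  have "dom4 = {(\<theta>, \<phi>, I, J). (\<theta>, \<phi>) \<in> strip s0 \<and> (I, J) \<in> Vbar r0 D}"
    by (auto simp: dom4_def)
  then show ?thesis using pert by (simp add: analytic_perturbation_def)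
qed

lemma h_holo: "vec.holo h (V r0 D)" and h_real: "cvec I \<in> V r0 D \<Longrightarrow> h (cvec I) \<in> \<real>"
  using hip by (auto simp: analytic_integrable_part_def U_def)

lemma strip_real: "(cvec \<theta>, cvec \<phi>) \<in> strip s0"
  using s0 by (simp add: strip_def cvec_def)

lemma dom4_real: "z \<in> Vbar r0 D \<Longrightarrow> (cvec \<theta>, cvec \<phi>, z) \<in> dom4"
  by (simp add: dom4_def strip_real)

lemma emb2_U: "fst x \<in> U r0 D \<longleftrightarrow> emb2 x \<in> Vbar r0 D"
  using U_Vbar[OF ne, of "fst x" r0 "snd x"] Vbar_fst[OF ne, of "cvec (fst x)" "cvec (snd x)" r0]
  by (auto simp: emb2_def case_prod_beta U_def)

lemma emb4_dom4: "emb4 (\<Theta>, x) \<in> dom4 \<longleftrightarrow> fst x \<in> U r0 D"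
  by (simp add: emb4_def emb2_U dom4_def strip_real)

lemma n2_has_derivative:
  assumes "z \<in> Vbar r0 D"
  shows "(n2 has_derivative (\<lambda>v. vec.dd (fst v) h (fst z) + cip2 (0, \<alpha>) v)) (at z)"
proof -
  have "fst z \<in> V r0 D" using Vbar_fst[OF ne, of "fst z" "snd z"] assms by simp
  from has_derivative_compose[OF has_derivative_fst[OF has_derivative_ident] vec.holo_has_derivative(1)[OF h_holo this]]
  have "((\<lambda>z. h (fst z)) has_derivative (\<lambda>v. vec.dd (fst v) h (fst z))) (at z)" by simp
  from has_derivative_add[OF this bounded_linear_imp_has_derivative[OF bounded_linear_cip2[of "(0, \<alpha>)"]]]
  show ?thesis unfolding n2_def[abs_def] .
qed

lemma n2_linear:
  assumes "z \<in> Vbar r0 D"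
  shows "vec.dd (fst (scale2 c v)) h (fst z) + cip2 (0, \<alpha>) (scale2 c v) = c * (vec.dd (fst v) h (fst z) + cip2 (0, \<alpha>) v)"
proof -
  have "fst z \<in> V r0 D" using Vbar_fst[OF ne, of "fst z" "snd z"] assms by simp
  moreover have "fst (scale2 c v) = c *s fst v" by (cases v) (simp add: scale2_def)
  ultimately show ?thesis
    by (simp add: vec.holo_has_derivative(2)[OF h_holo] cip2_scale distrib_left)
qed

lemma n2_holo: "prd.holo n2 (Vbar r0 D)"
  unfolding holomorphic_wrt_def using n2_has_derivative n2_linear by blast

lemma dd_n2: "z \<in> Vbar r0 D \<Longrightarrow> prd.dd v n2 z = vec.dd (fst v) h (fst z) + cip2 (0, \<alpha>) v"
  using prd.dd_eqI[OF n2_has_derivative n2_linear] by blast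

lemma n2_snd_holo: "ph.holo (\<lambda>p. n2 (snd (snd p))) dom4"
  unfolding holomorphic_wrt_def
proof
  fix p assume "p \<in> dom4"
  then have p: "snd (snd p) \<in> Vbar r0 D" by (simp add: dom4_def)
  have "((\<lambda>p :: ('n, 'm) phase. snd (snd p)) has_derivative (\<lambda>p. snd (snd p))) (at p)"
    by (intro has_derivative_snd has_derivative_ident)
  from has_derivative_compose[OF this prd.holo_has_derivative(1)[OF n2_holo p]]
  have "((\<lambda>p. n2 (snd (snd p))) has_derivative (\<lambda>w. prd.dd (snd (snd w)) n2 (snd (snd p)))) (at p)" .
  moreover have "snd (snd (scale4 c w)) = scale2 c (snd (snd w))" for c and w :: "('n, 'm) phase"
    by (cases w) (simp add: scale4_def scale2_def)
  ultimately show "\<exists>F'. ((\<lambda>p. n2 (snd (snd p))) has_derivative F') (at p) \<and> (\<forall>c v. F' (scale4 c v) = c * F' v)"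
    using prd.holo_has_derivative(2)[OF n2_holo p] by auto
qed

lemma Hc_holo: "ph.holo Hc dom4"
  unfolding Hc_def[abs_def] by (rule ph.holo_add[OF n2_snd_holo f_holo])

lemma g2_holo: "prd.holo (g2 \<Theta>) (Vbar r0 D)"
  unfolding holomorphic_wrt_def
proof
  fix z :: "(complex ^ 'n) \<times> (complex ^ 'm)" assume z: "z \<in> Vbar r0 D"
  let ?p = "(cvec (fst \<Theta>), cvec (snd \<Theta>), z)"
  have "((\<lambda>z. (cvec (fst \<Theta>), cvec (snd \<Theta>), z)) has_derivative (\<lambda>v. (0, 0, v))) (at z)"
    by (intro has_derivative_Pair has_derivative_const has_derivative_ident)
  from has_derivative_compose[OF this ph.holo_has_derivative(1)[OF f_holo dom4_real[OF z]]]
  have "(g2 \<Theta> has_derivative (\<lambda>v. ph.dd (0, 0, v) f ?p)) (at z)" unfolding g2_def[abs_def] .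
  moreover have "ph.dd (0, 0, scale2 c v) f ?p = c * ph.dd (0, 0, v) f ?p" for c v
    using ph.holo_has_derivative(2)[OF f_holo dom4_real[OF z], of c "(0, 0, v)"] by (simp add: scale4_action)
  ultimately show "\<exists>F'. (g2 \<Theta> has_derivative F') (at z) \<and> (\<forall>c v. F' (scale2 c v) = c * F' v)" by blast
qed

lemma dd_g2: "prd.dd v (g2 \<Theta>) z = ph.dd (0, 0, v) f (cvec (fst \<Theta>), cvec (snd \<Theta>), z)"
  unfolding prd.dd_def ph.dd_def by (simp add: g2_def scale4_action)

lemma dd_Hc_action:
  assumes "z \<in> Vbar r0 D"
  shows "ph.dd (0, 0, v) Hc (cvec (fst \<Theta>), cvec (snd \<Theta>), z) = prd.dd v n2 z + prd.dd v (g2 \<Theta>) z"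
proof -
  have "ph.dd (0, 0, v) Hc (cvec (fst \<Theta>), cvec (snd \<Theta>), z) = prd.dd v (\<lambda>z. n2 z + g2 \<Theta> z) z"
    unfolding prd.dd_def ph.dd_def by (simp add: g2_def scale4_action Hc_def)
  then show ?thesis by (simp add: prd.dd_add[OF n2_holo g2_holo assms])
qed

lemma Hc_real: "fst x \<in> U r0 D \<Longrightarrow> Im (Hc (emb4 (\<Theta>, x))) = 0"
proof -
  assume x: "fst x \<in> U r0 D"
  have "f (cvec (fst \<Theta>), cvec (snd \<Theta>), cvec (fst x), cvec (snd x)) \<in> \<real>"
    using pert x by (auto simp: analytic_perturbation_def)
  moreover have "h (cvec (fst x)) \<in> \<real>" using h_real x by (simp add: U_def)
  moreover have "Im (cip2 (0, \<alpha>) (emb2 x)) = 0"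
    by (cases x) (simp add: cip2_def emb2_def cvec_def)
  ultimately show ?thesis
    by (cases x) (simp add: Hc_def n2_def emb4_def complex_is_Real_iff emb2_def)
qed

lemma Hc_direction:
  assumes x: "fst x \<in> U r0 D"
  shows "((\<lambda>s. Hc (emb4 ((\<Theta>, x) + s *\<^sub>R w))) has_vector_derivative ph.dd (emb4 w) Hc (emb4 (\<Theta>, x))) (at 0)"
    and "Im (ph.dd (emb4 w) Hc (emb4 (\<Theta>, x))) = 0"
proof -
  let ?d = "ph.dd (emb4 w) Hc (emb4 (\<Theta>, x))" and ?p = "\<lambda>s :: real. Hc (emb4 ((\<Theta>, x) + s *\<^sub>R w))"
  have p: "emb4 (\<Theta>, x) \<in> dom4" using x by (simp add: emb4_dom4)
  have e: "emb4 ((\<Theta>, x) + s *\<^sub>R w) = emb4 (\<Theta>, x) + scale4 (of_real s) (emb4 w)" for s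
    by (simp add: emb4_add emb4_scaleR ph.sc_of_real)
  show d: "(?p has_vector_derivative ?d) (at 0)"
    unfolding e by (rule has_vector_derivative_real_field) (use ph.holo_line0[OF Hc_holo p] in simp)
  have d1: "((\<lambda>s. Im (?p s)) has_real_derivative Im ?d) (at 0)"
    using bounded_linear.has_vector_derivative[OF bounded_linear_Im d]
    by (simp add: has_real_derivative_iff_has_vector_derivative)
  have "((\<lambda>s. emb4 (\<Theta>, x) + s *\<^sub>R emb4 w) \<longlongrightarrow> emb4 (\<Theta>, x) + 0 *\<^sub>R emb4 w) (nhds 0)"
    by (intro tendsto_intros filterlim_ident)
  from topological_tendstoD[OF this open_dom4] p
  have "\<forall>\<^sub>F s in nhds 0. emb4 ((\<Theta>, x) + s *\<^sub>R w) \<in> dom4" by (simp add: emb4_add emb4_scaleR)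
  then have ev: "\<forall>\<^sub>F s in nhds 0. Im (?p s) = 0"
  proof (rule eventually_mono)
    fix s assume "emb4 ((\<Theta>, x) + s *\<^sub>R w) \<in> dom4"
    moreover obtain \<Theta>' x' where "(\<Theta>, x) + s *\<^sub>R w = (\<Theta>', x')" by (rule prod.exhaust)
    ultimately show "Im (?p s) = 0" using Hc_real[of x' \<Theta>'] by (simp add: emb4_dom4)
  qed
  have "((\<lambda>s. 0) has_real_derivative Im ?d) (at (0::real))"
    using iffD1[OF DERIV_cong_ev[OF refl ev refl] d1] by simp
  from DERIV_unique[OF this DERIV_const] show "Im ?d = 0" .
qed

abbreviation RH where "RH \<equiv> real_hamiltonian (hamiltonian h \<alpha> f)"

text \<open>The gradient in both actions, that is the velocity of the angles; \<open>gT\<close>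
  below is the gradient in the angles, the negative velocity of the actions.\<close>

definition gA :: "(real ^ 'n) \<times> (real ^ 'm) \<Rightarrow> (real ^ 'n) \<times> (real ^ 'm) \<Rightarrow> (real ^ 'n) \<times> (real ^ 'm)" where
  "gA \<Theta> x = (gradient (\<lambda>I. RH (fst \<Theta>) (snd \<Theta>) I (snd x)) (fst x), gradient (\<lambda>J. RH (fst \<Theta>) (snd \<Theta>) (fst x) J) (snd x))"

definition gT :: "(real ^ 'n) \<times> (real ^ 'm) \<Rightarrow> (real ^ 'n) \<times> (real ^ 'm) \<Rightarrow> (real ^ 'n) \<times> (real ^ 'm)" where
  "gT \<Theta> x = (gradient (\<lambda>\<theta>. RH \<theta> (snd \<Theta>) (fst x) (snd x)) (fst \<Theta>), gradient (\<lambda>\<phi>. RH (fst \<Theta>) \<phi> (fst x) (snd x)) (snd \<Theta>))"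

lemma RH_eq: "RH \<theta> \<phi> I J = Re (Hc (emb4 ((\<theta>, \<phi>), (I, J))))"
  by (simp add: real_hamiltonian_def Hc_eq emb4_def emb2_def)

lemma axis_scale: "axis i s = s *\<^sub>R (axis i 1 :: real ^ 'k)"
  by (simp add: vec_eq_iff axis_def)

lemma partial_direction:
  assumes "fst x \<in> U r0 D" "\<And>s. F (y + axis i s) = Re (Hc (emb4 ((\<Theta>, x) + s *\<^sub>R w)))"
  shows "complex_of_real (partial F i y) = ph.dd (emb4 w) Hc (emb4 (\<Theta>, x))"
proof -
  have "((\<lambda>s. F (y + axis i s)) has_real_derivative Re (ph.dd (emb4 w) Hc (emb4 (\<Theta>, x)))) (at 0)"
    unfolding assms(2) using bounded_linear.has_vector_derivative[OF bounded_linear_Re Hc_direction(1)[OF assms(1), of \<Theta> w]]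
    by (simp add: has_real_derivative_iff_has_vector_derivative)
  then have "partial F i y = Re (ph.dd (emb4 w) Hc (emb4 (\<Theta>, x)))"
    unfolding partial_def by (rule DERIV_imp_deriv)
  then show ?thesis using Hc_direction(2)[OF assms(1), of w \<Theta>] by (simp add: complex_eq_iff)
qed

lemma linear_dd_Hc:
  assumes "fst x \<in> U r0 D" "linear e"
  shows "linear (\<lambda>v. ph.dd (emb4 (e v)) Hc (emb4 (\<Theta>, x)))"
proof -
  have p: "emb4 (\<Theta>, x) \<in> dom4" using assms by (simp add: emb4_dom4)
  show ?thesis
    by (rule linearI) (simp_all add: linear_add[OF assms(2)] linear_scale[OF assms(2)] emb4_add emb4_scaleR
        ph.holo_has_derivative(3)[OF Hc_holo p] ph.dd_scaleR_dir[OF Hc_holo p] scaleR_conv_of_real)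
qed

lemma linear_inner_of_real: "linear (\<lambda>v. complex_of_real (v \<bullet> G))"
  by (rule linearI) (simp_all add: inner_add_left scaleR_conv_of_real)

text \<open>Both sides are linear in v, so the coordinate directions decide, and there the gradient
  consists of partial derivatives.\<close>

lemma gA_direction:
  assumes x: "fst x \<in> U r0 D"
  shows "complex_of_real (v \<bullet> gA \<Theta> x) = ph.dd (emb4 (0, v)) Hc (emb4 (\<Theta>, x))"
proof -
  have "(\<lambda>v. complex_of_real (v \<bullet> gA \<Theta> x)) = (\<lambda>v. ph.dd (emb4 (0, v)) Hc (emb4 (\<Theta>, x)))"
  proof (rule linear_eq_stdbasis[OF linear_inner_of_real linear_dd_Hc[OF x]])
    show "linear (\<lambda>v. (0, v) :: ((real ^ 'n) \<times> (real ^ 'm)) \<times> ((real ^ 'n) \<times> (real ^ 'm)))" by (rule linearI) auto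
    fix b :: "(real ^ 'n) \<times> (real ^ 'm)" assume "b \<in> Basis"
    then consider i where "b = (axis i 1, 0)" | j where "b = (0, axis j 1)" using Basis_pair_cases by blast
    then show "complex_of_real (b \<bullet> gA \<Theta> x) = ph.dd (emb4 (0, b)) Hc (emb4 (\<Theta>, x))"
    proof cases
      case 1
      have "complex_of_real (partial (\<lambda>I. RH (fst \<Theta>) (snd \<Theta>) I (snd x)) i (fst x)) = ph.dd (emb4 (0, b)) Hc (emb4 (\<Theta>, x))"
        by (rule partial_direction[OF x]) (cases \<Theta>; cases x; simp add: RH_eq 1 axis_scale[symmetric])
      then show ?thesis by (simp add: 1 gA_def gradient_def inner_axis' )
    next
      case 2
      have "complex_of_real (partial (\<lambda>J. RH (fst \<Theta>) (snd \<Theta>) (fst x) J) j (snd x)) = ph.dd (emb4 (0, b)) Hc (emb4 (\<Theta>, x))"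
        by (rule partial_direction[OF x]) (cases \<Theta>; cases x; simp add: RH_eq 2 axis_scale[symmetric])
      then show ?thesis by (simp add: 2 gA_def gradient_def inner_axis')
    qed
  qed
  then show ?thesis by (rule fun_cong)
qed

lemma gT_direction:
  assumes x: "fst x \<in> U r0 D"
  shows "complex_of_real (v \<bullet> gT \<Theta> x) = ph.dd (emb4 (v, 0)) Hc (emb4 (\<Theta>, x))"
proof -
  have "(\<lambda>v. complex_of_real (v \<bullet> gT \<Theta> x)) = (\<lambda>v. ph.dd (emb4 (v, 0)) Hc (emb4 (\<Theta>, x)))"
  proof (rule linear_eq_stdbasis[OF linear_inner_of_real linear_dd_Hc[OF x]])
    show "linear (\<lambda>v. (v, 0) :: ((real ^ 'n) \<times> (real ^ 'm)) \<times> ((real ^ 'n) \<times> (real ^ 'm)))" by (rule linearI) auto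
    fix b :: "(real ^ 'n) \<times> (real ^ 'm)" assume "b \<in> Basis"
    then consider i where "b = (axis i 1, 0)" | j where "b = (0, axis j 1)" using Basis_pair_cases by blast
    then show "complex_of_real (b \<bullet> gT \<Theta> x) = ph.dd (emb4 (b, 0)) Hc (emb4 (\<Theta>, x))"
    proof cases
      case 1
      have "complex_of_real (partial (\<lambda>\<theta>. RH \<theta> (snd \<Theta>) (fst x) (snd x)) i (fst \<Theta>)) = ph.dd (emb4 (b, 0)) Hc (emb4 (\<Theta>, x))"
        by (rule partial_direction[OF x]) (cases \<Theta>; cases x; simp add: RH_eq 1 axis_scale[symmetric])
      then show ?thesis by (simp add: 1 gT_def gradient_def inner_axis')
    next
      case 2
      have "complex_of_real (partial (\<lambda>\<phi>. RH (fst \<Theta>) \<phi> (fst x) (snd x)) j (snd \<Theta>)) = ph.dd (emb4 (b, 0)) Hc (emb4 (\<Theta>, x))"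
        by (rule partial_direction[OF x]) (cases \<Theta>; cases x; simp add: RH_eq 2 axis_scale[symmetric])
      then show ?thesis by (simp add: 2 gT_def gradient_def inner_axis')
    qed
  qed
  then show ?thesis by (rule fun_cong)
qed

lemma angle_velocity:
  assumes x: "fst x \<in> U r0 D"
  shows "complex_of_real (v \<bullet> gA \<Theta> x) = prd.dd (emb2 v) n2 (emb2 x) + prd.dd (emb2 v) (g2 \<Theta>) (emb2 x)"
proof -
  have "emb4 (\<Theta>, x) = (cvec (fst \<Theta>), cvec (snd \<Theta>), emb2 x)" by (simp add: emb4_def)
  then show ?thesis
    unfolding gA_direction[OF x] emb4_action using dd_Hc_action[of "emb2 x" "emb2 v" \<Theta>] x by (simp add: emb2_U)
qed

lemma action_velocity:
  assumes x: "fst x \<in> U r0 D"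
  shows "((\<lambda>s. g2 (\<Theta> + s *\<^sub>R v) (emb2 x)) has_vector_derivative complex_of_real (v \<bullet> gT \<Theta> x)) (at 0)"
proof -
  have "g2 (\<Theta> + s *\<^sub>R v) (emb2 x) = Hc (emb4 ((\<Theta>, x) + s *\<^sub>R (v, 0))) - n2 (emb2 x)" for s
    by (simp add: g2_def Hc_def emb4_def)
  then show ?thesis
    unfolding gT_direction[OF x]
    using has_vector_derivative_diff[OF Hc_direction(1)[OF x, of \<Theta> "(v, 0)"] has_vector_derivative_const[of "n2 (emb2 x)"]]
    by simp
qed

definition X4 :: "((real ^ 'n) \<times> (real ^ 'm)) \<times> ((real ^ 'n) \<times> (real ^ 'm)) \<Rightarrow> ((real ^ 'n) \<times> (real ^ 'm)) \<times> ((real ^ 'n) \<times> (real ^ 'm))" where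
  "X4 p = (gA (fst p) (snd p), - gT (fst p) (snd p))"

lemma X4_locally_lipschitz: "locally_lipschitz_on {p. fst (snd p) \<in> U r0 D} X4"
proof (rule locally_lipschitz_on_components)
  fix p b :: "((real ^ 'n) \<times> (real ^ 'm)) \<times> ((real ^ 'n) \<times> (real ^ 'm))" assume p: "p \<in> {p. fst (snd p) \<in> U r0 D}"
  \<comment> \<open>The component of the Hamiltonian vector field along b is the derivative of the
    Hamiltonian along b turned by the symplectic matrix. It is thus the real part of a holomorphic
    function, and those are locally Lipschitz.\<close>
  let ?w = "emb4 (- snd b, fst b)"
  have X: "X4 q \<bullet> b = Re (ph.dd ?w Hc (emb4 q))" if "fst (snd q) \<in> U r0 D" for q
  proof -
    have q: "emb4 q \<in> dom4" using that emb4_dom4[of "fst q" "snd q"] by simp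
    have "?w = emb4 (0, fst b) + emb4 (- snd b, 0)" by (simp flip: emb4_add)
    then have "ph.dd ?w Hc (emb4 q) = of_real (fst b \<bullet> gA (fst q) (snd q)) + of_real (- snd b \<bullet> gT (fst q) (snd q))"
      using gA_direction[OF that, of "fst b" "fst q"] gT_direction[OF that, of "- snd b" "fst q"]
      by (simp only: ph.holo_has_derivative(3)[OF Hc_holo q] prod.collapse)
    then show ?thesis by (simp add: X4_def inner_prod_def inner_commute)
  qed
  have W: "q \<in> {p. fst (snd p) \<in> U r0 D} \<longleftrightarrow> emb4 q \<in> dom4" for q using emb4_dom4[of "fst q" "snd q"] by simp
  from ph.holo_locally_lipschitz[OF open_dom4 ph.holo_dd[OF open_dom4 Hc_holo] p[unfolded W], of ?w]
  obtain e L where e: "e > 0" "cball (emb4 p) e \<subseteq> dom4"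
    and L: "\<And>y z. y \<in> cball (emb4 p) e \<Longrightarrow> z \<in> cball (emb4 p) e \<Longrightarrow> cmod (ph.dd ?w Hc y - ph.dd ?w Hc z) \<le> L * dist y z"
    by blast
  have c: "emb4 q \<in> cball (emb4 p) e" if "q \<in> cball p e" for q using that by (simp add: dist_emb4)
  have sub: "cball p e \<subseteq> {p. fst (snd p) \<in> U r0 D}" using c e(2) unfolding subset_iff W by blast
  have "\<bar>X4 y \<bullet> b - X4 z \<bullet> b\<bar> \<le> L * dist y z" if yz: "y \<in> cball p e" "z \<in> cball p e" for y z
  proof -
    have m: "fst (snd y) \<in> U r0 D" "fst (snd z) \<in> U r0 D"
      using subsetD[OF sub yz(1)] subsetD[OF sub yz(2)] by simp_all
    have "X4 y \<bullet> b - X4 z \<bullet> b = Re (ph.dd ?w Hc (emb4 y) - ph.dd ?w Hc (emb4 z))"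
      by (simp add: X[OF m(1)] X[OF m(2)])
    then show ?thesis
      using order_trans[OF abs_Re_le_cmod L[OF c[OF yz(1)] c[OF yz(2)]]] by (simp add: dist_emb4)
  qed
  with e sub show "\<exists>e>0. \<exists>L. cball p e \<subseteq> {p. fst (snd p) \<in> U r0 D} \<and> (\<forall>y\<in>cball p e. \<forall>z\<in>cball p e. \<bar>X4 y \<bullet> b - X4 z \<bullet> b\<bar> \<le> L * dist y z)"
    by blast
qed

section \<open>Fourier coefficients of the perturbation\<close>

definition F2 :: "(int ^ 'n) \<times> (int ^ 'm) \<Rightarrow> (complex ^ 'n) \<times> (complex ^ 'm) \<Rightarrow> complex" where
  "F2 k z = torus_space.fcoef mode2 (\<lambda>\<Theta>. g2 \<Theta> z) k"

lemma continuous_on_g2: "continuous_on (UNIV \<times> Vbar r0 D) (\<lambda>(\<Theta>, z). g2 \<Theta> z)"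
  unfolding g2_def case_prod_beta
  by (intro continuous_on_compose2[OF ph.holo_continuous_on[OF f_holo]] continuous_on_Pair
      bounded_linear.continuous_on[OF bounded_linear_cvec] continuous_intros) (auto simp: dom4_real)

lemma F2_eq: "F2 (k, l) (I, J) = fourier_coeff f k l I J"
proof -
  interpret torus_space scale2 dir2 wt2 "0 :: (complex ^ 'n) \<times> (complex ^ 'm)" emb2 mode2 cip2
    by (rule torus_space2)
  show ?thesis
    unfolding F2_def fcoef_def fourier_coeff_def cube_pair
    by (simp add: case_prod_unfold g2_def mode2_def inner_prod_def)
qed

lemma F2_holo: "prd.holo (F2 k) (Vbar r0 D)"
proof -
  interpret torus_space scale2 dir2 wt2 "0 :: (complex ^ 'n) \<times> (complex ^ 'm)" emb2 mode2 cip2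
    by (rule torus_space2)
  show ?thesis
    unfolding F2_def[abs_def]
  proof (rule fcoef_holo[OF open_Vbar g2_holo])
    show "continuous_on (cube \<times> Vbar r0 D) (\<lambda>(\<Theta>, z). g2 \<Theta> z)"
      by (rule continuous_on_subset[OF continuous_on_g2]) blast
    show "continuous_on cube (\<lambda>\<Theta>. prd.dd v (g2 \<Theta>) z)" if z: "z \<in> Vbar r0 D" for z v
      unfolding dd_g2
      by (intro continuous_on_compose2[OF ph.holo_continuous_on[OF ph.holo_dd[OF open_dom4 f_holo]]] continuous_on_Pair
          bounded_linear.continuous_on[OF bounded_linear_cvec] continuous_intros) (simp_all add: image_subset_iff dom4_real z)
  qed
qed

lemma F2_sum:
  assumes fn: "fourier_norm r0 s0 D f \<le> ennreal \<epsilon>" "\<epsilon> > 0" and z: "z \<in> Vbar r0 D" and P: "finite P"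
  shows "(\<Sum>k\<in>P. cmod (F2 k z) * exp (wt2 k * s0)) \<le> \<epsilon>"
proof -
  obtain I J where IJ: "z = (I, J)" by (cases z)
  let ?t = "\<lambda>(k, l). ennreal (cmod (fourier_coeff f k l I J) * exp ((l1 k + l1 l) * s0))"
  have "ennreal (\<Sum>k\<in>P. cmod (F2 k z) * exp (wt2 k * s0)) = (\<Sum>k\<in>P. ?t k)"
    by (subst sum_ennreal[symmetric]) (auto simp: IJ F2_eq[symmetric] wt2_def case_prod_beta intro!: sum.cong)
  also have "\<dots> \<le> (\<Sum>\<^sub>\<infinity>k\<in>UNIV. ?t k)"
    by (subst nonneg_infsum_complete) (use P in \<open>auto intro: SUP_upper\<close>)
  also have "\<dots> \<le> fourier_norm r0 s0 D f"
    unfolding fourier_norm_def using SUP_upper[OF z, of "\<lambda>(I, J). \<Sum>\<^sub>\<infinity>(k, l)\<in>UNIV. ennreal (cmod (fourier_coeff f k l I J) * exp ((l1 k + l1 l) * s0))"]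
    by (simp add: IJ)
  also note fn(1)
  finally show ?thesis using fn(2) by simp
qed

text \<open>The finite norm gives absolute summability, and holomorphy gives continuity in the
  angles; the Fourier series therefore represents the perturbation at every angle.\<close>

lemma F2_has_sum:
  assumes fn: "fourier_norm r0 s0 D f \<le> ennreal \<epsilon>" "\<epsilon> > 0" and z: "z \<in> Vbar r0 D"
  shows "((\<lambda>k. F2 k z * torus_space.ek mode2 k \<Theta>) has_sum g2 \<Theta> z) UNIV"
proof -
  interpret torus_space scale2 dir2 wt2 "0 :: (complex ^ 'n) \<times> (complex ^ 'm)" emb2 mode2 cip2
    by (rule torus_space2)
  show ?thesis
    unfolding F2_def
  proof (rule fourier_has_sum)
    have "continuous_on UNIV (\<lambda>\<Theta> :: (real ^ 'n) \<times> (real ^ 'm). (\<Theta>, z))" by (intro continuous_intros)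
    moreover have "range (\<lambda>\<Theta> :: (real ^ 'n) \<times> (real ^ 'm). (\<Theta>, z)) \<subseteq> UNIV \<times> Vbar r0 D" using z by blast
    ultimately show "continuous_on UNIV (\<lambda>\<Theta>. g2 \<Theta> z)"
      using continuous_on_compose2[OF continuous_on_g2] by fastforce
    show "g2 (\<Theta> + (2 * pi) *\<^sub>R b) z = g2 \<Theta> z" if "b \<in> Basis" for \<Theta> b
    proof -
      obtain I J where IJ: "z = (I, J)" by (cases z)
      have per: "f (cvec (fst \<Theta>) + cvec ((2 * pi) *\<^sub>R ivec k), cvec (snd \<Theta>) + cvec ((2 * pi) *\<^sub>R ivec l), I, J) = f (cvec (fst \<Theta>), cvec (snd \<Theta>), I, J)" for k l
        using pert strip_real[of "fst \<Theta>" "snd \<Theta>"] z unfolding analytic_perturbation_def IJ by blast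
      consider i where "b = (axis i 1, 0)" | j where "b = (0, axis j 1)" using \<open>b \<in> Basis\<close> Basis_pair_cases by blast
      then show ?thesis
      proof cases
        case (1 i)
        then show ?thesis using per[of "axis i 1" 0] by (simp add: g2_def IJ cvec_add ivec_axis)
      next
        case (2 j)
        then show ?thesis using per[of 0 "axis j 1"] by (simp add: g2_def IJ cvec_add ivec_axis)
      qed
    qed
    show "(\<lambda>k. cmod (fcoef (\<lambda>\<Theta>. g2 \<Theta> z) k)) summable_on UNIV"
    proof (rule nonneg_bdd_above_summable_on, simp)
      show "bdd_above (sum (\<lambda>k. cmod (fcoef (\<lambda>\<Theta>. g2 \<Theta> z) k)) ` {P. P \<subseteq> UNIV \<and> finite P})"
      proof (rule bdd_aboveI2)
        fix P :: "((int ^ 'n) \<times> (int ^ 'm)) set" assume "P \<in> {P. P \<subseteq> UNIV \<and> finite P}"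
        then have P: "finite P" by simp
        have "(\<Sum>k\<in>P. cmod (F2 k z)) \<le> (\<Sum>k\<in>P. cmod (F2 k z) * exp (wt2 k * s0))"
          using s0 by (intro sum_mono) (simp add: mult_le_cancel_left1)
        also have "\<dots> \<le> \<epsilon>" by (rule F2_sum[OF fn z P])
        finally show "(\<Sum>k\<in>P. cmod (fcoef (\<lambda>\<Theta>. g2 \<Theta> z) k)) \<le> \<epsilon>" unfolding F2_def .
      qed
    qed
  qed
qed

end

section \<open>Stability\<close>

lemma has_vector_derivative_prod_iff:
  "(y has_vector_derivative d) (at t within S) \<longleftrightarrow>
    ((\<lambda>t. fst (y t)) has_vector_derivative fst d) (at t within S) \<and> ((\<lambda>t. snd (y t)) has_vector_derivative snd d) (at t within S)"
proof
  assume y: "(y has_vector_derivative d) (at t within S)"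
  show "((\<lambda>t. fst (y t)) has_vector_derivative fst d) (at t within S) \<and> ((\<lambda>t. snd (y t)) has_vector_derivative snd d) (at t within S)"
    using bounded_linear.has_vector_derivative[OF bounded_linear_fst y] bounded_linear.has_vector_derivative[OF bounded_linear_snd y] by blast
next
  assume "((\<lambda>t. fst (y t)) has_vector_derivative fst d) (at t within S) \<and> ((\<lambda>t. snd (y t)) has_vector_derivative snd d) (at t within S)"
  then have "((\<lambda>t. (fst (y t), snd (y t))) has_vector_derivative (fst d, snd d)) (at t within S)"
    by (intro has_vector_derivative_Pair) auto
  then show "(y has_vector_derivative d) (at t within S)" by simp
qed

context perturbed_hamiltonian
begin

lemma ode_hamilton:
  "ode_solution X4 {p. fst (snd p) \<in> U r0 D} S y \<longleftrightarrow>
     hamilton_solution RH (U r0 D) S (\<lambda>t. fst (fst (y t))) (\<lambda>t. snd (fst (y t))) (\<lambda>t. fst (snd (y t))) (\<lambda>t. snd (snd (y t)))"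
  unfolding ode_solution_def hamilton_solution_def has_vector_derivative_prod_iff
  by (simp add: X4_def gA_def gT_def conj_ac)

lemma frequency_variation:
  assumes H: "hessian_bound r0 D h M" and a: "a \<in> D" and I: "I \<in> ball (cvec a) r0"
  shows "cmod (vec.dd c h I - vec.dd c h (cvec a)) \<le> M * norm c * norm (I - cvec a)"
proof (rule derivative_variation[OF open_V h_holo])
  have "closed_segment (cvec a) I \<subseteq> ball (cvec a) r0"
    using I r0 by (intro closed_segment_subset convex_ball) auto
  also have "\<dots> \<subseteq> V r0 D" using a by (auto simp: mem_V[OF ne] dist_commute)
  finally show "closed_segment (cvec a) I \<subseteq> V r0 D" .
  show "onorm (\<lambda>v. hessian h y *v v) \<le> M" if "y \<in> V r0 D" for y
    using H that by (simp add: hessian_bound_def)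
qed

lemma D_V: "a \<in> D \<Longrightarrow> cvec a \<in> V r0 D"
  using D_subset_U[OF r0] by (auto simp: U_def)

lemma frequency_eq: "a \<in> D \<Longrightarrow> vec.dd (cvec v) h (cvec a) = complex_of_real (v \<bullet> real_gradient h a)"
  using real_gradient_dd[OF open_V h_holo D_V h_real] by simp

text \<open>The Hessian bound is tested in the direction of the difference of the two gradients.
  Convexity keeps the segment between the points in the domain.\<close>

lemma real_gradient_lipschitz:
  assumes H: "hessian_bound r0 D h M" and D: "convex D" and ab: "a \<in> D" "b \<in> D"
  shows "norm (real_gradient h b - real_gradient h a) \<le> M * norm (b - a)"
proof -
  let ?v = "real_gradient h b - real_gradient h a"
  have "cmod (vec.dd (cvec ?v) h (cvec b) - vec.dd (cvec ?v) h (cvec a)) \<le> M * norm (cvec ?v) * norm (cvec b - cvec a)"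
  proof (rule derivative_variation[OF open_V h_holo])
    have "closed_segment (cvec a) (cvec b) = cvec ` closed_segment a b"
      by (rule closed_segment_linear_image[OF linear_cvec])
    then show "closed_segment (cvec a) (cvec b) \<subseteq> V r0 D"
      using closed_segment_subset[OF ab D] D_V by auto
    show "onorm (\<lambda>v. hessian h y *v v) \<le> M" if "y \<in> V r0 D" for y
      using H that by (simp add: hessian_bound_def)
  qed
  moreover have "vec.dd (cvec ?v) h (cvec b) - vec.dd (cvec ?v) h (cvec a) = complex_of_real (norm ?v * norm ?v)"
    by (simp only: frequency_eq[OF ab(1)] frequency_eq[OF ab(2)] of_real_diff[symmetric] inner_diff_right[symmetric]
        dot_square_norm power2_eq_square)
  moreover have "norm (cvec b - cvec a) = norm (b - a)"
    by (simp add: norm_cvec flip: linear_diff[OF linear_cvec])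
  ultimately have "norm ?v * norm ?v \<le> M * norm ?v * norm (b - a)"
    by (simp only: norm_of_real norm_cvec abs_mult abs_norm_cancel)
  then have "norm ?v * norm ?v \<le> (M * norm (b - a)) * norm ?v" by (simp only: mult_ac)
  moreover have "0 \<le> M * norm (b - a)" if "norm ?v = 0"
  proof (cases "a = b")
    case False
    have "0 \<le> onorm (\<lambda>v. hessian h (cvec a) *v v)" by (rule onorm_pos_le) simp
    then have "0 \<le> M" using H D_V[OF ab(1)] order_trans unfolding hessian_bound_def by blast
    then show ?thesis by simp
  qed simp
  ultimately show ?thesis
    using mult_right_le_imp_le[of "norm ?v" "norm ?v" "M * norm (b - a)"] by (cases "norm ?v = 0") auto
qed

lemma stability:
  fixes \<theta> :: "real \<Rightarrow> real ^ 'n" and \<phi> :: "real \<Rightarrow> real ^ 'm" and I J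
  assumes H: "hessian_bound r0 D h M" "M > 0"
    and fn: "fourier_norm r0 s0 D f \<le> ennreal \<epsilon>" "\<epsilon> > 0" and \<gamma>': "\<gamma>' > 0" and \<tau>': "\<tau>' > 0"
    and a: "a = 1 / (2 * (\<tau>' + 1))" and R: "R = 8 * \<gamma>' / (9 * M)" and e0: "\<epsilon>0 = \<gamma>'\<^sup>2 / (768 * M)"
    and le: "\<epsilon> \<le> min \<epsilon>0 (\<epsilon>0 * (r0 / R)\<^sup>2)"
    and T: "T = s0 * R / (5 * \<epsilon>0) * sqrt (\<epsilon>0 / \<epsilon>) * exp (s0 / 6 * (\<epsilon>0 / \<epsilon>) powr a)"
    and sol: "hamilton_solution RH (U r0 D) S \<theta> \<phi> I J" and S0: "0 \<in> S" and I0: "I 0 \<in> Dset D h \<alpha> \<gamma>' \<tau>'"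
  shows "\<forall>t\<in>S. \<bar>t\<bar> \<le> T \<longrightarrow> norm ((I t, J t) - (I 0, J 0)) \<le> R * sqrt (\<epsilon> / \<epsilon>0)"
    and "maximal_hamilton_solution RH (U r0 D) S \<theta> \<phi> I J \<Longrightarrow> {-T..T} \<subseteq> S"
proof -
  \<comment> \<open>All scales are powers of q: by the choice of a one has K powr (\<tau>' + 1) = 1
    / q, and the radius is R * q.\<close>
  define q where "q = sqrt (\<epsilon> / \<epsilon>0)"
  have e0p: "\<epsilon>0 > 0" and Rp: "R > 0" using e0 R \<gamma>' H(2) by auto
  have q: "q > 0" "q \<le> 1" "\<epsilon> = \<epsilon>0 * q\<^sup>2" "\<epsilon>0 / \<epsilon> = q powr (- 2)" "sqrt (\<epsilon>0 / \<epsilon>) = 1 / q"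
    using fn(2) e0p le by (auto simp: q_def powr_minus real_sqrt_divide divide_simps)
  define K where "K = (\<epsilon>0 / \<epsilon>) powr a"
  have K: "K = q powr (- 2 * a)" unfolding K_def q(4) by (simp add: powr_powr)
  have Kp: "K > 0" using q by (simp add: K)
  have Kt: "K powr (\<tau>' + 1) = 1 / q"
  proof -
    have "- 2 * a * (\<tau>' + 1) = - 1" using \<tau>' by (simp add: a field_simps)
    then have "K powr (\<tau>' + 1) = q powr (- 1)" unfolding K powr_powr by simp
    then show ?thesis using q(1) by (simp add: powr_minus divide_inverse)
  qed
  have Kn: "K powr (- \<tau>') = q * K"
  proof -
    have "K powr (- \<tau>') = K powr (1 - (\<tau>' + 1))" by simp
    also have "\<dots> = K powr 1 / K powr (\<tau>' + 1)" by (rule powr_diff)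
    finally show ?thesis using Kp q(1) by (simp add: Kt)
  qed
  \<comment> \<open>Since K powr (- \<tau>') = q * K, this is the Diophantine lower bound for the
    divisors of order at most K at the initial action.\<close>
  define A where "A = \<gamma>' * q * K"
  define \<rho> where "\<rho> = R * q"
  have A: "A > 0" and rho: "\<rho> > 0" using \<gamma>' q(1) Kp Rp by (auto simp: A_def \<rho>_def)
  have eps: "\<epsilon> = 3 * A * \<rho> / (2048 * K)"
    using Kp H(2) by (simp add: q(3) A_def \<rho>_def R e0 field_simps power2_eq_square)
  \<comment> \<open>Origin of the constant 8/9 in R: on the ball of radius 3/4 * \<rho> the divisors
    change by at most two thirds of A.\<close>
  have res: "M * K * (3/4 * \<rho>) = 2/3 * A"
    using H(2) by (simp add: A_def \<rho>_def R field_simps)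
  \<comment> \<open>Here the second bound on \<epsilon> enters: the ball of radius \<rho> must lie
    in the domain of analyticity.\<close>
  have rr: "\<rho> \<le> r0"
  proof -
    have "\<epsilon> / \<epsilon>0 \<le> (r0 / R)\<^sup>2" using le e0p by (simp add: pos_divide_le_eq mult.commute)
    then have "q \<le> sqrt ((r0 / R)\<^sup>2)" unfolding q_def by (rule real_sqrt_le_mono)
    then have "q \<le> r0 / R" using r0 Rp by simp
    then show ?thesis using Rp by (simp add: \<rho>_def field_simps)
  qed
  have TK: "T = s0 * \<rho> / (5 * \<epsilon>) * exp (K * s0 / 6)"
    using q(1) e0p unfolding T q(5) K_def[symmetric] by (simp add: q(3) \<rho>_def field_simps power2_eq_square)
  have aD: "I 0 \<in> D" and aB: "real_gradient h (I 0) \<in> Bset \<alpha> \<gamma>' \<tau>'" using I0 by (auto simp: Dset_def)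
  define X0 where "X0 = (I 0, J 0)"
  define x where "x t = (I t, J t)" for t
  define \<Theta> where "\<Theta> t = (\<theta> t, \<phi> t)" for t
  have x0: "emb2 (x 0) = emb2 X0" by (simp add: x_def X0_def)
  have ballV: "ball (emb2 X0) \<rho> \<subseteq> Vbar r0 D"
    using ball_subset_Vbar[OF aD, of "J 0" r0] rr unfolding X0_def by (auto simp: subset_iff)
  interpret ts: torus_space scale2 dir2 wt2 "emb2 X0" emb2 mode2 cip2 by (rule torus_space2)
  have nbF: "ts.nb \<rho> s0 F2 \<epsilon>"
    by (rule ts.nbI, rule F2_sum[OF fn]) (use ballV in auto)
  have g2h: "prd.holo (g2 \<Psi>) (ball (emb2 X0) \<rho>)" for \<Psi> by (rule prd.holo_subset[OF g2_holo ballV])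
  have var: "cmod (vec.dd c h (fst z) - vec.dd c h (cvec (I 0))) \<le> M * norm c * dist (emb2 X0) z"
    if z: "z \<in> ball (emb2 X0) \<rho>" for c z
  proof -
    have d: "dist (cvec (I 0)) (fst z) \<le> dist (emb2 X0) z"
      using dist_fst_le[of "emb2 X0" z] by (simp add: X0_def emb2_def)
    have "cmod (vec.dd c h (fst z) - vec.dd c h (cvec (I 0))) \<le> M * norm c * norm (fst z - cvec (I 0))"
      by (rule frequency_variation[OF H(1) aD]) (use d z rr in auto)
    also have "\<dots> \<le> M * norm c * dist (emb2 X0) z"
      using d H(2) by (intro mult_left_mono) (auto simp: dist_norm norm_minus_commute)
    finally show ?thesis .
  qed
  have hs: "is_interval S" and IU: "\<And>t. t \<in> S \<Longrightarrow> fst (x t) \<in> U r0 D"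
    using sol by (auto simp: hamilton_solution_def x_def)
  have xd: "(x has_vector_derivative - gT (\<Theta> t) (x t)) (at t within S)"
    and thd: "(\<Theta> has_vector_derivative gA (\<Theta> t) (x t)) (at t within S)" if "t \<in> S" for t
    unfolding has_vector_derivative_prod_iff using sol that
    by (auto simp: hamilton_solution_def x_def \<Theta>_def gT_def gA_def)
  interpret mo: resonance_free_motion scale2 dir2 wt2 "emb2 X0" emb2 mode2 cip2 s0 \<epsilon> \<rho> K A n2 F2 g2 S x \<Theta>
    "\<lambda>t. - gT (\<Theta> t) (x t)" "\<lambda>t. gA (\<Theta> t) (x t)"
  proof (intro resonance_free_motion.intro torus_space2 resonance_free_motion_axioms.intro)
    show "prd.holo n2 (ball (emb2 X0) \<rho>)" by (rule prd.holo_subset[OF n2_holo ballV])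
    show "prd.holo (F2 k) (ball (emb2 X0) \<rho>)" for k by (rule prd.holo_subset[OF F2_holo ballV])
    show "((\<lambda>k. F2 k z * ts.ek k \<Psi>) has_sum g2 \<Psi> z) UNIV" if "z \<in> ball (emb2 X0) \<rho>" for z \<Psi>
      by (rule F2_has_sum[OF fn subsetD[OF ballV that]])
    show "complex_of_real (mode2 k \<bullet> gA (\<Theta> t) (x t)) = prd.dd (dir2 k) n2 (emb2 (x t)) + prd.dd (dir2 k) (g2 (\<Theta> t)) (emb2 (x t))"
      if "t \<in> S" for t k unfolding dir2_def by (rule angle_velocity[OF IU[OF that]])
    show "((\<lambda>s. g2 (\<Theta> t + s *\<^sub>R v) (emb2 (x t))) has_vector_derivative - complex_of_real ((- gT (\<Theta> t) (x t)) \<bullet> v)) (at 0)"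
      if "t \<in> S" for t v using action_velocity[OF IU[OF that], of "\<Theta> t" v] by (simp add: inner_commute)
    show "A / 3 \<le> cmod (prd.dd (dir2 k) n2 z)" if z: "z \<in> ball (emb2 X0) (3/4 * \<rho>)" and k: "k \<noteq> 0" "wt2 k \<le> K" for k z
    proof -
      obtain u l where ul: "k = (u, l)" by (cases k)
      have zB: "z \<in> ball (emb2 X0) \<rho>" using z rho by auto
      define w where "w = l1 u + l1 l"
      have w: "1 \<le> w" "w \<le> K" "l1 u \<le> K"
        using k l1_ge_1[of u] l1_ge_1[of l] l1_nonneg[of u] l1_nonneg[of l] by (auto simp: ul wt2_def w_def zero_prod_def)
      let ?c = "complex_of_real (ivec u \<bullet> real_gradient h (I 0) + ivec l \<bullet> \<alpha>)"
      have "cip2 (0, \<alpha>) (dir2 k) = complex_of_real (ivec l \<bullet> \<alpha>)"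
        unfolding dir2_def ts.cip_emb by (simp add: ul mode2_def inner_commute)
      moreover have "fst (dir2 k) = cvec (ivec u)" by (simp add: ul dir2_def mode2_def emb2_def)
      ultimately have "prd.dd (dir2 k) n2 z = vec.dd (cvec (ivec u)) h (fst z) + complex_of_real (ivec l \<bullet> \<alpha>)"
        by (simp add: dd_n2[OF subsetD[OF ballV zB]])
      then have eq: "prd.dd (dir2 k) n2 z - ?c = vec.dd (cvec (ivec u)) h (fst z) - vec.dd (cvec (ivec u)) h (cvec (I 0))"
        by (simp add: frequency_eq[OF aD])
      have "A = \<gamma>' * K powr (- \<tau>')" by (simp add: A_def Kn)
      also have "\<dots> \<le> \<gamma>' * w powr (- \<tau>')"
        using w \<tau>' \<gamma>' by (intro mult_left_mono powr_mono2') auto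
      also have "\<dots> \<le> \<bar>ivec u \<bullet> real_gradient h (I 0) + ivec l \<bullet> \<alpha>\<bar>"
        using aB k by (auto simp: Bset_def w_def ul zero_prod_def)
      finally have 1: "A \<le> cmod ?c" by (simp only: norm_of_real)
      have "cmod (prd.dd (dir2 k) n2 z - ?c) \<le> M * norm (cvec (ivec u)) * dist (emb2 X0) z"
        unfolding eq by (rule var[OF zB])
      also have "\<dots> \<le> M * K * (3/4 * \<rho>)"
        using H(2) z Kp order_trans[OF norm_ivec_le w(3)] by (intro mult_mono mult_left_mono) (auto simp: norm_cvec)
      finally have "cmod (prd.dd (dir2 k) n2 z - ?c) \<le> 2/3 * A" by (simp only: res)
      then show ?thesis using 1 norm_triangle_ineq2[of ?c "prd.dd (dir2 k) n2 z"] by (simp add: norm_minus_commute)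
    qed
  qed (use s0 fn(2) rho Kp A eps nbF g2h hs S0 xd thd x0 in auto)
  have drift: "norm (x t - x 0) \<le> 9/10 * \<rho>" if "t \<in> S" "\<bar>t\<bar> \<le> T" for t
    using mo.drift[OF that(1)] that(2) by (simp add: TK)
  show "\<forall>t\<in>S. \<bar>t\<bar> \<le> T \<longrightarrow> norm ((I t, J t) - (I 0, J 0)) \<le> R * sqrt (\<epsilon> / \<epsilon>0)"
  proof (intro ballI impI)
    fix t assume "t \<in> S" "\<bar>t\<bar> \<le> T"
    from drift[OF this] rho have "norm (x t - x 0) \<le> \<rho>" by linarith
    then show "norm ((I t, J t) - (I 0, J 0)) \<le> R * sqrt (\<epsilon> / \<epsilon>0)" by (simp add: x_def \<rho>_def q_def)
  qed
  assume maxi: "maximal_hamilton_solution RH (U r0 D) S \<theta> \<phi> I J"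
  \<comment> \<open>The drift bound 9/10 * \<rho> instead of \<rho> leaves a collar, so this closed
    set lies in the open domain and Cauchy estimates hold on it. It is not compact, as the lifted
    angles are unbounded; an explicit bound m for the field replaces compactness.\<close>
  define C where "C = {p :: ((real ^ 'n) \<times> (real ^ 'm)) \<times> ((real ^ 'n) \<times> (real ^ 'm)). norm (snd p - X0) \<le> 9/10 * \<rho>}"
  define m where "m = norm (real_gradient h (I 0)) + M * \<rho> + norm (0 :: real ^ 'n, \<alpha>) + \<epsilon> / (\<rho> / 20) + \<epsilon> / (exp 1 * s0)"
  have CB: "emb2 (snd p) \<in> ball (emb2 X0) (\<rho> - \<rho> / 20)" if "p \<in> C" for p
  proof -
    have "dist (emb2 (snd p)) (emb2 X0) \<le> 9/10 * \<rho>"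
      unfolding dist_emb2 unfolding dist_norm using that by (simp only: C_def mem_Collect_eq)
    then show ?thesis unfolding mem_ball dist_commute[of "emb2 X0"] using rho by linarith
  qed
  have CB': "emb2 (snd p) \<in> ball (emb2 X0) \<rho>" if "p \<in> C" for p
    using CB[OF that] rho by auto
  have CU: "fst (snd p) \<in> U r0 D" if "p \<in> C" for p
    unfolding emb2_U by (rule subsetD[OF ballV CB'[OF that]])
  have gTb: "norm (gT \<Psi> y) \<le> \<epsilon> / (exp 1 * s0)" if p: "(\<Psi>, y) \<in> C" for \<Psi> y
  proof -
    have yB: "emb2 y \<in> ball (emb2 X0) \<rho>" and yU: "fst y \<in> U r0 D" using CB'[OF p] CU[OF p] by simp_all
    let ?v = "gT \<Psi> y"
    have bd: "(\<Sum>k\<in>Q. cmod (F2 k (emb2 y)) * wt2 k) \<le> \<epsilon> / (exp 1 * s0)" if "finite Q" for Q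
      using ts.nb_wt[OF nbF yB s0 that] by simp
    have "cmod (complex_of_real (?v \<bullet> ?v)) \<le> \<epsilon> / (exp 1 * s0) * norm ?v"
      using ts.fourier_derivative_tail[OF F2_has_sum[OF fn subsetD[OF ballV yB]] finite.emptyI bd action_velocity[OF yU, of \<Psi> ?v]] by simp
    then have "norm ?v * norm ?v \<le> \<epsilon> / (exp 1 * s0) * norm ?v"
      by (simp add: dot_square_norm power2_eq_square norm_mult)
    then show ?thesis
      using fn(2) s0 by (cases "?v = 0") (auto intro: mult_right_le_imp_le[of _ "norm ?v"])
  qed
  \<comment> \<open>The equation for the angle velocity is tested in the direction of that velocity.
    The terms come from the frequency at the initial action, its variation, \<alpha>, and a Cauchy
    estimate for the perturbation with collar \<rho> / 20.\<close>
  have gAb: "norm (gA \<Psi> y) \<le> norm (real_gradient h (I 0)) + M * \<rho> + norm (0 :: real ^ 'n, \<alpha>) + \<epsilon> / (\<rho> / 20)"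
    (is "_ \<le> ?c") if p: "(\<Psi>, y) \<in> C" for \<Psi> y
  proof -
    have yB: "emb2 y \<in> ball (emb2 X0) \<rho>" and yU: "fst y \<in> U r0 D" using CB'[OF p] CU[OF p] by simp_all
    let ?v = "gA \<Psi> y"
    have nf: "norm (fst ?v) \<le> norm ?v" using norm_fst_le[of "fst ?v" "snd ?v"] by simp
    let ?A = "vec.dd (cvec (fst ?v)) h (fst (emb2 y))" and ?Z = "vec.dd (cvec (fst ?v)) h (cvec (I 0))"
    have b1: "cmod (vec.dd (cvec (fst ?v)) h (fst (emb2 y)) - vec.dd (cvec (fst ?v)) h (cvec (I 0))) \<le> M * norm ?v * \<rho>"
      by (rule order_trans[OF var[OF yB]]) (use nf H(2) yB in \<open>auto simp: norm_cvec intro!: mult_mono\<close>)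
    have b2: "cmod (vec.dd (cvec (fst ?v)) h (cvec (I 0))) \<le> norm ?v * norm (real_gradient h (I 0))"
      unfolding frequency_eq[OF aD] norm_of_real
      by (rule order_trans[OF Cauchy_Schwarz_ineq2 mult_right_mono[OF nf]]) simp
    have b3: "cmod (cip2 (0, \<alpha>) (emb2 ?v)) \<le> norm (0 :: real ^ 'n, \<alpha>) * norm ?v"
      using norm_cip2[of "(0, \<alpha>)" "emb2 ?v"] by (simp add: norm_emb2)
    have b4: "cmod (prd.dd (emb2 ?v) (g2 \<Psi>) (emb2 y)) \<le> \<epsilon> * norm (emb2 ?v) / (\<rho> / 20)"
    proof (rule prd.dd_bound[OF g2h])
      show "cmod (g2 \<Psi> z) \<le> \<epsilon>" if z: "z \<in> ball (emb2 X0) \<rho>" for z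
      proof (rule has_sum_norm_le[OF F2_has_sum[OF fn subsetD[OF ballV z]]])
        fix Q :: "((int ^ 'n) \<times> (int ^ 'm)) set" assume Q: "finite Q"
        have "cmod (\<Sum>k\<in>Q. F2 k z * ts.ek k \<Psi>) \<le> (\<Sum>k\<in>Q. cmod (F2 k z) * exp (wt2 k * s0))"
          using s0 by (intro sum_norm_le) (simp add: norm_mult mult_le_cancel_left1)
        also have "\<dots> \<le> \<epsilon>" by (rule ts.nbD[OF nbF z Q])
        finally show "cmod (\<Sum>k\<in>Q. F2 k z * ts.ek k \<Psi>) \<le> \<epsilon>" .
      qed
      show "emb2 y \<in> ball (emb2 X0) (\<rho> - \<rho> / 20)" using CB[OF p] by simp
    qed (use rho in simp)
    have eq: "complex_of_real (?v \<bullet> ?v) = (vec.dd (cvec (fst ?v)) h (fst (emb2 y)) + cip2 (0, \<alpha>) (emb2 ?v)) + prd.dd (emb2 ?v) (g2 \<Psi>) (emb2 y)"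
    proof -
      have "fst (emb2 ?v) = cvec (fst ?v)" by (simp add: emb2_def case_prod_beta)
      then show ?thesis
        using angle_velocity[OF yU, of ?v \<Psi>] dd_n2[OF subsetD[OF ballV yB], of "emb2 ?v"] by simp
    qed
    have "cmod (complex_of_real (?v \<bullet> ?v)) \<le> cmod ?A + cmod (cip2 (0, \<alpha>) (emb2 ?v)) + cmod (prd.dd (emb2 ?v) (g2 \<Psi>) (emb2 y))"
      unfolding eq by (rule order_trans[OF norm_triangle_ineq add_right_mono[OF norm_triangle_ineq]])
    moreover have "cmod ?A \<le> cmod ?Z + cmod (?A - ?Z)" by (rule norm_triangle_sub)
    ultimately have "cmod (complex_of_real (?v \<bullet> ?v)) \<le> (norm ?v * norm (real_gradient h (I 0)) + M * norm ?v * \<rho>) + norm (0 :: real ^ 'n, \<alpha>) * norm ?v + \<epsilon> * norm ?v / (\<rho> / 20)"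
      using b1 b2 b3 b4[unfolded norm_emb2] by linarith
    then have "norm ?v * norm ?v \<le> ?c * norm ?v"
      by (simp add: dot_square_norm power2_eq_square norm_mult algebra_simps)
    then show ?thesis
      using fn(2) rho H(2) by (cases "?v = 0") (auto intro: mult_right_le_imp_le[of _ "norm ?v"] intro!: add_nonneg_nonneg)
  qed
  define y where "y t = (\<Theta> t, x t)" for t
  have "{- T..T} \<subseteq> S"
  proof (rule ode_maximal_contains[OF X4_locally_lipschitz _ S0, where y = y and C = C and m = m])
    show "ode_solution X4 {p. fst (snd p) \<in> U r0 D} S y"
      unfolding ode_hamilton using sol by (simp add: y_def x_def \<Theta>_def)
    show "closed C" unfolding C_def by (intro closed_Collect_le continuous_intros)
    show "C \<subseteq> {p. fst (snd p) \<in> U r0 D}" using CU by blast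
    show "norm (X4 p) \<le> m" if "p \<in> C" for p
    proof -
      have p: "(fst p, snd p) \<in> C" using that by simp
      have "norm (X4 p) \<le> norm (gA (fst p) (snd p)) + norm (gT (fst p) (snd p))"
        unfolding X4_def by (rule order_trans[OF norm_Pair_le]) simp
      then show ?thesis using gAb[OF p] gTb[OF p] unfolding m_def by linarith
    qed
    show "y t \<in> C" if "t \<in> S" "\<bar>t\<bar> \<le> T" for t
      using drift[OF that] by (simp add: C_def y_def X0_def x_def)
    fix S' y' assume y': "ode_solution X4 {p. fst (snd p) \<in> U r0 D} S' y'" "S \<subseteq> S'" "\<And>t. t \<in> S \<Longrightarrow> y' t = y t"
    show "S' = S"
    proof (rule maxi[unfolded maximal_hamilton_solution_def, THEN conjunct2, rule_format])
      show "hamilton_solution RH (U r0 D) S' (\<lambda>t. fst (fst (y' t))) (\<lambda>t. snd (fst (y' t))) (\<lambda>t. fst (snd (y' t))) (\<lambda>t. snd (snd (y' t)))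
        \<and> S \<subseteq> S' \<and> (\<forall>t\<in>S. fst (fst (y' t)) = \<theta> t \<and> snd (fst (y' t)) = \<phi> t \<and> fst (snd (y' t)) = I t \<and> snd (snd (y' t)) = J t)"
        using y' unfolding ode_hamilton[symmetric] by (simp add: y_def x_def \<Theta>_def)
    qed
  qed
  then show "{-T..T} \<subseteq> S" .
qed

end

theorem theorem4:
  fixes D :: "(real ^ 'n) set"
    and h :: "complex ^ 'n \<Rightarrow> complex"
    and \<alpha> :: "real ^ 'm"
    and r\<^sub>0 s\<^sub>0 M mbar \<gamma> \<tau> \<tau>' :: real
  assumes "open D" and "bounded D" and "convex D" and "D \<noteq> {}"
    and "r\<^sub>0 > 0" and "s\<^sub>0 > 0"
    and "analytic_integrable_part r\<^sub>0 D h"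
    and "hessian_bound r\<^sub>0 D h M"
    and "mbar > 0" and "measure_condition D h mbar"
    and "\<gamma> > 0" and "\<tau> \<ge> real CARD('m) - 1" and "diophantine \<alpha> \<gamma> \<tau>"
    and "\<tau>' > real CARD('n) + real CARD('m) - 1" and "\<tau>' \<ge> \<tau>"
  shows
    "(\<forall>\<gamma>' \<epsilon>. \<forall>f :: ('n, 'm) phase \<Rightarrow> complex.
        let a = 1 / (2 * (\<tau>' + 1));
            R = 8 * \<gamma>' / (9 * M);
            \<epsilon>\<^sub>0 = \<gamma>'\<^sup>2 / (768 * M);
            \<epsilon>\<^sub>1 = \<epsilon>\<^sub>0 * (r\<^sub>0 / R)\<^sup>2;
            T = s\<^sub>0 * R / (5 * \<epsilon>\<^sub>0) * sqrt (\<epsilon>\<^sub>0 / \<epsilon>) * exp (s\<^sub>0 / 6 * (\<epsilon>\<^sub>0 / \<epsilon>) powr a);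
            H = real_hamiltonian (hamiltonian h \<alpha> f)
        in 0 < \<gamma>' \<and> \<gamma>' \<le> \<gamma> \<and> 0 < \<epsilon> \<and>
           analytic_perturbation r\<^sub>0 s\<^sub>0 D f \<and> fourier_norm r\<^sub>0 s\<^sub>0 D f \<le> ennreal \<epsilon> \<and>
           \<epsilon> \<le> min \<epsilon>\<^sub>0 \<epsilon>\<^sub>1 \<longrightarrow>
           (\<forall>S \<theta> \<phi> I J.
              hamilton_solution H (U r\<^sub>0 D) S \<theta> \<phi> I J \<and> 0 \<in> S \<and> I 0 \<in> Dset D h \<alpha> \<gamma>' \<tau>' \<longrightarrow>
              (\<forall>t\<in>S. \<bar>t\<bar> \<le> T \<longrightarrow> norm ((I t, J t) - (I 0, J 0)) \<le> R * sqrt (\<epsilon> / \<epsilon>\<^sub>0)) \<and>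
              (maximal_hamilton_solution H (U r\<^sub>0 D) S \<theta> \<phi> I J \<longrightarrow> {-T..T} \<subseteq> S)))
     \<and>
     (\<exists>C. \<forall>\<gamma>'. 0 < \<gamma>' \<and> \<gamma>' \<le> \<gamma> \<longrightarrow>
        D - Dset D h \<alpha> \<gamma>' \<tau>' \<in> lmeasurable \<and>
        measure lebesgue (D - Dset D h \<alpha> \<gamma>' \<tau>') \<le> C * \<gamma>')"
proof -
  \<comment> \<open>The zero perturbation makes the results on the integrable part available before
    any f is given; the measure estimate concerns h alone.\<close>
  have pert0: "analytic_perturbation r\<^sub>0 s\<^sub>0 D (\<lambda>p :: ('n, 'm) phase. 0)"
    by (auto simp: analytic_perturbation_def)
  interpret p0: perturbed_hamiltonian D h \<alpha> r\<^sub>0 s\<^sub>0 "\<lambda>p :: ('n, 'm) phase. 0"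
    by unfold_locales (fact assms pert0)+
  note lip = p0.real_gradient_lipschitz[OF assms(8,3)]
  obtain a0 where a0: "a0 \<in> D" using assms(4) by blast
  have t': "\<tau>' > 0"
  proof -
    have "1 \<le> CARD('n)" "1 \<le> CARD('m)" by (simp_all add: Suc_le_eq)
    then have "real CARD('n) \<ge> 1" "real CARD('m) \<ge> 1" by simp_all
    then show ?thesis using assms(14) by linarith
  qed
  \<comment> \<open>If M \<le> 0 the gradient would be constant on D, and D would be the preimage of
    one point. The measure condition would then make the nonempty open set D a null set.\<close>
  have M: "M > 0"
  proof (rule ccontr)
    assume n: "\<not> M > 0"
    let ?w = "real_gradient h a0"
    have "real_gradient h b = ?w" if "b \<in> D" for b
    proof -
      have "M * norm (b - a0) \<le> 0" using n by (simp add: mult_nonpos_nonneg)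
      then show ?thesis using lip[OF a0 that] by (metis eq_iff_diff_eq_0 norm_le_zero_iff order_trans)
    qed
    then have "real_gradient h -` {?w} \<inter> D = D" by auto
    moreover have w: "{?w} \<in> null_sets lebesgue" using negligible_sing by (simp only: negligible_iff_null_sets)
    moreover have "emeasure lebesgue (real_gradient h -` {?w} \<inter> D) \<le> ennreal (inverse mbar) * emeasure lebesgue {?w}"
      using assms(10) null_setsD2[OF w] unfolding measure_condition_def by blast
    ultimately have "emeasure lebesgue D \<le> ennreal (inverse mbar) * 0" by (simp only: null_setsD1)
    then have "emeasure lebesgue D = 0" by simp
    then have "negligible D"
      using assms(1) by (simp add: negligible_iff_null_sets null_sets_def borel_open)
    then show False using open_not_negligible[OF assms(1,4)] by blast
  qed
  have part1: "(\<forall>t\<in>S. \<bar>t\<bar> \<le> s\<^sub>0 * (8 * \<gamma>' / (9 * M)) / (5 * (\<gamma>'\<^sup>2 / (768 * M))) * sqrt (\<gamma>'\<^sup>2 / (768 * M) / \<epsilon>) *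
        exp (s\<^sub>0 / 6 * (\<gamma>'\<^sup>2 / (768 * M) / \<epsilon>) powr (1 / (2 * (\<tau>' + 1)))) \<longrightarrow>
        norm ((I t, J t) - (I 0, J 0)) \<le> 8 * \<gamma>' / (9 * M) * sqrt (\<epsilon> / (\<gamma>'\<^sup>2 / (768 * M)))) \<and>
      (maximal_hamilton_solution (real_hamiltonian (hamiltonian h \<alpha> f)) (U r\<^sub>0 D) S \<theta> \<phi> I J \<longrightarrow>
        {- (s\<^sub>0 * (8 * \<gamma>' / (9 * M)) / (5 * (\<gamma>'\<^sup>2 / (768 * M))) * sqrt (\<gamma>'\<^sup>2 / (768 * M) / \<epsilon>) *
        exp (s\<^sub>0 / 6 * (\<gamma>'\<^sup>2 / (768 * M) / \<epsilon>) powr (1 / (2 * (\<tau>' + 1)))))..s\<^sub>0 * (8 * \<gamma>' / (9 * M)) / (5 * (\<gamma>'\<^sup>2 / (768 * M))) * sqrt (\<gamma>'\<^sup>2 / (768 * M) / \<epsilon>) *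
        exp (s\<^sub>0 / 6 * (\<gamma>'\<^sup>2 / (768 * M) / \<epsilon>) powr (1 / (2 * (\<tau>' + 1))))} \<subseteq> S)"
    if *: "0 < \<gamma>'" "0 < \<epsilon>" "analytic_perturbation r\<^sub>0 s\<^sub>0 D f" "fourier_norm r\<^sub>0 s\<^sub>0 D f \<le> ennreal \<epsilon>"
      "\<epsilon> \<le> min (\<gamma>'\<^sup>2 / (768 * M)) (\<gamma>'\<^sup>2 / (768 * M) * (r\<^sub>0 / (8 * \<gamma>' / (9 * M)))\<^sup>2)"
      "hamilton_solution (real_hamiltonian (hamiltonian h \<alpha> f)) (U r\<^sub>0 D) S \<theta> \<phi> I J" "0 \<in> S" "I 0 \<in> Dset D h \<alpha> \<gamma>' \<tau>'"
    for \<gamma>' \<epsilon> and f :: "('n, 'm) phase \<Rightarrow> complex" and S \<theta> \<phi> I J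
  proof -
    interpret pf: perturbed_hamiltonian D h \<alpha> r\<^sub>0 s\<^sub>0 f
      by unfold_locales (fact assms *)+
    show ?thesis
      using pf.stability[OF assms(8) M *(4,2,1) t' refl refl refl *(5) refl *(6-8)] by blast
  qed
  have cont: "continuous_on D (real_gradient h)"
    by (rule lipschitz_on_continuous_on[where L = M]) (use lip M in \<open>auto simp: lipschitz_on_def dist_norm\<close>)
  obtain B where B: "\<And>x. x \<in> D \<Longrightarrow> norm x \<le> B" using assms(2) by (auto simp: bounded_iff)
  define b where "b = norm (real_gradient h a0) + M * (B + norm a0)"
  have bd: "norm (real_gradient h x) \<le> b" if x: "x \<in> D" for x
  proof -
    have "norm (real_gradient h x - real_gradient h a0) \<le> M * norm (x - a0)" by (rule lip[OF a0 x])
    also have "\<dots> \<le> M * (B + norm a0)"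
      using M B[OF x] norm_triangle_ineq4[of x a0] by (intro mult_left_mono) auto
    finally show ?thesis using norm_triangle_ineq2[of "real_gradient h x" "real_gradient h a0"] by (simp add: b_def)
  qed
  have b0: "0 \<le> b" using bd[OF a0] norm_ge_zero order_trans by blast
  have mc: "emeasure lebesgue (real_gradient h -` A \<inter> D) \<le> ennreal (inverse mbar) * emeasure lebesgue A"
    if "A \<in> sets lebesgue" for A using assms(10) that by (simp add: measure_condition_def)
  define Res where "Res \<gamma>' = {x \<in> D. \<exists>k l. k \<noteq> 0 \<and> \<bar>ivec k \<bullet> real_gradient h x + ivec l \<bullet> \<alpha>\<bar> < \<gamma>' * (l1 k + l1 l) powr (- \<tau>')}" for \<gamma>'
  have eq: "D - Dset D h \<alpha> \<gamma>' \<tau>' = Res \<gamma>'" if g: "0 < \<gamma>'" "\<gamma>' \<le> \<gamma>" for \<gamma>'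
  proof -
    \<comment> \<open>For k = 0 the condition involves \<alpha> only and is implied by its
      Diophantine property, because \<gamma>' \<le> \<gamma> and \<tau>' \<ge> \<tau>. So only modes
      with k \<noteq> 0, to which slabs belong, remove points from D.\<close>
    have nz: "\<gamma>' * (l1 (0 :: int ^ 'n) + l1 l) powr (- \<tau>') \<le> \<bar>ivec (0 :: int ^ 'n) \<bullet> w + ivec l \<bullet> \<alpha>\<bar>" if l: "l \<noteq> 0" for w l
    proof -
      have "\<gamma>' * l1 l powr (- \<tau>') \<le> \<gamma> * l1 l powr (- \<tau>)"
        using g l1_ge_1[OF l] assms(15) by (intro mult_mono powr_mono) auto
      also have "\<dots> \<le> \<bar>ivec l \<bullet> \<alpha>\<bar>" using assms(13) l by (simp add: diophantine_def)
      finally show ?thesis by (simp add: l1_def)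
    qed
    have "real_gradient h x \<notin> Bset \<alpha> \<gamma>' \<tau>' \<longleftrightarrow> (\<exists>k l. k \<noteq> 0 \<and> \<bar>ivec k \<bullet> real_gradient h x + ivec l \<bullet> \<alpha>\<bar> < \<gamma>' * (l1 k + l1 l) powr (- \<tau>'))" for x
    proof
      assume "real_gradient h x \<notin> Bset \<alpha> \<gamma>' \<tau>'"
      then obtain k l where kl: "(k, l) \<noteq> (0, 0)" "\<not> \<gamma>' * (l1 k + l1 l) powr (- \<tau>') \<le> \<bar>ivec k \<bullet> real_gradient h x + ivec l \<bullet> \<alpha>\<bar>"
        unfolding Bset_def by blast
      have k: "k \<noteq> 0"
      proof
        assume k0: "k = 0"
        then have "l \<noteq> 0" using kl(1) by simp
        from nz[OF this] kl(2) k0 show False by blast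
      qed
      show "\<exists>k l. k \<noteq> 0 \<and> \<bar>ivec k \<bullet> real_gradient h x + ivec l \<bullet> \<alpha>\<bar> < \<gamma>' * (l1 k + l1 l) powr (- \<tau>')"
        by (intro exI[of _ k] exI[of _ l] conjI k kl(2)[unfolded not_le])
    next
      assume "\<exists>k l. k \<noteq> 0 \<and> \<bar>ivec k \<bullet> real_gradient h x + ivec l \<bullet> \<alpha>\<bar> < \<gamma>' * (l1 k + l1 l) powr (- \<tau>')"
      then obtain k l where kl: "k \<noteq> 0" "\<bar>ivec k \<bullet> real_gradient h x + ivec l \<bullet> \<alpha>\<bar> < \<gamma>' * (l1 k + l1 l) powr (- \<tau>')"
        by (elim exE conjE)
      show "real_gradient h x \<notin> Bset \<alpha> \<gamma>' \<tau>'"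
      proof
        assume "real_gradient h x \<in> Bset \<alpha> \<gamma>' \<tau>'"
        then have "(k, l) \<noteq> (0, 0) \<longrightarrow> \<bar>ivec k \<bullet> real_gradient h x + ivec l \<bullet> \<alpha>\<bar> \<ge> \<gamma>' * (l1 k + l1 l) powr (- \<tau>')"
          unfolding Bset_def mem_Collect_eq by (elim allE)
        then show False using kl by simp
      qed
    qed
    note nb = this
    have "D - Dset D h \<alpha> \<gamma>' \<tau>' = {x \<in> D. real_gradient h x \<notin> Bset \<alpha> \<gamma>' \<tau>'}" by (auto simp: Dset_def)
    then show ?thesis unfolding Res_def nb .
  qed
  have part2: "\<exists>C. \<forall>\<gamma>'. 0 < \<gamma>' \<and> \<gamma>' \<le> \<gamma> \<longrightarrow> Res \<gamma>' \<in> lmeasurable \<and> measure lebesgue (Res \<gamma>') \<le> C * \<gamma>'"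
  proof (rule resonant_measure[OF assms(1,2) cont bd b0 mc assms(9,14), of \<alpha>])
    fix C assume "\<And>\<gamma>. \<gamma> > 0 \<Longrightarrow>
     {x \<in> D. \<exists>k l. k \<noteq> 0 \<and> \<bar>ivec k \<bullet> real_gradient h x + ivec l \<bullet> \<alpha>\<bar> < \<gamma> * (l1 k + l1 l) powr (- \<tau>')} \<in> lmeasurable \<and>
     measure lebesgue {x \<in> D. \<exists>k l. k \<noteq> 0 \<and> \<bar>ivec k \<bullet> real_gradient h x + ivec l \<bullet> \<alpha>\<bar> < \<gamma> * (l1 k + l1 l) powr (- \<tau>')} \<le> C * \<gamma>"
    then show ?thesis unfolding Res_def[symmetric] by blast
  qed
  show ?thesis
  proof (intro conjI)
    from part2 obtain C where C: "\<And>\<gamma>'. 0 < \<gamma>' \<and> \<gamma>' \<le> \<gamma> \<Longrightarrow> Res \<gamma>' \<in> lmeasurable \<and> measure lebesgue (Res \<gamma>') \<le> C * \<gamma>'"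
      by blast
    show "\<exists>C. \<forall>\<gamma>'. 0 < \<gamma>' \<and> \<gamma>' \<le> \<gamma> \<longrightarrow> D - Dset D h \<alpha> \<gamma>' \<tau>' \<in> lmeasurable \<and>
        measure lebesgue (D - Dset D h \<alpha> \<gamma>' \<tau>') \<le> C * \<gamma>'"
    proof (intro exI[of _ C] allI impI)
      fix \<gamma>' assume g: "0 < \<gamma>' \<and> \<gamma>' \<le> \<gamma>"
      show "D - Dset D h \<alpha> \<gamma>' \<tau>' \<in> lmeasurable \<and> measure lebesgue (D - Dset D h \<alpha> \<gamma>' \<tau>') \<le> C * \<gamma>'"
        unfolding eq[OF conjunct1[OF g] conjunct2[OF g]] by (rule C[OF g])
    qed
  qed (unfold Let_def, intro allI impI, elim conjE, rule part1)
qed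

end
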